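(* Assume that $R$ is a Cohen-Macaulay ring that admits a dualizing module $D$, let $C$ be a semidualizing $R$-module, and set $C^{\dagger}=\operatorname{Hom}_R(C,D)$. Then $\operatorname{Ext}_{\mathcal{P}_C}$ and $\operatorname{Ext}_{\mathcal{I}_{C^{\dagger}}}$ are balanced on $\operatorname{res}\widehat{\mathcal{P}_C}\times\operatorname{cores}\widehat{\mathcal{I}_{C^{\dagger}}}$. In particular, if $\mathcal{P}_C\text{-}\mathrm{pd}_R(M)<\infty$ and $\mathcal{I}_{C^{\dagger}}\text{-}\mathrm{id}_R(N)<\infty$, then there are isomorphisms $\operatorname{Ext}^n_{\mathcal{P}_C}(M,N)\cong\operatorname{Ext}^n_{\mathcal{I}_{C^{\dagger}}}(M,N)$ for each integer $n$.
   Context: Rings are commutative; Cohen-Macaulay rings are noetherian. A subcategory of the category of $R$-modules means a full additive subcategory closed under isomorphisms. Resolutions. An $\mathcal{X}$-resolution of $M$ is a complex $X=(\cdots\to X_1\to X_0\to 0)$ with all $X_n\in\mathcal{X}$, $H_n(X)=0$ for $n>0$ and $H_0(X)\cong M$; it is proper if $\cdots\to X_1\to X_0\to M\to 0$ stays exact under $\operatorname{Hom}_R(X',-)$ for every $X'\in\mathcal{X}$. Dually, a $\mathcal{Y}$-coresolution of $N$ is a complex $Y=(0\to Y_0\to Y_{-1}\to\cdots)$ of modules in $\mathcal{Y}$ with $0\to N\to Y_0\to Y_{-1}\to\cdots$ exact; it is proper if this sequence stays exact under $\operatorname{Hom}_R(-,Y')$ for every $Y'\in\mathcal{Y}$. $\mathcal{X}\text{-}\mathrm{pd}_R(M)$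 is the infimum of $\sup\{n\ge 0: X_n\ne 0\}$ over all $\mathcal{X}$-resolutions of $M$; $\mathcal{Y}\text{-}\mathrm{id}_R(N)$ is defined dually. $\operatorname{res}\widehat{\mathcal{X}}$ is the class of modules $M$ with $\mathcal{X}\text{-}\mathrm{pd}_R(M)<\infty$, and $\operatorname{cores}\widehat{\mathcal{Y}}$ is the class of modules $N$ with $\mathcal{Y}\text{-}\mathrm{id}_R(N)<\infty$. Relative cohomology. For a proper $\mathcal{X}$-resolution $X$ of $M$, $\operatorname{Ext}^n_{\mathcal{X}R}(M,N)=H_{-n}(\operatorname{Hom}_R(X,N))$; for a proper $\mathcal{Y}$-coresolution $Y$ of $N$, $\operatorname{Ext}^n_{R\mathcal{Y}}(M,N)=H_{-n}(\operatorname{Hom}_R(M,Y))$. Write $\operatorname{Ext}_{\mathcal{P}_C}=\operatorname{Ext}_{\mathcal{P}_CR}$ and $\operatorname{Ext}_{\mathcal{I}_C}=\operatorname{Ext}_{R\,\mathcal{I}_C}$. Balance. Let $\mathcal{X}'$ be a subcategory of modules admitting proper $\mathcal{X}$-resolutions and $\mathcal{Y}'$ a subcategory of modules admitting proper $\mathcal{Y}$-coresolutions. $\operatorname{Ext}_{\mathcal{X}R}$ and $\operatorname{Ext}_{R\mathcal{Y}}$ are balanced on $\mathcal{X}'\times\mathcal{Y}'$ if for each $M\in\mathcal{X}'$ and $N\in\mathcal{Y}'$, each proper $\mathcal{X}$-resolution $X\to M$ and each proper $\mathcal{Y}$-coresolution $N\to Y$, the induced morphisms of complexes $\operatorname{Hom}_R(M,Y)\to\operatorname{Hom}_R(X,Y)\leftarrow\operatorname{Hom}_R(X,N)$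 are quasiisomorphisms. Here $\operatorname{Hom}_R(X,Y)$ is the Hom-complex with $\operatorname{Hom}_R(X,Y)_n=\prod_p\operatorname{Hom}_R(X_p,Y_{p+n})$. Semidualizing modules. $C$ is semidualizing if it has a (possibly unbounded) resolution by finite rank free modules, the homothety map $R\to\operatorname{Hom}_R(C,C)$ is an isomorphism, and $\operatorname{Ext}^{\ge1}_R(C,C)=0$. Over a Cohen-Macaulay ring, $D$ is dualizing if it is semidualizing of finite injective dimension; then $C^{\dagger}$ is semidualizing. Classes. $\mathcal{P}_C$: modules isomorphic to $P\otimes_RC$ with $P$ projective. $\mathcal{I}_{C}$: modules isomorphic to $\operatorname{Hom}_R(C,I)$ with $I$ injective. Modules in $\operatorname{res}\widehat{\mathcal{P}_C}$ are known to admit proper $\mathcal{P}_C$-resolutions, and those in $\operatorname{cores}\widehat{\mathcal{I}_{C}}$ proper $\mathcal{I}_{C}$-coresolutions. *)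

theory Defs
  imports "HOL-Algebra.Module" "HOL-Algebra.Ring_Divisibility" "HOL-Library.Extended_Nat"
begin

text \<open>
  Modules are records of type \<open>('a,'m) module\<close> satisfying the locale predicate \<open>module R M\<close>;
  the fields \<open>mult\<close> and \<open>one\<close> that this record inherits from rings play no role.

  All modules that are quantified over (test modules, members of classes of modules, terms of
  resolutions) have their elements in one type \<open>'m\<close>, which acts as the universe.  If \<open>'m\<close> is
  infinite and at least as large as \<open>R\<close>, then every module over \<open>'m\<close> is a quotient of a free
  module over \<open>'m\<close> and, for noetherian \<open>R\<close>, embeds in an injective module over \<open>'m\<close>.
\<close>

section \<open>Modules\<close>

definition lin_maps ::
  "('a,'r) ring_scheme \<Rightarrow> ('a,'m) module \<Rightarrow> ('a,'n) module \<Rightarrow> ('m \<Rightarrow> 'n) set" where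
  "lin_maps R M N = {f \<in> carrier M \<rightarrow> carrier N.
     (\<forall>x\<in>carrier M. \<forall>y\<in>carrier M. f (x \<oplus>\<^bsub>M\<^esub> y) = f x \<oplus>\<^bsub>N\<^esub> f y) \<and>
     (\<forall>r\<in>carrier R. \<forall>x\<in>carrier M. f (r \<odot>\<^bsub>M\<^esub> x) = r \<odot>\<^bsub>N\<^esub> f x)}"

definition mod_isomorphic ::
  "('a,'r) ring_scheme \<Rightarrow> ('a,'m) module \<Rightarrow> ('a,'n) module \<Rightarrow> bool" where
  "mod_isomorphic R M N \<longleftrightarrow> (\<exists>f\<in>lin_maps R M N. bij_betw f (carrier M) (carrier N))"

text \<open>Elements of a Hom module are extensional functions, so each linear map is represented once.\<close>

definition hom_mod ::
  "('a,'r) ring_scheme \<Rightarrow> ('a,'m) module \<Rightarrow> ('a,'n) module \<Rightarrow> ('a, 'm \<Rightarrow> 'n) module" where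
  "hom_mod R M N = \<lparr>carrier = lin_maps R M N \<inter> extensional (carrier M),
     monoid.mult = undefined, one = undefined,
     ring.zero = (\<lambda>x\<in>carrier M. \<zero>\<^bsub>N\<^esub>),
     ring.add = (\<lambda>f g. \<lambda>x\<in>carrier M. f x \<oplus>\<^bsub>N\<^esub> g x),
     module.smult = (\<lambda>r f. \<lambda>x\<in>carrier M. r \<odot>\<^bsub>N\<^esub> f x)\<rparr>"

definition prod_mod :: "('i \<Rightarrow> ('a,'m) module) \<Rightarrow> ('a, 'i \<Rightarrow> 'm) module" where
  "prod_mod M = \<lparr>carrier = {f. \<forall>i. f i \<in> carrier (M i)},
     monoid.mult = undefined, one = undefined,
     ring.zero = (\<lambda>i. \<zero>\<^bsub>M i\<^esub>),
     ring.add = (\<lambda>f g i. f i \<oplus>\<^bsub>M i\<^esub> g i),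
     module.smult = (\<lambda>r f i. r \<odot>\<^bsub>M i\<^esub> f i)\<rparr>"

definition quot_mod :: "('a,'m) module \<Rightarrow> 'm set \<Rightarrow> ('a, 'm set) module" where
  "quot_mod M K = \<lparr>carrier = a_rcosets\<^bsub>M\<^esub> K,
     monoid.mult = undefined, one = undefined,
     ring.zero = K,
     ring.add = (\<lambda>A B. A <+>\<^bsub>M\<^esub> B),
     module.smult = (\<lambda>r A. \<Union>x\<in>A. K +>\<^bsub>M\<^esub> (r \<odot>\<^bsub>M\<^esub> x))\<rparr>"

definition free_mod :: "('a,'r) ring_scheme \<Rightarrow> 'i set \<Rightarrow> ('a, 'i \<Rightarrow> 'a) module" where
  "free_mod R B = \<lparr>carrier = {f. (\<forall>i. f i \<in> carrier R) \<and>
       finite {i. f i \<noteq> \<zero>\<^bsub>R\<^esub>} \<and> {i. f i \<noteq> \<zero>\<^bsub>R\<^esub>} \<subseteq> B},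
     monoid.mult = undefined, one = undefined,
     ring.zero = (\<lambda>i. \<zero>\<^bsub>R\<^esub>),
     ring.add = (\<lambda>f g i. f i \<oplus>\<^bsub>R\<^esub> g i),
     module.smult = (\<lambda>r f i. r \<otimes>\<^bsub>R\<^esub> f i)\<rparr>"

definition free_gen :: "('a,'r) ring_scheme \<Rightarrow> 'i \<Rightarrow> 'i \<Rightarrow> 'a" where
  "free_gen R b = (\<lambda>i. if i = b then \<one>\<^bsub>R\<^esub> else \<zero>\<^bsub>R\<^esub>)"

definition tensor_relations ::
  "('a,'r) ring_scheme \<Rightarrow> ('a,'m) module \<Rightarrow> ('a,'n) module \<Rightarrow> ('m \<times> 'n \<Rightarrow> 'a) set" where
  "tensor_relations R M N = (let F = free_mod R (carrier M \<times> carrier N) in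
     {free_gen R (x \<oplus>\<^bsub>M\<^esub> x', y) \<ominus>\<^bsub>F\<^esub> (free_gen R (x, y) \<oplus>\<^bsub>F\<^esub> free_gen R (x', y)) |x x' y.
        x \<in> carrier M \<and> x' \<in> carrier M \<and> y \<in> carrier N} \<union>
     {free_gen R (x, y \<oplus>\<^bsub>N\<^esub> y') \<ominus>\<^bsub>F\<^esub> (free_gen R (x, y) \<oplus>\<^bsub>F\<^esub> free_gen R (x, y')) |x y y'.
        x \<in> carrier M \<and> y \<in> carrier N \<and> y' \<in> carrier N} \<union>
     {free_gen R (r \<odot>\<^bsub>M\<^esub> x, y) \<ominus>\<^bsub>F\<^esub> r \<odot>\<^bsub>F\<^esub> free_gen R (x, y) |r x y.
        r \<in> carrier R \<and> x \<in> carrier M \<and> y \<in> carrier N} \<union>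
     {free_gen R (x, r \<odot>\<^bsub>N\<^esub> y) \<ominus>\<^bsub>F\<^esub> r \<odot>\<^bsub>F\<^esub> free_gen R (x, y) |r x y.
        r \<in> carrier R \<and> x \<in> carrier M \<and> y \<in> carrier N})"

definition tensor ::
  "('a,'r) ring_scheme \<Rightarrow> ('a,'m) module \<Rightarrow> ('a,'n) module \<Rightarrow> ('a, ('m \<times> 'n \<Rightarrow> 'a) set) module" where
  "tensor R M N = (let F = free_mod R (carrier M \<times> carrier N) in
     quot_mod F (\<Inter>{K. submodule K R F \<and> tensor_relations R M N \<subseteq> K}))"

definition projective :: "('a,'r) ring_scheme \<Rightarrow> ('a,'m) module \<Rightarrow> bool" where
  "projective R P \<longleftrightarrow> module R P \<and>
     (\<forall>(A::('a,'m) module) (B::('a,'m) module) g f. module R A \<and> module R B \<and>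
        g \<in> lin_maps R A B \<and> g ` carrier A = carrier B \<and> f \<in> lin_maps R P B \<longrightarrow>
        (\<exists>h\<in>lin_maps R P A. \<forall>x\<in>carrier P. g (h x) = f x))"

definition injective :: "('a,'r) ring_scheme \<Rightarrow> ('a,'m) module \<Rightarrow> bool" where
  "injective R I \<longleftrightarrow> module R I \<and>
     (\<forall>(A::('a,'m) module) (B::('a,'m) module) g f. module R A \<and> module R B \<and>
        g \<in> lin_maps R A B \<and> inj_on g (carrier A) \<and> f \<in> lin_maps R A I \<longrightarrow>
        (\<exists>h\<in>lin_maps R B I. \<forall>x\<in>carrier A. h (g x) = f x))"

section \<open>Complexes\<close>

text \<open>Homological grading: \<open>cdiff X n\<close> maps \<open>cobj X n\<close> to \<open>cobj X (n - 1)\<close>.\<close>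

record ('a,'m) cplx =
  cobj :: "int \<Rightarrow> ('a,'m) module"
  cdiff :: "int \<Rightarrow> 'm \<Rightarrow> 'm"

definition is_complex :: "('a,'r) ring_scheme \<Rightarrow> ('a,'m) cplx \<Rightarrow> bool" where
  "is_complex R X \<longleftrightarrow>
     (\<forall>n. module R (cobj X n) \<and> cdiff X n \<in> lin_maps R (cobj X n) (cobj X (n - 1)) \<and>
       (\<forall>x\<in>carrier (cobj X n). cdiff X (n - 1) (cdiff X n x) = \<zero>\<^bsub>cobj X (n - 2)\<^esub>))"

definition cycles :: "('a,'m) cplx \<Rightarrow> int \<Rightarrow> 'm set" where
  "cycles X n = {x \<in> carrier (cobj X n). cdiff X n x = \<zero>\<^bsub>cobj X (n - 1)\<^esub>}"

definition boundaries :: "('a,'m) cplx \<Rightarrow> int \<Rightarrow> 'm set" where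
  "boundaries X n = cdiff X (n + 1) ` carrier (cobj X (n + 1))"

definition homology :: "('a,'m) cplx \<Rightarrow> int \<Rightarrow> ('a,'m set) module" where
  "homology X n = quot_mod ((cobj X n)\<lparr>carrier := cycles X n\<rparr>) (boundaries X n)"

definition zero_mod :: "('a,'m) module \<Rightarrow> bool" where
  "zero_mod M \<longleftrightarrow> carrier M = {\<zero>\<^bsub>M\<^esub>}"

definition exact_complex :: "('a,'r) ring_scheme \<Rightarrow> ('a,'m) cplx \<Rightarrow> bool" where
  "exact_complex R X \<longleftrightarrow> is_complex R X \<and> (\<forall>n. zero_mod (homology X n))"

definition chain_map ::
  "('a,'r) ring_scheme \<Rightarrow> ('a,'m) cplx \<Rightarrow> ('a,'n) cplx \<Rightarrow> (int \<Rightarrow> 'm \<Rightarrow> 'n) \<Rightarrow> bool" where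
  "chain_map R X Y \<phi> \<longleftrightarrow>
     (\<forall>n. \<phi> n \<in> lin_maps R (cobj X n) (cobj Y n) \<and>
       (\<forall>x\<in>carrier (cobj X n). cdiff Y n (\<phi> n x) = \<phi> (n - 1) (cdiff X n x)))"

definition homology_map ::
  "('a,'n) cplx \<Rightarrow> (int \<Rightarrow> 'm \<Rightarrow> 'n) \<Rightarrow> int \<Rightarrow> 'm set \<Rightarrow> 'n set" where
  "homology_map Y \<phi> n A = (\<Union>z\<in>A. boundaries Y n +>\<^bsub>cobj Y n\<^esub> \<phi> n z)"

definition quasi_iso ::
  "('a,'r) ring_scheme \<Rightarrow> ('a,'m) cplx \<Rightarrow> ('a,'n) cplx \<Rightarrow> (int \<Rightarrow> 'm \<Rightarrow> 'n) \<Rightarrow> bool" where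
  "quasi_iso R X Y \<phi> \<longleftrightarrow> is_complex R X \<and> is_complex R Y \<and> chain_map R X Y \<phi> \<and>
     (\<forall>n. bij_betw (homology_map Y \<phi> n) (carrier (homology X n)) (carrier (homology Y n)))"

text \<open>A module as a complex concentrated in degree 0; the other terms are its zero submodule.\<close>

definition stalk :: "('a,'m) module \<Rightarrow> ('a,'m) cplx" where
  "stalk M = \<lparr>cobj = (\<lambda>n. if n = 0 then M else M\<lparr>carrier := {\<zero>\<^bsub>M\<^esub>}\<rparr>),
     cdiff = (\<lambda>n x. \<zero>\<^bsub>M\<^esub>)\<rparr>"

text \<open>
  The Hom complex has \<open>\<Prod>p. Hom (X\<^sub>p, Y\<^bsub>p+n\<^esub>)\<close> in degree \<open>n\<close> and differential
  \<open>(\<partial>f)\<^sub>p = \<partial>\<^sup>Y f\<^sub>p - (-1)\<^sup>n f\<^bsub>p-1\<^esub> \<partial>\<^sup>X\<close>.  In particular \<open>Hom (X, N)\<close> and \<open>Hom (M, Y)\<close> for modules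
  \<open>M\<close>, \<open>N\<close> are obtained from their stalk complexes.
\<close>

definition hom_cplx ::
  "('a,'r) ring_scheme \<Rightarrow> ('a,'m) cplx \<Rightarrow> ('a,'n) cplx \<Rightarrow> ('a, int \<Rightarrow> 'm \<Rightarrow> 'n) cplx" where
  "hom_cplx R X Y = \<lparr>
     cobj = (\<lambda>n. prod_mod (\<lambda>p. hom_mod R (cobj X p) (cobj Y (p + n)))),
     cdiff = (\<lambda>n f p. \<lambda>x\<in>carrier (cobj X p).
       if even n
       then cdiff Y (p + n) (f p x) \<ominus>\<^bsub>cobj Y (p + n - 1)\<^esub> f (p - 1) (cdiff X p x)
       else cdiff Y (p + n) (f p x) \<oplus>\<^bsub>cobj Y (p + n - 1)\<^esub> f (p - 1) (cdiff X p x))\<rparr>"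

definition hom_precomp ::
  "('a,'l) cplx \<Rightarrow> (int \<Rightarrow> 'l \<Rightarrow> 'm) \<Rightarrow> int \<Rightarrow> (int \<Rightarrow> 'm \<Rightarrow> 'n) \<Rightarrow> int \<Rightarrow> 'l \<Rightarrow> 'n" where
  "hom_precomp X \<phi> n f = (\<lambda>p. \<lambda>x\<in>carrier (cobj X p). f p (\<phi> p x))"

definition hom_postcomp ::
  "('a,'l) cplx \<Rightarrow> (int \<Rightarrow> 'm \<Rightarrow> 'n) \<Rightarrow> int \<Rightarrow> (int \<Rightarrow> 'l \<Rightarrow> 'm) \<Rightarrow> int \<Rightarrow> 'l \<Rightarrow> 'n" where
  "hom_postcomp X \<phi> n f = (\<lambda>p. \<lambda>x\<in>carrier (cobj X p). \<phi> (p + n) (f p x))"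

section \<open>Resolutions and relative cohomology\<close>

text \<open>
  A resolution of \<open>M\<close> is given with its augmentation \<open>\<epsilon> : X\<^sub>0 \<rightarrow> M\<close>; the augmented complex
  \<open>\<dots> \<rightarrow> X\<^sub>1 \<rightarrow> X\<^sub>0 \<rightarrow> M \<rightarrow> 0\<close> has \<open>M\<close> in degree \<open>-1\<close>.  Its exactness says that \<open>H\<^sub>n(X) = 0\<close> for
  \<open>n > 0\<close> and that \<open>\<epsilon>\<close> induces an isomorphism \<open>H\<^sub>0(X) \<cong> M\<close>.  Dually, the module \<open>N\<close> is in degree 1
  of the augmentation of a coresolution.
\<close>

definition aug_res :: "('a,'m) cplx \<Rightarrow> ('m \<Rightarrow> 'm) \<Rightarrow> ('a,'m) module \<Rightarrow> ('a,'m) cplx" where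
  "aug_res X \<epsilon> M = \<lparr>cobj = (cobj X)(-1 := M),
     cdiff = (cdiff X)(0 := \<epsilon>, -1 := (\<lambda>_. \<zero>\<^bsub>cobj X (-2)\<^esub>))\<rparr>"

definition aug_cores :: "('a,'m) module \<Rightarrow> ('m \<Rightarrow> 'm) \<Rightarrow> ('a,'m) cplx \<Rightarrow> ('a,'m) cplx" where
  "aug_cores N \<eta> Y = \<lparr>cobj = (cobj Y)(1 := N),
     cdiff = (cdiff Y)(1 := \<eta>, 2 := (\<lambda>_. \<zero>\<^bsub>N\<^esub>))\<rparr>"

definition resolution ::
  "('a,'r) ring_scheme \<Rightarrow> ('a,'m) module set \<Rightarrow> ('a,'m) cplx \<Rightarrow> ('m \<Rightarrow> 'm) \<Rightarrow>
     ('a,'m) module \<Rightarrow> bool" where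
  "resolution R \<X> X \<epsilon> M \<longleftrightarrow> is_complex R X \<and> (\<forall>n. cobj X n \<in> \<X>) \<and>
     (\<forall>n<0. zero_mod (cobj X n)) \<and> exact_complex R (aug_res X \<epsilon> M)"

definition proper_resolution ::
  "('a,'r) ring_scheme \<Rightarrow> ('a,'m) module set \<Rightarrow> ('a,'m) cplx \<Rightarrow> ('m \<Rightarrow> 'm) \<Rightarrow>
     ('a,'m) module \<Rightarrow> bool" where
  "proper_resolution R \<X> X \<epsilon> M \<longleftrightarrow> resolution R \<X> X \<epsilon> M \<and>
     (\<forall>X'\<in>\<X>. exact_complex R (hom_cplx R (stalk X') (aug_res X \<epsilon> M)))"

definition coresolution ::
  "('a,'r) ring_scheme \<Rightarrow> ('a,'m) module set \<Rightarrow> ('a,'m) module \<Rightarrow> ('m \<Rightarrow> 'm) \<Rightarrow>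
     ('a,'m) cplx \<Rightarrow> bool" where
  "coresolution R \<Y> N \<eta> Y \<longleftrightarrow> is_complex R Y \<and> (\<forall>n. cobj Y n \<in> \<Y>) \<and>
     (\<forall>n>0. zero_mod (cobj Y n)) \<and> exact_complex R (aug_cores N \<eta> Y)"

definition proper_coresolution ::
  "('a,'r) ring_scheme \<Rightarrow> ('a,'m) module set \<Rightarrow> ('a,'m) module \<Rightarrow> ('m \<Rightarrow> 'm) \<Rightarrow>
     ('a,'m) cplx \<Rightarrow> bool" where
  "proper_coresolution R \<Y> N \<eta> Y \<longleftrightarrow> coresolution R \<Y> N \<eta> Y \<and>
     (\<forall>Y'\<in>\<Y>. exact_complex R (hom_cplx R (aug_cores N \<eta> Y) (stalk Y')))"

definition pd :: "('a,'r) ring_scheme \<Rightarrow> ('a,'m) module set \<Rightarrow> ('a,'m) module \<Rightarrow> enat" where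
  "pd R \<X> M = Inf {Sup {enat n |n. \<not> zero_mod (cobj X (int n))} |X \<epsilon>. resolution R \<X> X \<epsilon> M}"

definition idim :: "('a,'r) ring_scheme \<Rightarrow> ('a,'m) module set \<Rightarrow> ('a,'m) module \<Rightarrow> enat" where
  "idim R \<Y> N = Inf {Sup {enat n |n. \<not> zero_mod (cobj Y (- int n))} |\<eta> Y. coresolution R \<Y> N \<eta> Y}"

definition res_hat :: "('a,'r) ring_scheme \<Rightarrow> ('a,'m) module set \<Rightarrow> ('a,'m) module set" where
  "res_hat R \<X> = {M. module R M \<and> pd R \<X> M < \<infinity>}"

definition cores_hat :: "('a,'r) ring_scheme \<Rightarrow> ('a,'m) module set \<Rightarrow> ('a,'m) module set" where
  "cores_hat R \<Y> = {N. module R N \<and> idim R \<Y> N < \<infinity>}"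

text \<open>
  The relative Ext modules, as computed from a given proper resolution \<open>X\<close> of the first
  argument, respectively a given proper coresolution \<open>Y\<close> of the second argument.
\<close>

definition Ext_res ::
  "('a,'r) ring_scheme \<Rightarrow> int \<Rightarrow> ('a,'m) cplx \<Rightarrow> ('a,'n) module \<Rightarrow>
     ('a, (int \<Rightarrow> 'm \<Rightarrow> 'n) set) module" where
  "Ext_res R n X N = homology (hom_cplx R X (stalk N)) (- n)"

definition Ext_cores ::
  "('a,'r) ring_scheme \<Rightarrow> int \<Rightarrow> ('a,'m) module \<Rightarrow> ('a,'n) cplx \<Rightarrow>
     ('a, (int \<Rightarrow> 'm \<Rightarrow> 'n) set) module" where
  "Ext_cores R n M Y = homology (hom_cplx R (stalk M) Y) (- n)"

definition aug_chain_map :: "('a,'m) module \<Rightarrow> ('m \<Rightarrow> 'm) \<Rightarrow> int \<Rightarrow> 'm \<Rightarrow> 'm" where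
  "aug_chain_map M \<epsilon> p = (if p = 0 then \<epsilon> else (\<lambda>_. \<zero>\<^bsub>M\<^esub>))"

definition coaug_chain_map :: "('a,'m) cplx \<Rightarrow> ('m \<Rightarrow> 'm) \<Rightarrow> int \<Rightarrow> 'm \<Rightarrow> 'm" where
  "coaug_chain_map Y \<eta> p = (if p = 0 then \<eta> else (\<lambda>_. \<zero>\<^bsub>cobj Y p\<^esub>))"

text \<open>
  The first two conjuncts are the requirement that balance is only considered on classes of
  modules admitting proper resolutions, respectively proper coresolutions.
\<close>

definition balanced_on ::
  "('a,'r) ring_scheme \<Rightarrow> ('a,'m) module set \<Rightarrow> ('a,'m) module set \<Rightarrow>
     ('a,'m) module set \<Rightarrow> ('a,'m) module set \<Rightarrow> bool" where
  "balanced_on R \<X> \<Y> \<X>' \<Y>' \<longleftrightarrow>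
     (\<forall>M\<in>\<X>'. \<exists>X \<epsilon>. proper_resolution R \<X> X \<epsilon> M) \<and>
     (\<forall>N\<in>\<Y>'. \<exists>\<eta> Y. proper_coresolution R \<Y> N \<eta> Y) \<and>
     (\<forall>M\<in>\<X>'. \<forall>N\<in>\<Y>'. \<forall>X \<epsilon> \<eta> Y.
        proper_resolution R \<X> X \<epsilon> M \<and> proper_coresolution R \<Y> N \<eta> Y \<longrightarrow>
        quasi_iso R (hom_cplx R (stalk M) Y) (hom_cplx R X Y)
          (hom_precomp X (aug_chain_map M \<epsilon>)) \<and>
        quasi_iso R (hom_cplx R X (stalk N)) (hom_cplx R X Y)
          (hom_postcomp X (coaug_chain_map Y \<eta>)))"

section \<open>Semidualizing and dualizing modules\<close>

definition finite_free :: "('a,'r) ring_scheme \<Rightarrow> ('a,'m) module set" where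
  "finite_free R = {F. module R F \<and> (\<exists>n::nat. mod_isomorphic R (free_mod R {..<n}) F)}"

text \<open>
  In the last conjunct Ext is computed from an arbitrary projective resolution; one exists by
  the first conjunct.
\<close>

definition semidualizing :: "('a,'r) ring_scheme \<Rightarrow> ('a,'m) module \<Rightarrow> bool" where
  "semidualizing R C \<longleftrightarrow> module R C \<and>
     (\<exists>F \<epsilon>. resolution R (finite_free R) F \<epsilon> C) \<and>
     bij_betw (\<lambda>r. \<lambda>x\<in>carrier C. r \<odot>\<^bsub>C\<^esub> x) (carrier R) (carrier (hom_mod R C C)) \<and>
     (\<forall>F \<epsilon> n. resolution R {P. projective R P} F \<epsilon> C \<and> n \<ge> 1 \<longrightarrow> zero_mod (Ext_res R n F C))"

definition dualizing :: "('a,'r) ring_scheme \<Rightarrow> ('a,'m) module \<Rightarrow> bool" where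
  "dualizing R D \<longleftrightarrow> semidualizing R D \<and> idim R {I. injective R I} D < \<infinity>"

definition P_class :: "('a,'r) ring_scheme \<Rightarrow> ('a,'c) module \<Rightarrow> ('a,'m) module set" where
  "P_class R C = {X. module R X \<and>
     (\<exists>P::('a,'m) module. projective R P \<and> mod_isomorphic R X (tensor R P C))}"

definition I_class :: "('a,'r) ring_scheme \<Rightarrow> ('a,'c) module \<Rightarrow> ('a,'m) module set" where
  "I_class R C = {Y. module R Y \<and>
     (\<exists>I::('a,'m) module. injective R I \<and> mod_isomorphic R Y (hom_mod R C I))}"

section \<open>Cohen-Macaulay rings\<close>

definition frac_rel :: "('a,'r) ring_scheme \<Rightarrow> 'a set \<Rightarrow> (('a \<times> 'a) \<times> ('a \<times> 'a)) set" where
  "frac_rel R S = {((a, s), (b, t)). a \<in> carrier R \<and> b \<in> carrier R \<and> s \<in> S \<and> t \<in> S \<and>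
     (\<exists>u\<in>S. u \<otimes>\<^bsub>R\<^esub> (a \<otimes>\<^bsub>R\<^esub> t \<ominus>\<^bsub>R\<^esub> b \<otimes>\<^bsub>R\<^esub> s) = \<zero>\<^bsub>R\<^esub>)}"

definition frac :: "('a,'r) ring_scheme \<Rightarrow> 'a set \<Rightarrow> 'a \<times> 'a \<Rightarrow> ('a \<times> 'a) set" where
  "frac R S x = frac_rel R S `` {x}"

text \<open>
  The ring of fractions \<open>S\<^sup>-\<^sup>1R\<close>.  The sets of pairs over which the unions are taken all lie in a
  single equivalence class.
\<close>

definition fractions :: "('a,'r) ring_scheme \<Rightarrow> 'a set \<Rightarrow> ('a \<times> 'a) set ring" where
  "fractions R S = \<lparr>carrier = (carrier R \<times> S) // frac_rel R S,
     monoid.mult = (\<lambda>A B. \<Union>(a, s)\<in>A. \<Union>(b, t)\<in>B. frac R S (a \<otimes>\<^bsub>R\<^esub> b, s \<otimes>\<^bsub>R\<^esub> t)),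
     one = frac R S (\<one>\<^bsub>R\<^esub>, \<one>\<^bsub>R\<^esub>),
     ring.zero = frac R S (\<zero>\<^bsub>R\<^esub>, \<one>\<^bsub>R\<^esub>),
     ring.add = (\<lambda>A B. \<Union>(a, s)\<in>A. \<Union>(b, t)\<in>B.
       frac R S (a \<otimes>\<^bsub>R\<^esub> t \<oplus>\<^bsub>R\<^esub> b \<otimes>\<^bsub>R\<^esub> s, s \<otimes>\<^bsub>R\<^esub> t))\<rparr>"

definition localization :: "('a,'r) ring_scheme \<Rightarrow> 'a set \<Rightarrow> ('a \<times> 'a) set ring" where
  "localization R p = fractions R (carrier R - p)"

definition krull_dim :: "('a,'r) ring_scheme \<Rightarrow> enat" where
  "krull_dim R = Sup {enat n |n. \<exists>p :: nat \<Rightarrow> 'a set.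
     (\<forall>i\<le>n. primeideal (p i) R) \<and> (\<forall>i<n. p i \<subset> p (Suc i))}"

definition regular_sequence :: "('a,'r) ring_scheme \<Rightarrow> 'a list \<Rightarrow> bool" where
  "regular_sequence R xs \<longleftrightarrow> set xs \<subseteq> carrier R \<and> genideal R (set xs) \<noteq> carrier R \<and>
     (\<forall>i<length xs. \<forall>r\<in>carrier R. xs ! i \<otimes>\<^bsub>R\<^esub> r \<in> genideal R (set (take i xs)) \<longrightarrow>
        r \<in> genideal R (set (take i xs)))"

definition depth :: "('a,'r) ring_scheme \<Rightarrow> 'a set \<Rightarrow> enat" where
  "depth R I = Sup {enat (length xs) |xs. regular_sequence R xs \<and> set xs \<subseteq> I}"

text \<open>The maximal ideal of a local ring is its set of nonunits.\<close>

definition cohen_macaulay :: "('a,'r) ring_scheme \<Rightarrow> bool" where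
  "cohen_macaulay R \<longleftrightarrow> cring R \<and> noetherian_ring R \<and>
     (\<forall>m. maximalideal m R \<longrightarrow> (let L = localization R m in
        depth L (carrier L - Units L) = krull_dim L))"

end

theory Submission
 imports Defs "HOL-Algebra.IntRing" Complex_Main
begin

text \<open>
  A bounded complex is tested for exactness against character modules: if \<open>U\<close> is a bounded exact
  coresolution by modules \<open>Hom(C, I)\<close> with \<open>I\<close> injective, then a class in \<open>Hom(C\<^sup>\<dagger>, U)\<close> that is not a
  boundary yields, through \<open>Hom(D, I) \<cong> Bil(C\<^sup>\<dagger>, C; I)\<close>, a nonzero map out of \<open>D\<close> that has to vanish,
  because a finitely generated faithful module over a noetherian ring maps nontrivially to every
  nonzero module.  Applied to \<open>Hom(X, I)\<close> for a bounded \<open>\<P>\<^sub>C\<close>-resolution \<open>X\<close> this shows that \<open>Hom(X, Y)\<close> is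
  exact in the direction of \<open>X\<close> for \<open>Y\<close> in the class of \<open>C\<^sup>\<dagger>\<close>, and the same statement with \<open>C\<close> and \<open>C\<^sup>\<dagger>\<close> exchanged gives
  exactness in the direction of the coresolution.  Comparison of resolutions removes the boundedness, and the
  quasi-isomorphisms of the balance statement follow by contracting the augmented double complex.
\<close>

text \<open>Two obstacles shape the development. The first is Tor: the argument wants
  \<open>S \<otimes> Hom(S, I) = I\<close> and \<open>Tor(S, Hom(S, I)) = 0\<close> for injective
  \<open>I\<close>. Both are stated for bilinear maps into a further module, as
  \<open>double_dual_inj\<close>, \<open>double_dual_surj\<close> and
  \<open>acyclic_double_dual\<close>, and come from the complex \<open>Hom(F, S)\<close> of a
  resolution \<open>F\<close> by finitely generated projectives; that \<open>S\<close> is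
  semidualizing means that the cohomology of this complex is \<open>R\<close> alone. The second is
  typing: \<open>projective\<close> and \<open>injective\<close> test only modules over one type,
  but Hom and tensor modules leave that type. Baer's criterion (\<open>baer\<close>) and dual bases
  (\<open>fgproj\<close>, \<open>loc_basis\<close>) make sense over every type; the size assumptions
  on the universe serve to reach them. Finiteness of the dimensions enters because exactness is
  propagated from the zero end of a bounded sequence. Finite injective dimension of \<open>D\<close>
  is used through one bounded coresolution \<open>J\<close>: applying \<open>Hom(C, -)\<close> to it
  produces the pairing \<open>C' \<times> C \<rightarrow> D\<close> as well as the proof that
  \<open>C'\<close> is again semidualizing, without which \<open>C\<close> and \<open>C'\<close>
  could not be exchanged.\<close>

declare [[coercion_enabled]] [[coercion carrier]] [[coercion cobj]]

syntax "_index" :: "logic => index" ("\<^sub>_" [1000] 1000)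

abbreviation "Hom == hom_mod"

section \<open>Modules and linear maps\<close>

lemma module_cring: "module R M ==> cring R"
 by(simp add: module_def)

lemma module_abelian_group: "module R M ==> abelian_group M"
 by(simp add: module_def)

lemma
 assumes "module R M"
 shows mod_add_closed: "x \<in> M ==> y \<in> M ==> x \<oplus>\<^sub>M y \<in> M"
  and mod_zero_closed: "\<zero>\<^sub>M \<in> M"
  and mod_neg_closed: "x \<in> M ==> \<ominus>\<^sub>M x \<in> M"
  and mod_minus_closed: "x \<in> M ==> y \<in> M ==> x \<ominus>\<^sub>M y \<in> M"
  and mod_smult_closed: "r \<in> R ==> x \<in> M ==> r \<odot>\<^sub>M x \<in> M"
  and mod_add_zero: "x \<in> M ==> x \<oplus>\<^sub>M \<zero>\<^sub>M = x"
  and mod_zero_add: "x \<in> M ==> \<zero>\<^sub>M \<oplus>\<^sub>M x = x"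
  and mod_assoc: "x \<in> M ==> y \<in> M ==> z \<in> M ==>
  (x \<oplus>\<^sub>M y) \<oplus>\<^sub>M z = x \<oplus>\<^sub>M (y \<oplus>\<^sub>M z)"
  and mod_comm: "x \<in> M ==> y \<in> M ==> x \<oplus>\<^sub>M y = y \<oplus>\<^sub>M x"
  and mod_lcomm: "x \<in> M ==> y \<in> M ==> z \<in> M ==>
  x \<oplus>\<^sub>M (y \<oplus>\<^sub>M z) = y \<oplus>\<^sub>M (x \<oplus>\<^sub>M z)"
  and mod_neg_add: "x \<in> M ==> \<ominus>\<^sub>M x \<oplus>\<^sub>M x = \<zero>\<^sub>M"
  and mod_add_neg: "x \<in> M ==> x \<oplus>\<^sub>M \<ominus>\<^sub>M x = \<zero>\<^sub>M"
  and mod_neg_add_cancel: "x \<in> M ==> y \<in> M ==> \<ominus>\<^sub>M x \<oplus>\<^sub>M (x \<oplus>\<^sub>M y) = y"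
  and mod_add_neg_cancel: "x \<in> M ==> y \<in> M ==> x \<oplus>\<^sub>M (\<ominus>\<^sub>M x \<oplus>\<^sub>M y) = y"
  and mod_neg_neg: "x \<in> M ==> \<ominus>\<^sub>M (\<ominus>\<^sub>M x) = x"
  and mod_neg_distrib: "x \<in> M ==> y \<in> M ==> \<ominus>\<^sub>M (x \<oplus>\<^sub>M y) = \<ominus>\<^sub>M x \<oplus>\<^sub>M \<ominus>\<^sub>M y"
  and mod_neg_zero: "\<ominus>\<^sub>M \<zero>\<^sub>M = \<zero>\<^sub>M"
  and mod_smult_add: "r \<in> R ==> x \<in> M ==> y \<in> M ==>
  r \<odot>\<^sub>M (x \<oplus>\<^sub>M y) = r \<odot>\<^sub>M x \<oplus>\<^sub>M r \<odot>\<^sub>M y"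
  and mod_add_smult: "r \<in> R ==> s \<in> R ==> x \<in> M ==>
  (r \<oplus>\<^sub>R s) \<odot>\<^sub>M x = r \<odot>\<^sub>M x \<oplus>\<^sub>M s \<odot>\<^sub>M x"
  and mod_mult_smult: "r \<in> R ==> s \<in> R ==> x \<in> M ==>
  (r \<otimes>\<^sub>R s) \<odot>\<^sub>M x = r \<odot>\<^sub>M (s \<odot>\<^sub>M x)"
  and mod_one_smult: "x \<in> M ==> \<one>\<^sub>R \<odot>\<^sub>M x = x"
  and mod_zero_smult: "x \<in> M ==> \<zero>\<^sub>R \<odot>\<^sub>M x = \<zero>\<^sub>M"
  and mod_smult_zero: "r \<in> R ==> r \<odot>\<^sub>M \<zero>\<^sub>M = \<zero>\<^sub>M"
  and mod_smult_neg: "r \<in> R ==> x \<in> M ==> r \<odot>\<^sub>M (\<ominus>\<^sub>M x) = \<ominus>\<^sub>M (r \<odot>\<^sub>M x)"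
  and mod_neg_smult: "r \<in> R ==> x \<in> M ==> (\<ominus>\<^sub>R r) \<odot>\<^sub>M x = \<ominus>\<^sub>M (r \<odot>\<^sub>M x)"
  and mod_minus_self: "x \<in> M ==> x \<ominus>\<^sub>M x = \<zero>\<^sub>M"
  and mod_minus_zero: "x \<in> M ==> x \<ominus>\<^sub>M \<zero>\<^sub>M = x"
  and mod_minus_add_cancel: "x \<in> M ==> y \<in> M ==> (x \<ominus>\<^sub>M y) \<oplus>\<^sub>M y = x"
  and mod_minus_eq_zero: "x \<in> M ==> y \<in> M ==> x \<ominus>\<^sub>M y = \<zero>\<^sub>M \<longleftrightarrow> x = y"
  and mod_add_eq_zero: "x \<in> M ==> y \<in> M ==> x \<oplus>\<^sub>M y = \<zero>\<^sub>M \<longleftrightarrow> x = \<ominus>\<^sub>M y"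
proof -
 interpret module R M by fact
 show "x \<in> M ==> y \<in> M ==> x \<ominus>\<^sub>M y = \<zero>\<^sub>M \<longleftrightarrow> x = y"
  by(metis M.a_inv_closed M.add.inv_equality M.minus_eq M.r_neg M.minus_minus)
 show "x \<in> M ==> y \<in> M ==> x \<oplus>\<^sub>M y = \<zero>\<^sub>M \<longleftrightarrow> x = \<ominus>\<^sub>M y"
  by(metis M.add.inv_equality M.l_neg)
 show "x \<in> M ==> y \<in> M ==> (x \<ominus>\<^sub>M y) \<oplus>\<^sub>M y = x"
  by(simp add: M.minus_eq M.a_assoc M.l_neg)
 show "\<ominus>\<^sub>M \<zero>\<^sub>M = \<zero>\<^sub>M"
  by(rule M.minus_equality) auto
 thus "x \<in> M ==> x \<ominus>\<^sub>M \<zero>\<^sub>M = x"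
  by(simp add: M.minus_eq)
 show "x \<in> M ==> y \<in> M ==> z \<in> M ==>
  x \<oplus>\<^sub>M (y \<oplus>\<^sub>M z) = y \<oplus>\<^sub>M (x \<oplus>\<^sub>M z)"
  by(rule M.a_lcomm)
 show "x \<in> M ==> y \<in> M ==> \<ominus>\<^sub>M (x \<oplus>\<^sub>M y) = \<ominus>\<^sub>M x \<oplus>\<^sub>M \<ominus>\<^sub>M y"
  by(rule M.minus_add)
 show "x \<in> M ==> y \<in> M ==> x \<oplus>\<^sub>M y = y \<oplus>\<^sub>M x"
  by(rule M.a_comm)
 show "\<zero>\<^sub>M \<in> M" "x \<in> M ==> \<ominus>\<^sub>M x \<in> M"
  "x \<in> M ==> y \<in> M ==> x \<oplus>\<^sub>M y \<in> M"
  "x \<in> M ==> y \<in> M ==> x \<ominus>\<^sub>M y \<in> M"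
  "r \<in> R ==> x \<in> M ==> r \<odot>\<^sub>M x \<in> M"
  "x \<in> M ==> x \<oplus>\<^sub>M \<zero>\<^sub>M = x" "x \<in> M ==> \<zero>\<^sub>M \<oplus>\<^sub>M x = x"
  "x \<in> M ==> \<one>\<^sub>R \<odot>\<^sub>M x = x" "x \<in> M ==> \<zero>\<^sub>R \<odot>\<^sub>M x = \<zero>\<^sub>M"
  "r \<in> R ==> r \<odot>\<^sub>M \<zero>\<^sub>M = \<zero>\<^sub>M"
  by auto
 show "x \<in> M ==> x \<ominus>\<^sub>M x = \<zero>\<^sub>M"
  by(simp add: M.minus_eq M.r_neg)
 show "x \<in> M ==> \<ominus>\<^sub>M (\<ominus>\<^sub>M x) = x"
  by(rule M.minus_minus)
qed (simp_all add: module.smult_r_minus[OF assms] module.smult_l_minus[OF assms]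
  module.smult_l_distr[OF assms] module.smult_r_distr[OF assms] module.smult_assoc1[OF assms]
  abelian_group.r_neg[OF module_abelian_group[OF assms]] abelian_group.l_neg[OF module_abelian_group[OF assms]]
  abelian_group.r_neg1[OF module_abelian_group[OF assms]] abelian_group.r_neg2[OF module_abelian_group[OF assms]]
  abelian_monoid.a_assoc[OF abelian_group.axioms(1)[OF module_abelian_group[OF assms]]])

lemmas modD = mod_add_closed mod_zero_closed mod_neg_closed mod_minus_closed mod_smult_closed
 mod_add_zero mod_zero_add mod_neg_add mod_add_neg mod_neg_add_cancel mod_add_neg_cancel
 mod_neg_neg mod_neg_zero mod_one_smult mod_zero_smult mod_smult_zero mod_minus_self
 mod_minus_zero mod_minus_add_cancel

lemmas mod_ac = mod_assoc mod_comm mod_lcomm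

lemma mod_add_add_swap:
 "module R M ==> a \<in> M ==> b \<in> M ==> c \<in> M ==> d \<in> M ==>
  (a \<oplus>\<^sub>M b) \<oplus>\<^sub>M (c \<oplus>\<^sub>M d) = (a \<oplus>\<^sub>M c) \<oplus>\<^sub>M (b \<oplus>\<^sub>M d)"
 by(simp add: mod_ac[of R M] modD[of R M])

lemma
 assumes "cring R"
 shows cring_add_closed [simp, intro]: "r \<in> R ==> s \<in> R ==> r \<oplus>\<^sub>R s \<in> R"
  and cring_mult_closed [simp, intro]: "r \<in> R ==> s \<in> R ==> r \<otimes>\<^sub>R s \<in> R"
  and cring_neg_closed [simp, intro]: "r \<in> R ==> \<ominus>\<^sub>R r \<in> R"
  and cring_zero_closed [simp, intro]: "\<zero>\<^sub>R \<in> R"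
  and cring_one_closed [simp, intro]: "\<one>\<^sub>R \<in> R"
  and cring_mult_comm: "r \<in> R ==> s \<in> R ==> r \<otimes>\<^sub>R s = s \<otimes>\<^sub>R r"
proof -
 interpret cring R by fact
 show "r \<in> R ==> s \<in> R ==> r \<oplus>\<^sub>R s \<in> R"
  "r \<in> R ==> s \<in> R ==> r \<otimes>\<^sub>R s \<in> R"
  "r \<in> R ==> \<ominus>\<^sub>R r \<in> R" "\<zero>\<^sub>R \<in> R" "\<one>\<^sub>R \<in> R"
  by auto
 show "r \<in> R ==> s \<in> R ==> r \<otimes>\<^sub>R s = s \<otimes>\<^sub>R r" by(rule m_comm)
qed

text \<open>Additive inverses come from the scalars: minus one times \<open>x\<close> is inverse to
  \<open>x\<close> as soon as the zero of the ring acts as zero, so \<open>zero_smult\<close> takes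
  the place of the inverse axiom of the group.\<close>

lemma moduleI':
 assumes "cring R"
  and add: "!!x y. x \<in> carrier M ==> y \<in> carrier M ==> x \<oplus>\<^bsub>M\<^esub> y \<in> carrier M"
  and zero: "\<zero>\<^bsub>M\<^esub> \<in> carrier M"
  and assoc: "!!x y z. x \<in> carrier M ==> y \<in> carrier M ==> z \<in> carrier M ==>
  (x \<oplus>\<^bsub>M\<^esub> y) \<oplus>\<^bsub>M\<^esub> z = x \<oplus>\<^bsub>M\<^esub> (y \<oplus>\<^bsub>M\<^esub> z)"
  and comm: "!!x y. x \<in> carrier M ==> y \<in> carrier M ==> x \<oplus>\<^bsub>M\<^esub> y = y \<oplus>\<^bsub>M\<^esub> x"
  and zero_add: "!!x. x \<in> carrier M ==> \<zero>\<^bsub>M\<^esub> \<oplus>\<^bsub>M\<^esub> x = x"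
  and smult: "!!r x. r \<in> carrier R ==> x \<in> carrier M ==> r \<odot>\<^bsub>M\<^esub> x \<in> carrier M"
  and smult_add: "!!r x y. r \<in> carrier R ==> x \<in> carrier M ==> y \<in> carrier M ==>
  r \<odot>\<^bsub>M\<^esub> (x \<oplus>\<^bsub>M\<^esub> y) = r \<odot>\<^bsub>M\<^esub> x \<oplus>\<^bsub>M\<^esub> r \<odot>\<^bsub>M\<^esub> y"
  and add_smult: "!!r s x. r \<in> carrier R ==> s \<in> carrier R ==> x \<in> carrier M ==>
  (r \<oplus>\<^bsub>R\<^esub> s) \<odot>\<^bsub>M\<^esub> x = r \<odot>\<^bsub>M\<^esub> x \<oplus>\<^bsub>M\<^esub> s \<odot>\<^bsub>M\<^esub> x"
  and mult_smult: "!!r s x. r \<in> carrier R ==> s \<in> carrier R ==> x \<in> carrier M ==>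
  (r \<otimes>\<^bsub>R\<^esub> s) \<odot>\<^bsub>M\<^esub> x = r \<odot>\<^bsub>M\<^esub> (s \<odot>\<^bsub>M\<^esub> x)"
  and one_smult: "!!x. x \<in> carrier M ==> \<one>\<^bsub>R\<^esub> \<odot>\<^bsub>M\<^esub> x = x"
  and zero_smult: "!!x. x \<in> carrier M ==> \<zero>\<^bsub>R\<^esub> \<odot>\<^bsub>M\<^esub> x = \<zero>\<^bsub>M\<^esub>"
 shows "module R M"
proof(rule moduleI)
 interpret cring R by fact
 show "abelian_group M"
 proof(rule abelian_groupI)
  fix x assume x: "x \<in> M"
  have "(\<ominus>\<^sub>R \<one>\<^sub>R) \<odot>\<^sub>M x \<oplus>\<^sub>M x = (\<ominus>\<^sub>R \<one>\<^sub>R \<oplus>\<^sub>R \<one>\<^sub>R) \<odot>\<^sub>M x"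
  using x by(simp add: add_smult one_smult)
  also have "\<dots> = \<zero>\<^sub>M"
  using x by(simp add: l_neg zero_smult)
  finally show "\<exists>y\<in>M. y \<oplus>\<^sub>M x = \<zero>\<^sub>M"
  using x smult by blast
 qed (use assms in auto)
qed (use assms in auto)

text \<open>\<open>lin_maps\<close> says nothing about its two arguments being modules. Bundling the
  three facts lets all homomorphism and closure rules be drawn from a single hypothesis.\<close>

definition lmap :: "('a,'r) ring_scheme => ('a,'m) module => ('a,'n) module => ('m => 'n) => bool" where
 "lmap R M N f \<longleftrightarrow> module R M & module R N & f \<in> lin_maps R M N"

lemma lmapI:
 assumes "module R M" "module R N" "!!x. x \<in> M ==> f x \<in> N"
  "!!x y. x \<in> M ==> y \<in> M ==> f (x \<oplus>\<^sub>M y) = f x \<oplus>\<^sub>N f y"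
  "!!r x. r \<in> R ==> x \<in> M ==> f (r \<odot>\<^sub>M x) = r \<odot>\<^sub>N f x"
 shows "lmap R M N f"
 using assms by(auto simp: lmap_def lin_maps_def)

lemma
 assumes "lmap R M N f"
 shows lmap_dom: "module R M" and lmap_cod: "module R N"
  and lmap_in: "x \<in> M ==> f x \<in> N"
  and lmap_add: "x \<in> M ==> y \<in> M ==> f (x \<oplus>\<^sub>M y) = f x \<oplus>\<^sub>N f y"
  and lmap_smult: "r \<in> R ==> x \<in> M ==> f (r \<odot>\<^sub>M x) = r \<odot>\<^sub>N f x"
  and lmap_zero: "f \<zero>\<^sub>M = \<zero>\<^sub>N"
  and lmap_neg: "x \<in> M ==> f (\<ominus>\<^sub>M x) = \<ominus>\<^sub>N f x"
  and lmap_minus: "x \<in> M ==> y \<in> M ==> f (x \<ominus>\<^sub>M y) = f x \<ominus>\<^sub>N f y"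
proof -
 show M: "module R M" and N: "module R N"
  using assms by(auto simp: lmap_def)
 note [simp] = M N module_cring[OF M] modD[OF M] modD[OF N]
 show cl: "!!x. x \<in> M ==> f x \<in> N"
  and add: "!!x y. x \<in> M ==> y \<in> M ==> f (x \<oplus>\<^sub>M y) = f x \<oplus>\<^sub>N f y"
  and sm: "!!r x. r \<in> R ==> x \<in> M ==> f (r \<odot>\<^sub>M x) = r \<odot>\<^sub>N f x"
  using assms by(auto simp: lmap_def lin_maps_def)
 show z: "f \<zero>\<^sub>M = \<zero>\<^sub>N"
  using sm[of "\<zero>\<^sub>R" "\<zero>\<^sub>M"] cl[of "\<zero>\<^sub>M"] by(simp add: M N)
 show ng: "!!x. x \<in> M ==> f (\<ominus>\<^sub>M x) = \<ominus>\<^sub>N f x"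
 proof -
  fix x assume x: "x \<in> M"
  hence "f (\<ominus>\<^sub>M x) \<oplus>\<^sub>N f x = \<zero>\<^sub>N"
  using add[of "\<ominus>\<^sub>M x" x] z M by simp
  thus "f (\<ominus>\<^sub>M x) = \<ominus>\<^sub>N f x"
  using x cl M N by(simp add: mod_add_eq_zero[of R N])
 qed
 show "x \<in> M ==> y \<in> M ==> f (x \<ominus>\<^sub>M y) = f x \<ominus>\<^sub>N f y"
  by(simp add: a_minus_def add ng)
qed

lemmas lmapD = lmap_in lmap_add lmap_smult lmap_zero lmap_neg lmap_minus lmap_dom lmap_cod

lemma lmap_cong:
 assumes "lmap R M N f" "!!x. x \<in> M ==> g x = f x"
 shows "lmap R M N g"
 using modD[OF lmap_dom[OF assms(1)]] by(intro lmapI) (simp_all add: assms(2) lmapD[OF assms(1)])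

lemma lmap_ident: "module R M ==> lmap R M M (%x. x)"
 by(rule lmapI) auto

lemma lmap_comp:
 assumes "lmap R L M f" "lmap R M N g"
 shows "lmap R L N (%x. g (f x))"
 by(rule lmapI) (simp_all add: lmapD[OF assms(1)] lmapD[OF assms(2)])

lemma lmap_const_zero: "module R M ==> module R N ==> lmap R M N (%x. \<zero>\<^sub>N)"
 by(rule lmapI) (auto simp: modD[of R N])

lemma lmap_plus:
 assumes "lmap R M N f" "lmap R M N g"
 shows "lmap R M N (%x. f x \<oplus>\<^sub>N g x)"
proof -
 note [simp] = lmapD[OF assms(1)] lmapD[OF assms(2)] modD[OF lmap_cod[OF assms(1)]]
 show ?thesis
  by(rule lmapI) (auto simp: mod_add_add_swap[of R N] mod_smult_add[of R N])
qed

lemma lmap_uminus: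
 assumes "lmap R M N f"
 shows "lmap R M N (%x. \<ominus>\<^sub>N f x)"
proof -
 note [simp] = lmapD[OF assms(1)] modD[OF lmap_cod[OF assms(1)]]
 show ?thesis
  by(rule lmapI) (auto simp: mod_neg_distrib[of R N] mod_smult_neg[of R N])
qed

lemma lmap_diff:
 assumes "lmap R M N f" "lmap R M N g"
 shows "lmap R M N (%x. f x \<ominus>\<^sub>N g x)"
 using lmap_plus[OF assms(1) lmap_uminus[OF assms(2)]] by(simp add: a_minus_def)

lemma lmap_scale:
 assumes "lmap R M N f" "r \<in> R"
 shows "lmap R M N (%x. r \<odot>\<^sub>N f x)"
proof -
 note [simp] = lmapD[OF assms(1)] modD[OF lmap_cod[OF assms(1)]] assms(2) module_cring[OF lmap_dom[OF assms(1)]]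
 show ?thesis
  by(rule lmapI) (auto simp: mod_smult_add[of R N] cring_mult_comm[of R r] simp flip: mod_mult_smult[of R N])
qed

lemma mod_finsum_closed: "module R M ==> (!!i. i \<in> A ==> h i \<in> M) ==> finsum M h A \<in> M"
 by(rule abelian_monoid.finsum_closed) (auto simp: module_def abelian_group_def)

lemma mod_finsum_insert: "module R M ==> finite A ==> a \<notin> A ==> (!!i. i \<in> insert a A ==> h i \<in> M) ==>
  finsum M h (insert a A) = h a \<oplus>\<^sub>M finsum M h A"
 by(rule abelian_monoid.finsum_insert) (auto simp: module_def abelian_group_def)

lemma mod_finsum_empty: "module R M ==> finsum M h {} = \<zero>\<^sub>M"
 by(rule abelian_monoid.finsum_empty) (auto simp: module_def abelian_group_def)

lemma mod_finsum_cong: "module R M ==> (!!i. i \<in> A ==> h i = k i) ==> (!!i. i \<in> A ==> k i \<in> M) ==>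
  finsum M h A = finsum M k A"
 by(rule abelian_monoid.finsum_cong') (auto simp: module_def abelian_group_def)

lemma mod_finsum_zero:
 assumes "module R M" "!!i. i \<in> A ==> h i = \<zero>\<^sub>M"
 shows "finsum M h A = \<zero>\<^sub>M"
proof -
 interpret module R M by fact
 have "finsum M h A = finsum M (%i. \<zero>\<^sub>M) A"
  by(rule M.finsum_cong') (use assms(2) in auto)
 thus ?thesis by simp
qed

lemma lmap_finsum:
 assumes "lmap R M N f" "finite A" "!!i. i \<in> A ==> h i \<in> M"
 shows "f (finsum M h A) = finsum N (%i. f (h i)) A"
 using assms(2,3)
proof(induction A rule: finite_induct)
 case empty
 thus ?case using assms(1) by(simp add: mod_finsum_empty[of R] lmapD[OF assms(1)])
next
 case (insert a A)
 note [simp] = lmapD[OF assms(1)]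
 have "finsum M h (insert a A) = h a \<oplus>\<^sub>M finsum M h A"
  by(rule mod_finsum_insert[of R]) (use insert in auto)
 moreover have "finsum N (%i. f (h i)) (insert a A) = f (h a) \<oplus>\<^sub>N finsum N (%i. f (h i)) A"
  by(rule mod_finsum_insert[of R]) (use insert in auto)
 moreover have "finsum M h A \<in> M"
  by(rule mod_finsum_closed[of R]) (use insert in auto)
 ultimately show ?case using insert by simp
qed

lemma lmap_sum_maps:
 assumes "finite A" "module R M" "module R N" "!!i. i \<in> A ==> lmap R M N (h i)"
 shows "lmap R M N (%x. finsum N (%i. h i x) A)"
 using assms(1,4)
proof(induction A rule: finite_induct)
 case empty
 thus ?case using assms lmap_const_zero by(simp add: mod_finsum_empty[of R N])
next
 case (insert a A)
 hence "lmap R M N (%x. h a x \<oplus>\<^sub>N finsum N (%i. h i x) A)"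
  by(intro lmap_plus) auto
 thus ?case
 proof(rule lmap_cong)
  fix x assume "x \<in> M"
  thus "finsum N (%i. h i x) (insert a A) = h a x \<oplus>\<^sub>N finsum N (%i. h i x) A"
  by(intro mod_finsum_insert[of R] lmap_in[of R M N]) (use insert assms(3) in auto)
 qed
qed

text \<open>A ring scheme carries no scalar multiplication, so the ring as a module over itself has
  to be a new record. Its submodules are the ideals.\<close>

definition reg_mod :: "('a,'r) ring_scheme => ('a,'a) module" where
 "reg_mod R = \<lparr>carrier = carrier R, monoid.mult = undefined, one = undefined,
  ring.zero = \<zero>\<^sub>R, ring.add = add R, module.smult = monoid.mult R\<rparr>"

lemma reg_mod_simps [simp]:
 "carrier (reg_mod R) = carrier R" "\<zero>\<^sub>(reg_mod R) = \<zero>\<^sub>R"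
 "x \<oplus>\<^sub>(reg_mod R) y = x \<oplus>\<^sub>R y" "r \<odot>\<^sub>(reg_mod R) x = r \<otimes>\<^sub>R x"
 by(auto simp: reg_mod_def)

lemma module_reg_mod: "cring R ==> module R (reg_mod R)"
proof -
 assume "cring R"
 then interpret cring R .
 show ?thesis
  by(rule moduleI') (auto simp: is_cring a_ac m_assoc l_distr r_distr)
qed

lemma lmap_reg_mod_smult: "module R M ==> x \<in> M ==> lmap R (reg_mod R) M (%r. r \<odot>\<^sub>M x)"
 by(rule lmapI) (auto simp: module_reg_mod module_cring mod_add_smult[of R M] mod_mult_smult[of R M] modD[of R M])

subsection \<open>Submodules, kernels and factorisations\<close>

lemma submoduleI':
 assumes M: "module R M" and "H \<subseteq> carrier M" "\<zero>\<^sub>M \<in> H"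
  and "!!x y. x \<in> H ==> y \<in> H ==> x \<oplus>\<^sub>M y \<in> H"
  and sm: "!!r x. r \<in> R ==> x \<in> H ==> r \<odot>\<^sub>M x \<in> H"
 shows "submodule H R M"
proof(rule module.submoduleI)
 fix x assume x: "x \<in> H"
 have "\<ominus>\<^sub>M x = (\<ominus>\<^sub>R \<one>\<^sub>R) \<odot>\<^sub>M x"
  using M x assms(2) by(subst mod_neg_smult[of R M]) (auto simp: module_cring[OF M] modD[OF M])
 thus "\<ominus>\<^sub>M x \<in> H" using sm[of "\<ominus>\<^sub>R \<one>\<^sub>R" x] x M by(auto simp: module_cring)
qed (use assms in auto)

lemma
 assumes "submodule H R M" "module R M"
 shows submodule_sub: "x \<in> H ==> x \<in> M"
  and submodule_zero: "\<zero>\<^sub>M \<in> H"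
  and submodule_add: "x \<in> H ==> y \<in> H ==> x \<oplus>\<^sub>M y \<in> H"
  and submodule_smult: "r \<in> R ==> x \<in> H ==> r \<odot>\<^sub>M x \<in> H"
  and submodule_neg: "x \<in> H ==> \<ominus>\<^sub>M x \<in> H"
  and submodule_minus: "x \<in> H ==> y \<in> H ==> x \<ominus>\<^sub>M y \<in> H"
proof -
 note E = module.submoduleE[OF assms(2,1)]
 show "x \<in> H ==> x \<in> M" using E by auto
 show "\<zero>\<^sub>M \<in> H"
 proof -
  obtain x where x: "x \<in> H" using E(2) by blast
  hence "x \<oplus>\<^sub>M \<ominus>\<^sub>M x \<in> H" by(intro E)
  thus ?thesis using x E(1) modD[OF assms(2)] by auto
 qed
 show "x \<in> H ==> y \<in> H ==> x \<ominus>\<^sub>M y \<in> H" using E by(auto simp: a_minus_def)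
qed (use module.submoduleE[OF assms(2,1)] in auto)

text \<open>Submodules remain sets; to use one as a module only the carrier field is changed, so
  that the inclusion is the identity function and no embedding has to be named.\<close>

abbreviation restr_mod :: "('a,'m) module => 'm set => ('a,'m) module" where
 "restr_mod M K \<equiv> M\<lparr>carrier := K\<rparr>"

lemma module_restr_mod: "module R M ==> submodule K R M ==> module R (restr_mod M K)"
 by(rule submodule.submodule_is_module)

lemma lmap_restr_dom:
 assumes "lmap R M N f" "submodule K R M"
 shows "lmap R (restr_mod M K) N f"
 using assms by(intro lmapI) (auto simp: lmapD[OF assms(1)] module_restr_mod submodule_sub[of K R M])

lemma lmap_restr_cod:
 assumes "lmap R M N f" "submodule K R N" "!!x. x \<in> M ==> f x \<in> K"
 shows "lmap R M (restr_mod N K) f"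
 using assms by(intro lmapI) (auto simp: lmapD[OF assms(1)] module_restr_mod)

lemma lmap_extend_cod:
 assumes "lmap R M (restr_mod N K) f" "submodule K R N" "module R N"
 shows "lmap R M N f"
 using lmapD[OF assms(1)] assms by(intro lmapI) (auto simp: submodule_sub[of K R N])

definition kern :: "('a,'m) module => ('a,'n) module => ('m => 'n) => 'm set" where
 "kern M N f = {x \<in> M. f x = \<zero>\<^sub>N}"

lemma submodule_kern:
 assumes "lmap R M N f"
 shows "submodule (kern M N f) R M"
 by(rule submoduleI')
  (use lmapD[OF assms] modD[OF lmap_dom[OF assms]] modD[OF lmap_cod[OF assms]] in \<open>auto simp: kern_def\<close>)

lemma submodule_image:
 assumes "lmap R M N f"
 shows "submodule (f ` carrier M) R N"
proof(rule submoduleI')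
 note M = lmap_dom[OF assms]
 {
  fix x y assume "x \<in> f ` carrier M" "y \<in> f ` carrier M"
  then obtain a b where "a \<in> M" "b \<in> M" "x = f a" "y = f b" by blast
  thus "x \<oplus>\<^sub>N y \<in> f ` carrier M"
  using lmap_add[OF assms, of a b] mod_add_closed[OF M, of a b] by(metis image_eqI)
 next
  fix r x assume "r \<in> R" "x \<in> f ` carrier M"
  then obtain a where "a \<in> M" "x = f a" by blast
  thus "r \<odot>\<^sub>N x \<in> f ` carrier M"
  using lmap_smult[OF assms, of r a] mod_smult_closed[OF M, of r a] \<open>r \<in> R\<close> by(metis image_eqI)
 }
 show "\<zero>\<^sub>N \<in> f ` carrier M"
  using lmap_zero[OF assms] mod_zero_closed[OF M] by(metis image_eqI)
qed (use lmapD[OF assms] in auto)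

lemma submodule_Int:
 assumes "submodule H R M" "submodule K R M" "module R M"
 shows "submodule (H \<inter> K) R M"
 using assms(3)
 by(rule submoduleI')
  (auto simp: submodule_sub[OF assms(1,3)] submodule_zero[OF assms(1,3)] submodule_zero[OF assms(2,3)]
  submodule_add[OF assms(1,3)] submodule_add[OF assms(2,3)]
  submodule_smult[OF assms(1,3)] submodule_smult[OF assms(2,3)])

text \<open>The homomorphism theorem without quotients: \<open>S\<close> stands for \<open>F\<close>
  modulo the kernel of \<open>e\<close>. A value of \<open>k\<close> is found by choosing a
  preimage, and differences of preimages lie in the kernel.\<close>

lemma lmap_factor:
 assumes e: "lmap R F S e" and h: "lmap R F A h"
  and surj: "!!s. s \<in> S ==> \<exists>x\<in>F. e x = s"
  and ker: "!!x. x \<in> F ==> e x = \<zero>\<^sub>S ==> h x = \<zero>\<^sub>A"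
 shows "EX k. lmap R S A k & (\<forall>x\<in>F. k (e x) = h x)"
proof -
 note [simp] = lmapD[OF e] lmapD[OF h] modD[OF lmap_dom[OF e]]
 define k where "k s = h (SOME x. x \<in> F & e x = s)" for s
 have key: "h x = h y" if "x \<in> F" "y \<in> F" "e x = e y" for x y
  using ker[of "x \<ominus>\<^sub>F y"] that
  by(simp add: mod_minus_eq_zero[of R S] mod_minus_eq_zero[OF lmap_cod[OF h]])
 have k: "k (e x) = h x" if x: "x \<in> F" for x
 proof -
  have "(SOME y. y \<in> F & e y = e x) \<in> F & e (SOME y. y \<in> F & e y = e x) = e x"
  by(rule someI[of _ x]) (use x in auto)
  thus ?thesis unfolding k_def by(intro key) (use x in auto)
 qed
 have "lmap R S A k"
 proof(rule lmapI)
  fix s assume "s \<in> S"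
  thus "k s \<in> A" using surj k lmap_in[OF h] by metis
 next
  fix s t assume "s \<in> S" "t \<in> S"
  then obtain x y where "x \<in> F" "y \<in> F" "s = e x" "t = e y" using surj by metis
  thus "k (s \<oplus>\<^sub>S t) = k s \<oplus>\<^sub>A k t" using k[of "x \<oplus>\<^sub>F y"] by(simp add: k)
 next
  fix r s assume "r \<in> R" "s \<in> S"
  then obtain x where "x \<in> F" "s = e x" using surj by metis
  thus "k (r \<odot>\<^sub>S s) = r \<odot>\<^sub>A k s" using k[of "r \<odot>\<^sub>F x"] \<open>r \<in> R\<close> by(simp add: k)
 qed auto
 with k show ?thesis by auto
qed

subsection \<open>Hom modules\<close>

lemma hom_mod_simps:
 "carrier (Hom R M N) = lin_maps R M N \<inter> extensional (carrier M)"
 "\<zero>\<^sub>(Hom R M N) = (\<lambda>x\<in>M. \<zero>\<^sub>N)"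
 "f \<oplus>\<^sub>(Hom R M N) g = (\<lambda>x\<in>M. f x \<oplus>\<^sub>N g x)"
 "r \<odot>\<^sub>(Hom R M N) f = (\<lambda>x\<in>M. r \<odot>\<^sub>N f x)"
 by(auto simp: hom_mod_def)

lemma hom_apply [simp]:
 "x \<in> carrier M ==> \<zero>\<^bsub>Hom R M N\<^esub> x = \<zero>\<^bsub>N\<^esub>"
 "x \<in> carrier M ==> (f \<oplus>\<^bsub>Hom R M N\<^esub> g) x = f x \<oplus>\<^bsub>N\<^esub> g x"
 "x \<in> carrier M ==> (r \<odot>\<^bsub>Hom R M N\<^esub> f) x = r \<odot>\<^bsub>N\<^esub> f x"
 by(auto simp: hom_mod_simps)

lemma hom_lmap: "f \<in> Hom R M N ==> module R M ==> module R N ==> lmap R M N f"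
 by(auto simp: hom_mod_simps lmap_def)

lemma hom_mem: "lmap R M N f ==> (\<lambda>x\<in>M. f x) \<in> Hom R M N"
 by(auto simp: hom_mod_simps lmap_def lin_maps_def modD[of R M])

lemma hom_eqI:
 "f \<in> Hom R M N ==> g \<in> Hom R M N ==> (!!x. x \<in> M ==> f x = g x) ==> f = g"
 by(auto simp: hom_mod_simps intro: extensionalityI)

lemma hom_ext: "f \<in> Hom R M N ==> (\<lambda>x\<in>M. f x) = f"
 by(auto simp: hom_mod_simps extensional_restrict)

lemma hom_mod_add_closed:
 assumes "module R M" "module R N" "f \<in> Hom R M N" "g \<in> Hom R M N"
 shows "f \<oplus>\<^sub>(Hom R M N) g \<in> Hom R M N"
 using hom_mem[OF lmap_plus[OF hom_lmap[OF assms(3,1,2)] hom_lmap[OF assms(4,1,2)]]]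
 by(simp add: hom_mod_simps(3))

lemma module_hom_mod [simp, intro]:
 assumes M: "module R M" and N: "module R N"
 shows "module R (Hom R M N)"
proof -
 note [simp] = M N module_cring[OF M]
 have cl: "f x \<in> N" if "f \<in> Hom R M N" "x \<in> M" for f x
  using lmap_in[OF hom_lmap[OF that(1) M N]] that by auto
 have add: "f \<oplus>\<^sub>(Hom R M N) g \<in> Hom R M N"
  if "f \<in> Hom R M N" "g \<in> Hom R M N" for f g
  by(rule hom_mod_add_closed) (use that in auto)
 have sm: "r \<odot>\<^sub>(Hom R M N) f \<in> Hom R M N"
  if "f \<in> Hom R M N" "r \<in> R" for f r
  using hom_mem[OF lmap_scale[OF hom_lmap[OF that(1) M N] that(2)]] by(simp add: hom_mod_simps(4))
 show ?thesis
 proof(rule moduleI')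
  show "\<zero>\<^sub>(Hom R M N) \<in> Hom R M N"
  using hom_mem[OF lmap_const_zero[OF M N]] by(simp add: hom_mod_simps(2))
  have z: "\<zero>\<^sub>(Hom R M N) \<in> Hom R M N"
  using hom_mem[OF lmap_const_zero[OF M N]] by(simp add: hom_mod_simps(2))
  show "\<zero>\<^sub>(Hom R M N) \<oplus>\<^sub>(Hom R M N) f = f" if "f \<in> Hom R M N" for f
  by(rule hom_eqI[of _ R M N]) (use that z cl[OF that] add in \<open>auto simp: mod_zero_add[of R N]\<close>)
  show "\<zero>\<^sub>R \<odot>\<^sub>(Hom R M N) f = \<zero>\<^sub>(Hom R M N)" if "f \<in> Hom R M N" for f
  unfolding hom_mod_simps using cl[OF that] by(auto simp: fun_eq_iff restrict_def modD[OF N])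
 qed (auto simp: add sm intro!: hom_eqI[of _ R M N] simp: cl mod_assoc[of R N] mod_comm[of R N]
  mod_smult_add[of R N] mod_add_smult[of R N] mod_mult_smult[of R N]
  mod_zero_add[of R N] mod_one_smult[of R N])
qed

lemma hom_closed: "f \<in> Hom R M N ==> x \<in> M ==> f x \<in> N"
 by(auto simp: hom_mod_simps lin_maps_def)

lemma hom_neg_apply [simp]:
 assumes "module R M" "module R N" "f \<in> Hom R M N" "x \<in> M"
 shows "(\<ominus>\<^sub>(Hom R M N) f) x = \<ominus>\<^sub>N f x"
proof -
 have "(\<ominus>\<^sub>(Hom R M N) f \<oplus>\<^sub>(Hom R M N) f) x = \<zero>\<^sub>N"
  using assms by(subst mod_neg_add[of R]) auto
 thus ?thesis
  using assms by(simp add: mod_add_eq_zero[of R N] hom_closed[of _ R M N] mod_neg_closed[of R "Hom R M N"])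
qed

lemma hom_minus_apply [simp]:
 assumes "module R M" "module R N" "f \<in> Hom R M N" "g \<in> Hom R M N" "x \<in> M"
 shows "(f \<ominus>\<^sub>(Hom R M N) g) x = f x \<ominus>\<^sub>N g x"
 using assms by(simp add: a_minus_def)

lemma lmap_eval: "module R M ==> module R N ==> x \<in> M ==> lmap R (Hom R M N) N (%f. f x)"
 by(rule lmapI) (auto simp: hom_closed)

text \<open>Bilinear maps take the place of maps out of tensor products. This avoids the change of
  type that \<open>tensor\<close> brings, until the class of modules \<open>P \<otimes> C\<close>
  itself has to be unfolded.\<close>

definition bilin :: "('a,'r) ring_scheme => ('a,'l) module => ('a,'m) module => ('a,'n) module =>
  ('l => 'm => 'n) => bool" where
 "bilin R L M N B \<longleftrightarrow> module R L & module R M & module R N &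
  (\<forall>x\<in>L. lmap R M N (B x)) & (\<forall>y\<in>M. lmap R L N (%x. B x y))"

lemma
 assumes "bilin R L M N B"
 shows bilin_right: "x \<in> L ==> lmap R M N (B x)"
  and bilin_left: "y \<in> M ==> lmap R L N (%x. B x y)"
  and bilin_closed: "x \<in> L ==> y \<in> M ==> B x y \<in> N"
  and bilin_modules: "module R L" "module R M" "module R N"
proof -
 show r: "x \<in> L ==> lmap R M N (B x)" and "y \<in> M ==> lmap R L N (%x. B x y)"
  "module R L" "module R M" "module R N"
  using assms by(auto simp: bilin_def)
 show "x \<in> L ==> y \<in> M ==> B x y \<in> N"
  using lmap_in[OF r] by auto
qed

lemma bilin_flip: "bilin R L M N B ==> bilin R M L N (%y x. B x y)"
 by(auto simp: bilin_def)

lemma lmap_curry: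
 assumes "bilin R L M N B"
 shows "lmap R L (Hom R M N) (%x. \<lambda>y\<in>M. B x y)"
proof -
 note B = bilin_modules[OF assms]
 have m: "(\<lambda>y\<in>M. B x y) \<in> Hom R M N" if "x \<in> L" for x
  by(rule hom_mem) (use bilin_right[OF assms that] in auto)
 show ?thesis
 proof(rule lmapI)
  fix x y assume xy: "x \<in> L" "y \<in> L"
  show "(\<lambda>z\<in>M. B (x \<oplus>\<^sub>L y) z) = (\<lambda>z\<in>M. B x z) \<oplus>\<^sub>(Hom R M N) (\<lambda>z\<in>M. B y z)"
  by(rule hom_eqI[of _ R M N]) (use xy m B lmap_add[OF bilin_left[OF assms]] in \<open>auto simp: mod_add_closed[of R "Hom R M N"] mod_add_closed[of R L]\<close>)
 next
  fix r x assume xy: "r \<in> R" "x \<in> L"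
  show "(\<lambda>z\<in>M. B (r \<odot>\<^sub>L x) z) = r \<odot>\<^sub>(Hom R M N) (\<lambda>z\<in>M. B x z)"
  by(rule hom_eqI[of _ R M N]) (use xy m B lmap_smult[OF bilin_left[OF assms]] in \<open>auto simp: mod_smult_closed[of R "Hom R M N"] mod_smult_closed[of R L]\<close>)
 qed (use B m in auto)
qed

lemma bilin_uncurry:
 assumes "lmap R L (Hom R M N) f" "module R M" "module R N"
 shows "bilin R L M N f"
 unfolding bilin_def
proof(intro conjI ballI)
 show "lmap R M N (f x)" if "x \<in> L" for x
  by(rule hom_lmap) (use lmapD[OF assms(1)] assms that in auto)
 show "lmap R L N (%x. f x y)" if "y \<in> M" for y
  by(rule lmap_comp[OF assms(1) lmap_eval]) (use assms that in auto)
qed (use lmapD[OF assms(1)] assms in auto)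

lemma bilinI:
 assumes "module R L" "module R M" "module R N"
  "!!x. x \<in> L ==> lmap R M N (B x)" "!!y. y \<in> M ==> lmap R L N (%x. B x y)"
 shows "bilin R L M N B"
 using assms by(simp add: bilin_def)

lemma bilin_comp_left:
 assumes "bilin R L M N B" "lmap R K L f"
 shows "bilin R K M N (%x. B (f x))"
proof(rule bilinI)
 show "lmap R K N (%x. B (f x) y)" if "y \<in> M" for y
  by(rule lmap_comp[OF assms(2) bilin_left[OF assms(1) that]])
qed (use lmapD[OF assms(2)] bilin_modules[OF assms(1)] bilin_right[OF assms(1)] in auto)

lemma bilin_comp_right:
 assumes "bilin R L M N B" "lmap R K M f"
 shows "bilin R L K N (%x y. B x (f y))"
 using bilin_flip[OF bilin_comp_left[OF bilin_flip[OF assms(1)] assms(2)]] .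

lemma bilin_post:
 assumes "bilin R L M N B" "lmap R N K f"
 shows "bilin R L M K (%x y. f (B x y))"
proof(rule bilinI)
 show "lmap R L K (%x. f (B x y))" if "y \<in> M" for y
  by(rule lmap_comp[OF bilin_left[OF assms(1) that] assms(2)])
 show "lmap R M K (%y. f (B x y))" if "x \<in> L" for x
  by(rule lmap_comp[OF bilin_right[OF assms(1) that] assms(2)])
qed (use lmapD[OF assms(2)] bilin_modules[OF assms(1)] in auto)

lemma bilin_hom_comp:
 assumes "module R L" "module R M"
 shows "bilin R (Hom R L M) L M (%f x. f x)"
 unfolding bilin_def using assms by(auto intro: hom_lmap lmap_eval)

lemma lmap_precomp:
 assumes "lmap R A B f" "module R Z"
 shows "lmap R (Hom R B Z) (Hom R A Z) (%g. \<lambda>x\<in>A. g (f x))"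
 by(rule lmap_curry, rule bilin_comp_right[OF _ assms(1)], rule bilin_hom_comp)
  (use assms lmapD[OF assms(1)] in auto)

lemma lmap_postcomp:
 assumes "lmap R A B f" "module R Z"
 shows "lmap R (Hom R Z A) (Hom R Z B) (%g. \<lambda>x\<in>Z. f (g x))"
 by(rule lmap_curry, rule bilin_post[OF _ assms(1)], rule bilin_hom_comp)
  (use assms lmapD[OF assms(1)] in auto)

section \<open>Injective modules\<close>

text \<open>Baer's criterion taken as the definition of injectivity. Only ideals of \<open>R\<close>
  are tested, so no quantification over module types occurs and the notion applies to modules with
  elements of any type.\<close>

definition baer :: "('a,'r) ring_scheme => ('a,'m) module => bool" where
 "baer R E \<longleftrightarrow> module R E & (ALL I f. submodule I R (reg_mod R) & lmap R (restr_mod (reg_mod R) I) E f -->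
  (\<exists>e\<in>E. \<forall>a\<in>I. f a = a \<odot>\<^sub>E e))"

lemma baer_module: "baer R E ==> module R E"
 by(simp add: baer_def)

text \<open>The graph of a partial linear map, as a submodule of the product. By linearity
  single-valuedness may be stated at zero. Graphs are ordered by inclusion, which suits Zorn's
  lemma.\<close>

definition lin_graph :: "('a,'r) ring_scheme => ('a,'m) module => ('a,'n) module => ('m \<times> 'n) set => bool" where
 "lin_graph R B E G \<longleftrightarrow> G \<subseteq> carrier B \<times> carrier E & (\<zero>\<^sub>B, \<zero>\<^sub>E) \<in> G &
  (ALL x y x' y'. (x, y) \<in> G --> (x', y') \<in> G --> (x \<oplus>\<^sub>B x', y \<oplus>\<^sub>E y') \<in> G) &
  (ALL r x y. r \<in> R --> (x, y) \<in> G --> (r \<odot>\<^sub>B x, r \<odot>\<^sub>E y) \<in> G) &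
  (ALL y. (\<zero>\<^sub>B, y) \<in> G --> y = \<zero>\<^sub>E)"

lemma
 assumes "lin_graph R B E G"
 shows lin_graph_sub: "(x, y) \<in> G ==> x \<in> B" "(x, y) \<in> G ==> y \<in> E"
  and lin_graph_zero: "(\<zero>\<^sub>B, \<zero>\<^sub>E) \<in> G"
  and lin_graph_add: "(x, y) \<in> G ==> (x', y') \<in> G ==> (x \<oplus>\<^sub>B x', y \<oplus>\<^sub>E y') \<in> G"
  and lin_graph_smult: "r \<in> R ==> (x, y) \<in> G ==> (r \<odot>\<^sub>B x, r \<odot>\<^sub>E y) \<in> G"
  and lin_graph_sv: "(\<zero>\<^sub>B, y) \<in> G ==> y = \<zero>\<^sub>E"
 using assms unfolding lin_graph_def by blast+

lemma lin_graph_neg: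
 assumes "lin_graph R B E G" "module R B" "module R E" "(x, y) \<in> G"
 shows "(\<ominus>\<^sub>B x, \<ominus>\<^sub>E y) \<in> G"
proof -
 have "((\<ominus>\<^sub>R \<one>\<^sub>R) \<odot>\<^sub>B x, (\<ominus>\<^sub>R \<one>\<^sub>R) \<odot>\<^sub>E y) \<in> G"
  using lin_graph_smult[OF assms(1) _ assms(4)] module_cring[OF assms(2)] by auto
 thus ?thesis
  using lin_graph_sub[OF assms(1,4)] assms(2,3) module_cring[OF assms(2)]
  by(simp add: mod_neg_smult[of R B] mod_neg_smult[of R E] modD[of R B] modD[of R E])
qed

lemma lin_graph_unique:
 assumes "lin_graph R B E G" "module R B" "module R E" "(x, y) \<in> G" "(x, z) \<in> G"
 shows "y = z"
proof -
 have "(x \<oplus>\<^sub>B \<ominus>\<^sub>B x, y \<oplus>\<^sub>E \<ominus>\<^sub>E z) \<in> G"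
  by(intro lin_graph_add[OF assms(1)] lin_graph_neg[OF assms(1-3)] assms(4,5))
 hence "y \<oplus>\<^sub>E \<ominus>\<^sub>E z = \<zero>\<^sub>E"
  using lin_graph_sv[OF assms(1)] lin_graph_sub[OF assms(1,4)] by(simp add: modD[OF assms(2)])
 thus ?thesis
  using mod_minus_eq_zero[OF assms(3), of y z] lin_graph_sub[OF assms(1,4)] lin_graph_sub[OF assms(1,5)]
  by(simp add: a_minus_def)
qed

text \<open>Zorn's lemma gives a maximal graph \<open>M\<close> above \<open>G0\<close>. For any
  \<open>b\<close>, the ideal of those \<open>r\<close> with \<open>r b\<close> in the domain maps
  to \<open>E\<close>; Baer's criterion writes this map as multiplication by some \<open>e\<close>,
  and assigning \<open>e\<close> to \<open>b\<close> yields a graph containing \<open>M\<close>,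
  which is \<open>M\<close> by maximality.\<close>

lemma baer_graph_extend:
 assumes E: "baer R E" and B: "module R B" and G0: "lin_graph R B E G0"
 shows "EX f. lmap R B E f & (ALL x y. (x, y) \<in> G0 --> f x = y)"
proof -
 note ME = baer_module[OF E]
 note [simp] = modD[OF B] modD[OF ME] module_cring[OF B]
 let ?A = "{G. lin_graph R B E G & G0 \<subseteq> G}"
 have "\<exists>M\<in>?A. \<forall>X\<in>?A. M \<subseteq> X --> X = M"
 proof(rule subset_Zorn_nonempty)
  show "?A ~= {}" using G0 by blast
  fix \<C> assume ne: "\<C> ~= {}" and ch: "subset.chain ?A \<C>"
  have lg: "lin_graph R B E G" "G0 \<subseteq> G" if "G \<in> \<C>" for G
  using ch that by(auto simp: subset.chain_def)
  have two: "\<exists>G\<in>\<C>. p \<in> G & q \<in> G" if pq: "p \<in> \<Union>\<C>" "q \<in> \<Union>\<C>" for p q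
  proof -
  obtain G where "G \<in> \<C>" "p \<in> G" using pq(1) by auto
  moreover obtain H where "H \<in> \<C>" "q \<in> H" using pq(2) by auto
  ultimately have GH: "G \<in> \<C>" "H \<in> \<C>" "p \<in> G" "q \<in> H" by auto
  hence "G \<subseteq> H \<or> H \<subseteq> G" using ch unfolding subset.chain_def by blast
  thus ?thesis using GH by blast
  qed
  have "lin_graph R B E (\<Union>\<C>)"
  unfolding lin_graph_def
  proof(intro conjI allI impI)
  show "\<Union>\<C> \<subseteq> carrier B \<times> carrier E" using lg unfolding lin_graph_def by blast
  show "(\<zero>\<^sub>B, \<zero>\<^sub>E) \<in> \<Union>\<C>" using ne lin_graph_zero[OF lg(1)] by blast
  show "(x \<oplus>\<^sub>B x', y \<oplus>\<^sub>E y') \<in> \<Union>\<C>" if "(x, y) \<in> \<Union>\<C>" "(x', y') \<in> \<Union>\<C>" for x y x' y'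
  using two[OF that] lin_graph_add[OF lg(1)] by blast
  show "(r \<odot>\<^sub>B x, r \<odot>\<^sub>E y) \<in> \<Union>\<C>" if "r \<in> R" "(x, y) \<in> \<Union>\<C>" for r x y
  using that lin_graph_smult[OF lg(1)] by blast
  show "y = \<zero>\<^sub>E" if "(\<zero>\<^sub>B, y) \<in> \<Union>\<C>" for y
  using that lin_graph_sv[OF lg(1)] by blast
  qed
  thus "\<Union>\<C> \<in> ?A" using ne lg by blast
 qed
 then obtain M where M: "lin_graph R B E M" "G0 \<subseteq> M"
  and max: "!!X. lin_graph R B E X ==> M \<subseteq> X ==> X = M" by(metis (no_types, lifting) mem_Collect_eq order_trans)
 have uniq: "y = z" if "(x, y) \<in> M" "(x, z) \<in> M" for x y z
  using lin_graph_unique[OF M(1) B ME that] .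
 note sub = lin_graph_sub[OF M(1)]
 have dom: "EX y. (b, y) \<in> M" if b: "b \<in> B" for b
 proof -
  define I where "I = {r \<in> R. EX y. (r \<odot>\<^sub>B b, y) \<in> M}"
  define f where "f r = (THE y. (r \<odot>\<^sub>B b, y) \<in> M)" for r
  have fI: "f r = y" if "(r \<odot>\<^sub>B b, y) \<in> M" for r y
  unfolding f_def using that uniq by blast
  have f: "(r \<odot>\<^sub>B b, f r) \<in> M" if "r \<in> I" for r
  using that fI unfolding I_def by auto
  have add: "((r \<oplus>\<^sub>R s) \<odot>\<^sub>B b, f r \<oplus>\<^sub>E f s) \<in> M" if "r \<in> I" "s \<in> I" for r s
  using lin_graph_add[OF M(1) f[OF that(1)] f[OF that(2)]] that b
  by(simp add: mod_add_smult[OF B] I_def)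
  have sm: "((r \<otimes>\<^sub>R s) \<odot>\<^sub>B b, r \<odot>\<^sub>E f s) \<in> M" if "r \<in> R" "s \<in> I" for r s
  using lin_graph_smult[OF M(1) that(1) f[OF that(2)]] that b
  by(simp add: mod_mult_smult[OF B] I_def)
  have subI: "submodule I R (reg_mod R)"
  proof(rule submoduleI')
  show "\<zero>\<^sub>(reg_mod R) \<in> I" using lin_graph_zero[OF M(1)] b by(auto simp: I_def)
  show "x \<oplus>\<^sub>(reg_mod R) y \<in> I" if "x \<in> I" "y \<in> I" for x y
  using add[OF that] that by(auto simp: I_def)
  show "r \<odot>\<^sub>(reg_mod R) x \<in> I" if "r \<in> R" "x \<in> I" for r x
  using sm[OF that] that by(auto simp: I_def)
  qed (auto simp: module_reg_mod I_def)
  have "lmap R (restr_mod (reg_mod R) I) E f"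
  proof(rule lmapI)
  show "module R (restr_mod (reg_mod R) I)" using subI by(simp add: module_restr_mod module_reg_mod)
  show "f x \<in> E" if "x \<in> (restr_mod (reg_mod R) I)" for x
  using that f[of x] sub by auto
  qed (use fI[OF add] fI[OF sm] ME in auto)
  then obtain e where e: "e \<in> E" "!!a. a \<in> I ==> f a = a \<odot>\<^sub>E e"
  using E subI unfolding baer_def by blast
  define G where "G = {(x \<oplus>\<^sub>B r \<odot>\<^sub>B b, y \<oplus>\<^sub>E r \<odot>\<^sub>E e) |x y r. (x, y) \<in> M & r \<in> R}"
  have GI: "(x \<oplus>\<^sub>B r \<odot>\<^sub>B b, y \<oplus>\<^sub>E r \<odot>\<^sub>E e) \<in> G" if "(x, y) \<in> M" "r \<in> R" for x y r
  using that unfolding G_def by blast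
  have GE: "EX u v r. (u, v) \<in> M & r \<in> R & x = u \<oplus>\<^sub>B r \<odot>\<^sub>B b & y = v \<oplus>\<^sub>E r \<odot>\<^sub>E e"
  if "(x, y) \<in> G" for x y
  using that unfolding G_def by blast
  have MG: "M \<subseteq> G"
  proof
  fix p assume "p \<in> M"
  moreover obtain x y where "p = (x, y)" by force
  ultimately show "p \<in> G" using GI[of x y "\<zero>\<^sub>R"] b e sub by simp
  qed
  have "lin_graph R B E G"
  unfolding lin_graph_def
  proof(intro conjI allI impI)
  show "G \<subseteq> carrier B \<times> carrier E"
  using sub b e(1) by(auto simp: G_def)
  show "(\<zero>\<^sub>B, \<zero>\<^sub>E) \<in> G" using MG lin_graph_zero[OF M(1)] by blast
  next
  fix x y x' y' assume G: "(x, y) \<in> G" "(x', y') \<in> G"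
  obtain u v r u' v' r' where
  *: "(u, v) \<in> M" "r \<in> R" "x = u \<oplus>\<^sub>B r \<odot>\<^sub>B b" "y = v \<oplus>\<^sub>E r \<odot>\<^sub>E e"
  "(u', v') \<in> M" "r' \<in> R" "x' = u' \<oplus>\<^sub>B r' \<odot>\<^sub>B b" "y' = v' \<oplus>\<^sub>E r' \<odot>\<^sub>E e"
  using GE[OF G(1)] GE[OF G(2)] by blast
  thus "(x \<oplus>\<^sub>B x', y \<oplus>\<^sub>E y') \<in> G"
  using GI[OF lin_graph_add[OF M(1) *(1,5)], of "r \<oplus>\<^sub>R r'"] b e sub[of u v] sub[of u' v']
  by(simp add: mod_add_smult[OF B] mod_add_smult[OF ME] mod_add_add_swap[OF B] mod_add_add_swap[OF ME])
  next
  fix s x y assume s: "s \<in> R" and "(x, y) \<in> G"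
  then obtain u v r where *: "(u, v) \<in> M" "r \<in> R" "x = u \<oplus>\<^sub>B r \<odot>\<^sub>B b" "y = v \<oplus>\<^sub>E r \<odot>\<^sub>E e"
  using GE by blast
  thus "(s \<odot>\<^sub>B x, s \<odot>\<^sub>E y) \<in> G"
  using GI[OF lin_graph_smult[OF M(1) s *(1)], of "s \<otimes>\<^sub>R r"] b e sub[of u v] s
  by(simp add: mod_smult_add[OF B] mod_smult_add[OF ME] mod_mult_smult[OF B] mod_mult_smult[OF ME])
  next
  fix y assume "(\<zero>\<^sub>B, y) \<in> G"
  then obtain u v r where *: "(u, v) \<in> M" "r \<in> R" "\<zero>\<^sub>B = u \<oplus>\<^sub>B r \<odot>\<^sub>B b" "y = v \<oplus>\<^sub>E r \<odot>\<^sub>E e"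
  using GE by blast
  have uv: "u \<in> B" "v \<in> E" using sub[OF *(1)] by auto
  have "\<ominus>\<^sub>B u = r \<odot>\<^sub>B b"
  using mod_add_eq_zero[OF B uv(1), of "r \<odot>\<^sub>B b"] *(2,3) b uv by simp
  \<comment> \<open>This is where \<open>e\<close> matters: if \<open>u + r b = 0\<close>, then
    \<open>r\<close> lies in the ideal \<open>I\<close>, and the value at \<open>r b\<close> is both
    \<open>- v\<close> and \<open>r e\<close>, so that \<open>v + r e = 0\<close>.\<close>
  hence m: "(r \<odot>\<^sub>B b, \<ominus>\<^sub>E v) \<in> M"
  using lin_graph_neg[OF M(1) B ME *(1)] by simp
  hence "r \<in> I" "f r = \<ominus>\<^sub>E v" using *(2) fI by(auto simp: I_def)
  hence "r \<odot>\<^sub>E e = \<ominus>\<^sub>E v" using e(2) by simp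
  thus "y = \<zero>\<^sub>E" using *(4) uv by simp
  qed
  hence "G = M" using max MG by blast
  moreover have "(b, e) \<in> G" using GI[OF lin_graph_zero[OF M(1)], of "\<one>\<^sub>R"] b e by simp
  ultimately show ?thesis by blast
 qed
 define f where "f x = (THE y. (x, y) \<in> M)" for x
 have fI: "f x = y" if "(x, y) \<in> M" for x y
  unfolding f_def using that uniq by blast
 have f: "(x, f x) \<in> M" if "x \<in> B" for x
  using dom[OF that] fI by auto
 have "lmap R B E f"
  by(rule lmapI)
  (use B ME f sub(2)[OF f] in \<open>auto intro!: fI lin_graph_add[OF M(1)] lin_graph_smult[OF M(1)]\<close>)
 with fI M(2) show ?thesis by blast
qed

text \<open>The pairs \<open>(g x, f x)\<close> form a graph precisely because \<open>f\<close>
  vanishes on the kernel of \<open>g\<close>. In this form the lemma factors \<open>f\<close>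
  through the image of \<open>g\<close> and extends it in one stroke.\<close>

lemma baer_extend:
 assumes E: "baer R E" and g: "lmap R A B g" and f: "lmap R A E f"
  and ker: "!!x. x \<in> A ==> g x = \<zero>\<^sub>B ==> f x = \<zero>\<^sub>E"
 shows "EX h. lmap R B E h & (\<forall>x\<in>A. h (g x) = f x)"
proof -
 have "lin_graph R B E ((%x. (g x, f x)) ` carrier A)"
  unfolding lin_graph_def
 proof(intro conjI allI impI)
  show "(\<zero>\<^sub>B, \<zero>\<^sub>E) \<in> (%x. (g x, f x)) ` carrier A"
  using lmapD[OF f] lmapD[OF g] modD[OF lmap_dom[OF f]] by(intro image_eqI[of _ _ "\<zero>\<^sub>A"]) auto
 next
  fix x y x' y' assume "(x, y) \<in> (%x. (g x, f x)) ` carrier A" "(x', y') \<in> (%x. (g x, f x)) ` carrier A"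
  then obtain a b where "a \<in> A" "b \<in> A" "x = g a" "y = f a" "x' = g b" "y' = f b" by auto
  thus "(x \<oplus>\<^sub>B x', y \<oplus>\<^sub>E y') \<in> (%x. (g x, f x)) ` carrier A"
  using lmapD[OF f] lmapD[OF g] modD[OF lmap_dom[OF f]] by(intro image_eqI[of _ _ "a \<oplus>\<^sub>A b"]) auto
 next
  fix r x y assume "r \<in> R" "(x, y) \<in> (%x. (g x, f x)) ` carrier A"
  then obtain a where "a \<in> A" "x = g a" "y = f a" by auto
  thus "(r \<odot>\<^sub>B x, r \<odot>\<^sub>E y) \<in> (%x. (g x, f x)) ` carrier A"
  using lmapD[OF f] lmapD[OF g] modD[OF lmap_dom[OF f]] \<open>r \<in> R\<close>
  by(intro image_eqI[of _ _ "r \<odot>\<^sub>A a"]) auto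
 qed (use lmapD[OF f] lmapD[OF g] ker in \<open>auto\<close>)
 from baer_graph_extend[OF E lmap_cod[OF g] this] show ?thesis by blast
qed

subsection \<open>Character modules\<close>

text \<open>The underlying abelian group. Characters are maps of abelian groups, and the extension
  results above are reused for them over the integers.\<close>

definition zmod :: "('a,'m) module => (int,'m) module" where
 "zmod M = \<lparr>carrier = carrier M, monoid.mult = undefined, one = undefined,
  ring.zero = \<zero>\<^sub>M, ring.add = add M, module.smult = (%n x. [n] \<cdot>\<^bsub>M\<^esub> x)\<rparr>"

lemma zmod_simps [simp]:
 "carrier (zmod M) = carrier M" "\<zero>\<^sub>(zmod M) = \<zero>\<^sub>M" "x \<oplus>\<^sub>(zmod M) y = x \<oplus>\<^sub>M y"
 by(auto simp: zmod_def)

lemma module_zmod: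
 assumes "module R M"
 shows "module \<Z> (zmod M)"
proof -
 interpret module R M by fact
 show ?thesis
 proof(rule moduleI')
  show "\<zero>\<^sub>\<Z> \<odot>\<^sub>(zmod M) x = \<zero>\<^sub>(zmod M)" for x
  by(simp add: zmod_def add_pow_def)
  show "(r \<otimes>\<^sub>\<Z> s) \<odot>\<^sub>(zmod M) x = r \<odot>\<^sub>(zmod M) (s \<odot>\<^sub>(zmod M) x)" if "x \<in> (zmod M)" for r s x
  using that M.add.int_pow_pow[of x s r] M.add.int_pow_pow[of x r s] by(simp add: zmod_def mult.commute)
 qed (auto simp: zmod_def int_is_cring M.a_ac M.add.int_pow_mult M.add.int_pow_distrib M.add.int_pow_closed)
qed

text \<open>The multiplicative group of nonzero complex numbers, in additive notation. It stands in
  for the rationals modulo the integers: roots make it divisible, and it has elements of every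
  order.\<close>

definition circ_mod :: "(int, complex) module" where
 "circ_mod = \<lparr>carrier = - {0}, monoid.mult = undefined, one = undefined,
  ring.zero = 1, ring.add = (*), module.smult = (%n x. x powi n)\<rparr>"

lemma circ_mod_simps [simp]:
 "carrier circ_mod = - {0}" "\<zero>\<^sub>circ_mod = 1" "x \<oplus>\<^sub>circ_mod y = x * y" "n \<odot>\<^sub>circ_mod x = x powi n"
 by(auto simp: circ_mod_def)

lemma module_circ_mod: "module \<Z> circ_mod"
 by(rule moduleI')
  (auto simp: int_is_cring power_int_mult_distrib power_int_add power_int_mult[symmetric] mult.commute)

text \<open>Integer multiples are iterated sums and negatives. The form with a subset of a product
  is made for graphs: applied to the graph of an additive map it shows linearity over the
  integers.\<close>

lemma int_module_closed_smult:
 assumes M: "module \<Z> M" and N: "module \<Z> N" and sub: "G \<subseteq> carrier M \<times> carrier N"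
  and zero: "(\<zero>\<^sub>M, \<zero>\<^sub>N) \<in> G"
  and add: "!!x y x' y'. (x, y) \<in> G ==> (x', y') \<in> G ==> (x \<oplus>\<^sub>M x', y \<oplus>\<^sub>N y') \<in> G"
  and neg: "!!x y. (x, y) \<in> G ==> (\<ominus>\<^sub>M x, \<ominus>\<^sub>N y) \<in> G"
  and xy: "(x, y) \<in> G"
 shows "(n \<odot>\<^sub>M x, n \<odot>\<^sub>N y) \<in> G"
proof -
 have c: "x \<in> M" "y \<in> N" using xy sub by auto
 have pos: "(int k \<odot>\<^sub>M x, int k \<odot>\<^sub>N y) \<in> G" for k
 proof(induction k)
  case 0
  thus ?case using zero mod_zero_smult[OF M c(1)] mod_zero_smult[OF N c(2)] by simp
 next
  case (Suc k)
  have "int (Suc k) \<odot>\<^sub>M x = x \<oplus>\<^sub>M int k \<odot>\<^sub>M x"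
  using mod_add_smult[OF M, of 1 "int k" x] mod_one_smult[OF M, of x] c by simp
  moreover have "int (Suc k) \<odot>\<^sub>N y = y \<oplus>\<^sub>N int k \<odot>\<^sub>N y"
  using mod_add_smult[OF N, of 1 "int k" y] mod_one_smult[OF N, of y] c by simp
  ultimately show ?case using add[OF xy Suc] by simp
 qed
 show ?thesis
 proof(cases "n \<ge> 0")
  case True
  thus ?thesis using pos[of "nat n"] by simp
 next
  case False
  have inv: "\<ominus>\<^sub>\<Z> k = - k" for k :: int
  by(rule abelian_group.minus_equality[OF cring.axioms(1)[OF int_is_cring, THEN ring.is_abelian_group]]) auto
  have "n \<odot>\<^sub>M x = \<ominus>\<^sub>M (int (nat (- n)) \<odot>\<^sub>M x)"
  using mod_neg_smult[OF M, of "- n" x] c False by(simp add: inv)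
  moreover have "n \<odot>\<^sub>N y = \<ominus>\<^sub>N (int (nat (- n)) \<odot>\<^sub>N y)"
  using mod_neg_smult[OF N, of "- n" y] c False by(simp add: inv)
  ultimately show ?thesis using neg[OF pos[of "nat (- n)"]] by simp
 qed
qed

lemma complex_root_exists:
 fixes z :: complex assumes "n > 0"
 shows "EX w. w ^ n = z"
proof -
 have "(rcis (root n (cmod z)) (Arg z / real n)) ^ n = z"
  using assms by(simp add: DeMoivre2 rcis_cmod_Arg)
 thus ?thesis by blast
qed

text \<open>A nonzero ideal of the integers is generated by its least positive element
  \<open>m\<close>; an \<open>m\<close>-th root \<open>w\<close> of \<open>f m\<close> then gives
  every \<open>f a\<close> as a power of \<open>w\<close>.\<close>

lemma baer_circ_mod: "baer \<Z> circ_mod"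
 unfolding baer_def
proof(intro conjI allI impI module_circ_mod)
 fix I and f :: "int => complex"
 assume "submodule I \<Z> (reg_mod \<Z>) & lmap \<Z> (restr_mod (reg_mod \<Z>) I) circ_mod f"
 hence I: "submodule I \<Z> (reg_mod \<Z>)" and f: "lmap \<Z> (restr_mod (reg_mod \<Z>) I) circ_mod f" by auto
 note Z = module_reg_mod[OF int_is_cring]
 show "\<exists>e\<in>circ_mod. \<forall>a\<in>I. f a = a \<odot>\<^sub>circ_mod e"
 proof(cases "\<exists>a\<in>I. a > 0")
  case True
  define m where "m = (LEAST k. k > 0 & int k \<in> I)"
  obtain a where "a \<in> I" "a > 0" using True by blast
  hence m: "m > 0" "int m \<in> I"
  using LeastI[of "%k. k > 0 & int k \<in> I" "nat a"] by(auto simp: m_def)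
  obtain w where w: "w ^ m = f (int m)" using complex_root_exists m(1) by blast
  have fm: "f (int m) ~= 0" using lmap_in[OF f, of "int m"] m by simp
  hence w0: "w ~= 0" using w m by(auto simp: power_0_left)
  have "f a = w powi a" if a: "a \<in> I" for a
  proof -
  have "(- (a div int m)) * int m \<in> I"
  using submodule_smult[OF I Z, of "- (a div int m)" "int m"] m by simp
  hence "a + (- (a div int m)) * int m \<in> I"
  using submodule_add[OF I Z a, of "(- (a div int m)) * int m"] by simp
  moreover have "a + (- (a div int m)) * int m = a mod int m"
  by(simp add: minus_div_mult_eq_mod)
  ultimately have "a mod int m \<in> I" by(simp only:)
  moreover have "a mod int m \<ge> 0" "a mod int m < int m" using m by auto
  ultimately have "\<not> nat (a mod int m) > 0"
  using not_less_Least[of "nat (a mod int m)" "%k. k > 0 & int k \<in> I", folded m_def]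
  by(metis int_nat_eq nat_less_iff)
  hence "a mod int m = 0" using \<open>a mod int m \<ge> 0\<close> by simp
  then obtain q where q: "a = q * int m" by(metis dvd_def mod_eq_0_iff_dvd mult.commute)
  have "f a = f (int m) powi q"
  using lmap_smult[OF f, of q "int m"] m by(simp add: q)
  also have "\<dots> = w powi a"
  by(simp add: q w[symmetric] power_int_mult mult.commute[of q] flip: power_int_of_nat)
  finally show ?thesis .
  qed
  thus ?thesis using w0 by(intro bexI[of _ w]) auto
 next
  case False
  have "a = 0" if "a \<in> I" for a
  using False that submodule_smult[OF I Z, of "-1" a] by(auto simp: not_less) force
  moreover have "f 0 = 1" using lmap_zero[OF f] by simp
  ultimately show ?thesis by(intro bexI[of _ 1]) force+
 qed
qed

text \<open>The module coinduced from the divisible group \<open>circ_mod\<close>, with scalars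
  acting on the argument. It is an injective cogenerator whose element type depends only on that of
  \<open>R\<close>.\<close>

definition char_mod :: "('a,'r) ring_scheme => ('a, 'a => complex) module" where
 "char_mod R = (let H = hom_mod \<Z> (zmod (reg_mod R)) circ_mod in
  \<lparr>carrier = carrier H, monoid.mult = undefined, one = undefined,
  ring.zero = ring.zero H, ring.add = ring.add H,
  module.smult = (%r f. \<lambda>x\<in>R. f (r \<otimes>\<^sub>R x))\<rparr>)"

lemma char_mod_simps:
 "carrier (char_mod R) = carrier (hom_mod \<Z> (zmod (reg_mod R)) circ_mod)"
 "\<zero>\<^sub>(char_mod R) = (\<lambda>x\<in>R. 1)"
 "f \<oplus>\<^sub>(char_mod R) g = (\<lambda>x\<in>R. f x * g x)"
 "r \<odot>\<^sub>(char_mod R) f = (\<lambda>x\<in>R. f (r \<otimes>\<^sub>R x))"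
 by(auto simp: char_mod_def Let_def hom_mod_simps)

text \<open>A linear map over the integers is no more than an additive one; this frees all later
  constructions of characters from integer powers.\<close>

lemma additive_lmap_circ:
 assumes M: "module R M" and f0: "!!x. x \<in> M ==> f x ~= 0"
  and add: "!!x y. x \<in> M ==> y \<in> M ==> f (x \<oplus>\<^sub>M y) = f x * f y"
 shows "lmap \<Z> (zmod M) circ_mod f"
proof(rule lmapI)
 note Z = module_zmod[OF M]
 show "module \<Z> (zmod M)" "module \<Z> circ_mod" by(rule Z module_circ_mod)+
 have z: "f \<zero>\<^sub>M = 1"
  using add[of "\<zero>\<^sub>M" "\<zero>\<^sub>M"] f0[of "\<zero>\<^sub>M"] by(simp add: modD[OF M])
 fix r x assume x: "x \<in> (zmod M)"
 have "(r \<odot>\<^sub>(zmod M) x, r \<odot>\<^sub>circ_mod f x) \<in> (%x. (x, f x)) ` carrier M"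
 proof(rule int_module_closed_smult[OF Z module_circ_mod])
  fix x y assume "(x, y) \<in> (%x. (x, f x)) ` carrier M"
  hence x: "x \<in> M" and y: "y = f x" by auto
  have n: "\<ominus>\<^sub>(zmod M) x \<in> M" using mod_neg_closed[OF Z] x by simp
  have nc: "\<ominus>\<^sub>circ_mod y \<in> circ_mod" "y \<in> circ_mod"
  using mod_neg_closed[OF module_circ_mod] f0 x y by auto
  have "\<ominus>\<^sub>(zmod M) x \<oplus>\<^sub>M x = \<zero>\<^sub>M" using mod_neg_add[OF Z, of x] x by simp
  hence "f (\<ominus>\<^sub>(zmod M) x) * y = 1" using add[OF n x] z y by simp
  moreover have "\<ominus>\<^sub>circ_mod y * y = 1" using mod_neg_add[OF module_circ_mod, of y] nc by simp
  ultimately have "f (\<ominus>\<^sub>(zmod M) x) = \<ominus>\<^sub>circ_mod y"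
  by(metis mult_right_cancel nc(2) circ_mod_simps(1) Compl_iff singletonI)
  with n show "(\<ominus>\<^sub>(zmod M) x, \<ominus>\<^sub>circ_mod y) \<in> (%x. (x, f x)) ` carrier M" by force
 next
  fix x y x' y' assume "(x, y) \<in> (%x. (x, f x)) ` carrier M" "(x', y') \<in> (%x. (x, f x)) ` carrier M"
  thus "(x \<oplus>\<^sub>(zmod M) x', y \<oplus>\<^sub>circ_mod y') \<in> (%x. (x, f x)) ` carrier M"
  by(intro image_eqI[of _ _ "x \<oplus>\<^sub>M x'"]) (auto simp: add modD[OF M])
 next
  show "(\<zero>\<^sub>(zmod M), \<zero>\<^sub>circ_mod) \<in> (%x. (x, f x)) ` carrier M"
  using z by(intro image_eqI[of _ _ "\<zero>\<^sub>M"]) (auto simp: modD[OF M])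
 qed (use x f0 in auto)
 thus "f (r \<odot>\<^sub>(zmod M) x) = r \<odot>\<^sub>circ_mod f x" by auto
qed (use f0 add in auto)

lemma char_mod_iff:
 assumes "cring R"
 shows "f \<in> (char_mod R) \<longleftrightarrow> f \<in> extensional (carrier R) & (\<forall>x\<in>R. f x ~= 0) &
  (\<forall>x\<in>R. \<forall>y\<in>R. f (x \<oplus>\<^sub>R y) = f x * f y)"
 using additive_lmap_circ[OF module_reg_mod[OF assms], of f]
 by(auto simp: char_mod_simps hom_mod_simps lmap_def) (auto simp: lin_maps_def Pi_def)

lemma module_char_mod:
 assumes "cring R"
 shows "module R (char_mod R)"
proof -
 interpret cring R by fact
 show ?thesis
 proof(rule moduleI')
  have z: "f \<zero>\<^sub>R = 1" if "f \<in> (char_mod R)" for f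
  proof -
  have "f \<zero>\<^sub>R * f \<zero>\<^sub>R = f \<zero>\<^sub>R * 1" "f \<zero>\<^sub>R ~= 0"
  using that l_zero[OF zero_closed] zero_closed unfolding char_mod_iff[OF assms]
  by(metis mult_1_right, blast)
  thus ?thesis by simp
  qed
  show "\<zero>\<^sub>R \<odot>\<^sub>(char_mod R) f = \<zero>\<^sub>(char_mod R)" if "f \<in> (char_mod R)" for f
  using z[OF that] by(auto simp: char_mod_simps(2-4) fun_eq_iff restrict_def)
  show "\<zero>\<^sub>(char_mod R) \<oplus>\<^sub>(char_mod R) f = f" "\<one>\<^sub>R \<odot>\<^sub>(char_mod R) f = f"
  if "f \<in> (char_mod R)" for f
  using that by(auto simp: char_mod_simps(2-4) char_mod_iff[OF assms] fun_eq_iff restrict_def extensional_def)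
  show "(r \<otimes>\<^sub>R s) \<odot>\<^sub>(char_mod R) f = r \<odot>\<^sub>(char_mod R) (s \<odot>\<^sub>(char_mod R) f)"
  if "r \<in> R" "s \<in> R" "f \<in> (char_mod R)" for r s f
  proof -
  have "s \<otimes>\<^sub>R (r \<otimes>\<^sub>R x) = (r \<otimes>\<^sub>R s) \<otimes>\<^sub>R x" if "x \<in> R" for x
  using that \<open>r \<in> R\<close> \<open>s \<in> R\<close> by(simp add: m_assoc[symmetric] m_comm[of s])
  with that show ?thesis
  by(auto simp: char_mod_simps(2-4) fun_eq_iff restrict_def)
  qed
 qed (auto simp: assms char_mod_simps(2-4) char_mod_iff[OF assms] fun_eq_iff restrict_def
  r_distr l_distr mult_ac, auto simp: extensional_def)
qed

text \<open>By adjunction a linear map from an ideal into characters amounts to one additive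
  character of the ideal, \<open>a\<close> going to the value of \<open>f a\<close> at one.
  Divisibility extends it to all of \<open>R\<close>, and the extension is the element
  \<open>e\<close>.\<close>

lemma baer_char_mod:
 assumes R: "cring R"
 shows "baer R (char_mod R)"
 unfolding baer_def
proof(intro conjI allI impI module_char_mod[OF R])
 fix I f assume "submodule I R (reg_mod R) & lmap R (restr_mod (reg_mod R) I) (char_mod R) f"
 hence I: "submodule I R (reg_mod R)" and f: "lmap R (restr_mod (reg_mod R) I) (char_mod R) f" by auto
 interpret cring R by fact
 note RR = module_reg_mod[OF R]
 note MI = module_restr_mod[OF RR I]
 have Isub: "a \<in> R" if "a \<in> I" for a using submodule_sub[OF I RR that] by simp
 have fc: "f a \<in> (char_mod R)" if "a \<in> I" for a using lmap_in[OF f, of a] that by simp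
 have g: "lmap \<Z> (zmod (restr_mod (reg_mod R) I)) circ_mod (%a. f a \<one>\<^sub>R)"
 proof(rule additive_lmap_circ[OF MI])
  fix x y assume "x \<in> (restr_mod (reg_mod R) I)" "y \<in> (restr_mod (reg_mod R) I)"
  thus "f (x \<oplus>\<^sub>(restr_mod (reg_mod R) I) y) \<one>\<^sub>R = f x \<one>\<^sub>R * f y \<one>\<^sub>R"
  using lmap_add[OF f, of x y] by(simp add: char_mod_simps(3))
 qed (use fc in \<open>auto simp: char_mod_iff[OF R]\<close>)
 \<comment> \<open>The inclusion of the ideal has to be shown linear over the integers, since
   integer multiples are computed in two different records.\<close>
 have "lmap \<Z> (zmod (restr_mod (reg_mod R) I)) (zmod (reg_mod R)) (%a. a)"
 proof(rule lmapI)
  fix r x assume "x \<in> (zmod (restr_mod (reg_mod R) I))"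
  hence x: "x \<in> I" by simp
  interpret A: abelian_group "restr_mod (reg_mod R) I" by(rule module_abelian_group[OF MI])
  interpret B: abelian_group "reg_mod R" by(rule module_abelian_group[OF RR])
  have "(r \<odot>\<^sub>(zmod (restr_mod (reg_mod R) I)) x, r \<odot>\<^sub>(zmod (reg_mod R)) x) \<in> (%x. (x, x)) ` I"
  proof(rule int_module_closed_smult[OF module_zmod[OF MI] module_zmod[OF RR]])
  fix x y assume "(x, y) \<in> (%x. (x, x)) ` I"
  hence x: "x \<in> I" "y = x" by auto
  have a: "\<ominus>\<^sub>(zmod (restr_mod (reg_mod R) I)) x \<in> I"
  using mod_neg_closed[OF module_zmod[OF MI], of x] x by simp
  have "\<ominus>\<^sub>(zmod (restr_mod (reg_mod R) I)) x \<oplus>\<^sub>R x = \<zero>\<^sub>R"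
  using mod_neg_add[OF module_zmod[OF MI], of x] x by simp
  hence "\<ominus>\<^sub>(zmod (restr_mod (reg_mod R) I)) x = \<ominus>\<^sub>(zmod (reg_mod R)) x"
  using mod_add_eq_zero[OF module_zmod[OF RR], of "\<ominus>\<^sub>(zmod (restr_mod (reg_mod R) I)) x" x] a x Isub by simp
  thus "(\<ominus>\<^sub>(zmod (restr_mod (reg_mod R) I)) x, \<ominus>\<^sub>(zmod (reg_mod R)) y) \<in> (%x. (x, x)) ` I"
  using a x by simp
  next
  fix x y x' y' assume "(x, y) \<in> (%x. (x, x)) ` I" "(x', y') \<in> (%x. (x, x)) ` I"
  thus "(x \<oplus>\<^sub>(zmod (restr_mod (reg_mod R) I)) x', y \<oplus>\<^sub>(zmod (reg_mod R)) y') \<in> (%x. (x, x)) ` I"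
  using submodule_add[OF I RR, of x x'] by auto
  next
  show "(\<zero>\<^sub>(zmod (restr_mod (reg_mod R) I)), \<zero>\<^sub>(zmod (reg_mod R))) \<in> (%x. (x, x)) ` I"
  using submodule_zero[OF I RR] by auto
  qed (use x Isub in auto)
  thus "r \<odot>\<^sub>(zmod (restr_mod (reg_mod R) I)) x = r \<odot>\<^sub>(zmod (reg_mod R)) x" by auto
 qed (use Isub module_zmod[OF MI] module_zmod[OF RR] in auto)
 from baer_extend[OF baer_circ_mod this g] lmap_zero[OF g]
 obtain h where h: "lmap \<Z> (zmod (reg_mod R)) circ_mod h" "!!x. x \<in> I ==> h x = f x \<one>\<^sub>R"
  by auto
 define e where "e = (\<lambda>x\<in>R. h x)"
 have e: "e \<in> (char_mod R)"
  using hom_mem[OF h(1)] by(simp add: e_def char_mod_simps)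
 have "f a = a \<odot>\<^sub>(char_mod R) e" if a: "a \<in> I" for a
 proof
  fix x
  show "f a x = (a \<odot>\<^sub>(char_mod R) e) x"
  proof(cases "x \<in> R")
  case True
  have ax: "a \<otimes>\<^sub>R x \<in> I"
  using submodule_smult[OF I RR, of x a] True a Isub by(simp add: m_comm)
  have "f (a \<otimes>\<^sub>R x) = x \<odot>\<^sub>(char_mod R) f a"
  using lmap_smult[OF f, of x a] True a Isub by(simp add: m_comm)
  hence "f (a \<otimes>\<^sub>R x) \<one>\<^sub>R = f a x"
  using True by(simp add: char_mod_simps)
  thus ?thesis
  using True h(2)[OF ax] Isub[OF a] by(simp add: char_mod_simps e_def)
  next
  case False
  thus ?thesis using fc[OF a] by(auto simp: char_mod_simps(4) char_mod_iff[OF R] extensional_def)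
  qed
 qed
 thus "\<exists>e\<in>(char_mod R). \<forall>a\<in>I. f a = a \<odot>\<^sub>(char_mod R) e" using e by blast
qed

text \<open>On the group generated by \<open>B\<close> and \<open>z\<close> there is a character
  trivial on \<open>B\<close> that sends \<open>z\<close> to some \<open>w \<noteq> 1\<close>.
  Divisibility extends it to \<open>M\<close>, and adjunction turns the result into a linear map to
  \<open>char_mod\<close>.\<close>

lemma char_mod_separates:
 assumes M: "module R M" and B: "submodule B R M" and z: "z \<in> M" "z \<notin> B"
 shows "EX f. lmap R M (char_mod R) f & (\<forall>x\<in>B. f x = \<zero>\<^sub>(char_mod R)) & f z ~= \<zero>\<^sub>(char_mod R)"
proof -
 note Z = module_zmod[OF M]
 note R = module_cring[OF M]
 note [simp] = modD[OF M] R
 let ?p = "%n::int. n \<odot>\<^sub>(zmod M) z"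
 have zc: "z \<in> (zmod M)" using z by simp
 have pc: "?p n \<in> M" for n using mod_smult_closed[OF Z, of n z] z by simp
 have padd: "?p (m + n) = ?p m \<oplus>\<^sub>M ?p n" for m n
  using mod_add_smult[OF Z, of m n z] z by simp
 have p0: "?p 0 = \<zero>\<^sub>M" using mod_zero_smult[OF Z, of z] z by simp
 have p1: "?p 1 = z" using mod_one_smult[OF Z, of z] z by simp
 have pneg: "?p (- n) = \<ominus>\<^sub>M ?p n" for n
  using padd[of "- n" n] p0 pc mod_add_eq_zero[OF M, of "?p (- n)" "?p n"] by simp
 have pB: "?p (k * n) \<in> B" if "?p n \<in> B" for k n
 proof -
  have nat: "?p (int j * n) \<in> B" for j
  proof(induction j)
  case 0 thus ?case using p0 submodule_zero[OF B M] by simp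
  next
  case (Suc j)
  thus ?case using submodule_add[OF B M that Suc] padd[of n "int j * n"]
  by(simp add: algebra_simps)
  qed
  show ?thesis
  proof(cases "k \<ge> 0")
  case True thus ?thesis using nat[of "nat k"] by simp
  next
  case False
  hence "k * n = - (int (nat (- k)) * n)" by simp
  hence "?p (k * n) = \<ominus>\<^sub>M ?p (int (nat (- k)) * n)" using pneg by metis
  thus ?thesis using submodule_neg[OF B M nat[of "nat (- k)"]] by metis
  qed
 qed
 \<comment> \<open>\<open>w\<close> must respect every relation of \<open>z\<close> modulo
   \<open>B\<close>. If \<open>m z\<close> is the first positive multiple in \<open>B\<close>, a
   primitive \<open>m\<close>-th root of unity does; if there is none, only \<open>n = 0\<close> is
   constrained, and any number other than zero and one does, here two.\<close>
 have "EX w::complex. w ~= 0 & w ~= 1 & (ALL n. ?p n \<in> B --> w powi n = 1)"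
 proof(cases "EX n>0. ?p n \<in> B")
  case True
  define m where "m = (LEAST k. k > 0 & ?p (int k) \<in> B)"
  obtain a where "a > 0" "?p a \<in> B" using True by blast
  hence m: "m > 0" "?p (int m) \<in> B"
  using LeastI[of "%k. k > 0 & ?p (int k) \<in> B" "nat a"] by(auto simp: m_def)
  \<comment> \<open>\<open>m = 1\<close> would put \<open>z\<close> itself into \<open>B\<close>;
    \<open>m > 1\<close> is what keeps the root of unity away from one.\<close>
  have m1: "m > 1" using m p1 z by(cases "m = 1") auto
  define w where "w = cis (2 * pi / real m)"
  have wm: "w ^ m = 1" using m by(simp add: w_def DeMoivre)
  have w1: "w ~= 1"
  proof
  assume "w = 1"
  hence s: "cos (2 * pi / real m) = 1" by(simp add: w_def complex_eq_iff)
  have "2 * pi / real m < 2 * pi" "0 < 2 * pi / real m" using m1 by(auto simp: field_simps)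
  moreover have "cos (2 * (pi / real m)) = 1 - 2 * (sin (pi / real m))\<^sup>2"
  by(rule cos_double_sin)
  ultimately have "sin (pi / real m) = 0" using s by simp
  moreover have "sin (pi / real m) > 0"
  by(rule sin_gt_zero) (use m1 in \<open>auto simp: field_simps\<close>)
  ultimately show False by simp
  qed
  have "w powi n = 1" if n: "?p n \<in> B" for n
  proof -
  have "n mod int m = n + (- (n div int m)) * int m"
  by(simp add: minus_div_mult_eq_mod)
  hence "?p (n mod int m) = ?p n \<oplus>\<^sub>M ?p ((- (n div int m)) * int m)"
  by(metis padd)
  hence "?p (n mod int m) \<in> B"
  using submodule_add[OF B M n pB[OF m(2), of "- (n div int m)"]] by(simp only:)
  moreover have "n mod int m \<ge> 0" "n mod int m < int m" using m by auto
  ultimately have "\<not> nat (n mod int m) > 0"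
  using not_less_Least[of "nat (n mod int m)" "%k. k > 0 & ?p (int k) \<in> B", folded m_def]
  by(metis int_nat_eq nat_less_iff)
  hence "n mod int m = 0" using \<open>n mod int m \<ge> 0\<close> by simp
  then obtain q where q: "n = int m * q" by(metis dvd_def mod_eq_0_iff_dvd)
  show ?thesis by(simp add: q power_int_mult wm)
  qed
  thus ?thesis using w1 by(intro exI[of _ w]) (auto simp: w_def)
 next
  case False
  have "n = 0" if "?p n \<in> B" for n
  using False that pB[OF that, of "-1"] by(metis mult_minus1 neg_0_less_iff_less linorder_neqE)
  thus ?thesis by(intro exI[of _ 2]) force
 qed
 then obtain w :: complex where w: "w ~= 0" "w ~= 1" "!!n. ?p n \<in> B ==> w powi n = 1" by blast
 define G where "G = {(b \<oplus>\<^sub>M ?p n, w powi n) |b n. b \<in> B}"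
 have Bc: "b \<in> M" if "b \<in> B" for b using submodule_sub[OF B M that] .
 have G1: "G \<subseteq> carrier (zmod M) \<times> carrier circ_mod"
  using Bc pc w(1) by(auto simp: G_def)
 have G2: "(x \<oplus>\<^sub>(zmod M) x', y \<oplus>\<^sub>circ_mod y') \<in> G" if xy: "(x, y) \<in> G" "(x', y') \<in> G" for x y x' y'
 proof -
  obtain b n b' n' where *: "b \<in> B" "b' \<in> B" "x = b \<oplus>\<^sub>M ?p n" "y = w powi n" "x' = b' \<oplus>\<^sub>M ?p n'" "y' = w powi n'"
  using xy unfolding G_def by blast
  have "x \<oplus>\<^sub>M x' = (b \<oplus>\<^sub>M b') \<oplus>\<^sub>M ?p (n + n')" "y * y' = w powi (n + n')" "b \<oplus>\<^sub>M b' \<in> B"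
  using * Bc pc w(1) submodule_add[OF B M] by(auto simp: padd mod_add_add_swap[OF M] power_int_add)
  thus ?thesis unfolding G_def by auto
 qed
 have Gz: "(\<zero>\<^sub>(zmod M), \<zero>\<^sub>circ_mod) \<in> G"
 proof -
  have "(\<zero>\<^sub>M \<oplus>\<^sub>M ?p 0, w powi 0) \<in> G" unfolding G_def using submodule_zero[OF B M] by blast
  thus ?thesis by(simp add: p0)
 qed
 have Gneg: "(\<ominus>\<^sub>(zmod M) x, \<ominus>\<^sub>circ_mod y) \<in> G" if xy: "(x, y) \<in> G" for x y
 proof -
  obtain b n where *: "b \<in> B" "x = b \<oplus>\<^sub>M ?p n" "y = w powi n"
  using xy unfolding G_def by blast
  have "\<ominus>\<^sub>(zmod M) x = \<ominus>\<^sub>M b \<oplus>\<^sub>M ?p (- n)"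
  proof -
  have c: "b \<in> M" "?p n \<in> M" "x \<in> M" using * Bc pc by auto
  have "(\<ominus>\<^sub>M b \<oplus>\<^sub>M ?p (- n)) \<oplus>\<^sub>M x = \<zero>\<^sub>M"
  unfolding *(2) pneg using c by(subst mod_add_add_swap[OF M]) auto
  thus ?thesis
  using mod_add_eq_zero[OF Z, of "\<ominus>\<^sub>M b \<oplus>\<^sub>M ?p (- n)" x] c pc by simp
  qed
  moreover have "\<ominus>\<^sub>circ_mod y = w powi (- n)"
  using mod_add_eq_zero[OF module_circ_mod, of "w powi (- n)" y] * w(1)
  by(simp add: power_int_minus)
  ultimately show ?thesis unfolding G_def using submodule_neg[OF B M *(1)] by auto
 qed
 have "lin_graph \<Z> (zmod M) circ_mod G"
  unfolding lin_graph_def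
 proof(intro conjI allI impI)
  show "(r \<odot>\<^sub>(zmod M) x, r \<odot>\<^sub>circ_mod y) \<in> G" if "(x, y) \<in> G" for r x y
  using int_module_closed_smult[OF Z module_circ_mod G1 Gz G2 Gneg that] .
  show "y = \<zero>\<^sub>circ_mod" if y: "(\<zero>\<^sub>(zmod M), y) \<in> G" for y
  proof -
  obtain b n where *: "b \<in> B" "\<zero>\<^sub>M = b \<oplus>\<^sub>M ?p n" "y = w powi n"
  using y unfolding G_def by auto
  hence "b = \<ominus>\<^sub>M ?p n" using mod_add_eq_zero[OF M Bc pc, of b n] by simp
  hence "?p n = \<ominus>\<^sub>M b" using pc by simp
  thus ?thesis using w(3)[of n] submodule_neg[OF B M *(1)] *(3) by simp
  qed
 qed (use G1 G2 Gz in auto)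
 from baer_graph_extend[OF baer_circ_mod Z this]
 obtain h where h: "lmap \<Z> (zmod M) circ_mod h" and hG: "!!x y. (x, y) \<in> G ==> h x = y" by blast
 have hB: "h b = 1" if "b \<in> B" for b
 proof -
  have "(b \<oplus>\<^sub>M ?p 0, w powi 0) \<in> G" using that unfolding G_def by blast
  thus ?thesis using hG Bc[OF that] by(simp add: p0)
 qed
 have hz: "h z = w"
 proof -
  have "(\<zero>\<^sub>M \<oplus>\<^sub>M ?p 1, w powi 1) \<in> G" unfolding G_def using submodule_zero[OF B M] by blast
  thus ?thesis using hG z by(simp add: p1)
 qed
 \<comment> \<open>The adjoint of the character \<open>h\<close>; its value at \<open>z\<close>,
   evaluated at one, is again \<open>w\<close>.\<close>
 define f where "f x = (\<lambda>r\<in>R. h (r \<odot>\<^sub>M x))" for x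
 have h0: "h x ~= 0" if "x \<in> M" for x using lmap_in[OF h, of x] that by simp
 have hadd: "h (x \<oplus>\<^sub>M y) = h x * h y" if "x \<in> M" "y \<in> M" for x y
  using lmap_add[OF h, of x y] that by simp
 have "lmap R M (char_mod R) f"
 proof(rule lmapI)
  show "f x \<in> (char_mod R)" if "x \<in> M" for x
  using that by(auto simp: char_mod_iff[OF R] f_def h0 mod_add_smult[OF M] hadd)
  show "f (r \<odot>\<^sub>M x) = r \<odot>\<^sub>(char_mod R) f x" if "r \<in> R" "x \<in> M" for r x
  using that by(auto simp: f_def char_mod_simps fun_eq_iff restrict_def cring_mult_comm[OF R, of r]
  simp flip: mod_mult_smult[OF M])
 qed (use M module_char_mod[OF R] in \<open>auto simp: f_def char_mod_simps fun_eq_iff restrict_def mod_smult_add[OF M] hadd\<close>)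
 moreover have "f x = \<zero>\<^sub>(char_mod R)" if "x \<in> B" for x
  using hB submodule_smult[OF B M _ that] by(auto simp: f_def char_mod_simps fun_eq_iff restrict_def)
 moreover have "f z ~= \<zero>\<^sub>(char_mod R)"
 proof
  assume "f z = \<zero>\<^sub>(char_mod R)"
  hence "f z \<one>\<^sub>R = 1" by(simp add: char_mod_simps)
  thus False using hz w z by(simp add: f_def)
 qed
 ultimately show ?thesis by blast
qed

section \<open>Noetherian modules\<close>

text \<open>An inductive span instead of finite sums of multiples, so that statements about
  generated submodules are rule inductions.\<close>

inductive_set mspan :: "('a,'r) ring_scheme => ('a,'m) module => 'm set => 'm set" for R M A where
 mspan_zero: "\<zero>\<^sub>M \<in> mspan R M A"
| mspan_base: "a \<in> A ==> a \<in> mspan R M A"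
| mspan_add: "x \<in> mspan R M A ==> y \<in> mspan R M A ==> x \<oplus>\<^sub>M y \<in> mspan R M A"
| mspan_smult: "r \<in> R ==> x \<in> mspan R M A ==> r \<odot>\<^sub>M x \<in> mspan R M A"

lemma mspan_minimal:
 assumes "submodule K R M" "module R M" "A \<subseteq> K"
 shows "mspan R M A \<subseteq> K"
proof
 fix x assume "x \<in> mspan R M A"
 thus "x \<in> K"
  by induction (use assms(3) in \<open>auto simp: submodule_zero[OF assms(1,2)] submodule_add[OF assms(1,2)]
  submodule_smult[OF assms(1,2)]\<close>)
qed

lemma mspan_sub: "module R M ==> A \<subseteq> carrier M ==> mspan R M A \<subseteq> carrier M"
 by(rule mspan_minimal[OF module.carrier_is_submodule])

lemma submodule_mspan: "module R M ==> A \<subseteq> carrier M ==> submodule (mspan R M A) R M"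
 by(rule submoduleI') (auto intro: mspan.intros dest: mspan_sub)

definition fin_gen :: "('a,'r) ring_scheme => ('a,'m) module => 'm set => bool" where
 "fin_gen R M K \<longleftrightarrow> (EX A. finite A & A \<subseteq> K & K = mspan R M A)"

definition noeth :: "('a,'r) ring_scheme => ('a,'m) module => bool" where
 "noeth R M \<longleftrightarrow> module R M & (ALL K. submodule K R M --> fin_gen R M K)"

lemma fin_gen_image:
 assumes g: "lmap R M N g" and K: "submodule K R M" and fg: "fin_gen R M K"
 shows "fin_gen R N (g ` K)"
proof -
 note M = lmap_dom[OF g]
 obtain A where A: "finite A" "A \<subseteq> K" "K = mspan R M A" using fg by(auto simp: fin_gen_def)
 have Ac: "A \<subseteq> carrier M" using A submodule_sub[OF K M] by auto
 have sub: "submodule (g ` K) R N"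
  using submodule_image[OF lmap_restr_dom[OF g K]] by simp
 have "g x \<in> mspan R N (g ` A)" if "x \<in> mspan R M A" for x
  using that
 proof induction
  case (mspan_add x y)
  hence "x \<in> M" "y \<in> M" using mspan_sub[OF M Ac] by auto
  thus ?case using lmap_add[OF g, of x y] mspan.mspan_add[OF mspan_add.IH] by simp
 next
  case (mspan_smult r x)
  hence "x \<in> M" using mspan_sub[OF M Ac] by auto
  thus ?case using lmap_smult[OF g, of r x] mspan.mspan_smult[OF mspan_smult.hyps(1) mspan_smult.IH] mspan_smult.hyps by simp
 qed (auto simp: lmap_zero[OF g] intro: mspan.intros)
 moreover have "mspan R N (g ` A) \<subseteq> g ` K"
  by(rule mspan_minimal[OF sub lmap_cod[OF g]]) (use A in auto)
 ultimately show ?thesis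
  unfolding fin_gen_def using A by(intro exI[of _ "g ` A"]) auto
qed

text \<open>Generators of \<open>K\<close> are preimages of generators of its image, together with
  generators of the part of \<open>K\<close> in the kernel.\<close>

lemma fin_gen_extension:
 assumes g: "lmap R M N g" and N: "noeth R N" and K: "submodule K R M"
  and ker: "fin_gen R M (kern M N g \<inter> K)"
 shows "fin_gen R M K"
proof -
 note M = lmap_dom[OF g] and MN = lmap_cod[OF g]
 obtain B where B: "finite B" "B \<subseteq> kern M N g \<inter> K" "kern M N g \<inter> K = mspan R M B"
  using ker by(auto simp: fin_gen_def)
 have "fin_gen R N (g ` K)"
  using N submodule_image[OF lmap_restr_dom[OF g K]] by(simp add: noeth_def)
 then obtain A where A: "finite A" "A \<subseteq> g ` K" "g ` K = mspan R N A" by(auto simp: fin_gen_def)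
 have "\<forall>a\<in>A. EX x. x \<in> K & g x = a" using A(2) by blast
 then obtain k where k: "!!a. a \<in> A ==> k a \<in> K & g (k a) = a" by metis
 have kA: "k ` A \<subseteq> K" using k by auto
 have Kc: "x \<in> M" if "x \<in> K" for x using submodule_sub[OF K M that] .
 have kc: "mspan R M (k ` A) \<subseteq> K" by(rule mspan_minimal[OF K M kA])
 have lift: "\<exists>y\<in>mspan R M (k ` A). g y = z" if "z \<in> mspan R N A" for z
  using that
 proof induction
  case mspan_zero
  thus ?case using lmap_zero[OF g] mspan.mspan_zero by blast
 next
  case (mspan_base a)
  hence "k a \<in> mspan R M (k ` A)" by(intro mspan.mspan_base) simp
  thus ?case using k[OF mspan_base] by blast
 next
  case (mspan_add x y)
  then obtain x' y' where "x' \<in> mspan R M (k ` A)" "g x' = x" "y' \<in> mspan R M (k ` A)" "g y' = y" by blast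
  thus ?case using lmap_add[OF g, of x' y'] kc Kc
  by(intro bexI[of _ "x' \<oplus>\<^sub>M y'"] mspan.mspan_add) auto
 next
  case (mspan_smult r x)
  then obtain x' where "x' \<in> mspan R M (k ` A)" "g x' = x" by blast
  thus ?case using lmap_smult[OF g, of r x'] kc Kc mspan_smult(1)
  by(intro bexI[of _ "r \<odot>\<^sub>M x'"] mspan.mspan_smult) auto
 qed
 have Bc: "B \<subseteq> carrier M" using B(2) by(auto simp: kern_def)
 have mono: "mspan R M X \<subseteq> mspan R M (B \<union> k ` A)" if "X \<subseteq> B \<union> k ` A" for X
  by(rule mspan_minimal[OF submodule_mspan[OF M] M])
  (use Bc kA Kc that in \<open>auto intro: mspan.mspan_base\<close>)
 have "x \<in> mspan R M (B \<union> k ` A)" if x: "x \<in> K" for x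
 proof -
  have "g x \<in> mspan R N A" using A(3) x by blast
  then obtain y where y: "y \<in> mspan R M (k ` A)" "g y = g x" using lift by blast
  hence yK: "y \<in> K" using kc by auto
  have "x \<ominus>\<^sub>M y \<in> kern M N g \<inter> K"
  using submodule_minus[OF K M x yK] y(2) x yK Kc
  by(auto simp: kern_def lmapD[OF g] modD[OF M] modD[OF MN])
  hence "x \<ominus>\<^sub>M y \<in> mspan R M (B \<union> k ` A)" using B(3) mono[of B] by auto
  moreover have "y \<in> mspan R M (B \<union> k ` A)" using y(1) mono[of "k ` A"] by auto
  ultimately have "(x \<ominus>\<^sub>M y) \<oplus>\<^sub>M y \<in> mspan R M (B \<union> k ` A)" by(rule mspan.mspan_add)
  thus ?thesis using Kc[OF x] Kc[OF yK] by(simp add: modD[OF M])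
 qed
 moreover have "mspan R M (B \<union> k ` A) \<subseteq> K"
  by(rule mspan_minimal[OF K M]) (use B kA in auto)
 ultimately show ?thesis unfolding fin_gen_def using A(1) B(1,2) kA
  by(intro exI[of _ "B \<union> k ` A"]) auto
qed

lemma fin_gen_zero: "module R M ==> fin_gen R M {\<zero>\<^sub>M}"
proof -
 assume M: "module R M"
 have "mspan R M {} \<subseteq> {\<zero>\<^sub>M}"
  by(rule mspan_minimal[OF _ M]) (use modD[OF M] in \<open>auto intro!: submoduleI' M\<close>)
 hence "{\<zero>\<^sub>M} = mspan R M {}" using mspan.mspan_zero by blast
 thus ?thesis unfolding fin_gen_def by(intro exI[of _ "{}"]) auto
qed

text \<open>Induction on the number of maps: intersect \<open>K\<close> with one kernel and apply
  \<open>fin_gen_extension\<close>. This covers submodules of free modules, by coordinates, and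
  submodules of Hom modules, by evaluation at generators.\<close>

lemma fin_gen_joint:
 assumes "finite I" and N: "noeth R N" and M: "module R M"
  and "!!i. i \<in> I ==> lmap R M N (g i)" and "submodule K R M"
  and "!!x. x \<in> K ==> (!!i. i \<in> I ==> g i x = \<zero>\<^sub>N) ==> x = \<zero>\<^sub>M"
 shows "fin_gen R M K"
 using assms(1,4-6)
proof(induction I arbitrary: K rule: finite_induct)
 case empty
 hence "K = {\<zero>\<^sub>M}" using submodule_zero[OF _ M] by auto
 thus ?case using fin_gen_zero[OF M] by simp
next
 case (insert i I)
 have g: "lmap R M N (g i)" using insert by auto
 have "fin_gen R M (kern M N (g i) \<inter> K)"
 proof(rule insert.IH)
  show "submodule (kern M N (g i) \<inter> K) R M"
  by(rule submodule_Int[OF submodule_kern[OF g] insert.prems(2) M])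
  fix x assume x: "x \<in> kern M N (g i) \<inter> K" "!!j. j \<in> I ==> g j x = \<zero>\<^sub>N"
  show "x = \<zero>\<^sub>M"
  by(rule insert.prems(3)) (use x in \<open>auto simp: kern_def\<close>)
 qed (use insert in auto)
 thus ?case by(rule fin_gen_extension[OF g N insert.prems(2)])
qed

lemma noeth_reg_mod:
 assumes "cring R" "noetherian_ring R"
 shows "noeth R (reg_mod R)"
 unfolding noeth_def
proof(intro conjI allI impI module_reg_mod[OF assms(1)])
 fix K assume K: "submodule K R (reg_mod R)"
 note RR = module_reg_mod[OF assms(1)]
 interpret cring R by fact
 have "ideal K R"
 proof(rule idealI)
  show "subgroup K (add_monoid R)"
  using submodule.axioms(1)[OF K] by(simp add: reg_mod_def subgroup_def m_inv_def)
  show "x \<otimes>\<^sub>R a \<in> K" "a \<otimes>\<^sub>R x \<in> K" if "a \<in> K" "x \<in> R" for a x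
  using submodule_smult[OF K RR, of x a] that submodule_sub[OF K RR, of a] by(auto simp: m_comm)
 qed (rule ring_axioms)
 then obtain A where A: "A \<subseteq> carrier R" "finite A" "K = genideal R A"
  using noetherian_ring.finetely_gen[OF assms(2)] by blast
 have s: "submodule (mspan R (reg_mod R) A) R (reg_mod R)"
  by(rule submodule_mspan[OF RR]) (use A in auto)
 have sc: "x \<in> R" if "x \<in> mspan R (reg_mod R) A" for x
  using submodule_sub[OF s RR that] by simp
 have "ideal (mspan R (reg_mod R) A) R"
 proof(rule idealI)
  show "subgroup (mspan R (reg_mod R) A) (add_monoid R)"
  using submodule.axioms(1)[OF s] by(simp add: reg_mod_def subgroup_def m_inv_def)
  show "x \<otimes>\<^sub>R a \<in> mspan R (reg_mod R) A" "a \<otimes>\<^sub>R x \<in> mspan R (reg_mod R) A"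
  if "a \<in> mspan R (reg_mod R) A" "x \<in> R" for a x
  using submodule_smult[OF s RR, of x a] that sc by(auto simp: m_comm)
 qed (rule ring_axioms)
 hence "K \<subseteq> mspan R (reg_mod R) A"
  unfolding A(3) by(rule genideal_minimal) (auto intro: mspan.mspan_base)
 moreover have AK: "A \<subseteq> K" using A genideal_self by simp
 hence "mspan R (reg_mod R) A \<subseteq> K" by(rule mspan_minimal[OF K RR])
 ultimately show "fin_gen R (reg_mod R) K"
  unfolding fin_gen_def using A AK by blast
qed

section \<open>Free modules of finitely supported functions\<close>

lemma free_mod_simps:
 "carrier (free_mod R B) = {f. (ALL i. f i \<in> R) & finite {i. f i ~= \<zero>\<^sub>R} & {i. f i ~= \<zero>\<^sub>R} \<subseteq> B}"
 "\<zero>\<^sub>(free_mod R B) = (%i. \<zero>\<^sub>R)"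
 "f \<oplus>\<^sub>(free_mod R B) g = (%i. f i \<oplus>\<^sub>R g i)"
 "r \<odot>\<^sub>(free_mod R B) f = (%i. r \<otimes>\<^sub>R f i)"
 by(auto simp: free_mod_def)

lemma module_free_mod:
 assumes "cring R"
 shows "module R (free_mod R B)"
proof -
 interpret cring R by fact
 show ?thesis
 proof(rule moduleI')
  fix f g assume fg: "f \<in> free_mod R B" "g \<in> free_mod R B"
  have "{i. f i \<oplus>\<^sub>R g i ~= \<zero>\<^sub>R} \<subseteq> {i. f i ~= \<zero>\<^sub>R} \<union> {i. g i ~= \<zero>\<^sub>R}" by auto
  with fg show "f \<oplus>\<^sub>(free_mod R B) g \<in> free_mod R B"
  unfolding free_mod_simps by(auto dest: finite_subset)
 next
  fix r f assume f: "r \<in> R" "f \<in> free_mod R B"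
  have "{i. r \<otimes>\<^sub>R f i ~= \<zero>\<^sub>R} \<subseteq> {i. f i ~= \<zero>\<^sub>R}" using f by auto
  with f show "r \<odot>\<^sub>(free_mod R B) f \<in> free_mod R B"
  unfolding free_mod_simps by(auto dest: finite_subset)
 qed (auto simp: assms free_mod_simps a_ac l_distr r_distr m_assoc)
qed

lemma free_coord: "cring R ==> lmap R (free_mod R B) (reg_mod R) (%f. f i)"
 by(rule lmapI) (auto simp: module_free_mod module_reg_mod free_mod_simps)

lemma free_gen_mem: "cring R ==> b \<in> B ==> free_gen R b \<in> free_mod R B"
 by(auto simp: free_mod_simps free_gen_def)

lemma free_map:
 assumes M: "module R M" and I: "finite I" and x: "!!i. i \<in> I ==> x i \<in> M"
 shows "lmap R (free_mod R I) M (%f. finsum M (%i. f i \<odot>\<^sub>M x i) I)"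
  and "(%f. finsum M (%i. f i \<odot>\<^sub>M x i) I) ` carrier (free_mod R I) = mspan R M (x ` I)"
proof -
 note R = module_cring[OF M]
 let ?F = "%f. finsum M (%i. f i \<odot>\<^sub>M x i) I"
 show F: "lmap R (free_mod R I) M ?F"
  by(rule lmap_sum_maps[OF I module_free_mod[OF R] M])
  (rule lmap_comp[OF free_coord[OF R] lmap_reg_mod_smult[OF M x]])
 have gen: "?F (free_gen R i) = x i" if i: "i \<in> I" for i
 proof -
  have "?F (free_gen R i) = finsum M (%j. free_gen R i j \<odot>\<^sub>M x j) (insert i (I - {i}))"
  using i by(simp add: insert_absorb)
  also have "\<dots> = free_gen R i i \<odot>\<^sub>M x i \<oplus>\<^sub>M finsum M (%j. free_gen R i j \<odot>\<^sub>M x j) (I - {i})"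
  by(rule mod_finsum_insert[OF M]) (use I i x R in \<open>auto simp: free_gen_def modD[OF M]\<close>)
  also have "finsum M (%j. free_gen R i j \<odot>\<^sub>M x j) (I - {i}) = \<zero>\<^sub>M"
  by(rule mod_finsum_zero[OF M]) (use x in \<open>auto simp: free_gen_def modD[OF M]\<close>)
  finally show ?thesis using x[OF i] by(simp add: free_gen_def modD[OF M])
 qed
 have "mspan R M (x ` I) \<subseteq> ?F ` carrier (free_mod R I)"
  by(rule mspan_minimal[OF submodule_image[OF F] M])
  (auto intro!: image_eqI[where x = "free_gen R _"] gen[symmetric] free_gen_mem[OF R])
 moreover have "?F f \<in> mspan R M (x ` I)" if f: "f \<in> free_mod R I" for f
 proof -
  have "finsum M (%i. f i \<odot>\<^sub>M x i) J \<in> mspan R M (x ` I)" if "finite J" "J \<subseteq> I" for J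
  using that
  proof(induction J rule: finite_induct)
  case empty
  thus ?case by(simp add: mod_finsum_empty[OF M] mspan.mspan_zero)
  next
  case (insert j J)
  have "finsum M (%i. f i \<odot>\<^sub>M x i) (insert j J) = f j \<odot>\<^sub>M x j \<oplus>\<^sub>M finsum M (%i. f i \<odot>\<^sub>M x i) J"
  by(rule mod_finsum_insert[OF M]) (use insert f x in \<open>auto simp: free_mod_simps modD[OF M]\<close>)
  moreover have "f j \<odot>\<^sub>M x j \<in> mspan R M (x ` I)"
  using insert f by(intro mspan.mspan_smult mspan.mspan_base) (auto simp: free_mod_simps)
  ultimately show ?case using insert mspan.mspan_add by auto
  qed
  thus ?thesis using I by blast
 qed
 ultimately show "?F ` carrier (free_mod R I) = mspan R M (x ` I)" by blast
qed

text \<open>\<open>K\<close> is the image of its preimage \<open>K'\<close> in a finite free module,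
  where the coordinates are jointly injective maps into the noetherian module
  \<open>reg_mod R\<close>.\<close>

lemma noeth_fin_gen:
 assumes M: "module R M" and R: "noetherian_ring R" and fg: "fin_gen R M (carrier M)"
 shows "noeth R M"
 unfolding noeth_def
proof(intro conjI allI impI M)
 fix K assume K: "submodule K R M"
 obtain A where A: "finite A" "A \<subseteq> carrier M" "carrier M = mspan R M A" using fg by(auto simp: fin_gen_def)
 let ?F = "%f. finsum M (%i. f i \<odot>\<^sub>M i) A"
 have F: "lmap R (free_mod R A) M ?F" and Fim: "?F ` carrier (free_mod R A) = carrier M"
  using free_map[OF M A(1), of "%a. a"] A by auto
 note FM = lmap_dom[OF F]
 define K' where "K' = {f \<in> free_mod R A. ?F f \<in> K}"
 have K': "submodule K' R (free_mod R A)"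
  by(rule submoduleI')
  (use FM lmapD[OF F] in \<open>auto simp: K'_def submodule_zero[OF K M] submodule_add[OF K M] submodule_smult[OF K M] modD[OF FM]\<close>)
 have "fin_gen R (free_mod R A) K'"
 proof(rule fin_gen_joint[OF A(1) noeth_reg_mod[OF module_cring[OF M] R] FM _ K'])
  show "lmap R (free_mod R A) (reg_mod R) (%f. f i)" if "i \<in> A" for i by(rule free_coord[OF module_cring[OF M]])
  show "f = \<zero>\<^sub>(free_mod R A)" if "f \<in> K'" "!!i. i \<in> A ==> f i = \<zero>\<^sub>(reg_mod R)" for f
  using that by(auto simp: K'_def free_mod_simps fun_eq_iff)
 qed
 moreover have "?F ` K' = K"
  using Fim submodule_sub[OF K M] unfolding K'_def by(auto simp: image_iff)
 ultimately show "fin_gen R M K" using fin_gen_image[OF F K'] by simp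
qed

section \<open>Maps out of finitely generated faithful modules\<close>

text \<open>Existence of an associated prime: a maximal member among the annihilators of nonzero
  elements is prime. The submodule generated by \<open>w\<close> is then a copy of \<open>R\<close>
  modulo this prime, the target of the maps constructed next.\<close>

lemma exists_prime_annihilator:
 fixes V :: "('a,'m) module"
 assumes V: "module R V" and R: "noetherian_ring R" and v: "v \<in> V" "v ~= \<zero>\<^sub>V"
 shows "\<exists>w\<in>V. w ~= \<zero>\<^sub>V & (\<forall>a\<in>R. \<forall>b\<in>R. (a \<otimes>\<^sub>R b) \<odot>\<^sub>V w = \<zero>\<^sub>V -->
  a \<odot>\<^sub>V w = \<zero>\<^sub>V \<or> b \<odot>\<^sub>V w = \<zero>\<^sub>V)"
proof -
 interpret R: noetherian_ring R by fact
 note Rc = module_cring[OF V]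
 let ?ann = "%w. {r \<in> R. r \<odot>\<^sub>V w = \<zero>\<^sub>V}"
 let ?A = "{?ann w |w. w \<in> V & w ~= \<zero>\<^sub>V}"
 have id: "ideal (?ann w) R" if w: "w \<in> V" for w
 proof -
  have l: "lmap R (reg_mod R) V (%r. r \<odot>\<^sub>V w)" by(rule lmap_reg_mod_smult[OF V w])
  have k: "kern (reg_mod R) V (%r. r \<odot>\<^sub>V w) = ?ann w" by(simp add: kern_def)
  note s = submodule_kern[OF l, unfolded k]
  show ?thesis
  proof(rule idealI[OF R.ring_axioms])
  show "subgroup (?ann w) (add_monoid R)"
  using submodule.axioms(1)[OF s] by(simp add: reg_mod_def subgroup_def m_inv_def)
  show "x \<otimes>\<^sub>R a \<in> ?ann w" "a \<otimes>\<^sub>R x \<in> ?ann w" if "a \<in> ?ann w" "x \<in> R" for a x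
  using that w by(auto simp: cring_mult_closed[OF Rc] cring_mult_comm[OF Rc, of a x] mod_mult_smult[OF V] modD[OF V])
  qed
 qed
 have "\<exists>M\<in>?A. \<forall>X\<in>?A. M \<subseteq> X --> X = M"
 proof(rule subset_Zorn_nonempty)
  show "?A ~= {}" using v by blast
  fix C assume C: "C ~= {}" "subset.chain ?A C"
  have "subset.chain {I. ideal I R} C"
  using C(2) id unfolding subset.chain_def by blast
  \<comment> \<open>The noetherian hypothesis at work: a nonempty chain of ideals contains its own
    union.\<close>
  hence "\<Union>C \<in> C" using R.ideal_chain_is_trivial[OF C(1)] by blast
  thus "\<Union>C \<in> ?A" using C(2) unfolding subset.chain_def by blast
 qed
 then obtain J where J: "J \<in> ?A" "\<forall>X\<in>?A. J \<subseteq> X --> X = J" by(rule bexE)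
 from J(1) obtain w where w: "w \<in> V" "w ~= \<zero>\<^sub>V" "J = ?ann w" by blast
 have max: "?ann w' = ?ann w" if "w' \<in> V" "w' ~= \<zero>\<^sub>V" "?ann w \<subseteq> ?ann w'" for w'
 proof -
  have "?ann w' \<in> ?A" using that(1,2) by blast
  hence "J \<subseteq> ?ann w' --> ?ann w' = J" by(rule bspec[OF J(2)])
  thus ?thesis using that(3) w(3) by simp
 qed
 show ?thesis
 proof(intro bexI[of _ w] conjI ballI impI w(1,2))
  fix a b assume ab: "a \<in> R" "b \<in> R" "(a \<otimes>\<^sub>R b) \<odot>\<^sub>V w = \<zero>\<^sub>V"
  show "a \<odot>\<^sub>V w = \<zero>\<^sub>V \<or> b \<odot>\<^sub>V w = \<zero>\<^sub>V"
  proof(rule disjCI)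
  assume b: "b \<odot>\<^sub>V w ~= \<zero>\<^sub>V"
  have sub: "?ann w \<subseteq> ?ann (b \<odot>\<^sub>V w)"
  proof safe
  fix r assume r: "r \<in> R" "r \<odot>\<^sub>V w = \<zero>\<^sub>V"
  have "r \<odot>\<^sub>V (b \<odot>\<^sub>V w) = b \<odot>\<^sub>V (r \<odot>\<^sub>V w)"
  using r(1) ab w
  by(simp add: mod_mult_smult[OF V, symmetric] cring_mult_comm[OF Rc, of r b])
  thus "r \<odot>\<^sub>V (b \<odot>\<^sub>V w) = \<zero>\<^sub>V" using r ab by(simp add: modD[OF V])
  qed
  have "?ann (b \<odot>\<^sub>V w) = ?ann w"
  by(rule max[OF _ b sub]) (use ab w in \<open>auto simp: modD[OF V]\<close>)
  moreover have "a \<in> ?ann (b \<odot>\<^sub>V w)" using ab w by(simp add: mod_mult_smult[OF V])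
  ultimately show "a \<odot>\<^sub>V w = \<zero>\<^sub>V" by blast
  qed
 qed
qed

text \<open>The induction adjoins one generator at a time; when the relation of a new generator \<open>a\<close>
 modulo \<open>U\<close> is contained in the annihilator of \<open>w\<close>, then \<open>a \<mapsto> w\<close> gives the map, after
 multiplication with \<open>c\<close>.\<close>

lemma nonzero_map_or_torsion:
 assumes S: "module R S" and V: "module R V" and w: "w \<in> V" "w ~= \<zero>\<^sub>V"
  and prime: "!!a b. a \<in> R ==> b \<in> R ==> (a \<otimes>\<^sub>R b) \<odot>\<^sub>V w = \<zero>\<^sub>V ==>
  a \<odot>\<^sub>V w = \<zero>\<^sub>V \<or> b \<odot>\<^sub>V w = \<zero>\<^sub>V"
  and A: "finite A" "A \<subseteq> carrier S" and U: "submodule U R S" and gen: "mspan R S (U \<union> A) = carrier S"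
 shows "(\<exists>c\<in>R. c \<odot>\<^sub>V w ~= \<zero>\<^sub>V & (\<forall>s\<in>S. c \<odot>\<^sub>S s \<in> U)) \<or>
  (EX f. lmap R S V f & (\<forall>u\<in>U. f u = \<zero>\<^sub>V) & (\<exists>s\<in>S. f s ~= \<zero>\<^sub>V))"
 using A U gen
proof(induction A arbitrary: U rule: finite_induct)
 case empty
 have "mspan R S U \<subseteq> U" by(rule mspan_minimal[OF empty(2) S]) auto
 hence "carrier S \<subseteq> U" using empty by simp
 thus ?case using w module_cring[OF S] by(intro disjI1 bexI[of _ "\<one>\<^sub>R"]) (auto simp: modD[OF V] modD[OF S])
next
 case (insert a A)
 note U = insert.prems(2) and R = module_cring[OF S]
 have a: "a \<in> S" and Ac: "A \<subseteq> carrier S" using insert by auto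
 have Uc: "u \<in> S" if "u \<in> U" for u using submodule_sub[OF U S that] .
 define U' where "U' = {u \<oplus>\<^sub>S r \<odot>\<^sub>S a |u r. u \<in> U & r \<in> R}"
 have U'I: "u \<oplus>\<^sub>S r \<odot>\<^sub>S a \<in> U'" if "u \<in> U" "r \<in> R" for u r using that unfolding U'_def by blast
 have U'E: "EX u r. u \<in> U & r \<in> R & x = u \<oplus>\<^sub>S r \<odot>\<^sub>S a" if "x \<in> U'" for x using that unfolding U'_def by blast
 have UU': "U \<subseteq> U'" using U'I[of _ "\<zero>\<^sub>R"] Uc a R by(auto simp: modD[OF S])
 have aU': "a \<in> U'" using U'I[OF submodule_zero[OF U S], of "\<one>\<^sub>R"] a R by(simp add: modD[OF S])
 have add_eq: "(u \<oplus>\<^sub>S r \<odot>\<^sub>S a) \<oplus>\<^sub>S (u' \<oplus>\<^sub>S r' \<odot>\<^sub>S a) = (u \<oplus>\<^sub>S u') \<oplus>\<^sub>S (r \<oplus>\<^sub>R r') \<odot>\<^sub>S a"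
  if "u \<in> U" "u' \<in> U" "r \<in> R" "r' \<in> R" for u u' r r'
  using that a Uc by(simp add: mod_add_smult[OF S] mod_add_add_swap[OF S] modD[OF S])
 have sm_eq: "s \<odot>\<^sub>S (u \<oplus>\<^sub>S r \<odot>\<^sub>S a) = s \<odot>\<^sub>S u \<oplus>\<^sub>S (s \<otimes>\<^sub>R r) \<odot>\<^sub>S a"
  if "u \<in> U" "r \<in> R" "s \<in> R" for u r s
  using that a Uc by(simp add: mod_smult_add[OF S] mod_mult_smult[OF S] modD[OF S])
 have U': "submodule U' R S"
 proof(rule submoduleI'[OF S])
  show "U' \<subseteq> carrier S" using Uc a by(auto simp: U'_def modD[OF S])
  show "\<zero>\<^sub>S \<in> U'" using UU' submodule_zero[OF U S] by blast
  show "x \<oplus>\<^sub>S y \<in> U'" if xy: "x \<in> U'" "y \<in> U'" for x y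
  proof -
  obtain u r u' r' where "u \<in> U" "r \<in> R" "x = u \<oplus>\<^sub>S r \<odot>\<^sub>S a" "u' \<in> U" "r' \<in> R" "y = u' \<oplus>\<^sub>S r' \<odot>\<^sub>S a"
  using U'E[OF xy(1)] U'E[OF xy(2)] by blast
  thus ?thesis using add_eq U'I submodule_add[OF U S] R by(metis cring_add_closed)
  qed
  show "s \<odot>\<^sub>S x \<in> U'" if sx: "s \<in> R" "x \<in> U'" for s x
  proof -
  obtain u r where "u \<in> U" "r \<in> R" "x = u \<oplus>\<^sub>S r \<odot>\<^sub>S a" using U'E[OF sx(2)] by blast
  thus ?thesis using sm_eq U'I submodule_smult[OF U S] R sx(1) by(metis cring_mult_closed)
  qed
 qed
 have "carrier S \<subseteq> mspan R S (U' \<union> A)"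
  unfolding insert.prems(3)[symmetric]
  by(rule mspan_minimal[OF submodule_mspan[OF S] S])
  (use UU' aU' Ac submodule_sub[OF U' S] in \<open>auto intro: mspan.mspan_base\<close>)
 hence gen': "mspan R S (U' \<union> A) = carrier S"
  using mspan_sub[OF S, of "U' \<union> A"] Ac submodule_sub[OF U' S] by blast
 from insert.IH[OF Ac U' gen'] show ?case
 proof
  assume "EX f. lmap R S V f & (\<forall>u\<in>U'. f u = \<zero>\<^sub>V) & (\<exists>s\<in>S. f s ~= \<zero>\<^sub>V)"
  thus ?thesis using UU' by blast
 next
  assume "\<exists>c\<in>R. c \<odot>\<^sub>V w ~= \<zero>\<^sub>V & (\<forall>s\<in>S. c \<odot>\<^sub>S s \<in> U')"
  then obtain c where c: "c \<in> R" "c \<odot>\<^sub>V w ~= \<zero>\<^sub>V" "!!s. s \<in> S ==> c \<odot>\<^sub>S s \<in> U'" by blast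
  show ?thesis
  \<comment> \<open>If some \<open>b\<close> outside the annihilator of \<open>w\<close> takes
    \<open>a\<close> into \<open>U\<close>, then \<open>b c\<close> takes all of \<open>S\<close>
    into \<open>U\<close> and still does not kill \<open>w\<close>, by primality. Otherwise every
    relation of \<open>a\<close> modulo \<open>U\<close> kills \<open>w\<close>, and
    \<open>c s = u + r a\<close> may be sent to \<open>r w\<close>.\<close>
  proof(cases "\<exists>b\<in>R. b \<odot>\<^sub>S a \<in> U & b \<odot>\<^sub>V w ~= \<zero>\<^sub>V")
  case True
  then obtain b where b: "b \<in> R" "b \<odot>\<^sub>S a \<in> U" "b \<odot>\<^sub>V w ~= \<zero>\<^sub>V" by blast
  have "(b \<otimes>\<^sub>R c) \<odot>\<^sub>S s \<in> U" if s: "s \<in> S" for s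
  proof -
  obtain u r where ur: "u \<in> U" "r \<in> R" "c \<odot>\<^sub>S s = u \<oplus>\<^sub>S r \<odot>\<^sub>S a" using U'E[OF c(3)[OF s]] by blast
  have "(b \<otimes>\<^sub>R c) \<odot>\<^sub>S s = b \<odot>\<^sub>S u \<oplus>\<^sub>S (b \<otimes>\<^sub>R r) \<odot>\<^sub>S a"
  using ur b c s by(simp add: mod_mult_smult[OF S, of b c] sm_eq)
  also have "(b \<otimes>\<^sub>R r) \<odot>\<^sub>S a = r \<odot>\<^sub>S (b \<odot>\<^sub>S a)"
  using ur b a by(simp add: cring_mult_comm[OF R, of b] mod_mult_smult[OF S])
  finally show ?thesis using ur b submodule_add[OF U S] submodule_smult[OF U S] by simp
  qed
  moreover have "(b \<otimes>\<^sub>R c) \<odot>\<^sub>V w ~= \<zero>\<^sub>V" using prime b c by blast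
  ultimately show ?thesis using b c R by(intro disjI1 bexI[of _ "b \<otimes>\<^sub>R c"]) auto
  next
  case False
  hence bw: "b \<odot>\<^sub>V w = \<zero>\<^sub>V" if "b \<in> R" "b \<odot>\<^sub>S a \<in> U" for b using that by blast
  have uniq: "r \<odot>\<^sub>V w = r' \<odot>\<^sub>V w" if "u \<in> U" "u' \<in> U" "r \<in> R" "r' \<in> R"
  "u \<oplus>\<^sub>S r \<odot>\<^sub>S a = u' \<oplus>\<^sub>S r' \<odot>\<^sub>S a" for u u' r r'
  proof -
  let ?n = "\<ominus>\<^sub>R \<one>\<^sub>R"
  have n: "?n \<in> R" using R by simp
  have nx: "?n \<odot>\<^sub>S x = \<ominus>\<^sub>S x" if "x \<in> S" for x
  using that R mod_neg_smult[OF S, of "\<one>\<^sub>R" x] by(simp add: modD[OF S])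
  have nr: "?n \<otimes>\<^sub>R r' \<in> R" using n that R by simp
  have "(u' \<oplus>\<^sub>S r' \<odot>\<^sub>S a) \<oplus>\<^sub>S ?n \<odot>\<^sub>S (u' \<oplus>\<^sub>S r' \<odot>\<^sub>S a) = \<zero>\<^sub>S"
  using that(1-4) a Uc by(subst nx) (auto simp: modD[OF S])
  hence "(u \<oplus>\<^sub>S r \<odot>\<^sub>S a) \<oplus>\<^sub>S ?n \<odot>\<^sub>S (u' \<oplus>\<^sub>S r' \<odot>\<^sub>S a) = \<zero>\<^sub>S"
  unfolding that(5) .
  hence z: "(u \<oplus>\<^sub>S ?n \<odot>\<^sub>S u') \<oplus>\<^sub>S (r \<oplus>\<^sub>R ?n \<otimes>\<^sub>R r') \<odot>\<^sub>S a = \<zero>\<^sub>S"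
  using that(1-4) n nr submodule_smult[OF U S n] by(simp add: sm_eq add_eq)
  define v where "v = u \<oplus>\<^sub>S ?n \<odot>\<^sub>S u'"
  have v: "v \<in> U" unfolding v_def using that n submodule_smult[OF U S n] submodule_add[OF U S] by simp
  define q where "q = (r \<oplus>\<^sub>R ?n \<otimes>\<^sub>R r')"
  have qc: "q \<in> R" using that nr R by(simp add: q_def)
  have "v = \<ominus>\<^sub>S (q \<odot>\<^sub>S a)"
  using z mod_add_eq_zero[OF S Uc[OF v], of "q \<odot>\<^sub>S a"] a qc by(simp add: v_def q_def modD[OF S])
  hence "q \<odot>\<^sub>S a = \<ominus>\<^sub>S v" using a qc by(simp add: modD[OF S])
  hence "q \<odot>\<^sub>S a \<in> U" using submodule_neg[OF U S v] by simp
  hence "q \<odot>\<^sub>V w = \<zero>\<^sub>V" using bw qc by blast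
  hence "r \<odot>\<^sub>V w \<oplus>\<^sub>V \<ominus>\<^sub>V (r' \<odot>\<^sub>V w) = \<zero>\<^sub>V"
  using that w n nr R mod_neg_smult[OF V, of "\<one>\<^sub>R" "r' \<odot>\<^sub>V w"]
  by(simp add: q_def mod_add_smult[OF V] mod_mult_smult[OF V] modD[OF V])
  thus ?thesis using mod_minus_eq_zero[OF V, of "r \<odot>\<^sub>V w" "r' \<odot>\<^sub>V w"] that w
  by(simp add: a_minus_def modD[OF V])
  qed
  define f where "f s = (SOME y. \<exists>u\<in>U. \<exists>r\<in>R. c \<odot>\<^sub>S s = u \<oplus>\<^sub>S r \<odot>\<^sub>S a & y = r \<odot>\<^sub>V w)" for s
  have f: "f s = r \<odot>\<^sub>V w" if ur: "u \<in> U" "r \<in> R" "c \<odot>\<^sub>S s = u \<oplus>\<^sub>S r \<odot>\<^sub>S a" for s u r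
  proof -
  have "EX y. \<exists>u\<in>U. \<exists>r\<in>R. c \<odot>\<^sub>S s = u \<oplus>\<^sub>S r \<odot>\<^sub>S a & y = r \<odot>\<^sub>V w" using ur by blast
  from someI_ex[OF this] obtain u' r' where
  "u' \<in> U" "r' \<in> R" "c \<odot>\<^sub>S s = u' \<oplus>\<^sub>S r' \<odot>\<^sub>S a" "f s = r' \<odot>\<^sub>V w"
  unfolding f_def by blast
  thus ?thesis using uniq[of u u' r r'] ur by simp
  qed
  have ex: "EX u r. u \<in> U & r \<in> R & c \<odot>\<^sub>S s = u \<oplus>\<^sub>S r \<odot>\<^sub>S a" if "s \<in> S" for s
  using U'E[OF c(3)[OF that]] by blast
  have "lmap R S V f"
  proof(rule lmapI[OF S V])
  show "f s \<in> V" if "s \<in> S" for s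
  using ex[OF that] f w by(auto simp: modD[OF V])
  fix s t assume st: "s \<in> S" "t \<in> S"
  obtain u r u' r' where ur: "u \<in> U" "r \<in> R" "c \<odot>\<^sub>S s = u \<oplus>\<^sub>S r \<odot>\<^sub>S a"
  "u' \<in> U" "r' \<in> R" "c \<odot>\<^sub>S t = u' \<oplus>\<^sub>S r' \<odot>\<^sub>S a" using ex[OF st(1)] ex[OF st(2)] by blast
  have "c \<odot>\<^sub>S (s \<oplus>\<^sub>S t) = (u \<oplus>\<^sub>S u') \<oplus>\<^sub>S (r \<oplus>\<^sub>R r') \<odot>\<^sub>S a"
  using ur st c by(simp add: mod_smult_add[OF S] add_eq)
  from f[OF submodule_add[OF U S ur(1,4)] cring_add_closed[OF R ur(2,5)] this]
  show "f (s \<oplus>\<^sub>S t) = f s \<oplus>\<^sub>V f t"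
  using f[OF ur(1,2,3)] f[OF ur(4,5,6)] ur w by(simp add: mod_add_smult[OF V])
  next
  fix q s assume qs: "q \<in> R" "s \<in> S"
  obtain u r where ur: "u \<in> U" "r \<in> R" "c \<odot>\<^sub>S s = u \<oplus>\<^sub>S r \<odot>\<^sub>S a" using ex[OF qs(2)] by blast
  have "c \<odot>\<^sub>S (q \<odot>\<^sub>S s) = q \<odot>\<^sub>S (c \<odot>\<^sub>S s)"
  using qs c by(simp add: mod_mult_smult[OF S, symmetric] cring_mult_comm[OF R, of c q])
  also have "\<dots> = q \<odot>\<^sub>S u \<oplus>\<^sub>S (q \<otimes>\<^sub>R r) \<odot>\<^sub>S a" using ur qs by(simp add: sm_eq)
  finally show "f (q \<odot>\<^sub>S s) = q \<odot>\<^sub>V f s"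
  using f[OF submodule_smult[OF U S qs(1) ur(1)] cring_mult_closed[OF R qs(1) ur(2)]] f[OF ur] ur w qs
  by(simp add: mod_mult_smult[OF V])
  qed
  moreover have "f u = \<zero>\<^sub>V" if u: "u \<in> U" for u
  using f[OF submodule_smult[OF U S c(1) u] cring_zero_closed[OF R]] w Uc[OF u] c a by(simp add: modD[OF V] modD[OF S])
  \<comment> \<open>From \<open>c a = 0 + c a\<close> the value at \<open>a\<close> is
    \<open>c w\<close>, nonzero by the choice of \<open>c\<close>.\<close>
  moreover have "f a ~= \<zero>\<^sub>V"
  using f[OF submodule_zero[OF U S] c(1), of a] c a by(simp add: modD[OF S])
  ultimately show ?thesis using a by blast
  qed
 qed
qed

definition faithful :: "('a,'r) ring_scheme => ('a,'m) module => bool" where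
 "faithful R S \<longleftrightarrow> (\<forall>r\<in>R. (\<forall>s\<in>S. r \<odot>\<^sub>S s = \<zero>\<^sub>S) --> r = \<zero>\<^sub>R)"

text \<open>The preceding alternative for \<open>U = 0\<close>: a multiplier that kills
  \<open>S\<close> is zero by faithfulness and would kill \<open>w\<close> too, so the map must
  exist.\<close>

lemma nonzero_map_exists:
 assumes S: "module R S" and V: "module R V" and R: "noetherian_ring R"
  and fg: "fin_gen R S (carrier S)" and fa: "faithful R S"
  and v: "v \<in> V" "v ~= \<zero>\<^sub>V"
 shows "EX f. lmap R S V f & (\<exists>s\<in>S. f s ~= \<zero>\<^sub>V)"
proof -
 obtain w where w: "w \<in> V" "w ~= \<zero>\<^sub>V"
  and prime: "!!a b. a \<in> R ==> b \<in> R ==> (a \<otimes>\<^sub>R b) \<odot>\<^sub>V w = \<zero>\<^sub>V ==>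
  a \<odot>\<^sub>V w = \<zero>\<^sub>V \<or> b \<odot>\<^sub>V w = \<zero>\<^sub>V"
  using exists_prime_annihilator[OF V R v] by blast
 obtain A where A: "finite A" "A \<subseteq> carrier S" "carrier S = mspan R S A" using fg by(auto simp: fin_gen_def)
 have U: "submodule {\<zero>\<^sub>S} R S"
  by(rule submoduleI'[OF S]) (auto simp: modD[OF S])
 have "carrier S \<subseteq> mspan R S ({\<zero>\<^sub>S} \<union> A)"
  unfolding A(3)
  by(rule mspan_minimal[OF submodule_mspan[OF S] S]) (use A(2) in \<open>auto intro: mspan.mspan_base simp: modD[OF S]\<close>)
 hence gen: "mspan R S ({\<zero>\<^sub>S} \<union> A) = carrier S"
  using mspan_sub[OF S, of "{\<zero>\<^sub>S} \<union> A"] A(2) by(auto simp: modD[OF S])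
 have no: "\<not> (\<exists>c\<in>R. c \<odot>\<^sub>V w ~= \<zero>\<^sub>V & (\<forall>s\<in>S. c \<odot>\<^sub>S s \<in> {\<zero>\<^sub>S}))"
  using fa w unfolding faithful_def by(auto simp: modD[OF V])
 show ?thesis using nonzero_map_or_torsion[OF S V w prime A(1,2) U gen] no by blast
qed

text \<open>The test by which homology is made to vanish. If \<open>B\<close> were proper, the maps
  \<open>Z \<rightarrow> char_mod R\<close> trivial on \<open>B\<close>, that is the dual of the
  quotient, would form a nonzero module, and \<open>S\<close> would map nontrivially to it.\<close>

lemma submodule_eq_of_no_maps:
 assumes S: "module R S" and Z: "module R Z" and R: "noetherian_ring R"
  and fg: "fin_gen R S (carrier S)" and fa: "faithful R S" and B: "submodule B R Z"
  and null: "!!\<alpha> s z. lmap R S (Hom R Z (char_mod R)) \<alpha> ==>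
  (!!s b. s \<in> S ==> b \<in> B ==> \<alpha> s b = \<zero>\<^sub>(char_mod R)) ==>
  s \<in> S ==> z \<in> Z ==> \<alpha> s z = \<zero>\<^sub>(char_mod R)"
 shows "B = carrier Z"
proof(rule ccontr)
 assume "B ~= carrier Z"
 then obtain z where z: "z \<in> Z" "z \<notin> B" using submodule_sub[OF B Z] by blast
 let ?E = "char_mod R" let ?H = "Hom R Z ?E"
 note E = module_char_mod[OF module_cring[OF S]]
 note H = module_hom_mod[OF Z E]
 obtain f where f: "lmap R Z ?E f" "!!x. x \<in> B ==> f x = \<zero>\<^sub>?E" "f z ~= \<zero>\<^sub>?E"
  using char_mod_separates[OF Z B z] by blast
 define V where "V = {\<phi> \<in> ?H. \<forall>b\<in>B. \<phi> b = \<zero>\<^sub>?E}"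
 have V: "submodule V R ?H"
 proof(rule submoduleI'[OF H])
  show "V \<subseteq> carrier ?H" by(auto simp: V_def)
 qed (auto simp: V_def modD[OF H] modD[OF E] submodule_sub[OF B Z])
 define v where "v = (\<lambda>x\<in>Z. f x)"
 have v: "v \<in> V" using hom_mem[OF f(1)] f(2) submodule_sub[OF B Z] by(auto simp: V_def v_def)
 have vz: "v ~= \<zero>\<^sub>?H"
 proof
  assume "v = \<zero>\<^sub>?H"
  hence "v z = \<zero>\<^sub>?H z" by simp
  thus False using f(3) z by(simp add: v_def)
 qed
 obtain g s where g: "lmap R S (restr_mod ?H V) g" "s \<in> S" "g s ~= \<zero>\<^sub>?H"
  using nonzero_map_exists[OF S module_restr_mod[OF H V] R fg fa, of v] v vz by auto
 have gV: "g t \<in> V" if "t \<in> S" for t using lmap_in[OF g(1) that] by simp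
 have g': "lmap R S ?H g" by(rule lmap_extend_cod[OF g(1) V H])
 have "g s x = \<zero>\<^sub>?E" if "x \<in> Z" for x
  using null[OF g' _ g(2) that] gV by(auto simp: V_def)
 hence "g s = \<zero>\<^sub>?H"
  by(intro hom_eqI[of _ R Z ?E]) (use gV[OF g(2)] V_def modD[OF H] in auto)
 thus False using g(3) by blast
qed

section \<open>Finitely generated projective modules\<close>

text \<open>A finite dual basis describes finitely generated projective modules without test
  modules, hence independently of the element type.\<close>

definition fgproj :: "('a,'r) ring_scheme => ('a,'m) module => bool" where
 "fgproj R F \<longleftrightarrow> module R F & (EX (n::nat) e c.
  (ALL i<n. e i \<in> F & lmap R F (reg_mod R) (c i)) &
  (\<forall>x\<in>F. x = finsum F (%i. c i x \<odot>\<^sub>F e i) {..<n}))"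

lemma fgproj_module: "fgproj R F ==> module R F"
 by(simp add: fgproj_def)

lemma lmap_coord_smult:
 assumes "lmap R F (reg_mod R) c" "module R M" "y \<in> M"
 shows "lmap R F M (%x. c x \<odot>\<^sub>M y)"
 using lmap_comp[OF assms(1) lmap_reg_mod_smult[OF assms(2,3)]] .

lemma fgproj_lift:
 assumes F: "fgproj R F" and g: "lmap R A B g" and f: "lmap R F B f"
  and im: "!!x. x \<in> F ==> \<exists>a\<in>A. g a = f x"
 shows "EX h. lmap R F A h & (\<forall>x\<in>F. g (h x) = f x)"
proof -
 obtain n :: nat and e c where e: "!!i. i < n ==> e i \<in> F"
  and c: "!!i. i < n ==> lmap R F (reg_mod R) (c i)"
  and x: "!!x. x \<in> F ==> x = finsum F (%i. c i x \<odot>\<^sub>F e i) {..<n}"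
  using F unfolding fgproj_def by metis
 have "ALL i. EX a. i < n --> a \<in> A & g a = f (e i)" using im e by blast
 then obtain a where a: "!!i. i < n ==> a i \<in> A" "!!i. i < n ==> g (a i) = f (e i)" by metis
 note FM = fgproj_module[OF F] and A = lmap_dom[OF g] and B = lmap_cod[OF g]
 define h where "h x = finsum A (%i. c i x \<odot>\<^sub>A a i) {..<n}" for x
 have h: "lmap R F A h"
  unfolding h_def by(rule lmap_sum_maps) (use FM A a c in \<open>auto intro: lmap_coord_smult\<close>)
 have "g (h x) = f x" if xF: "x \<in> F" for x
 proof -
  have cx: "c i x \<in> R" if "i < n" for i using lmap_in[OF c[OF that] xF] by simp
  have "g (h x) = finsum B (%i. g (c i x \<odot>\<^sub>A a i)) {..<n}"
  unfolding h_def by(rule lmap_finsum[OF g]) (use a cx in \<open>auto simp: modD[OF A]\<close>)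
  also have "\<dots> = finsum B (%i. f (c i x \<odot>\<^sub>F e i)) {..<n}"
  by(rule mod_finsum_cong[OF B]) (use a cx e in \<open>auto simp: lmapD[OF g] lmapD[OF f] modD[OF FM] modD[OF B]\<close>)
  also have "\<dots> = f (finsum F (%i. c i x \<odot>\<^sub>F e i) {..<n})"
  by(rule lmap_finsum[OF f, symmetric]) (use e cx in \<open>auto simp: modD[OF FM]\<close>)
  finally show ?thesis using x[OF xF] by simp
 qed
 with h show ?thesis by blast
qed

lemma fgproj_retract:
 assumes F: "fgproj R F" and i: "lmap R G F i" and p: "lmap R F G p"
  and pi: "!!x. x \<in> G ==> p (i x) = x"
 shows "fgproj R G"
proof -
 obtain n :: nat and e c where e: "!!i. i < n ==> e i \<in> F"
  and c: "!!i. i < n ==> lmap R F (reg_mod R) (c i)"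
  and x: "!!x. x \<in> F ==> x = finsum F (%i. c i x \<odot>\<^sub>F e i) {..<n}"
  using F unfolding fgproj_def by metis
 note FM = fgproj_module[OF F] and GM = lmap_dom[OF i]
 have "y = finsum G (%j. c j (i y) \<odot>\<^sub>G p (e j)) {..<n}" if y: "y \<in> G" for y
 proof -
  have iy: "i y \<in> F" using lmap_in[OF i y] .
  have cy: "c j (i y) \<in> R" if "j < n" for j using lmap_in[OF c[OF that] iy] by simp
  have "p (finsum F (%j. c j (i y) \<odot>\<^sub>F e j) {..<n}) = finsum G (%j. p (c j (i y) \<odot>\<^sub>F e j)) {..<n}"
  by(rule lmap_finsum[OF p]) (use e cy in \<open>auto simp: modD[OF FM]\<close>)
  also have "\<dots> = finsum G (%j. c j (i y) \<odot>\<^sub>G p (e j)) {..<n}"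
  by(rule mod_finsum_cong[OF GM]) (use e cy in \<open>auto simp: lmapD[OF p] modD[OF GM]\<close>)
  finally show ?thesis using x[OF iy] pi[OF y] by simp
 qed
 thus ?thesis unfolding fgproj_def
  using GM e lmap_in[OF p] lmap_comp[OF i c]
  by(intro conjI exI[of _ n] exI[of _ "%j. p (e j)"] exI[of _ "%j y. c j (i y)"]) auto
qed

lemma fgproj_free_mod:
 assumes R: "cring R"
 shows "fgproj R (free_mod R {..<n::nat})"
proof -
 note FM = module_free_mod[OF R] and RR = module_reg_mod[OF R]
 interpret cring R by fact
 have "x = finsum (free_mod R {..<n}) (%i. x i \<odot>\<^sub>(free_mod R {..<n}) free_gen R i) {..<n}"
  if x: "x \<in> free_mod R {..<n}" for x
 proof
  fix j
  have mem: "x i \<odot>\<^sub>(free_mod R {..<n}) free_gen R i \<in> free_mod R {..<n}" if "i < n" for i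
  by(intro mod_smult_closed[OF FM] free_gen_mem[OF R]) (use x that in \<open>auto simp: free_mod_simps\<close>)
  have "finsum (free_mod R {..<n}) (%i. x i \<odot>\<^sub>(free_mod R {..<n}) free_gen R i) {..<n} j =
  finsum (reg_mod R) (%i. (x i \<odot>\<^sub>(free_mod R {..<n}) free_gen R i) j) {..<n}"
  by(rule lmap_finsum[OF free_coord[OF R]]) (use mem in auto)
  also have "\<dots> = finsum (reg_mod R) (%i. if i = j then x j else \<zero>\<^sub>R) {..<n}"
  by(rule mod_finsum_cong[OF RR]) (use x in \<open>auto simp: free_mod_simps free_gen_def\<close>)
  also have "\<dots> = x j"
  proof(cases "j < n")
  case True
  have "finsum (reg_mod R) (%i. if i = j then x j else \<zero>\<^sub>R) (insert j ({..<n} - {j})) =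
  x j \<oplus>\<^sub>(reg_mod R) finsum (reg_mod R) (%i. if i = j then x j else \<zero>\<^sub>R) ({..<n} - {j})"
  by(subst mod_finsum_insert[OF RR]) (use x in \<open>auto simp: free_mod_simps\<close>)
  also have "finsum (reg_mod R) (%i. if i = j then x j else \<zero>\<^sub>R) ({..<n} - {j}) = \<zero>\<^sub>(reg_mod R)"
  by(rule mod_finsum_zero[OF RR]) auto
  finally show ?thesis using True x by(simp add: insert_absorb free_mod_simps)
  next
  case False
  hence "x j = \<zero>\<^sub>R" using x by(auto simp: free_mod_simps)
  moreover have "finsum (reg_mod R) (%i. if i = j then x j else \<zero>\<^sub>R) {..<n} = \<zero>\<^sub>(reg_mod R)"
  by(rule mod_finsum_zero[OF RR]) (use False in auto)
  ultimately show ?thesis by simp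
  qed
  finally show "x j = finsum (free_mod R {..<n}) (%i. x i \<odot>\<^sub>(free_mod R {..<n}) free_gen R i) {..<n} j" by simp
 qed
 thus ?thesis unfolding fgproj_def
  using FM free_gen_mem[OF R, of _ "{..<n}"] free_coord[OF R]
  by(intro conjI exI[of _ n] exI[of _ "%i. free_gen R i"] exI[of _ "%i f. f i"]) auto
qed

text \<open>\<open>pre\<close> and \<open>post\<close> are the two functorialities of Hom. The
  domain is passed along because elements of Hom modules are extensional.\<close>

definition pre :: "('a,'l) module => ('l => 'm) => ('m => 'n) => 'l => 'n" where
 "pre A f g = (\<lambda>x\<in>A. g (f x))"

definition post :: "('a,'l) module => ('m => 'n) => ('l => 'm) => 'l => 'n" where
 "post A f g = (\<lambda>x\<in>A. f (g x))"

lemma pre_apply [simp]: "x \<in> carrier A ==> pre A f g x = g (f x)"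
 by(simp add: pre_def)

lemma post_apply [simp]: "x \<in> carrier A ==> post A f g x = f (g x)"
 by(simp add: post_def)

lemma lmap_pre: "lmap R A B f ==> module R Z ==> lmap R (Hom R B Z) (Hom R A Z) (pre A f)"
 unfolding pre_def using lmap_precomp by blast

lemma lmap_post: "lmap R A B f ==> module R Z ==> lmap R (Hom R Z A) (Hom R Z B) (post Z f)"
 unfolding post_def using lmap_postcomp by blast

text \<open>The natural map \<open>F \<otimes> Hom(S, I) \<rightarrow> Hom(Hom(F, S), I)\<close>, an isomorphism for finitely generated
 projective \<open>F\<close>; the two lemmas after its bilinearity state this after dualising once more.\<close>

definition hom_eval :: "('a,'r) ring_scheme => ('a,'f) module => ('a,'s) module => 'f => ('s => 'i) =>
  ('f => 's) => 'i" where
 "hom_eval R F S x g = (\<lambda>f\<in>Hom R F S. g (f x))"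

lemma bilin_hom_eval:
 assumes "module R F" "module R S" "module R I"
 shows "bilin R F (Hom R S I) (Hom R (Hom R F S) I) (hom_eval R F S)"
proof(rule bilinI)
 fix x assume x: "x \<in> F"
 show "lmap R (Hom R S I) (Hom R (Hom R F S) I) (hom_eval R F S x)"
  unfolding hom_eval_def
  by(rule lmap_curry, rule bilin_comp_right[OF bilin_hom_comp lmap_eval]) (use assms x in auto)
next
 fix g assume g: "g \<in> Hom R S I"
 have "bilin R F (Hom R F S) I (%x f. g (f x))"
  by(rule bilin_post[OF bilin_flip[OF bilin_hom_comp] hom_lmap[OF g]]) (use assms in auto)
 from lmap_curry[OF this] show "lmap R F (Hom R (Hom R F S) I) (%x. hom_eval R F S x g)"
  by(simp add: hom_eval_def)
qed (use assms in auto)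

lemma hom_eval_injective:
 assumes F: "fgproj R F" and S: "module R S" and I': "module R I'" and \<Phi>: "lmap R (Hom R (Hom R F S) I') I \<Phi>"
  and zero: "!!x g. x \<in> F ==> g \<in> Hom R S I' ==> \<Phi> (hom_eval R F S x g) = \<zero>\<^sub>I"
  and \<Lambda>: "\<Lambda> \<in> Hom R (Hom R F S) I'"
 shows "\<Phi> \<Lambda> = \<zero>\<^sub>I"
proof -
 obtain n :: nat and e c where e: "!!i. i < n ==> e i \<in> F"
  and c: "!!i. i < n ==> lmap R F (reg_mod R) (c i)"
  and x: "!!x. x \<in> F ==> x = finsum F (%i. c i x \<odot>\<^sub>F e i) {..<n}"
  using F unfolding fgproj_def by metis
 note FM = fgproj_module[OF F]
 let ?FS = "Hom R F S" let ?D = "Hom R ?FS I'"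
 have FS: "module R ?FS" and D: "module R ?D" using FM S I' by auto
 \<comment> \<open>\<open>k i\<close> places an element of \<open>S\<close> at the
   \<open>i\<close>-th coordinate. Every \<open>f\<close> is the sum of the
   \<open>k i (f (e i))\<close>, hence \<open>\<Lambda>\<close> is the sum of the evaluations at
   \<open>e i\<close> followed by \<open>\<Lambda> \<circ> k i\<close>.\<close>
 define k where "k i s = (\<lambda>x\<in>F. c i x \<odot>\<^sub>S s)" for i s
 have k: "lmap R S ?FS (k i)" if i: "i < n" for i
 proof -
  have "bilin R F S S (%x s. c i x \<odot>\<^sub>S s)"
  proof(rule bilinI[OF FM S S])
  fix x assume "x \<in> F"
  hence "c i x \<in> R" using lmap_in[OF c[OF i]] by simp
  thus "lmap R S S (%s. c i x \<odot>\<^sub>S s)" by(rule lmap_scale[OF lmap_ident[OF S]])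
  qed (rule lmap_coord_smult[OF c[OF i] S])
  from lmap_curry[OF bilin_flip[OF this]] show ?thesis by(simp add: k_def[abs_def])
 qed
 define g where "g i = pre S (k i) \<Lambda>" for i
 have g: "g i \<in> Hom R S I'" if "i < n" for i
  unfolding g_def using lmap_in[OF lmap_pre[OF k[OF that] I'] \<Lambda>] .
 have m: "hom_eval R F S (e i) (g i) \<in> ?D" if "i < n" for i
  using bilin_closed[OF bilin_hom_eval[OF FM S I'] e[OF that] g[OF that]] .
 have "\<Lambda> = finsum ?D (%i. hom_eval R F S (e i) (g i)) {..<n}"
 proof(rule hom_eqI[OF \<Lambda>])
  show "finsum ?D (%i. hom_eval R F S (e i) (g i)) {..<n} \<in> ?D"
  by(rule mod_finsum_closed[OF D]) (use m in auto)
  fix f assume f: "f \<in> ?FS"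
  note fl = hom_lmap[OF f FM S]
  have fe: "f (e i) \<in> S" if "i < n" for i using lmap_in[OF fl e[OF that]] .
  have kf: "k i (f (e i)) \<in> ?FS" if "i < n" for i using lmap_in[OF k[OF that] fe[OF that]] .
  have ff: "f = finsum ?FS (%i. k i (f (e i))) {..<n}"
  proof(rule hom_eqI[OF f])
  show "finsum ?FS (%i. k i (f (e i))) {..<n} \<in> ?FS"
  by(rule mod_finsum_closed[OF FS]) (use kf in auto)
  fix x assume xF: "x \<in> F"
  have cx: "c i x \<in> R" if "i < n" for i using lmap_in[OF c[OF that] xF] by simp
  have "finsum ?FS (%i. k i (f (e i))) {..<n} x = finsum S (%i. k i (f (e i)) x) {..<n}"
  by(rule lmap_finsum[OF lmap_eval[OF FM S xF]]) (use kf in auto)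
  also have "\<dots> = finsum S (%i. f (c i x \<odot>\<^sub>F e i)) {..<n}"
  by(rule mod_finsum_cong[OF S]) (use e cx xF in \<open>auto simp: k_def lmapD[OF fl] modD[OF S]\<close>)
  also have "\<dots> = f (finsum F (%i. c i x \<odot>\<^sub>F e i) {..<n})"
  by(rule lmap_finsum[OF fl, symmetric]) (use e cx in \<open>auto simp: modD[OF FM]\<close>)
  finally show "f x = finsum ?FS (%i. k i (f (e i))) {..<n} x" using x[OF xF] by simp
  qed
  have "finsum ?D (%i. hom_eval R F S (e i) (g i)) {..<n} f =
  finsum I' (%i. hom_eval R F S (e i) (g i) f) {..<n}"
  by(rule lmap_finsum[OF lmap_eval[OF FS I' f]]) (use m in auto)
  also have "\<dots> = finsum I' (%i. \<Lambda> (k i (f (e i)))) {..<n}"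
  by(rule mod_finsum_cong[OF I']) (use f fe kf hom_closed[OF \<Lambda>] in \<open>auto simp: hom_eval_def g_def\<close>)
  also have "\<dots> = \<Lambda> (finsum ?FS (%i. k i (f (e i))) {..<n})"
  by(rule lmap_finsum[OF hom_lmap[OF \<Lambda> FS I'], symmetric]) (use kf in auto)
  finally show "\<Lambda> f = finsum ?D (%i. hom_eval R F S (e i) (g i)) {..<n} f" using ff by simp
 qed
 hence "\<Phi> \<Lambda> = \<Phi> (finsum ?D (%i. hom_eval R F S (e i) (g i)) {..<n})" by simp
 also have "\<dots> = finsum I (%i. \<Phi> (hom_eval R F S (e i) (g i))) {..<n}"
  by(rule lmap_finsum[OF \<Phi>]) (use m in auto)
 also have "\<dots> = \<zero>\<^sub>I"
  by(rule mod_finsum_zero[OF lmap_cod[OF \<Phi>]]) (use zero e g in auto)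
 finally show ?thesis .
qed

lemma hom_eval_surjective:
 assumes F: "fgproj R F" and S: "module R S" and I': "module R I'" and I: "module R I"
  and \<phi>: "lmap R F (Hom R (Hom R S I') I) \<phi>"
 shows "EX \<Phi>. lmap R (Hom R (Hom R F S) I') I \<Phi> &
  (\<forall>x\<in>F. \<forall>g\<in>Hom R S I'. \<Phi> (hom_eval R F S x g) = \<phi> x g)"
proof -
 obtain n :: nat and e c where e: "!!i. i < n ==> e i \<in> F"
  and c: "!!i. i < n ==> lmap R F (reg_mod R) (c i)"
  and x: "!!x. x \<in> F ==> x = finsum F (%i. c i x \<odot>\<^sub>F e i) {..<n}"
  using F unfolding fgproj_def by metis
 note FM = fgproj_module[OF F]
 let ?FS = "Hom R F S" let ?D = "Hom R ?FS I'" let ?SI = "Hom R S I'"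
 have FS: "module R ?FS" and D: "module R ?D" and SI: "module R ?SI" using FM S I' by auto
 define k where "k i s = (\<lambda>x\<in>F. c i x \<odot>\<^sub>S s)" for i s
 have k: "lmap R S ?FS (k i)" if i: "i < n" for i
 proof -
  have "bilin R F S S (%x s. c i x \<odot>\<^sub>S s)"
  proof(rule bilinI[OF FM S S])
  fix x assume "x \<in> F"
  hence "c i x \<in> R" using lmap_in[OF c[OF i]] by simp
  thus "lmap R S S (%s. c i x \<odot>\<^sub>S s)" by(rule lmap_scale[OF lmap_ident[OF S]])
  qed (rule lmap_coord_smult[OF c[OF i] S])
  from lmap_curry[OF bilin_flip[OF this]] show ?thesis by(simp add: k_def[abs_def])
 qed
 have \<phi>e: "lmap R ?SI I (\<phi> (e i))" if "i < n" for i
  by(rule hom_lmap) (use lmap_in[OF \<phi> e[OF that]] SI I in auto)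
 \<comment> \<open>Forced: \<open>\<Lambda>\<close> is a sum of evaluations at the
   \<open>e i\<close>, and on each of these the value of \<open>\<Phi>\<close> is prescribed by
   \<open>\<phi>\<close>.\<close>
 define \<Phi> where "\<Phi> \<Lambda> = finsum I (%i. \<phi> (e i) (pre S (k i) \<Lambda>)) {..<n}" for \<Lambda>
 have \<Phi>: "lmap R ?D I \<Phi>"
  unfolding \<Phi>_def
  by(rule lmap_sum_maps) (use D I lmap_comp[OF lmap_pre[OF k I'] \<phi>e] in auto)
 have "\<Phi> (hom_eval R F S x g) = \<phi> x g" if xF: "x \<in> F" and g: "g \<in> ?SI" for x g
 proof -
  have cx: "c i x \<in> R" if "i < n" for i using lmap_in[OF c[OF that] xF] by simp
  note gl = hom_lmap[OF g S I']
  have pk: "pre S (k i) (hom_eval R F S x g) = c i x \<odot>\<^sub>?SI g" if i: "i < n" for i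
  proof(rule hom_eqI)
  show "pre S (k i) (hom_eval R F S x g) \<in> ?SI"
  using lmap_in[OF lmap_pre[OF k[OF i] I'] bilin_closed[OF bilin_hom_eval[OF FM S I'] xF g]] .
  show "c i x \<odot>\<^sub>?SI g \<in> ?SI" using cx[OF i] g modD[OF SI] by auto
  fix s assume s: "s \<in> S"
  show "pre S (k i) (hom_eval R F S x g) s = (c i x \<odot>\<^sub>?SI g) s"
  using s xF lmap_in[OF k[OF i] s] lmap_smult[OF gl cx[OF i] s] by(simp add: hom_eval_def k_def)
  qed
  have "lmap R F I (%x. \<phi> x g)" using bilin_left[OF bilin_uncurry[OF \<phi> SI I] g] .
  note pg = this
  have "\<Phi> (hom_eval R F S x g) = finsum I (%i. \<phi> (c i x \<odot>\<^sub>F e i) g) {..<n}"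
  unfolding \<Phi>_def
  proof(rule mod_finsum_cong[OF I])
  fix i assume "i \<in> {..<n}"
  hence i: "i < n" by simp
  show "\<phi> (e i) (pre S (k i) (hom_eval R F S x g)) = \<phi> (c i x \<odot>\<^sub>F e i) g"
  using lmap_smult[OF \<phi>e[OF i] cx[OF i] g] lmap_smult[OF pg cx[OF i] e[OF i]] by(simp add: pk[OF i])
  show "\<phi> (c i x \<odot>\<^sub>F e i) g \<in> I"
  using lmap_in[OF pg] e[OF i] cx[OF i] modD[OF FM] by auto
  qed
  also have "\<dots> = \<phi> (finsum F (%i. c i x \<odot>\<^sub>F e i) {..<n}) g"
  by(rule lmap_finsum[OF pg, symmetric]) (use e cx in \<open>auto simp: modD[OF FM]\<close>)
  finally show ?thesis using x[OF xF] by simp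
 qed
 with \<Phi> show ?thesis by blast
qed

text \<open>By \<open>van\<close> the functional \<open>\<Lambda>\<close> kills the kernel of
  \<open>Hom(G, S) \<rightarrow> Hom(G', S)\<close>, so injectivity of \<open>I'\<close> makes it
  come from a functional on \<open>Hom(G', S)\<close>. Such functionals are sums of evaluations at
  elements of \<open>G'\<close>, where \<open>\<Phi>\<close> vanishes by
  \<open>zero\<close>.\<close>

lemma hom_eval_kernel:
 assumes G: "fgproj R G" and G': "fgproj R G'" and d: "lmap R G' G d" and S: "module R S"
  and I': "baer R I'" and \<Phi>: "lmap R (Hom R (Hom R G S) I') I \<Phi>"
  and zero: "!!x g. x \<in> G' ==> g \<in> Hom R S I' ==> \<Phi> (hom_eval R G S (d x) g) = \<zero>\<^sub>I"
  and \<Lambda>: "\<Lambda> \<in> Hom R (Hom R G S) I'"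
  and van: "!!f. f \<in> Hom R G S ==> (!!x. x \<in> G' ==> f (d x) = \<zero>\<^sub>S) ==> \<Lambda> f = \<zero>\<^sub>I'"
 shows "\<Phi> \<Lambda> = \<zero>\<^sub>I"
proof -
 note GM = fgproj_module[OF G] and GM' = fgproj_module[OF G'] and IM' = baer_module[OF I']
 let ?GS = "Hom R G S" let ?GS' = "Hom R G' S"
 have GS: "module R ?GS" and GS': "module R ?GS'" using GM GM' S by auto
 note p = lmap_pre[OF d S]
 note pp = lmap_pre[OF p IM']
 have "EX h. lmap R ?GS' I' h & (\<forall>f\<in>?GS. h (pre G' d f) = \<Lambda> f)"
 proof(rule baer_extend[OF I' p hom_lmap[OF \<Lambda> GS IM']])
  fix f assume f: "f \<in> ?GS" "pre G' d f = \<zero>\<^sub>?GS'"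
  show "\<Lambda> f = \<zero>\<^sub>I'"
  proof(rule van[OF f(1)])
  fix x assume x: "x \<in> G'"
  have "pre G' d f x = \<zero>\<^sub>?GS' x" using f(2) by simp
  thus "f (d x) = \<zero>\<^sub>S" using x by simp
  qed
 qed
 then obtain h where h: "lmap R ?GS' I' h" "!!f. f \<in> ?GS ==> h (pre G' d f) = \<Lambda> f" by blast
 let ?h = "\<lambda>x\<in>?GS'. h x"
 have hm: "?h \<in> Hom R ?GS' I'" by(rule hom_mem[OF h(1)])
 have eq: "pre ?GS (pre G' d) ?h = \<Lambda>"
  by(rule hom_eqI[OF lmap_in[OF pp hm] \<Lambda>]) (use h(2) lmap_in[OF p] in auto)
 have "\<Phi> (pre ?GS (pre G' d) ?h) = \<zero>\<^sub>I"
 proof(rule hom_eval_injective[OF G' S IM' lmap_comp[OF pp \<Phi>] _ hm])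
  fix x g assume x: "x \<in> G'" and g: "g \<in> Hom R S I'"
  have "pre ?GS (pre G' d) (hom_eval R G' S x g) = hom_eval R G S (d x) g"
  by(rule hom_eqI[OF lmap_in[OF pp bilin_closed[OF bilin_hom_eval[OF GM' S IM'] x g]]
  bilin_closed[OF bilin_hom_eval[OF GM S IM'] lmap_in[OF d x] g]])
  (use x lmap_in[OF p] in \<open>auto simp: hom_eval_def\<close>)
  thus "\<Phi> (pre ?GS (pre G' d) (hom_eval R G' S x g)) = \<zero>\<^sub>I" using zero[OF x g] by simp
 qed
 thus ?thesis using eq by simp
qed

section \<open>Resolutions and acyclicity\<close>

text \<open>A resolution of \<open>S\<close> by finitely generated projectives with its exactness
  spelt out elementwise. It serves for Ext out of \<open>S\<close> and, through
  \<open>hom_eval\<close>, for duals of Tor.\<close>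

locale fp_res =
 fixes R :: "('a,'r) ring_scheme" and S :: "('a,'s) module"
  and F :: "nat => ('a,'f) module" and d :: "nat => 'f => 'f" and e :: "'f => 's"
 assumes F: "!!n. fgproj R (F n)" and d: "!!n. lmap R (F (Suc n)) (F n) (d n)" and e: "lmap R (F 0) S e"
  and e_surj: "!!s. s \<in> S ==> \<exists>x\<in>(F 0). e x = s"
  and e_d: "!!x. x \<in> (F (Suc 0)) ==> e (d 0 x) = \<zero>\<^sub>S"
  and e_exact: "!!x. x \<in> (F 0) ==> e x = \<zero>\<^sub>S ==> \<exists>y\<in>(F (Suc 0)). d 0 y = x"
  and d_d: "!!n x. x \<in> (F (Suc (Suc n))) ==> d n (d (Suc n) x) = \<zero>\<^sub>(F n)"
  and d_exact: "!!n x. x \<in> (F (Suc n)) ==> d n x = \<zero>\<^sub>(F n) ==> \<exists>y\<in>(F (Suc (Suc n))). d (Suc n) y = x"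
begin

lemma S_module: "module R S" using lmap_cod[OF e] .

lemma R_cring: "cring R" using module_cring[OF S_module] .

text \<open>Vanishing of \<open>Ext^n(S, Z)\<close> for all \<open>n \<ge> 1\<close>, as exactness
  of \<open>Hom(F, Z)\<close> at the places \<open>Suc n\<close>.\<close>

definition acyclic :: "('a,'z) module => bool" where
 "acyclic Z \<longleftrightarrow> module R Z & (ALL n \<phi>. lmap R (F (Suc n)) Z \<phi> &
  (\<forall>x\<in>(F (Suc (Suc n))). \<phi> (d (Suc n) x) = \<zero>\<^sub>Z) -->
  (EX \<psi>. lmap R (F n) Z \<psi> & (\<forall>x\<in>(F (Suc n)). \<psi> (d n x) = \<phi> x)))"

lemma acyclicI:
 assumes "module R Z"
  and "!!n \<phi>. lmap R (F (Suc n)) Z \<phi> ==> (!!x. x \<in> (F (Suc (Suc n))) ==> \<phi> (d (Suc n) x) = \<zero>\<^sub>Z) ==>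
  EX \<psi>. lmap R (F n) Z \<psi> & (\<forall>x\<in>(F (Suc n)). \<psi> (d n x) = \<phi> x)"
 shows "acyclic Z"
 using assms unfolding acyclic_def by blast

lemma acyclicD:
 assumes "acyclic Z" "lmap R (F (Suc n)) Z \<phi>"
  and "!!x. x \<in> (F (Suc (Suc n))) ==> \<phi> (d (Suc n) x) = \<zero>\<^sub>Z"
 shows "EX \<psi>. lmap R (F n) Z \<psi> & (\<forall>x\<in>(F (Suc n)). \<psi> (d n x) = \<phi> x)"
 using assms unfolding acyclic_def by blast

lemma acyclic_retract:
 assumes Z': "acyclic Z'" and i: "lmap R Z Z' i" and p: "lmap R Z' Z p"
  and pi: "!!z. z \<in> Z ==> p (i z) = z"
 shows "acyclic Z"
proof(rule acyclicI[OF lmap_dom[OF i]])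
 fix n \<phi> assume \<phi>: "lmap R (F (Suc n)) Z \<phi>" and z: "!!x. x \<in> (F (Suc (Suc n))) ==> \<phi> (d (Suc n) x) = \<zero>\<^sub>Z"
 obtain \<psi> where \<psi>: "lmap R (F n) Z' \<psi>" "!!x. x \<in> (F (Suc n)) ==> \<psi> (d n x) = i (\<phi> x)"
  using acyclicD[OF Z' lmap_comp[OF \<phi> i]] z lmap_zero[OF i] by auto
 thus "EX \<psi>. lmap R (F n) Z \<psi> & (\<forall>x\<in>(F (Suc n)). \<psi> (d n x) = \<phi> x)"
  using lmap_comp[OF \<psi>(1) p] pi lmap_in[OF \<phi>] by(intro exI[of _ "%x. p (\<psi> x)"]) auto
qed

lemma acyclic_zero:
 assumes Z: "module R Z" and zero: "!!z. z \<in> Z ==> z = \<zero>\<^sub>Z"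
 shows "acyclic Z"
proof(rule acyclicI[OF Z])
 fix n \<phi> assume "lmap R (F (Suc n)) Z \<phi>"
 hence "\<forall>x\<in>(F (Suc n)). \<zero>\<^sub>Z = \<phi> x" using lmap_in zero by metis
 thus "EX \<psi>. lmap R (F n) Z \<psi> & (\<forall>x\<in>(F (Suc n)). \<psi> (d n x) = \<phi> x)"
  using lmap_const_zero[OF fgproj_module[OF F] Z] by blast
qed

section \<open>Fragments of the long exact Ext sequence of a surjection\<close>

context
 fixes A :: "('a,'x) module" and B :: "('a,'y) module" and g
 assumes g: "lmap R A B g" and g_surj: "!!b. b \<in> B ==> \<exists>a\<in>A. g a = b"
begin

private abbreviation "K \<equiv> restr_mod A (kern A B g)"

text \<open>\<open>Ext^1(S, K) = 0\<close> is used as follows: lift over the projective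
  \<open>F 0\<close>; the lift fails to descend to \<open>S\<close> by a cocycle in
  \<open>K\<close>, whose bounding cochain \<open>\<chi>\<close> corrects it.\<close>

lemma lift_of_acyclic_kernel:
 assumes K: "acyclic K" and \<phi>: "lmap R S B \<phi>"
 shows "EX \<psi>. lmap R S A \<psi> & (\<forall>s\<in>S. g (\<psi> s) = \<phi> s)"
proof -
 note A = lmap_dom[OF g] and B = lmap_cod[OF g]
 note [simp] = modD[OF A] modD[OF B] lmapD[OF g]
 obtain \<psi>0 where \<psi>0: "lmap R (F 0) A \<psi>0" "!!x. x \<in> (F 0) ==> g (\<psi>0 x) = \<phi> (e x)"
  using fgproj_lift[OF F g lmap_comp[OF e \<phi>] g_surj] lmap_in[OF \<phi>] lmap_in[OF e] by blast
 have "lmap R (F (Suc 0)) K (%x. \<psi>0 (d 0 x))"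
  by(rule lmap_restr_cod[OF lmap_comp[OF d \<psi>0(1)] submodule_kern[OF g]])
  (use \<psi>0 lmap_in[OF d] e_d lmap_zero[OF \<phi>] lmap_in[OF \<psi>0(1)] in \<open>auto simp: kern_def\<close>)
 from acyclicD[OF K this] obtain \<chi> where \<chi>: "lmap R (F 0) K \<chi>" "!!x. x \<in> (F (Suc 0)) ==> \<chi> (d 0 x) = \<psi>0 (d 0 x)"
  using d_d lmap_zero[OF \<psi>0(1)] by auto
 have \<chi>': "lmap R (F 0) A \<chi>" by(rule lmap_extend_cod[OF \<chi>(1) submodule_kern[OF g] A])
 have \<chi>k: "g (\<chi> x) = \<zero>\<^sub>B" if "x \<in> (F 0)" for x using lmap_in[OF \<chi>(1) that] by(simp add: kern_def)
 have "EX k. lmap R S A k & (\<forall>x\<in>(F 0). k (e x) = \<psi>0 x \<ominus>\<^sub>A \<chi> x)"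
 proof(rule lmap_factor[OF e lmap_diff[OF \<psi>0(1) \<chi>'] e_surj])
  fix x assume x: "x \<in> (F 0)" "e x = \<zero>\<^sub>S"
  then obtain y where y: "y \<in> (F (Suc 0))" "d 0 y = x" using e_exact by blast
  hence "\<chi> x = \<psi>0 x" using \<chi>(2) by blast
  thus "\<psi>0 x \<ominus>\<^sub>A \<chi> x = \<zero>\<^sub>A" using lmap_in[OF \<psi>0(1) x(1)] by simp
 qed
 then obtain k where k: "lmap R S A k" "!!x. x \<in> (F 0) ==> k (e x) = \<psi>0 x \<ominus>\<^sub>A \<chi> x" by blast
 have "g (k s) = \<phi> s" if s: "s \<in> S" for s
 proof -
  obtain x where x: "x \<in> (F 0)" "e x = s" using e_surj s by blast
  thus ?thesis using k(2)[OF x(1)] \<psi>0(2)[OF x(1)] \<chi>k[OF x(1)] lmap_in[OF \<psi>0(1) x(1)]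
  lmap_in[OF \<chi>' x(1)] lmap_in[OF \<phi> s] by simp
 qed
 with k(1) show ?thesis by blast
qed

text \<open>\<open>Ext^n(S, B)\<close> sits between \<open>Ext^n(S, A)\<close> and
  \<open>Ext^(n+1)(S, K)\<close>. A lift of the cocycle to \<open>A\<close> misses being a cocycle
  by something in \<open>K\<close>, which \<open>\<chi>\<close> removes.\<close>

lemma acyclic_quotient:
 assumes K: "acyclic K" and A': "acyclic A"
 shows "acyclic B"
proof(rule acyclicI[OF lmap_cod[OF g]])
 note A = lmap_dom[OF g] and B = lmap_cod[OF g]
 note [simp] = modD[OF A] modD[OF B] lmapD[OF g]
 fix n \<phi> assume \<phi>: "lmap R (F (Suc n)) B \<phi>" and z: "!!x. x \<in> (F (Suc (Suc n))) ==> \<phi> (d (Suc n) x) = \<zero>\<^sub>B"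
 obtain \<phi>' where \<phi>': "lmap R (F (Suc n)) A \<phi>'" "!!x. x \<in> (F (Suc n)) ==> g (\<phi>' x) = \<phi> x"
  using fgproj_lift[OF F g \<phi> g_surj] lmap_in[OF \<phi>] by blast
 have "lmap R (F (Suc (Suc n))) K (%x. \<phi>' (d (Suc n) x))"
  by(rule lmap_restr_cod[OF lmap_comp[OF d \<phi>'(1)] submodule_kern[OF g]])
  (use \<phi>' lmap_in[OF d] z lmap_in[OF \<phi>'(1)] in \<open>auto simp: kern_def\<close>)
 from acyclicD[OF K this] obtain \<chi> where \<chi>: "lmap R (F (Suc n)) K \<chi>"
  "!!x. x \<in> (F (Suc (Suc n))) ==> \<chi> (d (Suc n) x) = \<phi>' (d (Suc n) x)"
  using d_d lmap_zero[OF \<phi>'(1)] by auto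
 have \<chi>': "lmap R (F (Suc n)) A \<chi>" by(rule lmap_extend_cod[OF \<chi>(1) submodule_kern[OF g] A])
 have \<chi>k: "g (\<chi> x) = \<zero>\<^sub>B" if "x \<in> (F (Suc n))" for x using lmap_in[OF \<chi>(1) that] by(simp add: kern_def)
 obtain \<psi> where \<psi>: "lmap R (F n) A \<psi>" "!!x. x \<in> (F (Suc n)) ==> \<psi> (d n x) = \<phi>' x \<ominus>\<^sub>A \<chi> x"
  using acyclicD[OF A' lmap_diff[OF \<phi>'(1) \<chi>']] \<chi>(2) lmap_in[OF \<phi>'(1)] lmap_in[OF d] by auto
 have "g (\<psi> (d n x)) = \<phi> x" if x: "x \<in> (F (Suc n))" for x
  using \<psi>(2)[OF x] \<phi>'(2)[OF x] \<chi>k[OF x] lmap_in[OF \<phi>'(1) x] lmap_in[OF \<chi>' x] lmap_in[OF \<phi> x] by simp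
 thus "EX \<psi>. lmap R (F n) B \<psi> & (\<forall>x\<in>(F (Suc n)). \<psi> (d n x) = \<phi> x)"
  using lmap_comp[OF \<psi>(1) g] by(intro exI[of _ "%x. g (\<psi> x)"]) auto
qed

text \<open>In the lowest degree \<open>Ext^1(S, K)\<close> is controlled by the cokernel of
  \<open>Hom(S, A) \<rightarrow> Hom(S, B)\<close>, whence the assumption \<open>lift\<close>;
  higher degrees use the acyclicity of \<open>B\<close>.\<close>

lemma acyclic_kernel:
 assumes A': "acyclic A" and B': "acyclic B"
  and lift: "!!\<phi>. lmap R S B \<phi> ==> EX \<psi>. lmap R S A \<psi> & (\<forall>s\<in>S. g (\<psi> s) = \<phi> s)"
 shows "acyclic K"
proof(rule acyclicI[OF module_restr_mod[OF lmap_dom[OF g] submodule_kern[OF g]]])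
 note A = lmap_dom[OF g] and B = lmap_cod[OF g]
 note [simp] = modD[OF A] modD[OF B] lmapD[OF g]
 fix n \<phi> assume \<phi>: "lmap R (F (Suc n)) K \<phi>" and z: "!!x. x \<in> (F (Suc (Suc n))) ==> \<phi> (d (Suc n) x) = \<zero>\<^sub>K"
 have \<phi>': "lmap R (F (Suc n)) A \<phi>" by(rule lmap_extend_cod[OF \<phi> submodule_kern[OF g] A])
 have \<phi>k: "g (\<phi> x) = \<zero>\<^sub>B" if "x \<in> (F (Suc n))" for x using lmap_in[OF \<phi> that] by(simp add: kern_def)
 obtain \<psi> where \<psi>: "lmap R (F n) A \<psi>" "!!x. x \<in> (F (Suc n)) ==> \<psi> (d n x) = \<phi> x"
  using acyclicD[OF A' \<phi>'] z by auto
 have gz: "g (\<psi> (d n x)) = \<zero>\<^sub>B" if "x \<in> (F (Suc n))" for x using \<psi>(2) \<phi>k that by simp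
 \<comment> \<open>\<open>\<psi>\<close> bounds \<open>\<phi>\<close> in \<open>A\<close> but need
   not take values in \<open>K\<close>. Subtracting a cocycle \<open>\<chi>\<close> with the same
   image in \<open>B\<close> repairs this and keeps the coboundary.\<close>
 have "EX \<chi>. lmap R (F n) A \<chi> & (\<forall>x\<in>(F n). g (\<chi> x) = g (\<psi> x)) & (\<forall>x\<in>(F (Suc n)). \<chi> (d n x) = \<zero>\<^sub>A)"
 proof(cases n)
  case 0
  have "EX h. lmap R S B h & (\<forall>x\<in>(F 0). h (e x) = g (\<psi> x))"
  by(rule lmap_factor[OF e _ e_surj]) (use lmap_comp[OF \<psi>(1) g] gz e_exact 0 in auto)
  then obtain h where h: "lmap R S B h" "!!x. x \<in> (F 0) ==> h (e x) = g (\<psi> x)" by blast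
  obtain k where k: "lmap R S A k" "!!s. s \<in> S ==> g (k s) = h s" using lift[OF h(1)] by blast
  show ?thesis
  by(rule exI[of _ "%x. k (e x)"])
  (use 0 lmap_comp[OF e k(1)] k h lmap_in[OF e] e_d lmap_zero[OF k(1)] in auto)
 next
  case (Suc m)
  obtain h where h: "lmap R (F m) B h" "!!x. x \<in> (F n) ==> h (d m x) = g (\<psi> x)"
  using acyclicD[OF B', of m "%x. g (\<psi> x)"] lmap_comp[OF \<psi>(1) g] gz Suc by auto
  obtain k where k: "lmap R (F m) A k" "!!x. x \<in> (F m) ==> g (k x) = h x"
  using fgproj_lift[OF F g h(1) g_surj] lmap_in[OF h(1)] by blast
  show ?thesis
  by(rule exI[of _ "%x. k (d m x)"])
  (use Suc lmap_comp[OF d k(1)] k h lmap_in[OF d] d_d lmap_zero[OF k(1)] in auto)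
 qed
 then obtain \<chi> where \<chi>: "lmap R (F n) A \<chi>" "!!x. x \<in> (F n) ==> g (\<chi> x) = g (\<psi> x)"
  "!!x. x \<in> (F (Suc n)) ==> \<chi> (d n x) = \<zero>\<^sub>A" by blast
 have "lmap R (F n) K (%x. \<psi> x \<ominus>\<^sub>A \<chi> x)"
  by(rule lmap_restr_cod[OF lmap_diff[OF \<psi>(1) \<chi>(1)] submodule_kern[OF g]])
  (use \<chi>(2) lmap_in[OF \<psi>(1)] lmap_in[OF \<chi>(1)] in \<open>auto simp: kern_def\<close>)
 moreover have "\<psi> (d n x) \<ominus>\<^sub>A \<chi> (d n x) = \<phi> x" if "x \<in> (F (Suc n))" for x
  using \<psi>(2)[OF that] \<chi>(3)[OF that] lmap_in[OF \<phi>' that] by simp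
 ultimately show "EX \<psi>. lmap R (F n) K \<psi> & (\<forall>x\<in>(F (Suc n)). \<psi> (d n x) = \<phi> x)" by blast
qed

end

end

section \<open>Exact sequences\<close>

text \<open>Exactness of a sequence ending in \<open>A 1 \<rightarrow> A 0 \<rightarrow> 0\<close>
  and continuing to the left. The resolved module is \<open>A 0\<close>, so the resolution proper
  starts at index one; \<open>right_exact_cores\<close> is the mirror image.\<close>

definition left_exact_res :: "('a,'r) ring_scheme => (nat => ('a,'m) module) => (nat => 'm => 'm) => bool" where
 "left_exact_res R A \<delta> \<longleftrightarrow> (ALL n. lmap R (A (Suc n)) (A n) (\<delta> n)) &
  (\<forall>x\<in>(A 0). \<exists>y\<in>(A (Suc 0)). \<delta> 0 y = x) &
  (ALL n. \<forall>x\<in>(A (Suc n)). \<delta> n x = \<zero>\<^sub>(A n) \<longleftrightarrow> (\<exists>y\<in>(A (Suc (Suc n))). \<delta> (Suc n) y = x))"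

definition right_exact_cores :: "('a,'r) ring_scheme => (nat => ('a,'m) module) => (nat => 'm => 'm) => bool" where
 "right_exact_cores R U \<delta> \<longleftrightarrow> (ALL n. lmap R (U n) (U (Suc n)) (\<delta> n)) &
  (\<forall>x\<in>(U 0). \<delta> 0 x = \<zero>\<^sub>(U (Suc 0)) --> x = \<zero>\<^sub>(U 0)) &
  (ALL n. \<forall>x\<in>(U (Suc n)). \<delta> (Suc n) x = \<zero>\<^sub>(U (Suc (Suc n))) \<longleftrightarrow> (\<exists>y\<in>(U n). \<delta> n y = x))"

lemma
 assumes "left_exact_res R A \<delta>"
 shows ler_lmap: "lmap R (A (Suc n)) (A n) (\<delta> n)"
  and ler_surj: "x \<in> (A 0) ==> \<exists>y\<in>(A (Suc 0)). \<delta> 0 y = x"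
  and ler_zero: "y \<in> (A (Suc (Suc n))) ==> \<delta> n (\<delta> (Suc n) y) = \<zero>\<^sub>(A n)"
  and ler_exact: "x \<in> (A (Suc n)) ==> \<delta> n x = \<zero>\<^sub>(A n) ==> \<exists>y\<in>(A (Suc (Suc n))). \<delta> (Suc n) y = x"
  and ler_module: "module R (A n)"
proof -
 show l: "lmap R (A (Suc n)) (A n) (\<delta> n)" for n using assms by(simp add: left_exact_res_def)
 show "x \<in> (A 0) ==> \<exists>y\<in>(A (Suc 0)). \<delta> 0 y = x" using assms by(simp add: left_exact_res_def)
 show "y \<in> (A (Suc (Suc n))) ==> \<delta> n (\<delta> (Suc n) y) = \<zero>\<^sub>(A n)"
  using assms lmap_in[OF l[of "Suc n"]] unfolding left_exact_res_def by blast
 show "x \<in> (A (Suc n)) ==> \<delta> n x = \<zero>\<^sub>(A n) ==> \<exists>y\<in>(A (Suc (Suc n))). \<delta> (Suc n) y = x"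
  using assms unfolding left_exact_res_def by blast
 show "module R (A n)" using lmap_cod[OF l] .
qed

lemma
 assumes "right_exact_cores R U \<delta>"
 shows rec_lmap: "lmap R (U n) (U (Suc n)) (\<delta> n)"
  and rec_inj: "x \<in> (U 0) ==> \<delta> 0 x = \<zero>\<^sub>(U (Suc 0)) ==> x = \<zero>\<^sub>(U 0)"
  and rec_zero: "y \<in> (U n) ==> \<delta> (Suc n) (\<delta> n y) = \<zero>\<^sub>(U (Suc (Suc n)))"
  and rec_exact: "x \<in> (U (Suc n)) ==> \<delta> (Suc n) x = \<zero>\<^sub>(U (Suc (Suc n))) ==> \<exists>y\<in>(U n). \<delta> n y = x"
  and rec_module: "module R (U n)"
proof -
 show l: "lmap R (U n) (U (Suc n)) (\<delta> n)" for n using assms by(simp add: right_exact_cores_def)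
 show "x \<in> (U 0) ==> \<delta> 0 x = \<zero>\<^sub>(U (Suc 0)) ==> x = \<zero>\<^sub>(U 0)" using assms by(simp add: right_exact_cores_def)
 show "y \<in> (U n) ==> \<delta> (Suc n) (\<delta> n y) = \<zero>\<^sub>(U (Suc (Suc n)))"
  using assms lmap_in[OF l] unfolding right_exact_cores_def by blast
 show "x \<in> (U (Suc n)) ==> \<delta> (Suc n) x = \<zero>\<^sub>(U (Suc (Suc n))) ==> \<exists>y\<in>(U n). \<delta> n y = x"
  using assms unfolding right_exact_cores_def by blast
 show "module R (U n)" using lmap_dom[OF l] .
qed

definition bounded_seq :: "(nat => ('a,'m) module) => nat => bool" where
 "bounded_seq A N \<longleftrightarrow> (\<forall>n\<ge>N. \<forall>x\<in>(A n). x = \<zero>\<^sub>(A n))"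

text \<open>Cutting at a kernel gives a sequence of the same kind whose zeroth term is that kernel.
  Inductions on the length run over these tails.\<close>

lemma left_exact_res_tail:
 assumes "left_exact_res R A \<delta>"
 shows "left_exact_res R (%k. if k = 0 then restr_mod (A (Suc n)) (kern (A (Suc n)) (A n) (\<delta> n)) else A (Suc (n + k)))
  (%k. \<delta> (Suc (n + k)))" (is "left_exact_res R ?T ?\<delta>")
 unfolding left_exact_res_def
proof(intro conjI allI ballI)
 note l = ler_lmap[OF assms]
 fix k
 show "lmap R (?T (Suc k)) (?T k) (?\<delta> k)"
 proof(cases k)
  case 0
  thus ?thesis
  using lmap_restr_cod[OF l[of "Suc n"] submodule_kern[OF l[of n]]] ler_zero[OF assms] lmap_in[OF l[of "Suc n"]]
  by(simp add: kern_def)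
 next
  case (Suc m)
  thus ?thesis using l[of "Suc (n + k)"] by simp
 qed
next
 fix x assume "x \<in> (?T 0)"
 thus "\<exists>y\<in>(?T (Suc 0)). ?\<delta> 0 y = x" using ler_exact[OF assms] by(simp add: kern_def)
next
 fix k x assume x: "x \<in> (?T (Suc k))"
 have "\<delta> (Suc (n + k)) x = \<zero>\<^sub>(A (Suc (n + k))) \<longleftrightarrow> (\<exists>y\<in>(A (Suc (Suc (Suc (n + k))))). \<delta> (Suc (Suc (n + k))) y = x)"
  using x assms unfolding left_exact_res_def by simp
 thus "?\<delta> k x = \<zero>\<^sub>(?T k) \<longleftrightarrow> (\<exists>y\<in>(?T (Suc (Suc k))). ?\<delta> (Suc k) y = x)" by(cases k) auto
qed

section \<open>Dualising exact sequences into an injective module\<close>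

lemma dual_left_exact:
 assumes U: "right_exact_cores R U \<delta>" and E: "baer R E"
 shows "left_exact_res R (%n. Hom R (U n) E) (%n. pre (U n) (\<delta> n))"
 unfolding left_exact_res_def
proof(intro conjI allI ballI)
 note l = rec_lmap[OF U] and EM = baer_module[OF E] and UM = rec_module[OF U]
 show "lmap R (Hom R (U (Suc n)) E) (Hom R (U n) E) (pre (U n) (\<delta> n))" for n
  by(rule lmap_pre[OF l EM])
 {
  fix f assume f: "f \<in> Hom R (U 0) E"
  obtain h where h: "lmap R (U (Suc 0)) E h" "!!x. x \<in> (U 0) ==> h (\<delta> 0 x) = f x"
  using baer_extend[OF E l[of 0] hom_lmap[OF f UM EM]] rec_inj[OF U] lmap_zero[OF hom_lmap[OF f UM EM]] by blast
  have "pre (U 0) (\<delta> 0) (\<lambda>x\<in>(U (Suc 0)). h x) = f"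
  by(rule hom_eqI[OF lmap_in[OF lmap_pre[OF l EM] hom_mem[OF h(1)]] f])
  (use h(2) lmap_in[OF l[of 0]] in auto)
  thus "\<exists>g\<in>(Hom R (U (Suc 0)) E). pre (U 0) (\<delta> 0) g = f"
  using hom_mem[OF h(1)] by blast
 }
 fix n f assume f: "f \<in> (Hom R (U (Suc n)) E)"
 show "pre (U n) (\<delta> n) f = \<zero>\<^sub>(Hom R (U n) E) \<longleftrightarrow>
  (\<exists>g\<in>(Hom R (U (Suc (Suc n))) E). pre (U (Suc n)) (\<delta> (Suc n)) g = f)"
 proof
  assume z: "pre (U n) (\<delta> n) f = \<zero>\<^sub>(Hom R (U n) E)"
  have fz: "f (\<delta> n x) = \<zero>\<^sub>E" if "x \<in> (U n)" for x
  using fun_cong[OF z, of x] that by simp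
  have "EX h. lmap R (U (Suc (Suc n))) E h & (\<forall>x\<in>(U (Suc n)). h (\<delta> (Suc n) x) = f x)"
  by(rule baer_extend[OF E l hom_lmap[OF f UM EM]]) (use fz rec_exact[OF U] in blast)
  then obtain h where h: "lmap R (U (Suc (Suc n))) E h" "!!x. x \<in> (U (Suc n)) ==> h (\<delta> (Suc n) x) = f x" by blast
  have "pre (U (Suc n)) (\<delta> (Suc n)) (\<lambda>x\<in>(U (Suc (Suc n))). h x) = f"
  by(rule hom_eqI[OF lmap_in[OF lmap_pre[OF l EM] hom_mem[OF h(1)]] f])
  (use h(2) lmap_in[OF l[of "Suc n"]] in auto)
  thus "\<exists>g\<in>(Hom R (U (Suc (Suc n))) E). pre (U (Suc n)) (\<delta> (Suc n)) g = f"
  using hom_mem[OF h(1)] by blast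
 next
  assume "\<exists>g\<in>(Hom R (U (Suc (Suc n))) E). pre (U (Suc n)) (\<delta> (Suc n)) g = f"
  then obtain g where g: "g \<in> (Hom R (U (Suc (Suc n))) E)" "pre (U (Suc n)) (\<delta> (Suc n)) g = f" by blast
  show "pre (U n) (\<delta> n) f = \<zero>\<^sub>(Hom R (U n) E)"
  by(rule hom_eqI[OF lmap_in[OF lmap_pre[OF l EM] f]])
  (use g(2)[symmetric] UM EM lmap_in[OF l[of n]] rec_zero[OF U] lmap_zero[OF hom_lmap[OF g(1) UM EM]]
  in \<open>auto intro: mod_zero_closed[OF module_hom_mod]\<close>)
 qed
qed

lemma dual_right_exact:
 assumes A: "left_exact_res R A \<delta>" and E: "baer R E"
 shows "right_exact_cores R (%n. Hom R (A n) E) (%n. pre (A (Suc n)) (\<delta> n))"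
 unfolding right_exact_cores_def
proof(intro conjI allI ballI impI)
 note l = ler_lmap[OF A] and EM = baer_module[OF E] and AM = ler_module[OF A]
 show "lmap R (Hom R (A n) E) (Hom R (A (Suc n)) E) (pre (A (Suc n)) (\<delta> n))" for n
  by(rule lmap_pre[OF l EM])
 {
  fix f assume f: "f \<in> Hom R (A 0) E" and z: "pre (A (Suc 0)) (\<delta> 0) f = \<zero>\<^sub>(Hom R (A (Suc 0)) E)"
  have "f x = \<zero>\<^sub>E" if x: "x \<in> (A 0)" for x
  proof -
  obtain y where "y \<in> (A (Suc 0))" "\<delta> 0 y = x" using ler_surj[OF A x] by blast
  thus ?thesis using fun_cong[OF z, of y] by simp
  qed
  thus "f = \<zero>\<^sub>(Hom R (A 0) E)"
  by(intro hom_eqI[OF f mod_zero_closed[OF module_hom_mod[OF AM EM]]]) auto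
 }
 fix n f assume f: "f \<in> (Hom R (A (Suc n)) E)"
 show "pre (A (Suc (Suc n))) (\<delta> (Suc n)) f = \<zero>\<^sub>(Hom R (A (Suc (Suc n))) E) \<longleftrightarrow>
  (\<exists>g\<in>Hom R (A n) E. pre (A (Suc n)) (\<delta> n) g = f)"
 proof
  assume z: "pre (A (Suc (Suc n))) (\<delta> (Suc n)) f = \<zero>\<^sub>(Hom R (A (Suc (Suc n))) E)"
  have fz: "f (\<delta> (Suc n) x) = \<zero>\<^sub>E" if "x \<in> (A (Suc (Suc n)))" for x
  using fun_cong[OF z, of x] that by simp
  have "EX h. lmap R (A n) E h & (\<forall>x\<in>(A (Suc n)). h (\<delta> n x) = f x)"
  by(rule baer_extend[OF E l hom_lmap[OF f AM EM]]) (use fz ler_exact[OF A] in blast)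
  then obtain h where h: "lmap R (A n) E h" "!!x. x \<in> (A (Suc n)) ==> h (\<delta> n x) = f x" by blast
  have "pre (A (Suc n)) (\<delta> n) (\<lambda>x\<in>(A n). h x) = f"
  by(rule hom_eqI[OF lmap_in[OF lmap_pre[OF l EM] hom_mem[OF h(1)]] f])
  (use h(2) lmap_in[OF l[of n]] in auto)
  thus "\<exists>g\<in>Hom R (A n) E. pre (A (Suc n)) (\<delta> n) g = f"
  using hom_mem[OF h(1)] by blast
 next
  assume "\<exists>g\<in>Hom R (A n) E. pre (A (Suc n)) (\<delta> n) g = f"
  then obtain g where g: "g \<in> Hom R (A n) E" "pre (A (Suc n)) (\<delta> n) g = f" by blast
  show "pre (A (Suc (Suc n))) (\<delta> (Suc n)) f = \<zero>\<^sub>(Hom R (A (Suc (Suc n))) E)"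
  by(rule hom_eqI[OF lmap_in[OF lmap_pre[OF l EM] f]])
  (use g(2)[symmetric] AM EM lmap_in[OF l[of "Suc n"]] ler_zero[OF A] lmap_zero[OF hom_lmap[OF g(1) AM EM]]
  in \<open>auto intro: mod_zero_closed[OF module_hom_mod]\<close>)
 qed
qed

lemma bounded_dual:
 assumes "bounded_seq A N" "!!n. module R (A n)" "module R E"
 shows "bounded_seq (%n. Hom R (A n) E) N"
 unfolding bounded_seq_def
proof(intro allI impI ballI)
 fix n f assume n: "N \<le> n" and f: "f \<in> Hom R (A n) E"
 have "f x = \<zero>\<^sub>E" if "x \<in> (A n)" for x
  using assms(1) n that lmap_zero[OF hom_lmap[OF f assms(2,3)]] unfolding bounded_seq_def by metis
 thus "f = \<zero>\<^sub>(Hom R (A n) E)"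
  by(intro hom_eqI[OF f mod_zero_closed[OF module_hom_mod[OF assms(2,3)]]]) auto
qed

section \<open>Acyclicity along exact sequences\<close>

context fp_res
begin

text \<open>Induction on the length, starting from the zero sequence. The kernel of
  \<open>A 1 \<rightarrow> A 0\<close> heads a shorter sequence and is therefore acyclic; both
  claims then follow from the Ext sequence of this surjection.\<close>

lemma bounded_resolution_lift_acyclic:
 assumes "left_exact_res R A \<delta>" "bounded_seq A N" "!!n. acyclic (A (Suc n))"
 shows "acyclic (A 0) & (ALL \<phi>. lmap R S (A 0) \<phi> --> (EX \<psi>. lmap R S (A (Suc 0)) \<psi> & (\<forall>s\<in>S. \<delta> 0 (\<psi> s) = \<phi> s)))"
 using assms
proof(induction N arbitrary: A \<delta>)
 case 0
 have z: "x = \<zero>\<^sub>(A n)" if "x \<in> (A n)" for n x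
  using 0(2) that by(simp add: bounded_seq_def)
 have "acyclic (A 0)" by(rule acyclic_zero[OF ler_module[OF 0(1)]]) (rule z)
 moreover have "EX \<psi>. lmap R S (A (Suc 0)) \<psi> & (\<forall>s\<in>S. \<delta> 0 (\<psi> s) = \<phi> s)" if "lmap R S (A 0) \<phi>" for \<phi>
  using lmap_const_zero[OF S_module ler_module[OF 0(1)], of "Suc 0"] z[OF lmap_in[OF that]] lmap_zero[OF ler_lmap[OF 0(1)], of 0]
  by(intro exI[of _ "%_. \<zero>\<^sub>(A (Suc 0))"]) auto
 ultimately show ?case by blast
next
 case (Suc N)
 note l = ler_lmap[OF Suc.prems(1), of 0]
 let ?K = "restr_mod (A (Suc 0)) (kern (A (Suc 0)) (A 0) (\<delta> 0))"
 let ?T = "%k. if k = 0 then ?K else A (Suc (0 + k))"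
 have "bounded_seq ?T N"
  using Suc.prems(2) unfolding bounded_seq_def by(auto simp: kern_def)
 hence K: "acyclic ?K"
  using Suc.IH[OF left_exact_res_tail[OF Suc.prems(1), of 0]] Suc.prems(3) by simp
 show ?case
  using acyclic_quotient[OF l ler_surj[OF Suc.prems(1)] K Suc.prems(3)]
  lift_of_acyclic_kernel[OF l ler_surj[OF Suc.prems(1)] K] by blast
qed

text \<open>Exactness of \<open>Hom(S, A)\<close> at the inner places: \<open>\<phi>\<close> takes
  values in a kernel, which is the zeroth term of a tail.\<close>

lemma bounded_resolution_lift:
 assumes A: "left_exact_res R A \<delta>" "bounded_seq A N" "!!n. acyclic (A (Suc n))"
  and \<phi>: "lmap R S (A (Suc n)) \<phi>" "!!s. s \<in> S ==> \<delta> n (\<phi> s) = \<zero>\<^sub>(A n)"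
 shows "EX \<psi>. lmap R S (A (Suc (Suc n))) \<psi> & (\<forall>s\<in>S. \<delta> (Suc n) (\<psi> s) = \<phi> s)"
proof -
 let ?K = "restr_mod (A (Suc n)) (kern (A (Suc n)) (A n) (\<delta> n))"
 let ?T = "%k. if k = 0 then ?K else A (Suc (n + k))"
 have b: "bounded_seq ?T N"
  using A(2) unfolding bounded_seq_def by(auto simp: kern_def)
 have "lmap R S ?K \<phi>"
  by(rule lmap_restr_cod[OF \<phi>(1) submodule_kern[OF ler_lmap[OF A(1)]]])
  (use \<phi> lmap_in[OF \<phi>(1)] in \<open>auto simp: kern_def\<close>)
 thus ?thesis
  using bounded_resolution_lift_acyclic[OF left_exact_res_tail[OF A(1), of n] b] A(3) by simp
qed

text \<open>In place of a bound there is an acyclic first kernel, since \<open>U\<close> will be the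
  dual of a possibly infinite resolution. Acyclicity travels upwards: each kernel is a quotient of
  the preceding term by the preceding kernel.\<close>

lemma coresolution_lift:
 assumes l: "!!n. lmap R (U n) (U (Suc n)) (\<delta> n)"
  and ex: "!!n x. x \<in> (U (Suc n)) ==> \<delta> (Suc n) x = \<zero>\<^sub>(U (Suc (Suc n))) \<longleftrightarrow> (\<exists>y\<in>(U n). \<delta> n y = x)"
  and K0: "acyclic (restr_mod (U 0) (kern (U 0) (U (Suc 0)) (\<delta> 0)))"
  and ac: "!!n. acyclic (U n)"
  and \<phi>: "lmap R S (U (Suc n)) \<phi>" "!!s. s \<in> S ==> \<delta> (Suc n) (\<phi> s) = \<zero>\<^sub>(U (Suc (Suc n)))"
 shows "EX \<psi>. lmap R S (U n) \<psi> & (\<forall>s\<in>S. \<delta> n (\<psi> s) = \<phi> s)"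
proof -
 let ?K = "%n. restr_mod (U n) (kern (U n) (U (Suc n)) (\<delta> n))"
 have g: "lmap R (U n) (?K (Suc n)) (\<delta> n)" for n
  by(rule lmap_restr_cod[OF l submodule_kern[OF l]]) (use ex lmap_in[OF l] in \<open>auto simp: kern_def\<close>)
 have gs: "\<exists>a\<in>(U n). \<delta> n a = b" if "b \<in> (?K (Suc n))" for n b
  using that ex[of b n] by(auto simp: kern_def)
 have k: "restr_mod (U n) (kern (U n) (?K (Suc n)) (\<delta> n)) = ?K n" for n
  by(simp add: kern_def)
 have K: "acyclic (?K n)" for n
 proof(induction n)
  case (Suc n)
  show ?case by(rule acyclic_quotient[OF g gs]) (use Suc ac k in auto)
 qed (rule K0)
 have \<phi>': "lmap R S (?K (Suc n)) \<phi>"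
  by(rule lmap_restr_cod[OF \<phi>(1) submodule_kern[OF l]])
  (use \<phi> lmap_in[OF \<phi>(1)] in \<open>auto simp: kern_def\<close>)
 show ?thesis by(rule lift_of_acyclic_kernel[OF g gs _ \<phi>']) (use K k in auto)
qed

text \<open>Acyclicity travels downwards from the zero end: each kernel is the kernel of a
  surjection from an acyclic term onto the next kernel, and the last assumption provides the lifting
  that \<open>acyclic_kernel\<close> asks for. \<open>U 0\<close> is isomorphic to the kernel at
  place one.\<close>

lemma bounded_coresolution_acyclic:
 assumes "right_exact_cores R U \<delta>" "bounded_seq U N" "!!n. acyclic (U (Suc n))"
  and "!!n \<phi>. lmap R S (U (Suc n)) \<phi> ==> (!!s. s \<in> S ==> \<delta> (Suc n) (\<phi> s) = \<zero>\<^sub>(U (Suc (Suc n)))) ==>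
  EX \<psi>. lmap R S (U n) \<psi> & (\<forall>s\<in>S. \<delta> n (\<psi> s) = \<phi> s)"
 shows "acyclic (U 0)"
proof -
 note l = rec_lmap[OF assms(1)]
 let ?K = "%n. restr_mod (U n) (kern (U n) (U (Suc n)) (\<delta> n))"
 have K: "acyclic (?K (Suc n))" for n
 proof(induction "N - n" arbitrary: n)
  case 0
  show ?case
  proof(rule acyclic_zero[OF module_restr_mod[OF rec_module[OF assms(1)] submodule_kern[OF l]]])
  fix z assume "z \<in> (?K (Suc n))"
  thus "z = \<zero>\<^sub>(?K (Suc n))" using assms(2) 0 unfolding bounded_seq_def kern_def by auto
  qed
 next
  case (Suc m)
  have IH: "acyclic (?K (Suc (Suc n)))" using Suc(1)[of "Suc n"] Suc(2) by simp
  have g: "lmap R (U (Suc n)) (?K (Suc (Suc n))) (\<delta> (Suc n))"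
  by(rule lmap_restr_cod[OF l submodule_kern[OF l]])
  (use rec_zero[OF assms(1)] lmap_in[OF l] in \<open>auto simp: kern_def\<close>)
  have gs: "\<exists>a\<in>(U (Suc n)). \<delta> (Suc n) a = b" if "b \<in> (?K (Suc (Suc n)))" for b
  using that rec_exact[OF assms(1)] by(auto simp: kern_def)
  have "acyclic (restr_mod (U (Suc n)) (kern (U (Suc n)) (?K (Suc (Suc n))) (\<delta> (Suc n))))"
  proof(rule acyclic_kernel[OF g gs assms(3) IH])
  fix \<phi> assume \<phi>: "lmap R S (?K (Suc (Suc n))) \<phi>"
  have "lmap R S (U (Suc (Suc n))) \<phi>"
  by(rule lmap_extend_cod[OF \<phi> submodule_kern[OF l] rec_module[OF assms(1)]])
  thus "EX \<psi>. lmap R S (U (Suc n)) \<psi> & (\<forall>s\<in>S. \<delta> (Suc n) (\<psi> s) = \<phi> s)"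
  using assms(4)[of "Suc n" \<phi>] lmap_in[OF \<phi>] by(simp add: kern_def)
  qed
  thus ?case by(simp add: kern_def)
 qed
 have i: "lmap R (U 0) (?K (Suc 0)) (\<delta> 0)"
  by(rule lmap_restr_cod[OF l submodule_kern[OF l]])
  (use rec_zero[OF assms(1)] lmap_in[OF l] in \<open>auto simp: kern_def\<close>)
 have s: "\<exists>x\<in>(U 0). \<delta> 0 x = y" if "y \<in> (?K (Suc 0))" for y
  using that rec_exact[OF assms(1)] by(auto simp: kern_def)
 have "EX p. lmap R (?K (Suc 0)) (U 0) p & (\<forall>x\<in>(U 0). p (\<delta> 0 x) = x)"
  by(rule lmap_factor[OF i lmap_ident[OF rec_module[OF assms(1)]] s]) (use rec_inj[OF assms(1)] in auto)
 thus ?thesis using acyclic_retract[OF K i] by blast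
qed

end

section \<open>Semidualizing modules\<close>

text \<open>The homothety map is onto by \<open>homothety\<close> and one-to-one by
  \<open>faithful\<close>. The resolution belongs to the data, which leaves the element type of
  \<open>S\<close> free.\<close>

locale semidual = fp_res +
 assumes self_acyclic: "acyclic S"
  and homothety: "!!f. lmap R S S f ==> \<exists>r\<in>R. \<forall>s\<in>S. f s = r \<odot>\<^sub>S s"
  and faithful: "faithful R S"
begin

text \<open>\<open>\<epsilon>\<close>, the augmentation as an element of \<open>Hom(F 0, S)\<close>,
  spans a copy of \<open>R\<close> because \<open>S\<close> is faithful. Injectivity of
  \<open>I'\<close> extends any prescribed value at \<open>\<epsilon>\<close> to a
  functional.\<close>

lemma dual_generator:
 assumes I': "baer R I'"
 defines "\<epsilon> \<equiv> \<lambda>x\<in>(F 0). e x"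
 shows "\<epsilon> \<in> Hom R (F 0) S"
  and "!!y. y \<in> I' ==> \<exists>\<Lambda>\<in>(Hom R (Hom R (F 0) S) I'). \<Lambda> \<epsilon> = y"
proof -
 note F0 = fgproj_module[OF F[of 0]]
 let ?H = "Hom R (F 0) S"
 have H: "module R ?H" using F0 S_module by auto
 show \<epsilon>: "\<epsilon> \<in> ?H" unfolding \<epsilon>_def by(rule hom_mem[OF e])
 fix y assume y: "y \<in> I'"
 have "EX h. lmap R ?H I' h & (\<forall>r\<in>reg_mod R. h (r \<odot>\<^sub>?H \<epsilon>) = r \<odot>\<^sub>I' y)"
 proof(rule baer_extend[OF I' lmap_reg_mod_smult[OF H \<epsilon>] lmap_reg_mod_smult[OF baer_module[OF I'] y]])
  fix r assume r: "r \<in> reg_mod R" "r \<odot>\<^sub>?H \<epsilon> = \<zero>\<^sub>?H"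
  have "r \<odot>\<^sub>S s = \<zero>\<^sub>S" if s: "s \<in> S" for s
  proof -
  obtain x where x: "x \<in> (F 0)" "e x = s" using e_surj s by blast
  thus ?thesis using fun_cong[OF r(2), of x] by(simp add: \<epsilon>_def)
  qed
  hence "r = \<zero>\<^sub>R" using faithful r(1) unfolding faithful_def by simp
  thus "r \<odot>\<^sub>I' y = \<zero>\<^sub>I'" using y modD[OF baer_module[OF I']] by simp
 qed
 then obtain h where h: "lmap R ?H I' h" "h (\<one>\<^sub>R \<odot>\<^sub>?H \<epsilon>) = \<one>\<^sub>R \<odot>\<^sub>I' y"
  using R_cring by auto
 have "(\<lambda>f\<in>?H. h f) \<epsilon> = y"
  using h(2) \<epsilon> y modD[OF H] modD[OF baer_module[OF I']] by simp
 thus "\<exists>\<Lambda>\<in>Hom R ?H I'. \<Lambda> \<epsilon> = y" using hom_mem[OF h(1)] by blast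
qed

text \<open>With \<open>double_dual_surj\<close> this is
  \<open>S \<otimes> Hom(S, I') = Hom(Hom(S, S), I') = I'\<close>, tested on maps into
  \<open>I\<close>: a map out of \<open>I'\<close> is determined by its values on the elements
  \<open>g s\<close>, and any bilinear \<open>\<beta>\<close> prescribes such values.\<close>

lemma double_dual_inj:
 assumes I': "baer R I'" and b: "lmap R I' I b"
  and zero: "!!s g. s \<in> S ==> g \<in> Hom R S I' ==> b (g s) = \<zero>\<^sub>I"
  and y: "y \<in> I'"
 shows "b y = \<zero>\<^sub>I"
proof -
 note F0 = fgproj_module[OF F[of 0]] and IM' = baer_module[OF I']
 define \<epsilon> where "\<epsilon> = (\<lambda>x\<in>(F 0). e x)"
 note g = dual_generator[OF I', folded \<epsilon>_def]
 let ?H = "Hom R (F 0) S"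
 have H: "module R ?H" using F0 S_module by auto
 obtain \<Lambda> where \<Lambda>: "\<Lambda> \<in> Hom R ?H I'" "\<Lambda> \<epsilon> = y" using g(2)[OF y] by blast
 have "lmap R (Hom R ?H I') I (%\<Lambda>. b (\<Lambda> \<epsilon>))"
  by(rule lmap_comp[OF lmap_eval[OF H IM' g(1)] b])
 hence "b (\<Lambda> \<epsilon>) = \<zero>\<^sub>I"
  by(rule hom_eval_injective[OF F S_module IM' _ _ \<Lambda>(1)])
  (use g(1) zero lmap_in[OF e] in \<open>auto simp: hom_eval_def \<epsilon>_def\<close>)
 thus ?thesis using \<Lambda> by simp
qed

text \<open>Over \<open>F 0\<close> the map \<open>\<beta>\<close> becomes a map
  \<open>\<Phi>\<close> on the dual of \<open>Hom(F 0, S)\<close>. Its value at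
  \<open>\<Lambda>\<close> depends on \<open>\<Lambda> \<epsilon>\<close> alone: an \<open>f\<close>
  that descends to \<open>S\<close> is a multiple of \<open>\<epsilon>\<close> by homothety, so a
  functional killing \<open>\<epsilon>\<close> kills it.\<close>

lemma double_dual_surj:
 assumes I': "baer R I'" and I: "module R I" and \<beta>: "lmap R S (Hom R (Hom R S I') I) \<beta>"
 shows "EX b. lmap R I' I b & (\<forall>s\<in>S. \<forall>g\<in>Hom R S I'. \<beta> s g = b (g s))"
proof -
 note F0 = fgproj_module[OF F[of 0]] and IM' = baer_module[OF I']
 define \<epsilon> where "\<epsilon> = (\<lambda>x\<in>(F 0). e x)"
 note gen = dual_generator[OF I', folded \<epsilon>_def]
 let ?H = "Hom R (F 0) S"
 have H: "module R ?H" and SI: "module R (Hom R S I')" using F0 S_module IM' by auto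
 obtain \<Phi> where \<Phi>: "lmap R (Hom R ?H I') I \<Phi>"
  "!!x g. x \<in> (F 0) ==> g \<in> Hom R S I' ==> \<Phi> (hom_eval R (F 0) S x g) = \<beta> (e x) g"
  using hom_eval_surjective[OF F S_module IM' I lmap_comp[OF e \<beta>]] by blast
 have "EX b. lmap R I' I b & (\<forall>\<Lambda>\<in>Hom R ?H I'. b (\<Lambda> \<epsilon>) = \<Phi> \<Lambda>)"
 proof(rule lmap_factor[OF lmap_eval[OF H IM' gen(1)] \<Phi>(1) gen(2)])
  fix \<Lambda> assume \<Lambda>: "\<Lambda> \<in> Hom R ?H I'" "\<Lambda> \<epsilon> = \<zero>\<^sub>I'"
  show "\<Phi> \<Lambda> = \<zero>\<^sub>I"
  proof(rule hom_eval_kernel[OF F F d S_module I' \<Phi>(1) _ \<Lambda>(1)])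
  fix x g assume x: "x \<in> (F (Suc 0))" and g: "g \<in> Hom R S I'"
  have "\<Phi> (hom_eval R (F 0) S (d 0 x) g) = \<beta> \<zero>\<^sub>S g"
  using \<Phi>(2)[OF lmap_in[OF d x] g] e_d[OF x] by simp
  also have "\<dots> = \<zero>\<^sub>I" using lmap_zero[OF \<beta>] g by simp
  finally show "\<Phi> (hom_eval R (F 0) S (d 0 x) g) = \<zero>\<^sub>I" .
  next
  fix f assume f: "f \<in> ?H" and z: "!!x. x \<in> (F (Suc 0)) ==> f (d 0 x) = \<zero>\<^sub>S"
  have "EX k. lmap R S S k & (\<forall>x\<in>(F 0). k (e x) = f x)"
  by(rule lmap_factor[OF e hom_lmap[OF f F0 S_module] e_surj]) (use z e_exact in auto)
  then obtain k where k: "lmap R S S k" "!!x. x \<in> (F 0) ==> k (e x) = f x" by blast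
  obtain r where r: "r \<in> R" "!!s. s \<in> S ==> k s = r \<odot>\<^sub>S s" using homothety[OF k(1)] by blast
  have "f = r \<odot>\<^sub>?H \<epsilon>"
  by(rule hom_eqI[OF f]) (use r k gen(1) lmap_in[OF e] in \<open>auto simp: \<epsilon>_def mod_smult_closed[OF H]\<close>)
  thus "\<Lambda> f = \<zero>\<^sub>I'"
  using lmap_smult[OF hom_lmap[OF \<Lambda>(1) H IM'] r(1) gen(1)] \<Lambda>(2) r(1) modD[OF IM'] by simp
  qed
 qed
 then obtain b where b: "lmap R I' I b" "!!\<Lambda>. \<Lambda> \<in> Hom R ?H I' ==> b (\<Lambda> \<epsilon>) = \<Phi> \<Lambda>" by blast
 have "\<beta> s g = b (g s)" if s: "s \<in> S" and g: "g \<in> Hom R S I'" for s g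
 proof -
  obtain x where x: "x \<in> (F 0)" "e x = s" using e_surj s by blast
  have "b (hom_eval R (F 0) S x g \<epsilon>) = \<beta> s g"
  using b(2)[OF bilin_closed[OF bilin_hom_eval[OF F0 S_module IM'] x(1) g]] \<Phi>(2)[OF x(1) g] x(2) by simp
  thus ?thesis using gen(1) x by(simp add: hom_eval_def \<epsilon>_def)
 qed
 with b(1) show ?thesis by blast
qed

text \<open>Classically this is \<open>Tor_n(S, Hom(S, I')) = 0\<close> for
  \<open>n \<ge> 1\<close>, dualised into \<open>I\<close>. The complex that computes Tor is the
  \<open>I'\<close>-dual of \<open>Hom(F, S)\<close>, which is exact in positive degrees because
  \<open>Ext(S, S)\<close> vanishes there.\<close>

lemma acyclic_double_dual:
 assumes I': "baer R I'" and I: "baer R I"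
 shows "acyclic (Hom R (Hom R S I') I)"
proof(rule acyclicI)
 note IM' = baer_module[OF I'] and IM = baer_module[OF I] and FM = fgproj_module[OF F]
 let ?SI = "Hom R S I'"
 let ?V = "Hom R ?SI I"
 have SI: "module R ?SI" using S_module IM' by auto
 show V: "module R ?V" using SI IM by auto
 fix n \<phi> assume \<phi>: "lmap R (F (Suc n)) ?V \<phi>" and z: "!!x. x \<in> (F (Suc (Suc n))) ==> \<phi> (d (Suc n) x) = \<zero>\<^sub>?V"
 let ?H = "%n. Hom R (F n) S"
 have H: "module R (?H n)" for n using FM S_module by auto
 obtain \<Phi> where \<Phi>: "lmap R (Hom R (?H (Suc n)) I') I \<Phi>"
  "!!x g. x \<in> (F (Suc n)) ==> g \<in> ?SI ==> \<Phi> (hom_eval R (F (Suc n)) S x g) = \<phi> x g"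
  using hom_eval_surjective[OF F S_module IM' IM \<phi>] by blast
 note p = lmap_pre[OF d S_module]
 note pp = lmap_pre[OF p IM']
 have "EX \<Psi>. lmap R (Hom R (?H n) I') I \<Psi> &
  (\<forall>\<Lambda>\<in>(Hom R (?H (Suc n)) I'). \<Psi> (pre (?H n) (pre (F (Suc n)) (d n)) \<Lambda>) = \<Phi> \<Lambda>)"
 proof(rule baer_extend[OF I pp \<Phi>(1)])
  fix \<Lambda> assume \<Lambda>: "\<Lambda> \<in> (Hom R (?H (Suc n)) I')"
  and \<Lambda>z: "pre (?H n) (pre (F (Suc n)) (d n)) \<Lambda> = \<zero>\<^sub>(Hom R (?H n) I')"
  show "\<Phi> \<Lambda> = \<zero>\<^sub>I"
  proof(rule hom_eval_kernel[OF F F d S_module I' \<Phi>(1) _ \<Lambda>])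
  fix x g assume x: "x \<in> (F (Suc (Suc n)))" and g: "g \<in> ?SI"
  show "\<Phi> (hom_eval R (F (Suc n)) S (d (Suc n) x) g) = \<zero>\<^sub>I"
  using \<Phi>(2)[OF lmap_in[OF d x] g] z[OF x] g by simp
  next
  fix f assume f: "f \<in> (?H (Suc n))" and fz: "!!x. x \<in> (F (Suc (Suc n))) ==> f (d (Suc n) x) = \<zero>\<^sub>S"
  obtain k where k: "lmap R (F n) S k" "!!x. x \<in> (F (Suc n)) ==> k (d n x) = f x"
  using acyclicD[OF self_acyclic hom_lmap[OF f FM S_module] fz] by blast
  let ?k = "\<lambda>x\<in>(F n). k x"
  have km: "?k \<in> (?H n)" by(rule hom_mem[OF k(1)])
  have "pre (F (Suc n)) (d n) ?k = f"
  by(rule hom_eqI[OF lmap_in[OF p km] f]) (use k lmap_in[OF d] in auto)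
  thus "\<Lambda> f = \<zero>\<^sub>I'" using fun_cong[OF \<Lambda>z, of ?k] km by simp
  qed
 qed
 then obtain \<Psi> where \<Psi>: "lmap R (Hom R (?H n) I') I \<Psi>"
  "!!\<Lambda>. \<Lambda> \<in> (Hom R (?H (Suc n)) I') ==> \<Psi> (pre (?H n) (pre (F (Suc n)) (d n)) \<Lambda>) = \<Phi> \<Lambda>" by blast
 note B = bilin_post[OF bilin_hom_eval[OF FM S_module IM'] \<Psi>(1)]
 define \<psi> where "\<psi> x = (\<lambda>g\<in>?SI. \<Psi> (hom_eval R (F n) S x g))" for x
 have \<psi>: "lmap R (F n) ?V \<psi>" unfolding \<psi>_def by(rule lmap_curry[OF B])
 have "\<psi> (d n x) = \<phi> x" if x: "x \<in> (F (Suc n))" for x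
 proof(rule hom_eqI[OF lmap_in[OF \<psi> lmap_in[OF d x]] lmap_in[OF \<phi> x]])
  fix g assume g: "g \<in> ?SI"
  note ev = bilin_closed[OF bilin_hom_eval[OF FM S_module IM'] x g]
  have "pre (?H n) (pre (F (Suc n)) (d n)) (hom_eval R (F (Suc n)) S x g) = hom_eval R (F n) S (d n x) g"
  by(rule hom_eqI[OF lmap_in[OF pp ev] bilin_closed[OF bilin_hom_eval[OF FM S_module IM'] lmap_in[OF d x] g]])
  (use x lmap_in[OF p] in \<open>auto simp: hom_eval_def\<close>)
  thus "\<psi> (d n x) g = \<phi> x g"
  using \<Psi>(2)[OF ev] \<Phi>(2)[OF x g] g by(simp add: \<psi>_def)
 qed
 with \<psi> show "EX \<psi>. lmap R (F n) ?V \<psi> & (\<forall>x\<in>(F (Suc n)). \<psi> (d n x) = \<phi> x)" by blast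
qed

end

lemma lmap_flip:
 assumes "lmap R U (Hom R S E) b" "module R S" "module R E"
 shows "lmap R S (Hom R U E) (%y. \<lambda>w\<in>U. b w y)"
 by(rule lmap_curry[OF bilin_flip[OF bilin_uncurry[OF assms]]])

lemma lmap_inverse:
 assumes f: "lmap R A B f" and surj: "!!b. b \<in> B ==> \<exists>a\<in>A. f a = b"
  and inj: "!!a. a \<in> A ==> f a = \<zero>\<^sub>B ==> a = \<zero>\<^sub>A"
 shows "EX k. lmap R B A k & (\<forall>a\<in>A. k (f a) = a) & (\<forall>b\<in>B. f (k b) = b)"
proof -
 obtain k where k: "lmap R B A k" "!!a. a \<in> A ==> k (f a) = a"
  using lmap_factor[OF f lmap_ident[OF lmap_dom[OF f]] surj] inj by auto
 have "f (k b) = b" if "b \<in> B" for b using surj[OF that] k(2) by auto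
 with k show ?thesis by blast
qed

text \<open>The kernel at \<open>s\<close>, with its inclusion, becomes the zeroth term, so that
  exactness from \<open>s\<close> onwards suffices. The key induction applies this when the place
  just below is still in question.\<close>

lemma right_exact_cores_shift_kernel:
 assumes W: "!!n. lmap R (W n) (W (Suc n)) (\<delta> n)"
  and zero: "!!n x. x \<in> (W n) ==> \<delta> (Suc n) (\<delta> n x) = \<zero>\<^sub>(W (Suc (Suc n)))"
  and ex: "!!n x. s \<le> n ==> x \<in> (W (Suc n)) ==> \<delta> (Suc n) x = \<zero>\<^sub>(W (Suc (Suc n))) ==> \<exists>y\<in>(W n). \<delta> n y = x"
 shows "right_exact_cores R
  (%k. case k of 0 => restr_mod (W s) (kern (W s) (W (Suc s)) (\<delta> s)) | Suc k => W (s + k))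
  (%k. case k of 0 => (%x. x) | Suc k => \<delta> (s + k))" (is "right_exact_cores R ?T ?\<tau>")
 unfolding right_exact_cores_def
proof(intro conjI allI ballI impI)
 note K = submodule_kern[OF W[of s]] and M = lmap_dom[OF W]
 show "lmap R (?T n) (?T (Suc n)) (?\<tau> n)" for n
  using W[of "s + (n - 1)"] lmap_restr_dom[OF lmap_ident[OF M] K] by(cases n) auto
 show "x = \<zero>\<^sub>(?T 0)" if "x \<in> (?T 0)" "?\<tau> 0 x = \<zero>\<^sub>(?T (Suc 0))" for x
  using that by simp
 show "?\<tau> (Suc n) x = \<zero>\<^sub>(?T (Suc (Suc n))) \<longleftrightarrow> (\<exists>y\<in>(?T n). ?\<tau> n y = x)" if x: "x \<in> (?T (Suc n))" for n x
 proof(cases n)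
  case 0
  thus ?thesis using x by(auto simp: kern_def)
 next
  case (Suc m)
  thus ?thesis using x zero[of _ "s + m"] ex[of "s + m" x] by auto
 qed
qed

section \<open>Maps from coresolutions by modules Hom(S, I) into Hom(S, E)\<close>

context semidual
begin

lemma acyclic_dual_of_hom:
 assumes I: "baer R I" and E: "baer R E" and u: "lmap R U (Hom R S I) u" and v: "lmap R (Hom R S I) U v"
  and vu: "!!x. x \<in> U ==> v (u x) = x"
 shows "acyclic (Hom R U E)"
proof(rule acyclic_retract[OF acyclic_double_dual[OF I E] lmap_pre[OF v baer_module[OF E]] lmap_pre[OF u baer_module[OF E]]])
 fix g assume g: "g \<in> Hom R U E"
 let ?p = "pre U u (pre (Hom R S I) v g)"
 have "?p \<in> Hom R U E"
  using lmap_in[OF lmap_pre[OF u baer_module[OF E]] lmap_in[OF lmap_pre[OF v baer_module[OF E]] g]] .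
 thus "?p = g"
  by(rule hom_eqI[OF _ g]) (use vu lmap_in[OF u] in auto)
qed

context
 fixes U :: "nat => ('a,'u) module" and \<delta> and N and I :: "nat => ('a,'i) module" and u v
  and E :: "('a,'e) module"
 assumes U: "right_exact_cores R U \<delta>" and bd: "bounded_seq U N" and I: "!!n. baer R (I n)"
  and u: "!!n. lmap R (U (Suc n)) (Hom R S (I n)) (u n)"
  and v: "!!n. lmap R (Hom R S (I n)) (U (Suc n)) (v n)"
  and vu: "!!n x. x \<in> (U (Suc n)) ==> v n (u n x) = x"
  and E: "baer R E"
begin

text \<open>Exchanging arguments turns maps \<open>U n \<rightarrow> Hom(S, E)\<close> into maps
  \<open>S \<rightarrow> Hom(U n, E)\<close>. The dual of \<open>U\<close> is a bounded exact
  sequence with acyclic terms, along which \<open>bounded_resolution_lift\<close> applies. In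
  substance, such coresolutions are proper.\<close>

lemma hom_into_dual_exact:
 assumes b: "lmap R (U (Suc n)) (Hom R S E) b"
  and z: "!!x. x \<in> (U n) ==> b (\<delta> n x) = \<zero>\<^sub>(Hom R S E)"
 shows "EX c. lmap R (U (Suc (Suc n))) (Hom R S E) c & (\<forall>x\<in>(U (Suc n)). c (\<delta> (Suc n) x) = b x)"
proof -
 note EM = baer_module[OF E] and UM = rec_module[OF U] and l = rec_lmap[OF U]
 let ?A = "%n. Hom R (U n) E"
 have A: "left_exact_res R ?A (%n. pre (U n) (\<delta> n))" by(rule dual_left_exact[OF U E])
 have ac: "acyclic (?A (Suc n))" for n by(rule acyclic_dual_of_hom[OF I E u v vu])
 note \<phi> = lmap_flip[OF b S_module EM]
 let ?\<phi> = "%y. \<lambda>w\<in>(U (Suc n)). b w y"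
 have "EX \<psi>. lmap R S (?A (Suc (Suc n))) \<psi> & (\<forall>s\<in>S. pre (U (Suc n)) (\<delta> (Suc n)) (\<psi> s) = ?\<phi> s)"
 proof(rule bounded_resolution_lift[OF A bounded_dual[OF bd UM EM] ac \<phi>])
  fix s assume s: "s \<in> S"
  show "pre (U n) (\<delta> n) (?\<phi> s) = \<zero>\<^sub>(?A n)"
  by(rule hom_eqI[OF lmap_in[OF lmap_pre[OF l EM] lmap_in[OF \<phi> s]] mod_zero_closed[OF module_hom_mod[OF UM EM]]])
  (use z lmap_in[OF l] s in auto)
 qed
 then obtain \<psi> where \<psi>: "lmap R S (?A (Suc (Suc n))) \<psi>"
  "!!s. s \<in> S ==> pre (U (Suc n)) (\<delta> (Suc n)) (\<psi> s) = ?\<phi> s" by blast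
 note c = lmap_flip[OF \<psi>(1) UM EM]
 show ?thesis
 proof(intro exI[of _ "%w. \<lambda>y\<in>S. \<psi> y w"] conjI ballI c)
  fix x assume x: "x \<in> (U (Suc n))"
  show "(\<lambda>y\<in>S. \<psi> y (\<delta> (Suc n) x)) = b x"
  by(rule hom_eqI[OF lmap_in[OF c lmap_in[OF l x]] lmap_in[OF b x]])
  (use fun_cong[OF \<psi>(2), of _ x] x in auto)
 qed
qed

text \<open>The same at the first place, where the surjectivity part of
  \<open>bounded_resolution_lift_acyclic\<close> is the relevant one.\<close>

lemma hom_into_dual_extends:
 assumes b: "lmap R (U 0) (Hom R S E) b"
 shows "EX c. lmap R (U (Suc 0)) (Hom R S E) c & (\<forall>x\<in>(U 0). c (\<delta> 0 x) = b x)"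
proof -
 note EM = baer_module[OF E] and UM = rec_module[OF U] and l = rec_lmap[OF U]
 let ?A = "%n. Hom R (U n) E"
 have A: "left_exact_res R ?A (%n. pre (U n) (\<delta> n))" by(rule dual_left_exact[OF U E])
 have ac: "acyclic (?A (Suc n))" for n by(rule acyclic_dual_of_hom[OF I E u v vu])
 note \<phi> = lmap_flip[OF b S_module EM]
 let ?\<phi> = "%y. \<lambda>w\<in>(U 0). b w y"
 obtain \<psi> where \<psi>: "lmap R S (?A (Suc 0)) \<psi>" "!!s. s \<in> S ==> pre (U 0) (\<delta> 0) (\<psi> s) = ?\<phi> s"
  using bounded_resolution_lift_acyclic[OF A bounded_dual[OF bd UM EM] ac] \<phi> by blast
 note c = lmap_flip[OF \<psi>(1) UM EM]
 show ?thesis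
 proof(intro exI[of _ "%w. \<lambda>y\<in>S. \<psi> y w"] conjI ballI c)
  fix x assume x: "x \<in> (U 0)"
  show "(\<lambda>y\<in>S. \<psi> y (\<delta> 0 x)) = b x"
  by(rule hom_eqI[OF lmap_in[OF c lmap_in[OF l x]] lmap_in[OF b x]])
  (use fun_cong[OF \<psi>(2), of _ x] x in auto)
 qed
qed

end

end

lemma fgproj_fin_gen:
 assumes "fgproj R F"
 shows "fin_gen R F (carrier F)"
proof -
 obtain n :: nat and e c where e: "!!i. i < n ==> e i \<in> F"
  and c: "!!i. i < n ==> lmap R F (reg_mod R) (c i)"
  and x: "!!x. x \<in> F ==> x = finsum F (%i. c i x \<odot>\<^sub>F e i) {..<n}"
  using assms unfolding fgproj_def by metis
 note FM = fgproj_module[OF assms]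
 have "y \<in> mspan R F (e ` {..<n})" if y: "y \<in> F" for y
 proof -
  have cy: "c i y \<in> R" if "i < n" for i using lmap_in[OF c[OF that] y] by simp
  have "finsum F (%i. c i y \<odot>\<^sub>F e i) J \<in> mspan R F (e ` {..<n})" if "finite J" "J \<subseteq> {..<n}" for J
  using that
  proof(induction J rule: finite_induct)
  case empty
  thus ?case by(simp add: mod_finsum_empty[OF FM] mspan.mspan_zero)
  next
  case (insert j J)
  have "finsum F (%i. c i y \<odot>\<^sub>F e i) (insert j J) = c j y \<odot>\<^sub>F e j \<oplus>\<^sub>F finsum F (%i. c i y \<odot>\<^sub>F e i) J"
  by(rule mod_finsum_insert[OF FM]) (use insert e cy in \<open>auto simp: modD[OF FM]\<close>)
  moreover have "c j y \<odot>\<^sub>F e j \<in> mspan R F (e ` {..<n})"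
  using insert cy by(intro mspan.mspan_smult mspan.mspan_base) auto
  ultimately show ?case using insert mspan.mspan_add by auto
  qed
  from this[of "{..<n}"] show ?thesis using x[OF y] by simp
 qed
 hence "carrier F = mspan R F (e ` {..<n})"
  using mspan_sub[OF FM, of "e ` {..<n}"] e by auto
 thus ?thesis unfolding fin_gen_def using e by(intro exI[of _ "e ` {..<n}"]) auto
qed

lemma (in fp_res) S_fin_gen: "fin_gen R S (carrier S)"
proof -
 have "e ` carrier (F 0) = carrier S" using e_surj lmap_in[OF e] by blast
 thus ?thesis
  using fin_gen_image[OF e module.carrier_is_submodule[OF fgproj_module[OF F]] fgproj_fin_gen[OF F]] by simp
qed

text \<open>The key exactness statement. Here \<open>S\<close> plays the role of a dualizing module, and the hypotheses
 on the pairing \<open>pr\<close> say that it induces \<open>S' \<otimes> S\<^sub>1 \<cong> S\<close>, tested on maps into injectives. If \<open>s\<close> is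
 the last place where exactness fails, then a map \<open>\<alpha>\<close> from \<open>S\<close> to the character dual of the homology
 there lifts to the dual of the whole term, since what follows is a bounded exact sequence with acyclic
 dual. There it is given by a map out of an injective module, and the exactness of the dual of the given
 coresolution shows that \<open>\<alpha> = 0\<close>.\<close>

lemma (in semidual) hom_coresolution_exact:
 fixes S1 :: "('a,'t) module" and S' :: "('a,'p) module" and U :: "nat => ('a,'u) module"
  and I :: "nat => ('a,'i) module"
 assumes noeth: "noetherian_ring R"
  and S1: "semidual R S1 F1 d1 e1" and S': "module R S'" and pr: "bilin R S' S1 S pr"
  and pr_surj: "!!(I::('a,'i) module) B. baer R I ==> bilin R S' S1 I B ==>
  EX \<gamma>. lmap R S I \<gamma> & (\<forall>f\<in>S'. \<forall>y\<in>S1. B f y = \<gamma> (pr f y))"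
  and pr_inj: "!!(I::('a,'i) module) \<gamma> x. baer R I ==> lmap R S I \<gamma> ==>
  (!!f y. f \<in> S' ==> y \<in> S1 ==> \<gamma> (pr f y) = \<zero>\<^sub>I) ==> x \<in> S ==> \<gamma> x = \<zero>\<^sub>I"
  and pr_inj_char: "!!\<gamma> x. lmap R S (char_mod R) \<gamma> ==>
  (!!f y. f \<in> S' ==> y \<in> S1 ==> \<gamma> (pr f y) = \<zero>\<^sub>(char_mod R)) ==> x \<in> S ==>
  \<gamma> x = \<zero>\<^sub>(char_mod R)"
  and U: "right_exact_cores R U \<delta>" and bd: "bounded_seq U N" and I: "!!n. baer R (I n)"
  and u: "!!n. lmap R (U (Suc n)) (Hom R S1 (I n)) (u n)"
  and v: "!!n. lmap R (Hom R S1 (I n)) (U (Suc n)) (v n)"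
  and vu: "!!n x. x \<in> (U (Suc n)) ==> v n (u n x) = x"
  and uv: "!!n x. x \<in> Hom R S1 (I n) ==> u n (v n x) = x"
 shows "right_exact_cores R (%n. Hom R S' (U n)) (%n. post S' (\<delta> n))"
proof -
 interpret S1: semidual R S1 F1 d1 e1 by fact
 let ?E = "char_mod R"
 have E: "baer R ?E" by(rule baer_char_mod[OF R_cring])
 note EM = baer_module[OF E] and UM = rec_module[OF U] and l = rec_lmap[OF U] and IM = baer_module[OF I]
 define W where "W n = Hom R S' (U n)" for n
 define dW where "dW n = post S' (\<delta> n)" for n
 have WM: "module R (W n)" for n unfolding W_def using S' UM by auto
 have dW: "lmap R (W n) (W (Suc n)) (dW n)" for n unfolding W_def dW_def by(rule lmap_post[OF l S'])
 have Wc: "g f \<in> (U n)" if "g \<in> (W n)" "f \<in> S'" for g f n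
  using hom_closed that unfolding W_def by metis
 have Wz: "g f = \<zero>\<^sub>(U n)" if "g = \<zero>\<^sub>(W n)" "f \<in> S'" for g f n
  using that unfolding W_def by simp
 have WI: "g = \<zero>\<^sub>(W n)" if "g \<in> (W n)" "!!f. f \<in> S' ==> g f = \<zero>\<^sub>(U n)" for g n
  using that mod_zero_closed[OF WM[of n]] unfolding W_def by(intro hom_eqI[of g]) auto
 have dWdW: "dW (Suc n) (dW n x) = \<zero>\<^sub>(W (Suc (Suc n)))" if "x \<in> (W n)" for n x
  by(rule WI) (use lmap_in[OF dW] Wc rec_zero[OF U] that in \<open>auto simp: dW_def\<close>)
 have bdW: "x = \<zero>\<^sub>(W n)" if "N \<le> n" "x \<in> (W n)" for n x
  by(rule WI[OF that(2)]) (use bd that Wc in \<open>auto simp: bounded_seq_def\<close>)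
 \<comment> \<open>At the first place exactness is the left exactness of Hom: a map with values in
   the kernel is pulled back along the injective \<open>\<delta> 0\<close>.\<close>
 have left: "\<exists>y\<in>(W 0). dW 0 y = x" if x: "x \<in> (W (Suc 0))" "dW (Suc 0) x = \<zero>\<^sub>(W (Suc (Suc 0)))" for x
 proof -
  have xl: "lmap R S' (U (Suc 0)) x" by(rule hom_lmap) (use x S' UM in \<open>auto simp: W_def\<close>)
  have z: "\<delta> (Suc 0) (x f) = \<zero>\<^sub>(U (Suc (Suc 0)))" if "f \<in> S'" for f
  using Wz[OF x(2) that] that by(simp add: dW_def)
  let ?K = "restr_mod (U (Suc 0)) (\<delta> 0 ` carrier (U 0))"
  have i: "lmap R (U 0) ?K (\<delta> 0)" by(rule lmap_restr_cod[OF l submodule_image[OF l]]) auto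
  obtain k where k: "lmap R ?K (U 0) k" "!!a. a \<in> (U 0) ==> k (\<delta> 0 a) = a" "!!b. b \<in> ?K ==> \<delta> 0 (k b) = b"
  proof -
  have "EX k. lmap R ?K (U 0) k & (\<forall>a\<in>(U 0). k (\<delta> 0 a) = a) & (\<forall>b\<in>?K. \<delta> 0 (k b) = b)"
  by(rule lmap_inverse[OF i]) (use rec_inj[OF U] in auto)
  thus ?thesis using that by blast
  qed
  have xK: "lmap R S' ?K x"
  proof(rule lmap_restr_cod[OF xl submodule_image[OF l]])
  fix f assume f: "f \<in> S'"
  obtain y where "y \<in> (U 0)" "\<delta> 0 y = x f" using rec_exact[OF U lmap_in[OF xl f] z[OF f]] by blast
  thus "x f \<in> \<delta> 0 ` carrier (U 0)" by(metis image_eqI)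
  qed
  note kx = lmap_comp[OF xK k(1)]
  let ?y = "\<lambda>f\<in>S'. k (x f)"
  have y: "?y \<in> (W 0)" unfolding W_def by(rule hom_mem[OF kx])
  have "dW 0 ?y = x"
  by(rule hom_eqI[OF lmap_in[OF dW y, unfolded W_def] x(1)[unfolded W_def]])
  (use k(3) lmap_in[OF xK] in \<open>auto simp: dW_def\<close>)
  with y show ?thesis by blast
 qed
 \<comment> \<open>The identification of \<open>Hom(S, I n)\<close> with
   \<open>Hom(S', Hom(S1, I n))\<close> induced by the pairing, followed by \<open>v n\<close>.
   Hence \<open>W (Suc n)\<close> is again of the form \<open>Hom(S, I)\<close>, and its dual is
   acyclic.\<close>
 define a where "a n \<gamma> = (\<lambda>f\<in>S'. v n (\<lambda>y\<in>S1. \<gamma> (pr f y)))" for n \<gamma>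
 let ?DI = "%n. Hom R S (I n)"
 have DI: "module R (?DI n)" for n using S_module IM by auto
 have prl: "bilin R S' S1 (I n) (%f y. \<gamma> (pr f y))" if "\<gamma> \<in> (?DI n)" for n \<gamma>
  by(rule bilin_post[OF pr hom_lmap[OF that S_module IM]])
 have pr1: "(\<lambda>y\<in>S1. \<gamma> (pr f y)) \<in> Hom R S1 (I n)" if "\<gamma> \<in> (?DI n)" "f \<in> S'" for n \<gamma> f
  by(rule hom_mem[OF bilin_right[OF prl[OF that(1)] that(2)]])
 have ua: "u n (a n \<gamma> f) = (\<lambda>y\<in>S1. \<gamma> (pr f y))" if "\<gamma> \<in> (?DI n)" "f \<in> S'" for n \<gamma> f
  using uv[OF pr1[OF that]] that(2) by(simp add: a_def)
 have a: "lmap R (?DI n) (W (Suc n)) (a n)" for n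
 proof -
  have "bilin R (?DI n) S' (U (Suc n)) (%\<gamma> f. v n (\<lambda>y\<in>S1. \<gamma> (pr f y)))"
  proof(rule bilin_post[OF _ v], rule bilinI[OF DI S' module_hom_mod[OF S1.S_module IM]])
  fix \<gamma> assume \<gamma>: "\<gamma> \<in> (?DI n)"
  show "lmap R S' (Hom R S1 (I n)) (%f. \<lambda>y\<in>S1. \<gamma> (pr f y))"
  by(rule lmap_curry[OF prl[OF \<gamma>]])
  next
  fix f assume f: "f \<in> S'"
  show "lmap R (?DI n) (Hom R S1 (I n)) (%\<gamma>. \<lambda>y\<in>S1. \<gamma> (pr f y))"
  by(rule lmap_curry, rule bilin_comp_right[OF bilin_hom_comp[OF S_module IM] bilin_right[OF pr f]])
  qed
  from lmap_curry[OF this] show ?thesis unfolding W_def a_def[abs_def] .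
 qed
 have a_surj: "\<exists>\<gamma>\<in>(?DI n). a n \<gamma> = g" if g: "g \<in> (W (Suc n))" for n g
 proof -
  have gl: "lmap R S' (U (Suc n)) g" by(rule hom_lmap) (use g S' UM in \<open>auto simp: W_def\<close>)
  have "bilin R S' S1 (I n) (%f. u n (g f))"
  by(rule bilin_uncurry[OF lmap_comp[OF gl u] S1.S_module IM])
  then obtain \<gamma> where \<gamma>: "lmap R S (I n) \<gamma>" "!!f y. f \<in> S' ==> y \<in> S1 ==> u n (g f) y = \<gamma> (pr f y)"
  using pr_surj[OF I] by blast
  let ?\<gamma> = "\<lambda>x\<in>S. \<gamma> x"
  have \<gamma>m: "?\<gamma> \<in> (?DI n)" by(rule hom_mem[OF \<gamma>(1)])
  have "a n ?\<gamma> = g"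
  proof(rule hom_eqI[OF lmap_in[OF a \<gamma>m, unfolded W_def] g[unfolded W_def]])
  fix f assume f: "f \<in> S'"
  have "(\<lambda>y\<in>S1. ?\<gamma> (pr f y)) = u n (g f)"
  by(rule hom_eqI[OF pr1[OF \<gamma>m f] lmap_in[OF u Wc[OF g f]]])
  (use \<gamma>(2)[OF f] bilin_closed[OF pr f] in auto)
  thus "a n ?\<gamma> f = g f" using f vu[OF Wc[OF g f]] by(simp add: a_def)
  qed
  with \<gamma>m show ?thesis by blast
 qed
 have a_inj: "\<gamma> = \<zero>\<^sub>(?DI n)" if \<gamma>: "\<gamma> \<in> (?DI n)" and z: "a n \<gamma> = \<zero>\<^sub>(W (Suc n))" for n \<gamma>
 proof(rule hom_eqI[OF \<gamma> mod_zero_closed[OF DI]])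
  fix x assume x: "x \<in> S"
  have "\<gamma> x = \<zero>\<^sub>(I n)"
  proof(rule pr_inj[OF I hom_lmap[OF \<gamma> S_module IM] _ x])
  fix f y assume f: "f \<in> S'" and y: "y \<in> S1"
  have "u n (a n \<gamma> f) = \<zero>\<^sub>(Hom R S1 (I n))" using Wz[OF z f] lmap_zero[OF u] by simp
  hence "u n (a n \<gamma> f) y = \<zero>\<^sub>(I n)" using y by simp
  thus "\<gamma> (pr f y) = \<zero>\<^sub>(I n)" using ua[OF \<gamma> f] y by simp
  qed
  thus "\<gamma> x = \<zero>\<^sub>(?DI n) x" using x by simp
 qed
 have acW: "acyclic (Hom R (W (Suc n)) ?E)" for n
 proof -
  obtain k where k: "lmap R (W (Suc n)) (?DI n) k" "!!b. b \<in> (W (Suc n)) ==> a n (k b) = b"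
  using lmap_inverse[OF a a_surj a_inj] by blast
  thus ?thesis using acyclic_dual_of_hom[OF I E k(1) a] by blast
 qed
 have main: "\<exists>y\<in>(W s). dW s y = x" if "x \<in> (W (Suc s))" "dW (Suc s) x = \<zero>\<^sub>(W (Suc (Suc s)))" for s x
  using that
 proof(induction "N - s" arbitrary: s x rule: less_induct)
  case less
  \<comment> \<open>\<open>U 0\<close> is not of the form \<open>Hom(S1, I)\<close>, so
    \<open>s = 0\<close> stands apart. For \<open>s = Suc r\<close> both \<open>U s\<close> and
    \<open>U (Suc s)\<close> have this form, and the argument passes through maps out of
    \<open>I s\<close> and out of \<open>I r\<close>.\<close>
  consider "s = 0" | "N \<le> s" | r where "s = Suc r" "s < N" by(metis not0_implies_Suc not_less)
  thus ?case
  proof cases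
  case 1 thus ?thesis using left less.prems by simp
  next
  case 2
  hence "x = \<zero>\<^sub>(W (Suc s))" using bdW[of "Suc s"] less.prems by simp
  thus ?thesis using lmap_zero[OF dW] mod_zero_closed[OF WM] by blast
  next
  case 3
  let ?Z = "kern (W (Suc s)) (W (Suc (Suc s))) (dW (Suc s))"
  let ?Zm = "restr_mod (W (Suc s)) ?Z"
  let ?B = "dW s ` carrier (W s)"
  let ?T = "%k. case k of 0 => ?Zm | Suc k => W (Suc s + k)"
  let ?\<tau> = "%k. case k of 0 => (%x. x) | Suc k => dW (Suc s + k)"
  note Zs = submodule_kern[OF dW[of "Suc s"]]
  have Zm: "module R ?Zm" by(rule module_restr_mod[OF WM Zs])
  have T: "right_exact_cores R ?T ?\<tau>"
  proof(rule right_exact_cores_shift_kernel[of R W dW "Suc s", OF dW dWdW])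
  fix n x assume "Suc s \<le> n" "x \<in> (W (Suc n))" "dW (Suc n) x = \<zero>\<^sub>(W (Suc (Suc n)))"
  thus "\<exists>y\<in>(W n). dW n y = x" using less.hyps[of n x] 3 by simp
  qed
  have TM: "module R (?T k)" for k by(rule rec_module[OF T])
  have bT: "bounded_seq ?T (Suc N)"
  unfolding bounded_seq_def using bdW by(auto split: nat.split)
  have acT: "acyclic (Hom R (?T (Suc k)) ?E)" for k using acW[of "s + k"] by simp
  have BZ: "?B \<subseteq> ?Z" using dWdW lmap_in[OF dW] by(auto simp: kern_def)
  have "?B = carrier ?Zm"
  proof(rule submodule_eq_of_no_maps[OF S_module Zm noeth S_fin_gen faithful])
  have "lmap R (W s) ?Zm (dW s)" by(rule lmap_restr_cod[OF dW Zs]) (use BZ in auto)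
  from submodule_image[OF this] show "submodule ?B R ?Zm" .
  fix \<alpha> x g assume \<alpha>: "lmap R S (Hom R ?Zm ?E) \<alpha>"
  and \<alpha>B: "!!s b. s \<in> S ==> b \<in> ?B ==> \<alpha> s b = \<zero>\<^sub>?E" and x: "x \<in> S" and g: "g \<in> ?Zm"
  obtain \<beta> where \<beta>: "lmap R S (Hom R (W (Suc s)) ?E) \<beta>" "!!x g. x \<in> S ==> g \<in> ?Z ==> \<beta> x g = \<alpha> x g"
  proof -
  have "EX \<psi>. lmap R S (Hom R (?T (Suc 0)) ?E) \<psi> & (\<forall>s\<in>S. pre (?T 0) (?\<tau> 0) (\<psi> s) = \<alpha> s)"
  using bounded_resolution_lift_acyclic[OF dual_left_exact[OF T E] bounded_dual[OF bT TM EM] acT] \<alpha> by simp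
  then obtain \<psi> where \<psi>: "lmap R S (Hom R (W (Suc s)) ?E) \<psi>" "!!x. x \<in> S ==> pre ?Zm (%x. x) (\<psi> x) = \<alpha> x"
  by auto
  have "\<psi> x g = \<alpha> x g" if "x \<in> S" "g \<in> ?Z" for x g
  using fun_cong[OF \<psi>(2)[OF that(1)], of g] that(2) by simp
  with \<psi>(1) show ?thesis by(rule that)
  qed
  obtain b0 where b0: "lmap R (I s) ?E b0" "!!x \<gamma>. x \<in> S ==> \<gamma> \<in> (?DI s) ==> \<beta> x (a s \<gamma>) = b0 (\<gamma> x)"
  using double_dual_surj[OF I EM lmap_comp[OF \<beta>(1) lmap_pre[OF a EM]]] by auto
  have key: "\<beta> (pr f y) g = b0 (u s (g f) y)" if "g \<in> (W (Suc s))" "f \<in> S'" "y \<in> S1" for g f y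
  proof -
  obtain \<gamma> where \<gamma>: "\<gamma> \<in> (?DI s)" "a s \<gamma> = g" using a_surj \<open>g \<in> (W (Suc s))\<close> by blast
  thus ?thesis using b0(2)[OF bilin_closed[OF pr that(2,3)] \<gamma>(1)] ua[OF \<gamma>(1) that(2)] that(3) by simp
  qed
  \<comment> \<open>By \<open>key\<close>, \<open>b (g f) y\<close> is the value of
    \<open>\<beta> (pr f y)\<close> at \<open>g\<close>. It remains to see that \<open>b\<close>
    kills the image of \<open>\<delta> s\<close>; then it factors through
    \<open>\<delta> (Suc s)\<close> and kills the values of every cycle \<open>g\<close>.\<close>
  define b where "b w = post S1 b0 (u s w)" for w
  have b: "lmap R (U (Suc s)) (Hom R S1 ?E) b"
  unfolding b_def by(rule lmap_comp[OF u lmap_post[OF b0(1) S1.S_module]])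
  have b_apply: "b w y = b0 (u s w y)" if "y \<in> S1" for w y using that by(simp add: b_def)
  define c1 where "c1 q = b (\<delta> s (v r q))" for q
  have vr: "lmap R (Hom R S1 (I r)) (U s) (v r)" using v[of r] 3 by simp
  have c1: "lmap R (Hom R S1 (I r)) (Hom R S1 ?E) c1"
  unfolding c1_def by(rule lmap_comp[OF lmap_comp[OF vr l] b])
  \<comment> \<open>The same description one place earlier: up to \<open>v r\<close>,
    \<open>b \<circ> \<delta> s\<close> is given by a map \<open>b1\<close> out of
    \<open>I r\<close>. It vanishes on the elements \<open>\<gamma> (pr f y)\<close> because
    \<open>\<alpha>\<close> kills \<open>?B\<close>; \<open>pr_inj_char\<close> and then
    \<open>double_dual_inj\<close> spread this to all of \<open>I r\<close>.\<close>
  obtain b1 where b1: "lmap R (I r) ?E b1"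
  "!!y q. y \<in> S1 ==> q \<in> Hom R S1 (I r) ==> c1 q y = b1 (q y)"
  using S1.double_dual_surj[OF I EM lmap_flip[OF c1 S1.S_module EM]] by auto
  have b1z: "b1 t = \<zero>\<^sub>?E" if t: "t \<in> (I r)" for t
  proof(rule double_dual_inj[OF I b1(1) _ t])
  fix x \<gamma> assume x: "x \<in> S" and \<gamma>: "\<gamma> \<in> (?DI r)"
  show "b1 (\<gamma> x) = \<zero>\<^sub>?E"
  proof(rule pr_inj_char[OF lmap_comp[OF hom_lmap[OF \<gamma> S_module IM] b1(1)] _ x])
  fix f y assume f: "f \<in> S'" and y: "y \<in> S1"
  let ?h = "a r \<gamma>" let ?q = "\<lambda>y\<in>S1. \<gamma> (pr f y)"
  have h: "?h \<in> (W s)" using lmap_in[OF a \<gamma>] 3 by simp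
  have gB: "dW s ?h \<in> ?B" using h by blast
  have gW: "dW s ?h \<in> (W (Suc s))" using lmap_in[OF dW h] .
  have "\<beta> (pr f y) (dW s ?h) = \<zero>\<^sub>?E"
  using \<beta>(2)[OF bilin_closed[OF pr f y], of "dW s ?h"] \<alpha>B[OF bilin_closed[OF pr f y] gB] BZ gB by auto
  hence "b (dW s ?h f) y = \<zero>\<^sub>?E" using key[OF gW f y] b_apply[OF y] by simp
  moreover have "dW s ?h f = \<delta> s (v r ?q)" using f by(simp add: dW_def a_def)
  ultimately have "c1 ?q y = \<zero>\<^sub>?E" by(simp add: c1_def)
  thus "b1 (\<gamma> (pr f y)) = \<zero>\<^sub>?E" using b1(2)[OF y pr1[OF \<gamma> f]] y by simp
  qed
  qed
  have bz: "b (\<delta> s w) = \<zero>\<^sub>(Hom R S1 ?E)" if w: "w \<in> (U s)" for w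
  proof(rule hom_eqI[OF lmap_in[OF b lmap_in[OF l w]] mod_zero_closed[OF module_hom_mod[OF S1.S_module EM]]])
  fix y assume y: "y \<in> S1"
  have w': "w \<in> (U (Suc r))" using w 3 by simp
  have "c1 (u r w) y = b1 (u r w y)" by(rule b1(2)[OF y lmap_in[OF u w']])
  hence "b (\<delta> s w) y = b1 (u r w y)" using vu[OF w'] by(simp add: c1_def)
  also have "\<dots> = \<zero>\<^sub>?E" by(rule b1z[OF hom_closed[OF lmap_in[OF u w'] y]])
  finally show "b (\<delta> s w) y = \<zero>\<^sub>(Hom R S1 ?E) y" using y by simp
  qed
  obtain c where c: "lmap R (U (Suc (Suc s))) (Hom R S1 ?E) c" "!!w. w \<in> (U (Suc s)) ==> c (\<delta> (Suc s) w) = b w"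
  using S1.hom_into_dual_exact[OF U bd I u v vu E b bz] by blast
  have gZ: "g \<in> (W (Suc s))" "dW (Suc s) g = \<zero>\<^sub>(W (Suc (Suc s)))" using g by(auto simp: kern_def)
  show "\<alpha> x g = \<zero>\<^sub>?E"
  proof(rule pr_inj_char[OF lmap_comp[OF \<alpha> lmap_eval[OF Zm EM g]] _ x])
  fix f y assume f: "f \<in> S'" and y: "y \<in> S1"
  have "\<delta> (Suc s) (g f) = \<zero>\<^sub>(U (Suc (Suc s)))"
  using Wz[OF gZ(2) f] f by(simp add: dW_def)
  hence "b (g f) = \<zero>\<^sub>(Hom R S1 ?E)" using c(2)[OF Wc[OF gZ(1) f]] lmap_zero[OF c(1)] by simp
  hence "b (g f) y = \<zero>\<^sub>?E" using y by simp
  thus "\<alpha> (pr f y) g = \<zero>\<^sub>?E"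
  using key[OF gZ(1) f y] b_apply[OF y] \<beta>(2)[OF bilin_closed[OF pr f y], of g] g by simp
  qed
  qed
  hence "x \<in> ?B" using less.prems by(simp add: kern_def)
  thus ?thesis by(metis imageE)
  qed
 qed
 have "right_exact_cores R W dW"
  unfolding right_exact_cores_def
 proof(intro conjI allI ballI impI)
  show "lmap R (W n) (W (Suc n)) (dW n)" for n by(rule dW)
  show "x = \<zero>\<^sub>(W 0)" if x: "x \<in> (W 0)" "dW 0 x = \<zero>\<^sub>(W (Suc 0))" for x
  proof(rule WI[OF x(1)])
  fix f assume f: "f \<in> S'"
  show "x f = \<zero>\<^sub>(U 0)"
  by(rule rec_inj[OF U Wc[OF x(1) f]]) (use Wz[OF x(2) f] f in \<open>simp add: dW_def\<close>)
  qed
  show "dW (Suc n) x = \<zero>\<^sub>(W (Suc (Suc n))) \<longleftrightarrow> (\<exists>y\<in>(W n). dW n y = x)" if "x \<in> (W (Suc n))" for n x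
  using main[OF that] dWdW by blast
 qed
 thus ?thesis unfolding W_def[abs_def] dW_def[abs_def] .
qed

text \<open>The ring resolves itself, with zero modules above degree zero. Taking it as
  \<open>S1\<close> makes the key exactness statement speak about coresolutions by
  injectives.\<close>

lemma semidual_reg_mod:
 assumes R: "cring R"
 shows "semidual R (reg_mod R) (%n. if n = 0 then reg_mod R else restr_mod (reg_mod R) {\<zero>\<^sub>R}) (%n x. \<zero>\<^sub>R) (%x. x)"
proof -
 note RM = module_reg_mod[OF R]
 interpret cring R by fact
 let ?F = "%n::nat. if n = 0 then reg_mod R else restr_mod (reg_mod R) {\<zero>\<^sub>R}"
 have Zs: "submodule {\<zero>\<^sub>R} R (reg_mod R)" by(rule submoduleI'[OF RM]) auto
 note ZM = module_restr_mod[OF RM Zs]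
 have fg: "fgproj R (reg_mod R)"
  unfolding fgproj_def
 proof(intro conjI RM exI[of _ "Suc 0"] exI[of _ "%_. \<one>\<^sub>R"] exI[of _ "%_ x. x"] ballI allI impI)
  fix x assume x: "x \<in> reg_mod R"
  have "finsum (reg_mod R) (%i. x \<odot>\<^sub>(reg_mod R) \<one>\<^sub>R) (insert (0::nat) {}) = x \<odot>\<^sub>(reg_mod R) \<one>\<^sub>R \<oplus>\<^sub>(reg_mod R) finsum (reg_mod R) (%i. x \<odot>\<^sub>(reg_mod R) \<one>\<^sub>R) ({} :: nat set)"
  using mod_finsum_insert[OF RM, of "{}" "0::nat" "%i. x \<odot>\<^sub>(reg_mod R) \<one>\<^sub>R"] x by simp
  thus "x = finsum (reg_mod R) (%i. x \<odot>\<^sub>(reg_mod R) \<one>\<^sub>R) {..<Suc 0}"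
  using x by(simp add: mod_finsum_empty[OF RM] lessThan_Suc)
 qed (auto intro: lmap_ident[OF RM])
 have fz: "fgproj R (restr_mod (reg_mod R) {\<zero>\<^sub>R})"
  by(rule fgproj_retract[OF fg lmap_restr_dom[OF lmap_ident[OF RM] Zs] lmap_restr_cod[OF lmap_const_zero[OF RM RM] Zs]]) auto
 interpret fp_res R "reg_mod R" ?F "%n x. \<zero>\<^sub>R" "%x. x"
  by unfold_locales (use fg fz lmap_ident[OF RM] lmap_const_zero[OF RM RM] lmap_const_zero[OF RM ZM]
  lmap_const_zero[OF ZM RM] lmap_const_zero[OF ZM ZM] in auto)
 show ?thesis
 proof unfold_locales
  show "acyclic (reg_mod R)"
  proof(rule acyclicI[OF RM])
  fix n \<phi> assume \<phi>: "lmap R (?F (Suc n)) (reg_mod R) \<phi>"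
  have "\<phi> \<zero>\<^sub>R = \<zero>\<^sub>R" using lmap_zero[OF \<phi>] by simp
  thus "EX \<psi>. lmap R (?F n) (reg_mod R) \<psi> & (\<forall>x\<in>(?F (Suc n)). \<psi> \<zero>\<^sub>R = \<phi> x)"
  using lmap_const_zero[OF RM RM] lmap_const_zero[OF ZM RM] by(intro exI[of _ "%x. \<zero>\<^sub>R"]) auto
  qed
  show "\<exists>r\<in>R. \<forall>s\<in>reg_mod R. f s = r \<odot>\<^sub>(reg_mod R) s" if f: "lmap R (reg_mod R) (reg_mod R) f" for f
  proof(intro bexI[of _ "f \<one>\<^sub>R"] ballI)
  fix s assume "s \<in> reg_mod R"
  thus "f s = f \<one>\<^sub>R \<odot>\<^sub>(reg_mod R) s"
  using lmap_smult[OF f, of s "\<one>\<^sub>R"] lmap_in[OF f, of "\<one>\<^sub>R"] by(simp add: m_comm)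
  qed (use lmap_in[OF f, of "\<one>\<^sub>R"] in auto)
  show "faithful R (reg_mod R)" unfolding faithful_def using r_one by(auto simp: dest: bspec[of _ _ "\<one>\<^sub>R"])
 qed
qed

section \<open>Finite projective resolutions over noetherian rings\<close>

lemma fin_gen_free_cover:
 assumes M: "module R M" and K: "submodule K R M" and fg: "fin_gen R M K"
 shows "EX (n::nat) g. lmap R (free_mod R {..<n}) M g & g ` carrier (free_mod R {..<n}) = K"
proof -
 obtain A where A: "finite A" "A \<subseteq> K" "K = mspan R M A" using fg by(auto simp: fin_gen_def)
 obtain x and n :: nat where x: "A = x ` {..<n}"
  using A(1) by(metis finite_imp_nat_seg_image_inj_on lessThan_def)
 have xc: "x i \<in> M" if "i \<in> {..<n}" for i
  using that A(2) submodule_sub[OF K M] unfolding x by blast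
 have "lmap R (free_mod R {..<n}) M (%f. finsum M (%i. f i \<odot>\<^sub>M x i) {..<n})"
  by(rule free_map(1)[OF M finite_lessThan xc])
 moreover have "(%f. finsum M (%i. f i \<odot>\<^sub>M x i) {..<n}) ` carrier (free_mod R {..<n}) = K"
  unfolding A(3) x by(rule free_map(2)[OF M finite_lessThan xc])
 ultimately show ?thesis by blast
qed

text \<open>Kernels of maps out of finite free modules are finitely generated, so dependent choice
  builds a resolution. Free modules on initial segments of the naturals share one element type,
  whatever the type of \<open>S\<close>.\<close>

lemma exists_fp_res:
 assumes R: "cring R" "noetherian_ring R" and S: "noeth R S"
 shows "EX (G :: nat => ('a, nat => 'a) module) d e. fp_res R S G d e"
proof -
 let ?f = "%n::nat. free_mod R {..<n}"
 note FM = module_free_mod[OF R(1)]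
 have SM: "module R S" using S by(simp add: noeth_def)
 have nf: "noeth R (?f n)" for n
  by(rule noeth_fin_gen[OF FM R(2) fgproj_fin_gen[OF fgproj_free_mod[OF R(1)]]])
 have step: "EX n'' d'. lmap R (?f n'') (?f n') d' & d' ` carrier (?f n'') = kern (?f n') M d"
  if "lmap R (?f n') M d" for n' d and M :: "('a, 'x) module"
  using fin_gen_free_cover[OF FM submodule_kern[OF that]] nf submodule_kern[OF that] unfolding noeth_def by blast
 obtain n0 e where e: "lmap R (?f n0) S e" "e ` carrier (?f n0) = carrier S"
  using fin_gen_free_cover[OF SM module.carrier_is_submodule[OF SM]] S module.carrier_is_submodule[OF SM]
  unfolding noeth_def by blast
 obtain n1 d0 where d0: "lmap R (?f n1) (?f n0) d0" "d0 ` carrier (?f n1) = kern (?f n0) S e"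
  using step[OF e(1)] by blast
 \<comment> \<open>A state \<open>(n, n', d)\<close> is one differential, from rank
   \<open>n'\<close> to rank \<open>n\<close>; \<open>?Q\<close> demands that the next one covers
   its kernel, and the clause for \<open>k = 0\<close> fixes the start.\<close>
 let ?P = "%k (n, n', d). lmap R (?f n') (?f n) d & (k = 0 --> n = n0 & n' = n1 & d = d0)"
 let ?Q = "%(n, n', d) (m, m', d'). m = n' & d' ` carrier (?f m') = kern (?f n') (?f n) d"
 have "EX s. ALL k. ?P k (s k) & ?Q (s k) (s (Suc k))"
 proof(rule dependent_nat_choice)
  show "EX x. ?P 0 x" using d0 by(intro exI[of _ "(n0, n1, d0)"]) simp
  show "EX y. ?P (Suc k) y & ?Q x y" if x: "?P k x" for x k
  proof -
  obtain n n' d where xx: "x = (n, n', d)" by(cases x)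
  have "lmap R (?f n') (?f n) d" using x by(simp add: xx)
  from step[OF this] obtain n'' d' where "lmap R (?f n'') (?f n') d'" "d' ` carrier (?f n'') = kern (?f n') (?f n) d" by blast
  thus ?thesis by(intro exI[of _ "(n', n'', d')"]) (simp add: xx)
  qed
 qed
 then obtain s where "ALL k. ?P k (s k) & ?Q (s k) (s (Suc k))" by(rule exE)
 hence s: "?P k (s k)" "?Q (s k) (s (Suc k))" for k by(simp_all only:)
 define n where "n k = fst (s k)" for k
 define d where "d k = snd (snd (s k))" for k
 have sk: "s k = (n k, n (Suc k), d k)" for k
  using s(2)[of k] by(cases "s k"; cases "s (Suc k)") (auto simp: n_def d_def)
 have d: "lmap R (?f (n (Suc k))) (?f (n k)) (d k)" for k using s(1)[of k] by(simp add: sk)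
 have im: "d (Suc k) ` carrier (?f (n (Suc (Suc k)))) = kern (?f (n (Suc k))) (?f (n k)) (d k)" for k
  using s(2)[of k] by(simp add: sk)
 have z: "n 0 = n0" "n (Suc 0) = n1" "d 0 = d0" using s(1)[of 0] by(auto simp: sk)
 have "fp_res R S (%k. ?f (n k)) d e"
 proof
  show "\<exists>x\<in>(?f (n 0)). e x = s" if "s \<in> S" for s using that e(2) z by(metis imageE)
  show "e (d 0 x) = \<zero>\<^sub>S" if "x \<in> (?f (n (Suc 0)))" for x
  using that d0(2) z by(auto simp: kern_def)
  show "\<exists>y\<in>(?f (n (Suc 0))). d 0 y = x" if "x \<in> (?f (n 0))" "e x = \<zero>\<^sub>S" for x
  proof -
  have "x \<in> d0 ` carrier (?f n1)" unfolding d0(2) using that z by(simp add: kern_def)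
  thus ?thesis using z by auto
  qed
  show "d k (d (Suc k) x) = \<zero>\<^sub>(?f (n k))" if "x \<in> (?f (n (Suc (Suc k))))" for k x
  proof -
  have "d (Suc k) x \<in> kern (?f (n (Suc k))) (?f (n k)) (d k)" using that im[of k] by blast
  thus ?thesis by(simp add: kern_def)
  qed
  show "\<exists>y\<in>(?f (n (Suc (Suc k)))). d (Suc k) y = x" if "x \<in> (?f (n (Suc k)))" "d k x = \<zero>\<^sub>(?f (n k))" for k x
  proof -
  have "x \<in> d (Suc k) ` carrier (?f (n (Suc (Suc k))))" unfolding im using that by(simp add: kern_def)
  thus ?thesis by auto
  qed
 qed (use d e z fgproj_free_mod[OF R(1)] in auto)
 thus ?thesis by blast
qed

section \<open>Summands of infinite direct sums and dual bases\<close>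

lemma mod_finsum_support:
 assumes M: "module R M" and "finite B" "A \<subseteq> B" and "!!i. i \<in> B ==> h i \<in> M"
  and "!!i. i \<in> B - A ==> h i = \<zero>\<^sub>M"
 shows "finsum M h B = finsum M h A"
proof -
 interpret module R M by fact
 have "finsum M h (A \<union> (B - A)) = finsum M h A \<oplus>\<^sub>M finsum M h (B - A)"
  by(rule M.finsum_Un_disjoint) (use assms finite_subset[OF assms(3,2)] in auto)
 moreover have "finsum M h (B - A) = \<zero>\<^sub>M" by(rule mod_finsum_zero[OF M]) (use assms(5) in auto)
 moreover have "finsum M h A \<in> M" by(rule mod_finsum_closed[OF M]) (use assms in auto)
 moreover have "A \<union> (B - A) = B" using assms(3) by blast
 ultimately show ?thesis by(simp add: modD[OF M])
qed

text \<open>\<open>X\<close> is a summand of a (possibly infinite) direct sum of copies of \<open>Q\<close>; the maps \<open>t b\<close> and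
 \<open>s b\<close> are the components of the two maps between \<open>X\<close> and the direct sum.\<close>

definition loc_summand :: "('a,'r) ring_scheme => ('a,'q) module => ('a,'m) module => 'b set =>
  ('b => 'q => 'm) => ('b => 'm => 'q) => bool" where
 "loc_summand R Q X B t s \<longleftrightarrow> module R X & (\<forall>b\<in>B. lmap R Q X (t b) & lmap R X Q (s b)) &
  (\<forall>x\<in>X. finite {b \<in> B. s b x ~= \<zero>\<^sub>Q} &
  x = finsum X (%b. t b (s b x)) {b \<in> B. s b x ~= \<zero>\<^sub>Q})"

lemma finsum_enlarge:
 assumes Z: "module R Z" and y: "!!b. b \<in> B ==> lmap R Q Z (y b)" and s: "!!b. b \<in> B ==> s b \<in> Q"
  and A: "finite A" "{b \<in> B. s b ~= \<zero>\<^sub>Q} \<subseteq> A" "A \<subseteq> B"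
 shows "finsum Z (%b. y b (s b)) A = finsum Z (%b. y b (s b)) {b \<in> B. s b ~= \<zero>\<^sub>Q}"
 by(rule mod_finsum_support[OF Z A(1,2)]) (use A(3) lmap_in[OF y s] lmap_zero[OF y] in auto)

text \<open>The sum at \<open>x\<close> runs over a support that varies with \<open>x\<close>.
  Linearity is checked on a common finite index set, to which \<open>finsum_enlarge\<close>
  passes.\<close>

lemma loc_summand_map:
 assumes X: "loc_summand R Q X B t s" and Z: "module R Z" and y: "!!b. b \<in> B ==> lmap R Q Z (y b)"
 shows "lmap R X Z (%x. finsum Z (%b. y b (s b x)) {b \<in> B. s b x ~= \<zero>\<^sub>Q})"
proof -
 let ?s = "%x. {b \<in> B. s b x ~= \<zero>\<^sub>Q}"
 let ?h = "%x. finsum Z (%b. y b (s b x)) (?s x)"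
 have XM: "module R X" and s: "!!b. b \<in> B ==> lmap R X Q (s b)"
  and fin: "!!x. x \<in> X ==> finite (?s x)" using X by(auto simp: loc_summand_def)
 note cl = lmap_in[OF s] and ycl = lmap_in[OF y lmap_in[OF s]]
 have big: "finsum Z (%b. y b (s b x)) A = ?h x" if "x \<in> X" "finite A" "?s x \<subseteq> A" "A \<subseteq> B" for x A
  by(rule finsum_enlarge[OF Z y _ that(2-4)]) (use cl that(1) in auto)
 show ?thesis
 proof(rule lmapI[OF XM Z])
  show "?h x \<in> Z" if "x \<in> X" for x by(rule mod_finsum_closed[OF Z]) (use ycl that in auto)
  fix x x' assume x: "x \<in> X" "x' \<in> X"
  let ?A = "?s x \<union> ?s x' \<union> ?s (x \<oplus>\<^sub>X x')"
  have xx: "x \<oplus>\<^sub>X x' \<in> X" using x by(simp add: modD[OF XM])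
  interpret module R Z by fact
  have "?h (x \<oplus>\<^sub>X x') = finsum Z (%b. y b (s b (x \<oplus>\<^sub>X x'))) ?A"
  by(rule big[symmetric]) (use fin x xx in auto)
  also have "\<dots> = finsum Z (%b. y b (s b x) \<oplus>\<^sub>Z y b (s b x')) ?A"
  by(rule mod_finsum_cong[OF Z]) (use x cl ycl lmap_add[OF s] lmap_add[OF y] in auto)
  also have "\<dots> = finsum Z (%b. y b (s b x)) ?A \<oplus>\<^sub>Z finsum Z (%b. y b (s b x')) ?A"
  by(rule M.finsum_addf) (use ycl x in auto)
  also have "\<dots> = ?h x \<oplus>\<^sub>Z ?h x'"
  by(intro arg_cong2[where f = "(\<oplus>\<^sub>Z)"] big) (use fin x xx in auto)
  finally show "?h (x \<oplus>\<^sub>X x') = ?h x \<oplus>\<^sub>Z ?h x'" .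
 next
  fix r x assume r: "r \<in> R" and x: "x \<in> X"
  have rx: "r \<odot>\<^sub>X x \<in> X" using r x by(simp add: modD[OF XM])
  have "?h (r \<odot>\<^sub>X x) = finsum Z (%b. y b (s b (r \<odot>\<^sub>X x))) (?s x \<union> ?s (r \<odot>\<^sub>X x))"
  by(rule big[symmetric]) (use fin x rx in auto)
  also have "\<dots> = finsum Z (%b. r \<odot>\<^sub>Z y b (s b x)) (?s x \<union> ?s (r \<odot>\<^sub>X x))"
  by(rule mod_finsum_cong[OF Z]) (use r x cl ycl lmap_smult[OF s] lmap_smult[OF y] in \<open>auto simp: modD[OF Z]\<close>)
  also have "\<dots> = r \<odot>\<^sub>Z finsum Z (%b. y b (s b x)) (?s x \<union> ?s (r \<odot>\<^sub>X x))"
  by(rule module.finsum_smult_ldistr[OF Z, symmetric]) (use fin x rx r ycl in auto)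
  also have "\<dots> = r \<odot>\<^sub>Z ?h x"
  by(intro arg_cong2[where f = "(\<odot>\<^sub>Z)"] refl big) (use fin x rx in auto)
  finally show "?h (r \<odot>\<^sub>X x) = r \<odot>\<^sub>Z ?h x" .
 qed
qed

lemma loc_summand_lift:
 assumes X: "loc_summand R Q X B t s" and g: "lmap R A Y g" and f: "lmap R X Y f"
  and y: "!!b. b \<in> B ==> EX h. lmap R Q A h & (\<forall>q\<in>Q. g (h q) = f (t b q))"
 shows "EX h. lmap R X A h & (\<forall>x\<in>X. g (h x) = f x)"
proof -
 have XM: "module R X" and ts: "!!b. b \<in> B ==> lmap R Q X (t b)" "!!b. b \<in> B ==> lmap R X Q (s b)"
  and fin: "!!x. x \<in> X ==> finite {b \<in> B. s b x ~= \<zero>\<^sub>Q}"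
  and x: "!!x. x \<in> X ==> x = finsum X (%b. t b (s b x)) {b \<in> B. s b x ~= \<zero>\<^sub>Q}"
  using X by(auto simp: loc_summand_def)
 obtain h where h: "!!b. b \<in> B ==> lmap R Q A (h b)" "!!b q. b \<in> B ==> q \<in> Q ==> g (h b q) = f (t b q)"
  using y by metis
 let ?h = "%x. finsum A (%b. h b (s b x)) {b \<in> B. s b x ~= \<zero>\<^sub>Q}"
 have "g (?h z) = f z" if z: "z \<in> X" for z
 proof -
  let ?s = "{b \<in> B. s b z ~= \<zero>\<^sub>Q}"
  have sz: "s b z \<in> Q" if "b \<in> B" for b using lmap_in[OF ts(2)[OF that] z] .
  have "g (?h z) = finsum Y (%b. g (h b (s b z))) ?s"
  by(rule lmap_finsum[OF g fin[OF z]]) (use lmap_in[OF h(1) sz] in auto)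
  also have "\<dots> = finsum Y (%b. f (t b (s b z))) ?s"
  by(rule mod_finsum_cong[OF lmap_cod[OF g]]) (use h(2) sz lmap_in[OF f lmap_in[OF ts(1) sz]] in auto)
  also have "\<dots> = f (finsum X (%b. t b (s b z)) ?s)"
  by(rule lmap_finsum[OF f fin[OF z], symmetric]) (use lmap_in[OF ts(1) sz] in auto)
  finally show ?thesis using x[OF z] by simp
 qed
 moreover have "lmap R X A ?h" by(rule loc_summand_map[OF X lmap_dom[OF g] h(1)])
 ultimately show ?thesis by blast
qed

text \<open>The description of projectivity by the dual basis lemma, with an index set of any size;
  it is the case \<open>Q = R\<close> of \<open>loc_summand\<close>.\<close>

definition loc_basis :: "('a,'r) ring_scheme => ('a,'m) module => 'b set => ('b => 'm) => ('b => 'm => 'a) => bool" where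
 "loc_basis R P B p c \<longleftrightarrow> module R P & (\<forall>b\<in>B. p b \<in> P & lmap R P (reg_mod R) (c b)) &
  (\<forall>x\<in>P. finite {b \<in> B. c b x ~= \<zero>\<^sub>R} &
  x = finsum P (%b. c b x \<odot>\<^sub>P p b) {b \<in> B. c b x ~= \<zero>\<^sub>R})"

lemma loc_basis_summand:
 "loc_basis R P B p c ==> loc_summand R (reg_mod R) P B (%b r. r \<odot>\<^sub>P p b) c"
 by(simp add: loc_basis_def loc_summand_def lmap_reg_mod_smult)

lemma loc_basis_map:
 assumes P: "loc_basis R P B p c" and Z: "module R Z" and y: "!!b. b \<in> B ==> y b \<in> Z"
 shows "lmap R P Z (%x. finsum Z (%b. c b x \<odot>\<^sub>Z y b) {b \<in> B. c b x ~= \<zero>\<^sub>R})"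
 using loc_summand_map[OF loc_basis_summand[OF P] Z lmap_reg_mod_smult[OF Z y]] by simp

lemma fgproj_loc_basis:
 assumes "fgproj R F"
 shows "EX B p c. loc_basis R F (B::nat set) p c"
proof -
 obtain n :: nat and e c where e: "!!i. i < n ==> e i \<in> F"
  and c: "!!i. i < n ==> lmap R F (reg_mod R) (c i)"
  and x: "!!x. x \<in> F ==> x = finsum F (%i. c i x \<odot>\<^sub>F e i) {..<n}"
  using assms unfolding fgproj_def by metis
 note FM = fgproj_module[OF assms]
 have "x = finsum F (%i. c i x \<odot>\<^sub>F e i) {i \<in> {..<n}. c i x ~= \<zero>\<^sub>R}" if xF: "x \<in> F" for x
 proof -
  have cx: "c i x \<in> R" if "i < n" for i using lmap_in[OF c[OF that] xF] by simp
  have "finsum F (%i. c i x \<odot>\<^sub>F e i) {..<n} = finsum F (%i. c i x \<odot>\<^sub>F e i) {i \<in> {..<n}. c i x ~= \<zero>\<^sub>R}"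
  by(rule mod_finsum_support[OF FM]) (use cx e in \<open>auto simp: modD[OF FM]\<close>)
  thus ?thesis using x[OF xF] by simp
 qed
 hence "loc_basis R F {..<n} e c" unfolding loc_basis_def using FM e c by auto
 thus ?thesis by blast
qed

text \<open>At each basis element a map from an ideal to \<open>Hom(P, J)\<close> gives a map to
  \<open>J\<close>, which Baer's criterion realises by an element \<open>y b\<close>. The dual basis
  assembles these elements into one map.\<close>

lemma baer_hom:
 assumes P: "loc_basis R P B p c" and J: "baer R J"
 shows "baer R (Hom R P J)"
 unfolding baer_def
proof(intro conjI allI impI)
 have PM: "module R P" and p: "!!b. b \<in> B ==> p b \<in> P"
  and c: "!!b. b \<in> B ==> lmap R P (reg_mod R) (c b)"
  and fin: "!!x. x \<in> P ==> finite {b \<in> B. c b x ~= \<zero>\<^sub>R}"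
  and x: "!!x. x \<in> P ==> x = finsum P (%b. c b x \<odot>\<^sub>P p b) {b \<in> B. c b x ~= \<zero>\<^sub>R}"
  using P by(auto simp: loc_basis_def)
 note JM = baer_module[OF J] and R = module_cring[OF PM]
 show HM: "module R (Hom R P J)" using PM JM by auto
 fix I f assume "submodule I R (reg_mod R) & lmap R (restr_mod (reg_mod R) I) (Hom R P J) f"
 hence I: "submodule I R (reg_mod R)" and f: "lmap R (restr_mod (reg_mod R) I) (Hom R P J) f" by auto
 have Ic: "a \<in> R" if "a \<in> I" for a using submodule_sub[OF I module_reg_mod[OF R] that] by simp
 have "\<exists>e\<in>J. \<forall>a\<in>I. f a (p b) = a \<odot>\<^sub>J e" if "b \<in> B" for b
  using J I lmap_comp[OF f lmap_eval[OF PM JM p[OF that]]] unfolding baer_def by blast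
 then obtain y where y: "!!b. b \<in> B ==> y b \<in> J" "!!b a. b \<in> B ==> a \<in> I ==> f a (p b) = a \<odot>\<^sub>J y b" by metis
 let ?h = "%x. finsum J (%b. c b x \<odot>\<^sub>J y b) {b \<in> B. c b x ~= \<zero>\<^sub>R}"
 have h: "lmap R P J ?h" by(rule loc_basis_map[OF P JM y(1)])
 let ?e = "\<lambda>x\<in>P. ?h x"
 have e: "?e \<in> Hom R P J" by(rule hom_mem[OF h])
 have "f a = a \<odot>\<^sub>(Hom R P J) ?e" if a: "a \<in> I" for a
 proof(rule hom_eqI)
  have fa: "f a \<in> Hom R P J" using lmap_in[OF f] a by simp
  thus "f a \<in> Hom R P J" .
  show "a \<odot>\<^sub>(Hom R P J) ?e \<in> Hom R P J" using mod_smult_closed[OF HM Ic[OF a] e] .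
  note fl = hom_lmap[OF fa PM JM]
  fix x assume xP: "x \<in> P"
  let ?s = "{b \<in> B. c b x ~= \<zero>\<^sub>R}"
  have cx: "c b x \<in> R" if "b \<in> B" for b using lmap_in[OF c[OF that] xP] by simp
  have "f a x = f a (finsum P (%b. c b x \<odot>\<^sub>P p b) ?s)" using x[OF xP] by simp
  also have "\<dots> = finsum J (%b. f a (c b x \<odot>\<^sub>P p b)) ?s"
  by(rule lmap_finsum[OF fl fin[OF xP]]) (use cx p in \<open>auto simp: modD[OF PM]\<close>)
  also have "\<dots> = finsum J (%b. a \<odot>\<^sub>J (c b x \<odot>\<^sub>J y b)) ?s"
  proof(rule mod_finsum_cong[OF JM])
  fix b assume "b \<in> ?s"
  hence b: "b \<in> B" by simp
  show "a \<odot>\<^sub>J (c b x \<odot>\<^sub>J y b) \<in> J" using Ic[OF a] cx[OF b] y(1)[OF b] by(simp add: modD[OF JM])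
  show "f a (c b x \<odot>\<^sub>P p b) = a \<odot>\<^sub>J (c b x \<odot>\<^sub>J y b)"
  using lmap_smult[OF fl cx[OF b] p[OF b]] y(2)[OF b a] Ic[OF a] cx[OF b] y(1)[OF b]
  by(simp add: mod_mult_smult[OF JM, symmetric] cring_mult_comm[OF R, of "c b x"])
  qed
  also have "\<dots> = a \<odot>\<^sub>J ?h x"
  by(rule module.finsum_smult_ldistr[OF JM, symmetric]) (use fin[OF xP] Ic[OF a] cx y in \<open>auto simp: modD[OF JM]\<close>)
  finally show "f a x = (a \<odot>\<^sub>(Hom R P J) ?e) x" using xP by simp
 qed
 with e show "\<exists>e\<in>Hom R P J. \<forall>a\<in>I. f a = a \<odot>\<^sub>(Hom R P J) e" by blast
qed

section \<open>The dual of a semidualizing module\<close>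

lemma (in fp_res) acyclic_baer:
 assumes "baer R E"
 shows "acyclic E"
proof(rule acyclicI[OF baer_module[OF assms]])
 fix n \<phi> assume \<phi>: "lmap R (F (Suc n)) E \<phi>" and z: "!!x. x \<in> (F (Suc (Suc n))) ==> \<phi> (d (Suc n) x) = \<zero>\<^sub>E"
 show "EX \<psi>. lmap R (F n) E \<psi> & (\<forall>x\<in>(F (Suc n)). \<psi> (d n x) = \<phi> x)"
  by(rule baer_extend[OF assms d \<phi>]) (use z d_exact in blast)
qed

text \<open>In other words, \<open>Ext(S, J 0)\<close> vanishes in positive degrees when
  \<open>J 0\<close> has finite injective dimension. It is the key statement with
  \<open>S1 = R\<close>, scalar multiplication as pairing, and injectives read as
  \<open>Hom(R, J)\<close>.\<close>

lemma (in semidual) hom_injective_coresolution_exact: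
 fixes J :: "nat => ('a,'j) module"
 assumes noeth: "noetherian_ring R" and J: "right_exact_cores R J \<delta>" and bd: "bounded_seq J N"
  and inj: "!!n. baer R (J (Suc n))"
 shows "right_exact_cores R (%n. Hom R S (J n)) (%n. post S (\<delta> n))"
proof(rule hom_coresolution_exact[OF noeth semidual_reg_mod[OF R_cring] S_module, where pr = "%s r. r \<odot>\<^sub>S s"
  and I = "%n. J (Suc n)" and u = "%n x. \<lambda>r\<in>reg_mod R. r \<odot>\<^sub>(J (Suc n)) x" and v = "%n q. q \<one>\<^sub>R"])
 note RM = module_reg_mod[OF R_cring]
 interpret cring R by(rule R_cring)
 show "bilin R S (reg_mod R) S (%s r. r \<odot>\<^sub>S s)"
  by(rule bilinI[OF S_module RM S_module])
  (use lmap_reg_mod_smult[OF S_module] lmap_scale[OF lmap_ident[OF S_module]] in auto)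
 show "EX \<gamma>. lmap R S I \<gamma> & (\<forall>f\<in>S. \<forall>y\<in>reg_mod R. B f y = \<gamma> (y \<odot>\<^sub>S f))"
  if B: "bilin R S (reg_mod R) I B" for I :: "('a,'j) module" and B
 proof(intro exI[of _ "%s. B s \<one>\<^sub>R"] conjI ballI)
  show l: "lmap R S I (%s. B s \<one>\<^sub>R)" by(rule bilin_left[OF B]) simp
  fix s r assume s: "s \<in> S" and r: "r \<in> reg_mod R"
  have "B s r = r \<odot>\<^sub>I B s \<one>\<^sub>R"
  using lmap_smult[OF bilin_right[OF B s], of r "\<one>\<^sub>R"] r by simp
  thus "B s r = B (r \<odot>\<^sub>S s) \<one>\<^sub>R" using lmap_smult[OF l, of r s] r s by simp
 qed
 show "\<gamma> x = \<zero>\<^sub>I" if "!!f y. f \<in> S ==> y \<in> reg_mod R ==> \<gamma> (y \<odot>\<^sub>S f) = \<zero>\<^sub>I" "x \<in> S" for I :: "('a,'j) module" and \<gamma> x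
  using that(1)[OF that(2), of "\<one>\<^sub>R"] that(2) by(simp add: modD[OF S_module])
 show "\<gamma> x = \<zero>\<^sub>(char_mod R)" if "!!f y. f \<in> S ==> y \<in> reg_mod R ==> \<gamma> (y \<odot>\<^sub>S f) = \<zero>\<^sub>(char_mod R)" "x \<in> S" for \<gamma> x
  using that(1)[OF that(2), of "\<one>\<^sub>R"] that(2) by(simp add: modD[OF S_module])
 fix n
 note JM = baer_module[OF inj[of n]]
 show "lmap R (J (Suc n)) (Hom R (reg_mod R) (J (Suc n))) (%x. \<lambda>r\<in>reg_mod R. r \<odot>\<^sub>(J (Suc n)) x)"
  by(rule lmap_curry, rule bilinI[OF JM RM JM])
  (use lmap_reg_mod_smult[OF JM] lmap_scale[OF lmap_ident[OF JM]] in auto)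
 show "lmap R (Hom R (reg_mod R) (J (Suc n))) (J (Suc n)) (%q. q \<one>\<^sub>R)"
  by(rule lmap_eval[OF RM JM]) simp
 show "(\<lambda>r\<in>reg_mod R. r \<odot>\<^sub>(J (Suc n)) x) \<one>\<^sub>R = x" if "x \<in> (J (Suc n))" for x
  using that by(simp add: modD[OF JM])
 show "(\<lambda>r\<in>reg_mod R. r \<odot>\<^sub>(J (Suc n)) q \<one>\<^sub>R) = q" if q: "q \<in> (Hom R (reg_mod R) (J (Suc n)))" for q
 proof -
  have "r \<odot>\<^sub>(J (Suc n)) q \<one>\<^sub>R = q r" if "r \<in> R" for r
  using lmap_smult[OF hom_lmap[OF q RM JM], of r "\<one>\<^sub>R"] that by simp
  hence "(\<lambda>r\<in>reg_mod R. r \<odot>\<^sub>(J (Suc n)) q \<one>\<^sub>R) = (\<lambda>r\<in>reg_mod R. q r)"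
  by(auto simp: restrict_def)
  thus ?thesis using hom_ext[OF q] by simp
 qed
qed (use J bd inj in auto)

text \<open>\<open>J\<close> is a bounded injective coresolution of \<open>D\<close> including
  \<open>D\<close> itself at index zero, so the injectives start at index one and the augmentation
  is \<open>\<delta> 0\<close>.\<close>

locale dualizing_pair = C: semidual R C FC dC eC + D: semidual R D FD dD eD
 for R :: "('a,'r) ring_scheme" and C :: "('a,'c) module" and FC :: "nat => ('a,'f) module" and dC eC
  and D :: "('a,'m) module" and FD :: "nat => ('a,'g) module" and dD eD +
 fixes J :: "nat => ('a,'m) module" and \<delta> N
 assumes noeth: "noetherian_ring R" and J: "right_exact_cores R J \<delta>" and bd: "bounded_seq J N" and J0: "J 0 = D"
  and inj: "!!n. baer R (J (Suc n))"
begin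

abbreviation "C' \<equiv> Hom R C D"

abbreviation "W n \<equiv> Hom R C (J n)"

lemma JM: "module R (J n)" by(rule rec_module[OF J])

text \<open>The vanishing of \<open>Ext(C, D)\<close>: \<open>Hom(C, -)\<close> keeps
  \<open>J\<close> exact, so that \<open>W\<close> coresolves \<open>W 0 = C'\<close> by modules of
  the form \<open>Hom(C, I)\<close>.\<close>

lemma W: "right_exact_cores R W (%n. post C (\<delta> n))"
 by(rule C.hom_injective_coresolution_exact[OF noeth J bd inj])

lemma DJ: "right_exact_cores R (%n. Hom R D (J n)) (%n. post D (\<delta> n))"
 by(rule D.hom_injective_coresolution_exact[OF noeth J bd inj])

lemma bdW: "bounded_seq W N"
 unfolding bounded_seq_def
proof(intro allI impI ballI)
 fix n x assume n: "N \<le> n" and x: "x \<in> (W n)"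
 show "x = \<zero>\<^sub>(W n)"
  by(rule hom_eqI[OF x mod_zero_closed[OF module_hom_mod[OF C.S_module JM]]])
  (use bd n hom_closed[OF x] in \<open>auto simp: bounded_seq_def\<close>)
qed

lemma C'_module: "module R C'" using C.S_module D.S_module by auto

lemmas WM = module_hom_mod[OF C.S_module JM]

text \<open>The terms of \<open>W\<close> from index one on are literally \<open>Hom(C, I)\<close>
  with \<open>I\<close> injective, so the identifications \<open>u\<close> and \<open>v\<close> are
  identities.\<close>

lemmas hom_W_exact = C.hom_into_dual_exact[where I = "%n. J (Suc n)" and u = "%n x. x" and v = "%n x. x", OF W bdW inj lmap_ident[OF WM] lmap_ident[OF WM] refl]

lemmas hom_W_extends = C.hom_into_dual_extends[where I = "%n. J (Suc n)" and u = "%n x. x" and v = "%n x. x", OF W bdW inj lmap_ident[OF WM] lmap_ident[OF WM] refl]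

lemma pairing: "bilin R C' C D (%u c. u c)"
 by(rule bilin_hom_comp[OF C.S_module D.S_module])

text \<open>With \<open>pairing_inj\<close> this is \<open>C' \<otimes> C = D\<close>, tested on
  maps into injectives. Read as a map \<open>W 0 \<rightarrow> Hom(C, I)\<close>, the form
  \<open>B\<close> extends to \<open>W 1 = Hom(C, J 1)\<close>, where it is given by a map out of
  \<open>J 1\<close>; restricting that map to \<open>D\<close> gives
  \<open>\<gamma>\<close>.\<close>

lemma pairing_surj:
 assumes I: "baer R I" and B: "bilin R C' C I B"
 shows "EX \<gamma>. lmap R D I \<gamma> & (\<forall>u\<in>C'. \<forall>c\<in>C. B u c = \<gamma> (u c))"
proof -
 note IM = baer_module[OF I]
 have b: "lmap R (W 0) (Hom R C I) (%u. \<lambda>c\<in>C. B u c)"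
  unfolding J0 by(rule lmap_curry[OF B])
 obtain b' where b': "lmap R (W (Suc 0)) (Hom R C I) b'" "!!u. u \<in> (W 0) ==> b' (post C (\<delta> 0) u) = (\<lambda>c\<in>C. B u c)"
  using hom_W_extends[OF I b] by blast
 obtain b0 where b0: "lmap R (J (Suc 0)) I b0" "!!c w. c \<in> C ==> w \<in> (W (Suc 0)) ==> b' w c = b0 (w c)"
  using C.double_dual_surj[OF inj IM lmap_flip[OF b'(1) C.S_module IM]] by auto
 have "B u c = b0 (\<delta> 0 (u c))" if u: "u \<in> C'" and c: "c \<in> C" for u c
 proof -
  have u': "u \<in> (W 0)" using u J0 by simp
  have "B u c = b' (post C (\<delta> 0) u) c" using b'(2)[OF u'] c by simp
  also have "\<dots> = b0 (\<delta> 0 (u c))" using b0(2)[OF c lmap_in[OF rec_lmap[OF W] u']] c by simp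
  finally show ?thesis .
 qed
 moreover have "lmap R D I (%x. b0 (\<delta> 0 x))" using lmap_comp[OF rec_lmap[OF J, of 0] b0(1)] J0 by simp
 ultimately show ?thesis by blast
qed

text \<open>Extend \<open>\<gamma>\<close> to \<open>b0\<close> on \<open>J 1\<close>. By hypothesis
  \<open>b0\<close> induces zero on \<open>C'\<close> inside \<open>Hom(C, J 1)\<close>, so the
  induced map factors over \<open>Hom(C, J 2)\<close> and is given there by some \<open>c1\<close>.
  Hence \<open>b0\<close> equals \<open>c1\<close> after the second differential, which vanishes on
  \<open>D\<close>.\<close>

lemma pairing_inj:
 assumes I: "baer R I" and \<gamma>: "lmap R D I \<gamma>"
  and z: "!!u c. u \<in> C' ==> c \<in> C ==> \<gamma> (u c) = \<zero>\<^sub>I" and x: "x \<in> D"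
 shows "\<gamma> x = \<zero>\<^sub>I"
proof -
 note IM = baer_module[OF I] and l = rec_lmap[OF J]
 have l0: "lmap R D (J (Suc 0)) (\<delta> 0)" using l[of 0] J0 by simp
 obtain b0 where b0: "lmap R (J (Suc 0)) I b0" "!!x. x \<in> D ==> b0 (\<delta> 0 x) = \<gamma> x"
  using baer_extend[OF I l0 \<gamma>] rec_inj[OF J] lmap_zero[OF \<gamma>] J0 by auto
 have c0: "lmap R (W (Suc 0)) (Hom R C I) (post C b0)" by(rule lmap_post[OF b0(1) C.S_module])
 have "post C b0 (post C (\<delta> 0) u) = \<zero>\<^sub>(Hom R C I)" if u: "u \<in> (W 0)" for u
 proof(rule hom_eqI[OF lmap_in[OF c0 lmap_in[OF rec_lmap[OF W] u]] mod_zero_closed[OF module_hom_mod[OF C.S_module IM]]])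
  fix c assume c: "c \<in> C"
  thus "post C b0 (post C (\<delta> 0) u) c = \<zero>\<^sub>(Hom R C I) c"
  using u b0(2) hom_closed[OF u c] z[of u c] J0 by simp
 qed
 then obtain k where k: "lmap R (W (Suc (Suc 0))) (Hom R C I) k"
  "!!w. w \<in> (W (Suc 0)) ==> k (post C (\<delta> (Suc 0)) w) = post C b0 w"
  using hom_W_exact[OF I c0] by blast
 obtain c1 where c1: "lmap R (J (Suc (Suc 0))) I c1" "!!c w. c \<in> C ==> w \<in> (W (Suc (Suc 0))) ==> k w c = c1 (w c)"
  using C.double_dual_surj[OF inj IM lmap_flip[OF k(1) C.S_module IM]] by auto
 note df = lmap_diff[OF b0(1) lmap_comp[OF l c1(1)]]
 have "b0 t \<ominus>\<^sub>I c1 (\<delta> (Suc 0) t) = \<zero>\<^sub>I" if t: "t \<in> (J (Suc 0))" for t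
 proof(rule C.double_dual_inj[OF inj df _ t])
  fix c w assume c: "c \<in> C" and w: "w \<in> (W (Suc 0))"
  have "b0 (w c) = c1 (\<delta> (Suc 0) (w c))"
  using fun_cong[OF k(2)[OF w], of c] c1(2)[OF c lmap_in[OF rec_lmap[OF W] w]] c by simp
  moreover have "b0 (w c) \<in> I" using lmap_in[OF b0(1) hom_closed[OF w c]] .
  ultimately show "b0 (w c) \<ominus>\<^sub>I c1 (\<delta> (Suc 0) (w c)) = \<zero>\<^sub>I" by(simp add: modD[OF IM])
 qed
 from this[of "\<delta> 0 x"] have "b0 (\<delta> 0 x) \<ominus>\<^sub>I c1 (\<delta> (Suc 0) (\<delta> 0 x)) = \<zero>\<^sub>I" using lmap_in[OF l0 x] by simp
 moreover have "\<delta> (Suc 0) (\<delta> 0 x) = \<zero>\<^sub>(J (Suc (Suc 0)))" using rec_zero[OF J, of x 0] x J0 by simp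
 ultimately show ?thesis
  using b0(2)[OF x] lmap_zero[OF c1(1)] lmap_in[OF \<gamma> x] by(simp add: modD[OF IM])
qed

text \<open>The dual form of \<open>Tor(C, C') = 0\<close>, inherited from the terms
  \<open>Hom(C, J n)\<close> along the bounded dual of \<open>W\<close>.\<close>

lemma acyclic_dual_C':
 assumes I: "baer R I"
 shows "C.acyclic (Hom R C' I)"
proof -
 have "C.acyclic (Hom R (W (Suc n)) I)" for n
  by(rule C.acyclic_dual_of_hom[OF inj I, where u = "%x. x" and v = "%x. x"]) (auto intro: lmap_ident[OF WM])
 hence "C.acyclic (Hom R (W 0) I)"
  using C.bounded_resolution_lift_acyclic[OF dual_left_exact[OF W I] bounded_dual[OF bdW WM baer_module[OF I]]] by blast
 thus ?thesis by(simp add: J0)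
qed

text \<open>Through the pairing a cocycle in \<open>Hom(C', W)\<close> is a cocycle in
  \<open>Hom(D, J)\<close>, where it bounds because \<open>Ext(D, D)\<close> vanishes. Endomorphisms
  and self-extensions of \<open>C'\<close> are both reduced to \<open>D\<close> in this way.\<close>

lemma factor_through_coresolution:
 assumes \<phi>: "lmap R C' (W (Suc n)) \<phi>" and z: "!!u. u \<in> C' ==> post C (\<delta> (Suc n)) (\<phi> u) = \<zero>\<^sub>(W (Suc (Suc n)))"
 shows "\<exists>\<rho>\<in>Hom R D (J n). \<forall>u\<in>C'. \<forall>c\<in>C. \<phi> u c = \<delta> n (\<rho> (u c))"
proof -
 note l = rec_lmap[OF J]
 obtain \<gamma> where \<gamma>: "lmap R D (J (Suc n)) \<gamma>" "!!u c. u \<in> C' ==> c \<in> C ==> \<phi> u c = \<gamma> (u c)"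
  using pairing_surj[OF inj bilin_uncurry[OF \<phi> C.S_module JM]] by blast
 let ?\<gamma> = "\<lambda>x\<in>D. \<gamma> x"
 have \<gamma>m: "?\<gamma> \<in> (Hom R D (J (Suc n)))" by(rule hom_mem[OF \<gamma>(1)])
 have \<gamma>z: "\<delta> (Suc n) (\<gamma> x) = \<zero>\<^sub>(J (Suc (Suc n)))" if "x \<in> D" for x
 proof(rule pairing_inj[OF inj lmap_comp[OF \<gamma>(1) l] _ that])
  fix u c assume u: "u \<in> C'" and c: "c \<in> C"
  thus "\<delta> (Suc n) (\<gamma> (u c)) = \<zero>\<^sub>(J (Suc (Suc n)))"
  using fun_cong[OF z[OF u], of c] \<gamma>(2)[OF u c] by simp
 qed
 have "post D (\<delta> (Suc n)) ?\<gamma> = \<zero>\<^sub>(Hom R D (J (Suc (Suc n))))"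
  by(rule hom_eqI[OF lmap_in[OF rec_lmap[OF DJ] \<gamma>m] mod_zero_closed[OF module_hom_mod[OF D.S_module JM]]])
  (use \<gamma>z in auto)
 then obtain \<rho> where \<rho>: "\<rho> \<in> Hom R D (J n)" "post D (\<delta> n) \<rho> = ?\<gamma>"
  using rec_exact[OF DJ \<gamma>m] by blast
 have "\<phi> u c = \<delta> n (\<rho> (u c))" if "u \<in> C'" "c \<in> C" for u c
  using fun_cong[OF \<rho>(2), of "u c"] \<gamma>(2)[OF that] hom_closed[OF that] by simp
 with \<rho>(1) show ?thesis by blast
qed

lemma homothety_C':
 assumes f: "lmap R C' C' f"
 shows "\<exists>r\<in>R. \<forall>u\<in>C'. f u = r \<odot>\<^sub>C' u"
proof -
 have l0: "lmap R C' (W (Suc 0)) (post C (\<delta> 0))" using rec_lmap[OF W, of 0] J0 by simp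
 have z: "post C (\<delta> (Suc 0)) (post C (\<delta> 0) (f u)) = \<zero>\<^sub>(W (Suc (Suc 0)))" if "u \<in> C'" for u
  using rec_zero[OF W, of "f u" 0] lmap_in[OF f that] J0 by simp
 \<comment> \<open>Place zero of the preceding lemma: as \<open>J 0 = D\<close>, the map
   \<open>\<rho>\<close> is an endomorphism of \<open>D\<close>, hence multiplication by some
   \<open>r\<close>.\<close>
 obtain \<rho> where \<rho>: "\<rho> \<in> Hom R D (J 0)"
  "!!u c. u \<in> C' ==> c \<in> C ==> post C (\<delta> 0) (f u) c = \<delta> 0 (\<rho> (u c))"
  using factor_through_coresolution[OF lmap_comp[OF f l0] z] by blast
 have \<rho>l: "lmap R D D \<rho>" using hom_lmap[OF \<rho>(1) D.S_module JM] J0 by simp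
 obtain r where r: "r \<in> R" "!!x. x \<in> D ==> \<rho> x = r \<odot>\<^sub>D x" using D.homothety[OF \<rho>l] by blast
 have "f u = r \<odot>\<^sub>C' u" if u: "u \<in> C'" for u
 proof(rule hom_eqI[OF lmap_in[OF f u] mod_smult_closed[OF C'_module r(1) u]])
  fix c assume c: "c \<in> C"
  have uc: "u c \<in> D" using hom_closed[OF u c] .
  have fuc: "f u c \<in> D" using hom_closed[OF lmap_in[OF f u] c] .
  have "\<delta> 0 (f u c \<ominus>\<^sub>D r \<odot>\<^sub>D (u c)) = \<zero>\<^sub>(J (Suc 0))"
  proof -
  have l: "lmap R D (J (Suc 0)) (\<delta> 0)" using rec_lmap[OF J, of 0] J0 by simp
  have m: "r \<odot>\<^sub>D (u c) \<in> D" using r(1) uc by(simp add: modD[OF D.S_module])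
  have "\<delta> 0 (f u c) = \<delta> 0 (r \<odot>\<^sub>D (u c))" using \<rho>(2)[OF u c] r(2)[OF uc] c by simp
  thus ?thesis using lmap_minus[OF l fuc m] lmap_in[OF l m] by(simp add: modD[OF JM])
  qed
  hence "f u c \<ominus>\<^sub>D r \<odot>\<^sub>D (u c) = \<zero>\<^sub>D"
  using rec_inj[OF J] fuc uc r(1) by(simp add: J0 modD[OF D.S_module])
  thus "f u c = (r \<odot>\<^sub>C' u) c"
  using fuc uc r(1) c by(simp add: mod_minus_eq_zero[OF D.S_module] modD[OF D.S_module])
 qed
 with r(1) show ?thesis by blast
qed

text \<open>An \<open>r\<close> that kills \<open>C'\<close> kills all values \<open>u c\<close>,
  hence all of \<open>D\<close> by \<open>pairing_inj\<close>. Composition with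
  \<open>\<delta> 0\<close> supplies the injective target which that lemma requires.\<close>

lemma faithful_C': "faithful R C'"
 unfolding faithful_def
proof(intro ballI impI)
 fix r assume r: "r \<in> R" and z: "\<forall>u\<in>C'. r \<odot>\<^sub>C' u = \<zero>\<^sub>C'"
 have l: "lmap R D (J (Suc 0)) (\<delta> 0)" using rec_lmap[OF J, of 0] J0 by simp
 have "r \<odot>\<^sub>D x = \<zero>\<^sub>D" if x: "x \<in> D" for x
 proof -
  have "r \<odot>\<^sub>(J (Suc 0)) \<delta> 0 x = \<zero>\<^sub>(J (Suc 0))"
  proof(rule pairing_inj[OF inj lmap_scale[OF l r] _ x])
  fix u c assume u: "u \<in> C'" and c: "c \<in> C"
  have "r \<odot>\<^sub>D (u c) = \<zero>\<^sub>D" using fun_cong[OF bspec[OF z u], of c] c by simp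
  thus "r \<odot>\<^sub>(J (Suc 0)) \<delta> 0 (u c) = \<zero>\<^sub>(J (Suc 0))"
  using lmap_smult[OF l r hom_closed[OF u c]] lmap_zero[OF l] by simp
  qed
  hence "\<delta> 0 (r \<odot>\<^sub>D x) = \<zero>\<^sub>(J (Suc 0))" using lmap_smult[OF l r x] by simp
  thus ?thesis using rec_inj[OF J] r x by(simp add: J0 modD[OF D.S_module])
 qed
 thus "r = \<zero>\<^sub>R" using D.faithful r unfolding faithful_def by blast
qed

lemma C'_noeth: "noeth R C'"
proof -
 have nD: "noeth R D" by(rule noeth_fin_gen[OF D.S_module noeth D.S_fin_gen])
 obtain A where A: "finite A" "A \<subseteq> carrier C" "carrier C = mspan R C A" using C.S_fin_gen by(auto simp: fin_gen_def)
 have "fin_gen R C' K" if K: "submodule K R C'" for K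
 proof(rule fin_gen_joint[OF A(1) nD C'_module _ K])
  show "lmap R C' D (%u. u a)" if "a \<in> A" for a
  by(rule lmap_eval[OF C.S_module D.S_module]) (use that A(2) in auto)
  fix u assume u: "u \<in> K" and z: "!!a. a \<in> A ==> u a = \<zero>\<^sub>D"
  have uC: "u \<in> C'" using submodule_sub[OF K C'_module u] .
  note ul = hom_lmap[OF uC C.S_module D.S_module]
  have "mspan R C A \<subseteq> kern C D u"
  by(rule mspan_minimal[OF submodule_kern[OF ul] C.S_module]) (use z A(2) in \<open>auto simp: kern_def\<close>)
  thus "u = \<zero>\<^sub>C'"
  using A(3) by(intro hom_eqI[OF uC mod_zero_closed[OF C'_module]]) (auto simp: kern_def)
 qed
 thus ?thesis unfolding noeth_def using C'_module by blast
qed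

text \<open>The point left is self-acyclicity. Modules \<open>Hom(C, K)\<close> with
  \<open>K\<close> injective are acyclic for \<open>C'\<close>, and
  \<open>bounded_coresolution_acyclic\<close> carries this along \<open>W\<close> down to
  \<open>W 0 = C'\<close>.\<close>

lemma semidual_C': "EX (G :: nat => ('a, nat => 'a) module) d e. semidual R C' G d e"
proof -
 obtain G :: "nat => ('a, nat => 'a) module" and d e where "fp_res R C' G d e"
  using exists_fp_res[OF C.R_cring noeth C'_noeth] by blast
 then interpret G: fp_res R C' G d e .
 note GM = fgproj_module[OF G.F]
 \<comment> \<open>Exchange of arguments identifies \<open>Hom(G, Hom(C, K))\<close> with
   \<open>Hom(C, Hom(G, K))\<close>. The sequence \<open>Hom(G, K)\<close> consists of injectives
   and begins with \<open>Hom(C', K)\<close>, which \<open>acyclic_dual_C'\<close> shows to be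
   acyclic for \<open>C\<close>.\<close>
 have acJ: "G.acyclic (Hom R C K)" if K: "baer R K" for K :: "('a,'m) module"
 proof(rule G.acyclicI)
  note KM = baer_module[OF K]
  show "module R (Hom R C K)" using C.S_module KM by auto
  fix n \<phi> assume \<phi>: "lmap R (G (Suc n)) (Hom R C K) \<phi>"
  and z: "!!x. x \<in> (G (Suc (Suc n))) ==> \<phi> (d (Suc n) x) = \<zero>\<^sub>(Hom R C K)"
  let ?U = "%n. Hom R (G n) K" let ?\<delta> = "%n. pre (G (Suc n)) (d n)"
  have UM: "module R (?U n)" for n using GM KM by auto
  have l: "lmap R (?U n) (?U (Suc n)) (?\<delta> n)" for n by(rule lmap_pre[OF G.d KM])
  have zero_iff: "?\<delta> n f = \<zero>\<^sub>(?U (Suc n)) \<longleftrightarrow> (\<forall>x\<in>(G (Suc n)). f (d n x) = \<zero>\<^sub>K)" if f: "f \<in> (?U n)" for n f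
  proof
  show "\<forall>x\<in>(G (Suc n)). f (d n x) = \<zero>\<^sub>K" if "?\<delta> n f = \<zero>\<^sub>(?U (Suc n))"
  using fun_cong[OF that] by(metis pre_apply hom_apply(1))
  show "?\<delta> n f = \<zero>\<^sub>(?U (Suc n))" if "\<forall>x\<in>(G (Suc n)). f (d n x) = \<zero>\<^sub>K"
  by(rule hom_eqI[OF lmap_in[OF l f] mod_zero_closed[OF UM]]) (use that in auto)
  qed
  have ex: "?\<delta> (Suc n) f = \<zero>\<^sub>(?U (Suc (Suc n))) \<longleftrightarrow> (\<exists>g\<in>(?U n). ?\<delta> n g = f)" if f: "f \<in> (?U (Suc n))" for n f
  proof
  assume "?\<delta> (Suc n) f = \<zero>\<^sub>(?U (Suc (Suc n)))"
  hence fz: "f (d (Suc n) x) = \<zero>\<^sub>K" if "x \<in> (G (Suc (Suc n)))" for x using zero_iff[OF f] that by blast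
  have "EX h. lmap R (G n) K h & (\<forall>x\<in>(G (Suc n)). h (d n x) = f x)"
  by(rule baer_extend[OF K G.d hom_lmap[OF f GM KM]]) (use fz G.d_exact in blast)
  then obtain h where h: "lmap R (G n) K h" "!!x. x \<in> (G (Suc n)) ==> h (d n x) = f x" by blast
  have "?\<delta> n (\<lambda>x\<in>(G n). h x) = f"
  by(rule hom_eqI[OF lmap_in[OF l hom_mem[OF h(1)]] f]) (use h(2) lmap_in[OF G.d] in auto)
  thus "\<exists>g\<in>(?U n). ?\<delta> n g = f" using hom_mem[OF h(1)] by blast
  next
  assume "\<exists>g\<in>(?U n). ?\<delta> n g = f"
  then obtain g where g: "g \<in> (?U n)" "?\<delta> n g = f" by blast
  thus "?\<delta> (Suc n) f = \<zero>\<^sub>(?U (Suc (Suc n)))"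
  unfolding zero_iff[OF f] using lmap_in[OF G.d] G.d_d lmap_zero[OF hom_lmap[OF g(1) GM KM]] by auto
  qed
  \<comment> \<open>This first kernel is \<open>Hom(C', K)\<close>, embedded by
    \<open>pre (G 0) e\<close>.\<close>
  let ?K0 = "restr_mod (?U 0) (kern (?U 0) (?U (Suc 0)) (?\<delta> 0))"
  have K0: "C.acyclic ?K0"
  proof -
  note s = submodule_kern[OF l[of 0]]
  have p: "lmap R (Hom R C' K) ?K0 (pre (G 0) e)"
  by(rule lmap_restr_cod[OF lmap_pre[OF G.e KM] s])
  (use lmap_in[OF lmap_pre[OF G.e KM]] lmap_in[OF G.d] G.e_d lmap_zero[OF hom_lmap[OF _ C'_module KM]] zero_iff[of _ 0]
  in \<open>auto simp: kern_def\<close>)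
  have "EX k. lmap R ?K0 (Hom R C' K) k & (\<forall>a\<in>Hom R C' K. k (pre (G 0) e a) = a) & (\<forall>b\<in>?K0. pre (G 0) e (k b) = b)"
  proof(rule lmap_inverse[OF p])
  fix f assume f: "f \<in> ?K0"
  hence f': "f \<in> (?U 0)" "!!x. x \<in> (G (Suc 0)) ==> f (d 0 x) = \<zero>\<^sub>K"
  using zero_iff[of f 0] by(auto simp: kern_def)
  have "EX h. lmap R C' K h & (\<forall>x\<in>(G 0). h (e x) = f x)"
  by(rule lmap_factor[OF G.e hom_lmap[OF f'(1) GM KM] G.e_surj]) (use f'(2) G.e_exact in auto)
  then obtain h where h: "lmap R C' K h" "!!x. x \<in> (G 0) ==> h (e x) = f x" by blast
  have "pre (G 0) e (\<lambda>u\<in>C'. h u) = f"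
  by(rule hom_eqI[OF lmap_in[OF lmap_pre[OF G.e KM] hom_mem[OF h(1)]] f'(1)]) (use h(2) lmap_in[OF G.e] in auto)
  thus "\<exists>a\<in>Hom R C' K. pre (G 0) e a = f" using hom_mem[OF h(1)] by blast
  next
  fix a assume a: "a \<in> Hom R C' K" and az: "pre (G 0) e a = \<zero>\<^sub>?K0"
  show "a = \<zero>\<^sub>(Hom R C' K)"
  proof(rule hom_eqI[OF a mod_zero_closed[OF module_hom_mod[OF C'_module KM]]])
  fix u assume u: "u \<in> C'"
  obtain x where x: "x \<in> (G 0)" "e x = u" using G.e_surj[OF u] by blast
  thus "a u = \<zero>\<^sub>(Hom R C' K) u" using fun_cong[OF az, of x] u by simp
  qed
  qed
  thus ?thesis using C.acyclic_retract[OF acyclic_dual_C'[OF K] _ p] by blast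
  qed
  have acU: "C.acyclic (?U n)" for n
  proof -
  obtain B p c where "loc_basis R (G n) (B::nat set) p c" using fgproj_loc_basis[OF G.F] by blast
  thus ?thesis by(intro C.acyclic_baer baer_hom[OF _ K])
  qed
  note \<phi>f = lmap_flip[OF \<phi> C.S_module KM]
  have "EX \<psi>. lmap R C (?U n) \<psi> & (\<forall>c\<in>C. ?\<delta> n (\<psi> c) = (\<lambda>w\<in>(G (Suc n)). \<phi> w c))"
  proof(rule C.coresolution_lift[of ?U ?\<delta>, OF l ex K0 acU \<phi>f])
  fix c assume c: "c \<in> C"
  show "?\<delta> (Suc n) (\<lambda>w\<in>(G (Suc n)). \<phi> w c) = \<zero>\<^sub>(?U (Suc (Suc n)))"
  unfolding zero_iff[OF lmap_in[OF \<phi>f c]] using z lmap_in[OF G.d] c by simp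
  qed
  then obtain \<psi> where \<psi>: "lmap R C (?U n) \<psi>" "!!c. c \<in> C ==> ?\<delta> n (\<psi> c) = (\<lambda>w\<in>(G (Suc n)). \<phi> w c)" by blast
  note \<psi>f = lmap_flip[OF \<psi>(1) GM KM]
  have "(\<lambda>c\<in>C. \<psi> c (d n x)) = \<phi> x" if x: "x \<in> (G (Suc n))" for x
  by(rule hom_eqI[OF lmap_in[OF \<psi>f lmap_in[OF G.d x]] lmap_in[OF \<phi> x]])
  (use fun_cong[OF \<psi>(2), of _ x] x in auto)
  with \<psi>f show "EX \<psi>. lmap R (G n) (Hom R C K) \<psi> & (\<forall>x\<in>(G (Suc n)). \<psi> (d n x) = \<phi> x)" by blast
 qed
 have "G.acyclic (W 0)"
 proof(rule G.bounded_coresolution_acyclic[OF W bdW])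
  show "G.acyclic (W (Suc n))" for n by(rule acJ[OF inj])
  fix n \<phi> assume \<phi>: "lmap R C' (W (Suc n)) \<phi>" and z: "!!u. u \<in> C' ==> post C (\<delta> (Suc n)) (\<phi> u) = \<zero>\<^sub>(W (Suc (Suc n)))"
  obtain \<rho> where \<rho>: "\<rho> \<in> Hom R D (J n)" "!!u c. u \<in> C' ==> c \<in> C ==> \<phi> u c = \<delta> n (\<rho> (u c))"
  using factor_through_coresolution[OF \<phi> z] by blast
  have \<psi>: "lmap R C' (W n) (post C \<rho>)" by(rule lmap_post[OF hom_lmap[OF \<rho>(1) D.S_module JM] C.S_module])
  have "post C (\<delta> n) (post C \<rho> u) = \<phi> u" if u: "u \<in> C'" for u
  by(rule hom_eqI[OF lmap_in[OF rec_lmap[OF W] lmap_in[OF \<psi> u]] lmap_in[OF \<phi> u]]) (use \<rho>(2)[OF u] in auto)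
  with \<psi> show "EX \<psi>. lmap R C' (W n) \<psi> & (\<forall>u\<in>C'. post C (\<delta> n) (\<psi> u) = \<phi> u)" by blast
 qed
 hence "semidual R C' G d e"
  by unfold_locales (use homothety_C' faithful_C' in \<open>auto simp: J0\<close>)
 thus ?thesis by blast
qed

section \<open>Exactness of Hom out of C and out of its dual\<close>

context
 fixes U :: "nat => ('a,'u) module" and \<tau> and K and I :: "nat => ('a,'i) module"
 assumes U: "right_exact_cores R U \<tau>" and bdU: "bounded_seq U K" and I: "!!n. baer R (I n)"
begin

text \<open>The key statement with \<open>D\<close> as \<open>S\<close>, \<open>C\<close> as
  \<open>S1\<close> and \<open>C'\<close> as \<open>S'\<close>. In \<open>hom_C_exact\<close> the
  last two are exchanged, which rests on \<open>semidual_C'\<close>.\<close>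

lemma hom_C'_exact:
 assumes "!!n. lmap R (U (Suc n)) (Hom R C (I n)) (u n)" "!!n. lmap R (Hom R C (I n)) (U (Suc n)) (v n)"
  "!!n x. x \<in> (U (Suc n)) ==> v n (u n x) = x" "!!n x. x \<in> Hom R C (I n) ==> u n (v n x) = x"
 shows "right_exact_cores R (%n. Hom R C' (U n)) (%n. post C' (\<tau> n))"
proof(rule D.hom_coresolution_exact[OF noeth C.semidual_axioms C'_module pairing _ _ _ U bdU I assms])
 show "\<gamma> x = \<zero>\<^sub>(char_mod R)" if "lmap R D (char_mod R) \<gamma>"
  "!!f y. f \<in> C' ==> y \<in> C ==> \<gamma> (f y) = \<zero>\<^sub>(char_mod R)" "x \<in> D" for \<gamma> x
  by(rule pairing_inj[OF baer_char_mod[OF C.R_cring] that(1) _ that(3)]) (use that(2) in auto)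
 show "\<gamma> x = \<zero>\<^sub>I" if "baer R I" "lmap R D I \<gamma>"
  "!!f y. f \<in> C' ==> y \<in> C ==> \<gamma> (f y) = \<zero>\<^sub>I" "x \<in> D" for I :: "('a,'i) module" and \<gamma> x
  by(rule pairing_inj[OF that(1,2) _ that(4)]) (use that(3) in auto)
qed (rule pairing_surj)

lemma hom_C_exact:
 assumes "!!n. lmap R (U (Suc n)) (Hom R C' (I n)) (u n)" "!!n. lmap R (Hom R C' (I n)) (U (Suc n)) (v n)"
  "!!n x. x \<in> (U (Suc n)) ==> v n (u n x) = x" "!!n x. x \<in> Hom R C' (I n) ==> u n (v n x) = x"
 shows "right_exact_cores R (%n. Hom R C (U n)) (%n. post C (\<tau> n))"
proof -
 obtain G :: "nat => ('a, nat => 'a) module" and d e where sd: "semidual R C' G d e" using semidual_C' by blast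
 show ?thesis
 proof(rule D.hom_coresolution_exact[OF noeth sd C.S_module bilin_flip[OF pairing] _ _ _ U bdU I assms])
  show "EX \<gamma>. lmap R D I \<gamma> & (\<forall>f\<in>C. \<forall>y\<in>C'. B f y = \<gamma> (y f))"
  if "baer R I" "bilin R C C' I B" for I :: "('a,'i) module" and B
  using pairing_surj[OF that(1) bilin_flip[OF that(2)]] by blast
  show "\<gamma> x = \<zero>\<^sub>(char_mod R)" if "lmap R D (char_mod R) \<gamma>"
  "!!f y. f \<in> C ==> y \<in> C' ==> \<gamma> (y f) = \<zero>\<^sub>(char_mod R)" "x \<in> D" for \<gamma> x
  by(rule pairing_inj[OF baer_char_mod[OF C.R_cring] that(1) _ that(3)]) (use that(2) in auto)
  show "\<gamma> x = \<zero>\<^sub>I" if "baer R I" "lmap R D I \<gamma>"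
  "!!f y. f \<in> C ==> y \<in> C' ==> \<gamma> (y f) = \<zero>\<^sub>I" "x \<in> D" for I :: "('a,'i) module" and \<gamma> x
  by(rule pairing_inj[OF that(1,2) _ that(4)]) (use that(3) in auto)
 qed
qed

end

end

section \<open>Quotient modules\<close>

lemma coset_mem: "y \<in> K +>\<^sub>M x \<longleftrightarrow> (\<exists>h\<in>K. y = h \<oplus>\<^sub>M x)"
 by(auto simp: a_r_coset_def')

lemma coset_eq_iff:
 assumes M: "module R M" and K: "submodule K R M" and x: "x \<in> M" and y: "y \<in> M"
 shows "K +>\<^sub>M x = K +>\<^sub>M y \<longleftrightarrow> x \<ominus>\<^sub>M y \<in> K"
proof
 note [simp] = modD[OF M] submodule_sub[OF K M]
 assume e: "K +>\<^sub>M x = K +>\<^sub>M y"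
 have "\<zero>\<^sub>M \<oplus>\<^sub>M x \<in> K +>\<^sub>M x" using submodule_zero[OF K M] coset_mem by metis
 then obtain h where h: "h \<in> K" "x = h \<oplus>\<^sub>M y" using e x coset_mem[of x M K y] by auto
 hence "x \<ominus>\<^sub>M y = h" using y by(simp add: a_minus_def mod_assoc[OF M])
 thus "x \<ominus>\<^sub>M y \<in> K" using h by simp
next
 note [simp] = modD[OF M] submodule_sub[OF K M]
 assume d: "x \<ominus>\<^sub>M y \<in> K"
 have "h \<oplus>\<^sub>M x = (h \<oplus>\<^sub>M (x \<ominus>\<^sub>M y)) \<oplus>\<^sub>M y" if "h \<in> K" for h
  using that x y by(simp add: mod_assoc[OF M])
 hence 1: "K +>\<^sub>M x \<subseteq> K +>\<^sub>M y"
  using submodule_add[OF K M _ d] unfolding subset_iff coset_mem by blast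
 have "h \<oplus>\<^sub>M y = (h \<oplus>\<^sub>M \<ominus>\<^sub>M (x \<ominus>\<^sub>M y)) \<oplus>\<^sub>M x" if "h \<in> K" for h
  using that x y by(simp add: mod_assoc[OF M] a_minus_def mod_neg_distrib[OF M] mod_comm[OF M, of "\<ominus>\<^sub>M x" y])
 hence "K +>\<^sub>M y \<subseteq> K +>\<^sub>M x"
  using submodule_add[OF K M _ submodule_neg[OF K M d]] unfolding subset_iff coset_mem by blast
 with 1 show "K +>\<^sub>M x = K +>\<^sub>M y" by blast
qed

lemma quot_mod_carrier: "carrier (quot_mod M K) = (%x. K +>\<^sub>M x) ` carrier M"
 by(auto simp: quot_mod_def A_RCOSETS_def')

lemma quot_map:
 assumes M: "module R M" and K: "submodule K R M"
 shows "lmap R M (quot_mod M K) (%x. K +>\<^sub>M x)"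
  and "!!x. x \<in> M ==> K +>\<^sub>M x = \<zero>\<^sub>(quot_mod M K) \<longleftrightarrow> x \<in> K"
proof -
 note [simp] = modD[OF M] submodule_sub[OF K M]
 let ?q = "%x. K +>\<^sub>M x"
 let ?Q = "quot_mod M K"
 note R = module_cring[OF M]
 have zero: "?q \<zero>\<^sub>M = K" by(auto simp: a_r_coset_def')
 have add: "?q x \<oplus>\<^sub>?Q ?q y = ?q (x \<oplus>\<^sub>M y)" if xy: "x \<in> M" "y \<in> M" for x y
 proof -
  have "?q x <+>\<^sub>M ?q y = ?q (x \<oplus>\<^sub>M y)"
  proof(rule equalityI; rule subsetI)
  fix z assume "z \<in> ?q x <+>\<^sub>M ?q y"
  then obtain h k where "h \<in> K" "k \<in> K" "z = (h \<oplus>\<^sub>M x) \<oplus>\<^sub>M (k \<oplus>\<^sub>M y)"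
  unfolding set_add_def' a_r_coset_def' by blast
  thus "z \<in> ?q (x \<oplus>\<^sub>M y)"
  unfolding coset_mem using xy submodule_add[OF K M]
  by(intro bexI[of _ "h \<oplus>\<^sub>M k"]) (simp_all add: mod_add_add_swap[OF M])
  next
  fix z assume "z \<in> ?q (x \<oplus>\<^sub>M y)"
  then obtain h where h: "h \<in> K" "z = h \<oplus>\<^sub>M (x \<oplus>\<^sub>M y)" unfolding coset_mem by blast
  hence "z = (h \<oplus>\<^sub>M x) \<oplus>\<^sub>M (\<zero>\<^sub>M \<oplus>\<^sub>M y)" using xy by(simp add: mod_assoc[OF M])
  thus "z \<in> ?q x <+>\<^sub>M ?q y"
  unfolding set_add_def' a_r_coset_def' using h(1) submodule_zero[OF K M] by blast
  qed
  thus ?thesis unfolding quot_mod_def by simp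
 qed
 have smult: "r \<odot>\<^sub>?Q ?q x = ?q (r \<odot>\<^sub>M x)" if rx: "r \<in> R" "x \<in> M" for r x
 proof -
  have "?q (r \<odot>\<^sub>M z) = ?q (r \<odot>\<^sub>M x)" if z: "z \<in> ?q x" for z
  proof -
  obtain h where h: "h \<in> K" "z = h \<oplus>\<^sub>M x" using z coset_mem by metis
  have "r \<odot>\<^sub>M z \<ominus>\<^sub>M r \<odot>\<^sub>M x = r \<odot>\<^sub>M h"
  using h rx by(simp add: mod_smult_add[OF M] a_minus_def mod_assoc[OF M])
  thus ?thesis
  using h rx submodule_smult[OF K M rx(1) h(1)] by(subst coset_eq_iff[OF M K]) auto
  qed
  moreover have "\<zero>\<^sub>M \<oplus>\<^sub>M x \<in> ?q x" using submodule_zero[OF K M] coset_mem by metis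
  ultimately have "(\<Union>z\<in>?q x. ?q (r \<odot>\<^sub>M z)) = ?q (r \<odot>\<^sub>M x)" by blast
  thus ?thesis by(simp add: quot_mod_def)
 qed
 have z: "\<zero>\<^sub>?Q = ?q \<zero>\<^sub>M" unfolding zero by(simp add: quot_mod_def)
 have o: "\<one>\<^sub>R \<in> R" "\<zero>\<^sub>R \<in> R" using R by(simp_all add: cring.cring_simprules)
 have Q: "module R ?Q"
  by(rule moduleI'[OF R])
  (auto simp: quot_mod_carrier add smult z mod_assoc[OF M] mod_smult_add[OF M] mod_add_smult[OF M]
  mod_mult_smult[OF M] cring_add_closed[OF R] cring_mult_closed[OF R] o mod_ac[OF M])
 show "lmap R M ?Q ?q"
  by(rule lmapI[OF M Q]) (auto simp: quot_mod_carrier add smult)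
 show "?q x = \<zero>\<^sub>?Q \<longleftrightarrow> x \<in> K" if "x \<in> M" for x
  unfolding z using that by(subst coset_eq_iff[OF M K]) auto
qed

section \<open>Transport to another type\<close>

text \<open>Transport of structure along an injection. Since \<open>projective\<close> and
  \<open>injective\<close> test modules over one type only, ideals of \<open>R\<close> and free
  modules are copied into that type before they can serve as tests.\<close>

definition copy_mod :: "('m => 'n) => ('a,'m) module => ('a,'n) module" where
 "copy_mod j M = (let i = inv_into (carrier M) j in \<lparr>carrier = j ` carrier M, monoid.mult = undefined, one = undefined,
  ring.zero = j \<zero>\<^sub>M, ring.add = (%x y. j (i x \<oplus>\<^sub>M i y)), module.smult = (%r x. j (r \<odot>\<^sub>M i x))\<rparr>)"

lemma copy_mod_maps:
 assumes M: "module R M" and j: "inj_on j (carrier M)"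
 shows "lmap R M (copy_mod j M) j" "lmap R (copy_mod j M) M (inv_into (carrier M) j)"
proof -
 note [simp] = modD[OF M] inv_into_f_f[OF j]
 have [simp]: "carrier (copy_mod j M) = j ` carrier M" "\<zero>\<^sub>(copy_mod j M) = j \<zero>\<^sub>M"
  "!!x y. x \<in> M ==> y \<in> M ==> j x \<oplus>\<^sub>(copy_mod j M) j y = j (x \<oplus>\<^sub>M y)"
  "!!r x. x \<in> M ==> r \<odot>\<^sub>(copy_mod j M) j x = j (r \<odot>\<^sub>M x)"
  by(auto simp: copy_mod_def Let_def)
 note R = module_cring[OF M]
 have C: "module R (copy_mod j M)"
  by(rule moduleI'[OF R])
  (auto simp: mod_assoc[OF M] mod_smult_add[OF M] mod_add_smult[OF M]
  mod_mult_smult[OF M] cring_add_closed[OF R] cring_mult_closed[OF R] intro: arg_cong[where f = j, OF mod_comm[OF M]])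
 show "lmap R M (copy_mod j M) j" by(rule lmapI[OF M C]) auto
 show "lmap R (copy_mod j M) M (inv_into (carrier M) j)" by(rule lmapI[OF C M]) auto
qed

text \<open>An infinite type is equinumerous with its square. Folding a pairing function codes lists
  of a fixed length, and the length is coded alongside.\<close>

lemma list_injection:
 assumes "infinite (UNIV :: 'm set)"
 shows "EX f :: 'm list => 'm. inj f"
proof -
 obtain p :: "'m \<times> 'm => 'm" where "bij_betw p (UNIV \<times> UNIV) UNIV"
  using card_of_Times_same_infinite[OF assms] unfolding card_of_ordIso[symmetric] by blast
 hence p: "inj p" by(auto simp: bij_betw_def UNIV_Times_UNIV)
 obtain \<nu> :: "nat => 'm" where \<nu>: "inj \<nu>" using assms infinite_countable_subset by blast
 define g where "g xs = foldr (%x y. p (x, y)) xs (undefined :: 'm)" for xs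
 have g: "xs = ys" if "length xs = length ys" "g xs = g ys" for xs ys
  using that by(induction xs ys rule: list_induct2) (auto simp: g_def dest!: injD[OF p])
 have "inj (%xs. p (\<nu> (length xs), g xs))"
 proof(rule injI)
  fix xs ys assume "p (\<nu> (length xs), g xs) = p (\<nu> (length ys), g ys)"
  hence "\<nu> (length xs) = \<nu> (length ys)" "g xs = g ys" using injD[OF p] by blast+
  thus "xs = ys" using injD[OF \<nu>] g by blast
 qed
 thus ?thesis by blast
qed

text \<open>A finitely supported function is recovered from the list of its support with the values.
  Decoding compares sets of entries, so the choice of the enumeration does not matter.\<close>

lemma free_mod_injection:
 fixes R :: "('a,'r) ring_scheme"
 assumes inf: "infinite (UNIV :: 'm set)" and \<iota>: "inj_on (\<iota> :: 'a => 'm) (carrier R)"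
 shows "EX j :: ('m => 'a) => 'm. inj_on j (carrier (free_mod R B))"
proof -
 obtain l :: "'m list => 'm" where l: "inj l" using list_injection[OF inf] by blast
 define xs where "xs f = (SOME xs. set xs = {i. f i ~= \<zero>\<^sub>R})" for f :: "'m => 'a"
 define j where "j f = l (map (%i. l [i, \<iota> (f i)]) (xs f))" for f
 have xs: "set (xs f) = {i. f i ~= \<zero>\<^sub>R}" if "f \<in> free_mod R B" for f
  unfolding xs_def by(rule someI_ex) (use that finite_list in \<open>auto simp: free_mod_simps\<close>)
 have half: "g i = f i" if f: "f \<in> free_mod R B" and g: "g \<in> free_mod R B"
  and e: "j f = j g" and i: "f i ~= \<zero>\<^sub>R" for f g i
 proof -
  have "map (%i. l [i, \<iota> (f i)]) (xs f) = map (%i. l [i, \<iota> (g i)]) (xs g)"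
  using e injD[OF l] unfolding j_def by blast
  hence "(%i. l [i, \<iota> (f i)]) ` set (xs f) = (%i. l [i, \<iota> (g i)]) ` set (xs g)"
  by(metis list.set_map)
  hence "l [i, \<iota> (f i)] \<in> (%i. l [i, \<iota> (g i)]) ` set (xs g)" using i xs[OF f] by blast
  then obtain k where "l [i, \<iota> (f i)] = l [k, \<iota> (g k)]" by blast
  hence "\<iota> (f i) = \<iota> (g i)" using injD[OF l, of "[i, \<iota> (f i)]" "[k, \<iota> (g k)]"] by auto
  thus ?thesis using inj_onD[OF \<iota>] f g by(auto simp: free_mod_simps)
 qed
 have "inj_on j (carrier (free_mod R B))"
 proof(rule inj_onI, rule ext)
  fix f g i assume fg: "f \<in> free_mod R B" "g \<in> free_mod R B" "j f = j g"
  show "f i = g i" using half[OF fg] half[OF fg(2,1) fg(3)[symmetric]] by metis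
 qed
 thus ?thesis by blast
qed

text \<open>Ideals and \<open>reg_mod R\<close> are copied along \<open>\<iota>\<close>. The
  inclusion of an ideal then is an admissible test, and the extension evaluated at one is the
  element that Baer's criterion asks for.\<close>

lemma baer_injective:
 fixes R :: "('a,'r) ring_scheme" and I :: "('a,'m) module"
 assumes \<iota>: "inj_on (\<iota> :: 'a => 'm) (carrier R)" and I: "injective R I"
 shows "baer R I"
 unfolding baer_def
proof(intro conjI allI impI)
 show IM: "module R I" using I by(simp add: injective_def)
 note R = module_cring[OF IM] and RM = module_reg_mod[OF module_cring[OF IM]]
 fix A f assume "submodule A R (reg_mod R) & lmap R (restr_mod (reg_mod R) A) I f"
 hence A: "submodule A R (reg_mod R)" and f: "lmap R (restr_mod (reg_mod R) A) I f" by auto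
 let ?A = "restr_mod (reg_mod R) A"
 have Ac: "a \<in> R" if "a \<in> A" for a using submodule_sub[OF A RM that] by simp
 have \<iota>A: "inj_on \<iota> (carrier ?A)" using inj_on_subset[OF \<iota>] Ac by auto
 note cA = copy_mod_maps[OF module_restr_mod[OF RM A] \<iota>A]
 have \<iota>R: "inj_on \<iota> (carrier (reg_mod R))" using \<iota> by simp
 note cR = copy_mod_maps[OF RM \<iota>R]
 let ?g = "%x. \<iota> (inv_into (carrier ?A) \<iota> x)"
 have incl: "lmap R ?A (reg_mod R) (%x. x)" by(rule lmap_restr_dom[OF lmap_ident[OF RM] A])
 have g: "lmap R (copy_mod \<iota> ?A) (copy_mod \<iota> (reg_mod R)) ?g"
  by(rule lmap_comp[OF cA(2) lmap_comp[OF incl cR(1)]])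
 have cAc: "carrier (copy_mod \<iota> ?A) = \<iota> ` A" by(simp add: copy_mod_def Let_def)
 have ginj: "inj_on ?g (carrier (copy_mod \<iota> ?A))"
  unfolding cAc using inv_into_f_f[OF \<iota>A] by(auto simp: inj_on_def)
 note fA = lmap_comp[OF cA(2) f]
 have "\<exists>h\<in>lin_maps R (copy_mod \<iota> (reg_mod R)) I. \<forall>x\<in>(copy_mod \<iota> ?A). h (?g x) = f (inv_into (carrier ?A) \<iota> x)"
  using I g fA ginj unfolding injective_def lmap_def by blast
 then obtain h where h: "lmap R (copy_mod \<iota> (reg_mod R)) I h" "!!x. x \<in> \<iota> ` A ==> h (?g x) = f (inv_into (carrier ?A) \<iota> x)"
  using lmap_dom[OF cR(2)] IM unfolding cAc lmap_def by blast
 note h' = lmap_comp[OF cR(1) h(1)]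
 have one: "\<one>\<^sub>R \<in> R" using R by simp
 show "\<exists>e\<in>I. \<forall>a\<in>A. f a = a \<odot>\<^sub>I e"
 proof(intro bexI[of _ "h (\<iota> \<one>\<^sub>R)"] ballI)
  show "h (\<iota> \<one>\<^sub>R) \<in> I" using lmap_in[OF h'] one by simp
  fix a assume a: "a \<in> A"
  interpret cring R by(rule R)
  have "f a = h (\<iota> (a \<otimes>\<^sub>R \<one>\<^sub>R))" using h(2)[of "\<iota> a"] a inv_into_f_f[OF \<iota>A] Ac[OF a] by simp
  also have "\<dots> = a \<odot>\<^sub>I h (\<iota> \<one>\<^sub>R)" using lmap_smult[OF h', of a "\<one>\<^sub>R"] Ac[OF a] by simp
  finally show "f a = a \<odot>\<^sub>I h (\<iota> \<one>\<^sub>R)" .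
 qed
qed

section \<open>Projective modules\<close>

lemma loc_basis_free_mod:
 assumes R: "cring R"
 shows "loc_basis R (free_mod R B) B (free_gen R) (%b f. f b)"
 unfolding loc_basis_def
proof(intro conjI ballI)
 note FM = module_free_mod[OF R, of B] and RM = module_reg_mod[OF R]
 interpret cring R by fact
 fix f assume f: "f \<in> free_mod R B"
 let ?s = "{b \<in> B. f b ~= \<zero>\<^sub>R}"
 have fc: "f b \<in> R" for b using f by(simp add: free_mod_simps)
 show fin: "finite ?s" using f by(auto simp: free_mod_simps intro: finite_subset[of _ "{i. f i ~= \<zero>\<^sub>R}"])
 have t: "f b \<odot>\<^sub>(free_mod R B) free_gen R b \<in> free_mod R B" if "b \<in> B" for b
  using fc free_gen_mem[OF R that] by(simp add: modD[OF FM])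
 show "f = finsum (free_mod R B) (%b. f b \<odot>\<^sub>(free_mod R B) free_gen R b) ?s"
 proof
  fix i
  have "finsum (free_mod R B) (%b. f b \<odot>\<^sub>(free_mod R B) free_gen R b) ?s i =
  finsum (reg_mod R) (%b. (f b \<odot>\<^sub>(free_mod R B) free_gen R b) i) ?s"
  by(rule lmap_finsum[OF free_coord[OF R] fin]) (use t in auto)
  also have "\<dots> = finsum (reg_mod R) (%b. if b = i then f i else \<zero>\<^sub>R) ?s"
  by(rule mod_finsum_cong[OF RM]) (use fc in \<open>auto simp: free_mod_simps free_gen_def\<close>)
  also have "\<dots> = f i"
  proof(cases "i \<in> ?s")
  case True
  have "finsum (reg_mod R) (%b. if b = i then f i else \<zero>\<^sub>R) ?s = finsum (reg_mod R) (%b. if b = i then f i else \<zero>\<^sub>R) {i}"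
  by(rule mod_finsum_support[OF RM fin]) (use True fc in auto)
  also have "\<dots> = f i"
  using mod_finsum_insert[OF RM, of "{}" i "%b. if b = i then f i else \<zero>\<^sub>R"] fc
  by(simp add: mod_finsum_empty[OF RM])
  finally show ?thesis .
  next
  case False
  hence "f i = \<zero>\<^sub>R" using f by(auto simp: free_mod_simps)
  thus ?thesis using mod_finsum_zero[OF RM, of ?s "%b. if b = i then f i else \<zero>\<^sub>R"] by simp
  qed
  finally show "f i = finsum (free_mod R B) (%b. f b \<odot>\<^sub>(free_mod R B) free_gen R b) ?s i" by simp
 qed
qed (use R in \<open>auto intro: module_free_mod free_gen_mem free_coord\<close>)

lemma free_mod_extend:
 assumes Z: "module R Z" and y: "!!b. b \<in> B ==> y b \<in> Z"
 shows "EX f. lmap R (free_mod R B) Z f & (\<forall>b\<in>B. f (free_gen R b) = y b) &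
  (\<forall>x\<in>free_mod R B. f x = finsum Z (%b. x b \<odot>\<^sub>Z y b) {b \<in> B. x b ~= \<zero>\<^sub>R})"
proof(intro exI conjI ballI)
 note R = module_cring[OF Z]
 let ?f = "%x. finsum Z (%b. x b \<odot>\<^sub>Z y b) {b \<in> B. x b ~= \<zero>\<^sub>R}"
 show "lmap R (free_mod R B) Z ?f" by(rule loc_basis_map[OF loc_basis_free_mod[OF R] Z y])
 fix b assume b: "b \<in> B"
 let ?h = "%i. free_gen R b i \<odot>\<^sub>Z y i"
 have "finsum Z ?h {b} = finsum Z ?h {i \<in> B. free_gen R b i ~= \<zero>\<^sub>R}"
 proof(rule mod_finsum_support[OF Z])
  \<comment> \<open>The zero ring is an exception: there \<open>free_gen R b\<close> is zero and its
    support misses \<open>b\<close>, but all elements of \<open>Z\<close> are zero as well.\<close>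
  have "y b = \<zero>\<^sub>Z" if "\<one>\<^sub>R = \<zero>\<^sub>R"
  proof -
  have "y b = \<one>\<^sub>R \<odot>\<^sub>Z y b" using y[OF b] by(simp add: modD[OF Z])
  thus ?thesis unfolding that using y[OF b] by(simp add: modD[OF Z])
  qed
  thus "?h x = \<zero>\<^sub>Z" if "x \<in> {b} - {i \<in> B. free_gen R b i ~= \<zero>\<^sub>R}" for x
  using that b y by(auto simp: free_gen_def modD[OF Z])
 qed (use b y R in \<open>auto simp: free_gen_def modD[OF Z]\<close>)
 moreover have "finsum Z ?h {b} = y b"
  using mod_finsum_insert[OF Z, of "{}" b ?h] y[OF b] R by(simp add: mod_finsum_empty[OF Z] free_gen_def modD[OF Z])
 ultimately show "?f (free_gen R b) = y b" by simp
qed simp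

text \<open>The free module on the set \<open>P\<close> itself, copied into \<open>'m\<close>, maps
  onto \<open>P\<close>. Projectivity splits this map, and the coordinates of the splitting form the
  dual basis.\<close>

lemma projective_loc_basis:
 fixes R :: "('a,'r) ring_scheme" and P :: "('a,'m) module"
 assumes inf: "infinite (UNIV :: 'm set)" and \<iota>: "inj_on (\<iota> :: 'a => 'm) (carrier R)" and P: "projective R P"
 shows "EX c. loc_basis R P (carrier P) (%b. b) c"
proof -
 have PM: "module R P" using P by(simp add: projective_def)
 note R = module_cring[OF PM]
 let ?F = "free_mod R (carrier P)"
 note FM = module_free_mod[OF R, of "carrier P"]
 obtain \<sigma> where \<sigma>: "lmap R ?F P \<sigma>" "!!b. b \<in> P ==> \<sigma> (free_gen R b) = b"
  "!!x. x \<in> ?F ==> \<sigma> x = finsum P (%b. x b \<odot>\<^sub>P b) {b \<in> P. x b ~= \<zero>\<^sub>R}"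
  using free_mod_extend[OF PM, of "carrier P" "%b. b"] by auto
 obtain j :: "('m => 'a) => 'm" where j: "inj_on j (carrier ?F)" using free_mod_injection[OF inf \<iota>] by blast
 let ?i = "inv_into (carrier ?F) j"
 note cp = copy_mod_maps[OF FM j]
 note g = lmap_comp[OF cp(2) \<sigma>(1)]
 have surj: "(%x. \<sigma> (?i x)) ` carrier (copy_mod j ?F) = carrier P"
 proof
  show "(%x. \<sigma> (?i x)) ` carrier (copy_mod j ?F) \<subseteq> carrier P" using lmap_in[OF g] by blast
  show "carrier P \<subseteq> (%x. \<sigma> (?i x)) ` carrier (copy_mod j ?F)"
  proof
  fix b assume b: "b \<in> P"
  note m = free_gen_mem[OF R b]
  have "b = \<sigma> (?i (j (free_gen R b)))" using \<sigma>(2)[OF b] inv_into_f_f[OF j m] by simp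
  thus "b \<in> (%x. \<sigma> (?i x)) ` carrier (copy_mod j ?F)" using lmap_in[OF cp(1) m] by blast
  qed
 qed
 have "\<exists>h\<in>lin_maps R P (copy_mod j ?F). \<forall>x\<in>P. \<sigma> (?i (h x)) = x"
  using P g surj lmap_ident[OF PM] unfolding projective_def lmap_def by blast
 then obtain h where h: "lmap R P (copy_mod j ?F) h" "!!x. x \<in> P ==> \<sigma> (?i (h x)) = x"
  using PM lmap_cod[OF cp(1)] unfolding lmap_def by blast
 note k = lmap_comp[OF h(1) cp(2)]
 have "loc_basis R P (carrier P) (%b. b) (%b x. ?i (h x) b)"
  unfolding loc_basis_def
 proof(intro conjI ballI PM)
  show "lmap R P (reg_mod R) (%x. ?i (h x) b)" for b by(rule lmap_comp[OF k free_coord[OF R]])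
  fix x assume x: "x \<in> P"
  have m: "?i (h x) \<in> ?F" by(rule lmap_in[OF k x])
  show "finite {b \<in> P. ?i (h x) b ~= \<zero>\<^sub>R}"
  using m by(auto simp: free_mod_simps intro: finite_subset[of _ "{b. ?i (h x) b ~= \<zero>\<^sub>R}"])
  show "x = finsum P (%b. ?i (h x) b \<odot>\<^sub>P b) {b \<in> P. ?i (h x) b ~= \<zero>\<^sub>R}"
  using \<sigma>(3)[OF m] h(2)[OF x] by simp
 qed
 thus ?thesis by blast
qed

lemma finite_free_fgproj:
 assumes R: "cring R" and F: "F \<in> finite_free R"
 shows "fgproj R F"
proof -
 obtain n :: nat and f where FM: "module R F" and f: "f \<in> lin_maps R (free_mod R {..<n}) F" "bij_betw f (carrier (free_mod R {..<n})) (carrier F)"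
  using F unfolding finite_free_def mod_isomorphic_def by blast
 have fl: "lmap R (free_mod R {..<n}) F f" using f FM module_free_mod[OF R] by(simp add: lmap_def)
 have "EX k. lmap R F (free_mod R {..<n}) k & (\<forall>a\<in>free_mod R {..<n}. k (f a) = a) & (\<forall>b\<in>F. f (k b) = b)"
 proof(rule lmap_inverse[OF fl])
  show "\<exists>a\<in>free_mod R {..<n}. f a = b" if "b \<in> F" for b
  using f(2) that unfolding bij_betw_def by(metis imageE)
  show "a = \<zero>\<^sub>(free_mod R {..<n})" if "a \<in> free_mod R {..<n}" "f a = \<zero>\<^sub>F" for a
  using f(2) that lmap_zero[OF fl] modD(2)[OF lmap_dom[OF fl]] unfolding bij_betw_def inj_on_def by metis
 qed
 thus ?thesis using fgproj_retract[OF fgproj_free_mod[OF R] _ fl] by blast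
qed

lemma fgproj_projective:
 fixes R :: "('a,'r) ring_scheme" and F :: "('a,'m) module"
 assumes "fgproj R F"
 shows "projective R F"
 unfolding projective_def
proof(intro conjI allI impI fgproj_module[OF assms])
 fix A B :: "('a,'m) module" and g f
 assume a: "module R A & module R B & g \<in> lin_maps R A B & g ` carrier A = carrier B & f \<in> lin_maps R F B"
 hence g: "lmap R A B g" and f: "lmap R F B f" using fgproj_module[OF assms] by(auto simp: lmap_def)
 have "\<exists>x\<in>A. g x = f z" if "z \<in> F" for z
  using lmap_in[OF f that] a by(metis imageE)
 thus "\<exists>h\<in>lin_maps R F A. \<forall>x\<in>F. g (h x) = f x"
  using fgproj_lift[OF assms g f] by(auto simp: lmap_def)
qed

section \<open>Tensor products\<close>

text \<open>The simple tensor of \<open>x\<close> and \<open>y\<close>: the coset of a generator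
  modulo the submodule by which \<open>tensor\<close> divides.\<close>

definition pure :: "('a,'r) ring_scheme => ('a,'m) module => ('a,'n) module => 'm => 'n => ('m \<times> 'n => 'a) set" where
 "pure R M N x y = (\<Inter>{K. submodule K R (free_mod R (carrier M \<times> carrier N)) & tensor_relations R M N \<subseteq> K})
  +>\<^sub>(free_mod R (carrier M \<times> carrier N)) free_gen R (x, y)"

context
 fixes R :: "('a,'r) ring_scheme" and M :: "('a,'m) module" and N :: "('a,'n) module"
 assumes M: "module R M" and N: "module R N"
begin

private abbreviation "Fr \<equiv> free_mod R (carrier M \<times> carrier N)"
private abbreviation "Rel \<equiv> \<Inter>{K. submodule K R Fr & tensor_relations R M N \<subseteq> K}"

private lemma FrM: "module R Fr"
 by(rule module_free_mod[OF module_cring[OF M]])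

private lemma gen: "x \<in> M ==> y \<in> N ==> free_gen R (x, y) \<in> Fr"
 by(rule free_gen_mem[OF module_cring[OF M]]) simp

private lemma relations_carrier: "tensor_relations R M N \<subseteq> carrier Fr"
 unfolding tensor_relations_def Let_def
 by(auto simp: gen modD[OF FrM] modD[OF M] modD[OF N])

private lemma Rel: "submodule Rel R Fr"
proof(rule submoduleI'[OF FrM])
 show "Rel \<subseteq> carrier Fr" using relations_carrier module.carrier_is_submodule[OF FrM] by blast
qed (use submodule_zero[OF _ FrM] submodule_add[OF _ FrM] submodule_smult[OF _ FrM] in blast)+

private lemma q: "lmap R Fr (tensor R M N) (%x. Rel +>\<^sub>Fr x)"
 using quot_map(1)[OF FrM Rel] by(simp add: tensor_def Let_def)

private lemma q_eq: "x \<in> Fr ==> y \<in> Fr ==> x \<ominus>\<^sub>Fr y \<in> tensor_relations R M N ==> Rel +>\<^sub>Fr x = Rel +>\<^sub>Fr y"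
 by(subst coset_eq_iff[OF FrM Rel]) auto

private lemma relations:
 "x \<in> M ==> x' \<in> M ==> y \<in> N ==>
  free_gen R (x \<oplus>\<^sub>M x', y) \<ominus>\<^sub>Fr (free_gen R (x, y) \<oplus>\<^sub>Fr free_gen R (x', y)) \<in> tensor_relations R M N"
 "x \<in> M ==> y \<in> N ==> y' \<in> N ==>
  free_gen R (x, y \<oplus>\<^sub>N y') \<ominus>\<^sub>Fr (free_gen R (x, y) \<oplus>\<^sub>Fr free_gen R (x, y')) \<in> tensor_relations R M N"
 "r \<in> R ==> x \<in> M ==> y \<in> N ==>
  free_gen R (r \<odot>\<^sub>M x, y) \<ominus>\<^sub>Fr r \<odot>\<^sub>Fr free_gen R (x, y) \<in> tensor_relations R M N"
 "r \<in> R ==> x \<in> M ==> y \<in> N ==>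
  free_gen R (x, r \<odot>\<^sub>N y) \<ominus>\<^sub>Fr r \<odot>\<^sub>Fr free_gen R (x, y) \<in> tensor_relations R M N"
 unfolding tensor_relations_def Let_def by blast+

private lemma q_surj: "z \<in> tensor R M N ==> \<exists>x\<in>Fr. Rel +>\<^sub>Fr x = z"
 by(auto simp: tensor_def Let_def quot_mod_carrier)

lemma module_tensor: "module R (tensor R M N)"
 by(rule lmap_cod[OF q])

lemma bilin_pure: "bilin R M N (tensor R M N) (pure R M N)"
proof -
 note [simp] = gen modD[OF FrM] modD[OF M] modD[OF N]
 have pm: "pure R M N x y = Rel +>\<^sub>Fr free_gen R (x, y)" for x y by(simp add: pure_def)
 have cl: "pure R M N x y \<in> tensor R M N" if "x \<in> M" "y \<in> N" for x y
  unfolding pm using lmap_in[OF q] that by simp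
 show ?thesis
 proof(rule bilinI[OF M N module_tensor])
  fix x assume x: "x \<in> M"
  show "lmap R N (tensor R M N) (pure R M N x)"
  proof(rule lmapI[OF N module_tensor cl[OF x]])
  fix y y' assume y: "y \<in> N" "y' \<in> N"
  show "pure R M N x (y \<oplus>\<^sub>N y') = pure R M N x y \<oplus>\<^sub>(tensor R M N) pure R M N x y'"
  unfolding pm lmap_add[OF q gen[OF x y(1)] gen[OF x y(2)], symmetric] by(rule q_eq[OF _ _ relations(2)]) (use x y in auto)
  next
  fix r y assume y: "r \<in> R" "y \<in> N"
  show "pure R M N x (r \<odot>\<^sub>N y) = r \<odot>\<^sub>(tensor R M N) pure R M N x y"
  unfolding pm lmap_smult[OF q y(1) gen[OF x y(2)], symmetric] by(rule q_eq[OF _ _ relations(4)]) (use x y in auto)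
  qed
 next
  fix y assume y: "y \<in> N"
  show "lmap R M (tensor R M N) (%x. pure R M N x y)"
  proof(rule lmapI[OF M module_tensor cl[OF _ y]])
  fix x x' assume x: "x \<in> M" "x' \<in> M"
  show "pure R M N (x \<oplus>\<^sub>M x') y = pure R M N x y \<oplus>\<^sub>(tensor R M N) pure R M N x' y"
  unfolding pm lmap_add[OF q gen[OF x(1) y] gen[OF x(2) y], symmetric] by(rule q_eq[OF _ _ relations(1)]) (use x y in auto)
  next
  fix r x assume x: "r \<in> R" "x \<in> M"
  show "pure R M N (r \<odot>\<^sub>M x) y = r \<odot>\<^sub>(tensor R M N) pure R M N x y"
  unfolding pm lmap_smult[OF q x(1) gen[OF x(2) y], symmetric] by(rule q_eq[OF _ _ relations(3)]) (use x y in auto)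
  qed
 qed
qed

lemma tensor_universal:
 assumes B: "bilin R M N Z B"
 shows "EX T. lmap R (tensor R M N) Z T & (\<forall>x\<in>M. \<forall>y\<in>N. T (pure R M N x y) = B x y)"
proof -
 note Z = bilin_modules(3)[OF B]
 obtain f where f: "lmap R Fr Z f" "!!x y. x \<in> M ==> y \<in> N ==> f (free_gen R (x, y)) = B x y"
  using free_mod_extend[OF Z, of "carrier M \<times> carrier N" "%(x, y). B x y"] bilin_closed[OF B] by auto
 note [simp] = gen modD[OF FrM] modD[OF M] modD[OF N] lmapD[OF f(1)] f(2)
 have "tensor_relations R M N \<subseteq> kern Fr Z f"
  unfolding tensor_relations_def Let_def kern_def
  by(auto simp: lmap_add[OF bilin_left[OF B]] lmap_add[OF bilin_right[OF B]] lmap_smult[OF bilin_left[OF B]]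
  lmap_smult[OF bilin_right[OF B]] bilin_closed[OF B] modD[OF Z])
 hence "Rel \<subseteq> kern Fr Z f" using submodule_kern[OF f(1)] by blast
 hence "f x = \<zero>\<^sub>Z" if "x \<in> Fr" "Rel +>\<^sub>Fr x = \<zero>\<^sub>(tensor R M N)" for x
  using that quot_map(2)[OF FrM Rel that(1)] by(auto simp: kern_def tensor_def Let_def)
 then obtain T where "lmap R (tensor R M N) Z T" "!!x. x \<in> Fr ==> T (Rel +>\<^sub>Fr x) = f x"
  using lmap_factor[OF q f(1) q_surj] by blast
 thus ?thesis by(intro exI[of _ T]) (auto simp: pure_def)
qed

lemma tensor_induct:
 assumes K: "submodule K R (tensor R M N)" and p: "!!x y. x \<in> M ==> y \<in> N ==> pure R M N x y \<in> K"
 shows "carrier (tensor R M N) \<subseteq> K"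
proof
 fix z assume "z \<in> tensor R M N"
 then obtain f where f: "f \<in> Fr" "z = Rel +>\<^sub>Fr f" using q_surj by blast
 let ?A = "{b \<in> M \<times> carrier N. f b ~= \<zero>\<^sub>R}"
 have fin: "finite ?A" and fe: "f = finsum Fr (%b. f b \<odot>\<^sub>Fr free_gen R b) ?A"
  using loc_basis_free_mod[OF module_cring[OF M], of "carrier M \<times> carrier N"] f(1) unfolding loc_basis_def by auto
 have fb: "f b \<in> R" for b using f(1) by(cases b) (simp add: free_mod_simps)
 have KM: "module R (restr_mod (tensor R M N) K)" by(rule module_restr_mod[OF module_tensor K])
 have "finsum (tensor R M N) h A \<in> K" if "finite A" "!!b. b \<in> A ==> h b \<in> K" for A and h :: "'m \<times> 'n => _"
  using that
 proof(induction A rule: finite_induct)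
  case empty
  thus ?case using submodule_zero[OF K module_tensor] by(simp add: mod_finsum_empty[OF module_tensor])
 next
  case (insert a A)
  have "finsum (tensor R M N) h (insert a A) = h a \<oplus>\<^sub>(tensor R M N) finsum (tensor R M N) h A"
  by(rule mod_finsum_insert[OF module_tensor insert(1,2)]) (use insert submodule_sub[OF K module_tensor] in auto)
  thus ?case using submodule_add[OF K module_tensor] insert by simp
 qed
 note fs = this
 have "z = finsum (tensor R M N) (%b. Rel +>\<^sub>Fr (f b \<odot>\<^sub>Fr free_gen R b)) ?A"
  unfolding f(2) by(subst fe, rule lmap_finsum[OF q fin]) (use fb gen in \<open>auto simp: modD[OF FrM]\<close>)
 also have "\<dots> \<in> K"
 proof(rule fs[OF fin])
  fix b assume "b \<in> ?A"
  then obtain x y where b: "b = (x, y)" "x \<in> M" "y \<in> N" by auto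
  have "Rel +>\<^sub>Fr (f b \<odot>\<^sub>Fr free_gen R b) = f b \<odot>\<^sub>(tensor R M N) pure R M N x y"
  using lmap_smult[OF q fb gen[OF b(2,3)], of b] b(1) by(simp add: pure_def)
  thus "Rel +>\<^sub>Fr (f b \<odot>\<^sub>Fr free_gen R b) \<in> K"
  using submodule_smult[OF K module_tensor fb p[OF b(2,3)]] by simp
 qed
 finally show "z \<in> K" .
qed

lemma tensor_map_zero:
 assumes T: "lmap R (tensor R M N) Z T" and z: "!!x y. x \<in> M ==> y \<in> N ==> T (pure R M N x y) = \<zero>\<^sub>Z"
  and t: "t \<in> tensor R M N"
 shows "T t = \<zero>\<^sub>Z"
proof -
 have "carrier (tensor R M N) \<subseteq> kern (tensor R M N) Z T"
  by(rule tensor_induct[OF submodule_kern[OF T]]) (use z bilin_closed[OF bilin_pure] in \<open>auto simp: kern_def\<close>)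
 thus ?thesis using t by(auto simp: kern_def)
qed

end

section \<open>The classes of modules\<close>

lemma mod_isomorphic_maps:
 assumes "module R X" "module R Y" "mod_isomorphic R X Y"
 shows "EX f g. lmap R X Y f & lmap R Y X g & (\<forall>x\<in>X. g (f x) = x) & (\<forall>y\<in>Y. f (g y) = y)"
proof -
 obtain f where f: "f \<in> lin_maps R X Y" "bij_betw f (carrier X) (carrier Y)"
  using assms(3) unfolding mod_isomorphic_def by blast
 have fl: "lmap R X Y f" using f assms by(simp add: lmap_def)
 have "EX k. lmap R Y X k & (\<forall>a\<in>X. k (f a) = a) & (\<forall>b\<in>Y. f (k b) = b)"
 proof(rule lmap_inverse[OF fl])
  show "\<exists>a\<in>X. f a = b" if "b \<in> Y" for b
  using f(2) that unfolding bij_betw_def by(metis imageE)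
  show "a = \<zero>\<^sub>X" if "a \<in> X" "f a = \<zero>\<^sub>Y" for a
  using f(2) that lmap_zero[OF fl] modD(2)[OF lmap_dom[OF fl]] unfolding bij_betw_def inj_on_def by metis
 qed
 with fl show ?thesis by blast
qed

lemma P_class_maps:
 fixes R :: "('a,'r) ring_scheme" and X :: "('a,'m) module" and C :: "('a,'c) module"
 assumes C: "module R C" and X: "X \<in> P_class R C"
 shows "EX (P :: ('a,'m) module) f g. projective R P & lmap R X (tensor R P C) f & lmap R (tensor R P C) X g &
  (\<forall>x\<in>X. g (f x) = x) & (\<forall>y\<in>tensor R P C. f (g y) = y)"
proof -
 obtain P :: "('a,'m) module" where P: "projective R P" "module R X" "mod_isomorphic R X (tensor R P C)"
  using X unfolding P_class_def by blast
 have "module R P" using P(1) by(simp add: projective_def)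
 with mod_isomorphic_maps[OF P(2) module_tensor[OF _ C] P(3)] P(1) show ?thesis by blast
qed

lemma P_class_module: "X \<in> P_class R C ==> module R X"
 by(simp add: P_class_def)

text \<open>A dual basis of \<open>P\<close> exhibits \<open>P \<otimes> C\<close> as a summand of a
  sum of copies of \<open>C\<close>: the copy at \<open>b\<close> is embedded by tensoring with
  \<open>b\<close>, and its projection \<open>T b\<close> is induced by the coordinate
  \<open>c b\<close>.\<close>

lemma P_class_loc_summand:
 fixes R :: "('a,'r) ring_scheme" and X :: "('a,'m) module" and C :: "('a,'c) module"
 assumes inf: "infinite (UNIV :: 'm set)" and \<iota>: "inj_on (\<iota> :: 'a => 'm) (carrier R)"
  and C: "module R C" and X: "X \<in> P_class R C"
 shows "EX (B :: 'm set) t s. loc_summand R C X B t s"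
proof -
 obtain P :: "('a,'m) module" and f g where P: "projective R P" and f: "lmap R X (tensor R P C) f" and g: "lmap R (tensor R P C) X g"
  and gf: "!!x. x \<in> X ==> g (f x) = x" and fg: "!!y. y \<in> tensor R P C ==> f (g y) = y"
  using P_class_maps[OF C X] by(elim exE conjE) (rule that, auto)
 have PM: "module R P" using P by(simp add: projective_def)
 note XM = lmap_dom[OF f]
 obtain c where c: "loc_basis R P (carrier P) (%b. b) c" using projective_loc_basis[OF inf \<iota> P] by blast
 have cl: "lmap R P (reg_mod R) (c b)" if "b \<in> P" for b using c that by(simp add: loc_basis_def)
 have cr: "c b p \<in> R" if "b \<in> P" "p \<in> P" for b p using lmap_in[OF cl[OF that(1)] that(2)] by simp
 have fin: "finite {b \<in> P. c b p ~= \<zero>\<^sub>R}"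
  and pe: "p = finsum P (%b. c b p \<odot>\<^sub>P b) {b \<in> P. c b p ~= \<zero>\<^sub>R}" if "p \<in> P" for p
  using c that by(auto simp: loc_basis_def)
 note pure = bilin_pure[OF PM C]
 have bil: "bilin R P C C (%p x. c b p \<odot>\<^sub>C x)" if b: "b \<in> P" for b
  by(rule bilinI[OF PM C C]) (use lmap_scale[OF lmap_ident[OF C]] cr b lmap_coord_smult[OF cl[OF b] C] in auto)
 have "EX T. lmap R (tensor R P C) C T & (\<forall>p\<in>P. \<forall>x\<in>C. T (pure R P C p x) = c b p \<odot>\<^sub>C x)" if "b \<in> P" for b
  by(rule tensor_universal[OF PM C bil[OF that]])
 then obtain T where T: "!!b. b \<in> P ==> lmap R (tensor R P C) C (T b)"
  "!!b p x. b \<in> P ==> p \<in> P ==> x \<in> C ==> T b (pure R P C p x) = c b p \<odot>\<^sub>C x" by metis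
 let ?T = "tensor R P C"
 let ?pb = "%b. pure R P C b"
 note TM = module_tensor[OF PM C]
 have pl: "lmap R C ?T (?pb b)" if "b \<in> P" for b by(rule bilin_right[OF pure that])
 let ?S = "%z. {b \<in> P. T b z ~= \<zero>\<^sub>C}"
 let ?h = "%z. finsum ?T (%b. ?pb b (T b z)) (?S z)"
 \<comment> \<open>Finite support is evident for simple tensors, and the elements with finite
   support form a submodule; \<open>sumT\<close> follows the same pattern.\<close>
 have finT: "finite (?S z)" if "z \<in> ?T" for z
 proof -
  have "carrier ?T \<subseteq> {z \<in> ?T. finite (?S z)}"
  proof(rule tensor_induct[OF PM C submoduleI'[OF TM]])
  show "\<zero>\<^sub>?T \<in> {z \<in> ?T. finite (?S z)}" using lmap_zero[OF T(1)] by(simp add: modD[OF TM] cong: conj_cong)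
  show "x \<oplus>\<^sub>?T y \<in> {z \<in> ?T. finite (?S z)}" if xy: "x \<in> {z \<in> ?T. finite (?S z)}" "y \<in> {z \<in> ?T. finite (?S z)}" for x y
  proof -
  have "?S (x \<oplus>\<^sub>?T y) \<subseteq> ?S x \<union> ?S y" using xy lmap_add[OF T(1)] by(auto simp: modD[OF C])
  thus ?thesis using xy finite_subset by(auto simp: modD[OF TM])
  qed
  show "r \<odot>\<^sub>?T x \<in> {z \<in> ?T. finite (?S z)}" if xy: "r \<in> R" "x \<in> {z \<in> ?T. finite (?S z)}" for r x
  proof -
  have "?S (r \<odot>\<^sub>?T x) \<subseteq> ?S x" using xy lmap_smult[OF T(1)] by(auto simp: modD[OF C])
  thus ?thesis using xy finite_subset by(auto simp: modD[OF TM])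
  qed
  fix p x assume px: "p \<in> P" "x \<in> C"
  have "?S (pure R P C p x) \<subseteq> {b \<in> P. c b p ~= \<zero>\<^sub>R}" using T(2)[OF _ px] px by(auto simp: modD[OF C])
  thus "pure R P C p x \<in> {z \<in> ?T. finite (?S z)}"
  using finite_subset[OF _ fin[OF px(1)]] bilin_closed[OF pure px] by auto
  qed auto
  thus ?thesis using that by blast
 qed
 have sumT: "z = ?h z" if z: "z \<in> ?T" for z
 proof -
  have enl: "finsum ?T (%b. ?pb b (T b w)) A = ?h w" if "w \<in> ?T" "finite A" "?S w \<subseteq> A" "A \<subseteq> carrier P" for w A
  by(rule finsum_enlarge[OF TM pl _ that(2-4)]) (use lmap_in[OF T(1)] that(1) in auto)
  have tc: "?pb b (T b w) \<in> ?T" if "b \<in> P" "w \<in> ?T" for b w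
  using lmap_in[OF pl[OF that(1)] lmap_in[OF T(1)[OF that(1)] that(2)]] .
  interpret module R ?T by(rule TM)
  have "carrier ?T \<subseteq> {z \<in> ?T. z = ?h z}"
  proof(rule tensor_induct[OF PM C submoduleI'[OF TM]])
  have "?h \<zero>\<^sub>?T = \<zero>\<^sub>?T" by(rule mod_finsum_zero[OF TM]) (use lmap_zero[OF T(1)] in auto)
  thus "\<zero>\<^sub>?T \<in> {z \<in> ?T. z = ?h z}" by simp
  fix x y assume xy: "x \<in> {z \<in> ?T. z = ?h z}" "y \<in> {z \<in> ?T. z = ?h z}"
  have x: "x \<in> ?T" "x = ?h x" and y: "y \<in> ?T" "y = ?h y" using xy by auto
  let ?A = "?S x \<union> ?S y \<union> ?S (x \<oplus>\<^sub>?T y)"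
  have fA: "finite ?A" using finT x(1) y(1) by simp
  have "?h (x \<oplus>\<^sub>?T y) = finsum ?T (%b. ?pb b (T b (x \<oplus>\<^sub>?T y))) ?A"
  by(rule enl[symmetric]) (use fA x y in auto)
  also have "\<dots> = finsum ?T (%b. ?pb b (T b x) \<oplus>\<^sub>?T ?pb b (T b y)) ?A"
  by(rule mod_finsum_cong[OF TM]) (use x(1) y(1) tc lmap_add[OF T(1)] lmap_add[OF pl] lmap_in[OF T(1)] in auto)
  also have "\<dots> = finsum ?T (%b. ?pb b (T b x)) ?A \<oplus>\<^sub>?T finsum ?T (%b. ?pb b (T b y)) ?A"
  by(rule M.finsum_addf) (use tc x(1) y(1) in auto)
  also have "\<dots> = ?h x \<oplus>\<^sub>?T ?h y"
  by(intro arg_cong2[where f = "(\<oplus>\<^sub>?T)"] enl) (use fA x y in auto)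
  finally show "x \<oplus>\<^sub>?T y \<in> {z \<in> ?T. z = ?h z}" using x y by simp
  next
  fix r x assume r: "r \<in> R" and "x \<in> {z \<in> ?T. z = ?h z}"
  hence x: "x \<in> ?T" "x = ?h x" by auto
  let ?A = "?S x \<union> ?S (r \<odot>\<^sub>?T x)"
  have fA: "finite ?A" using finT x(1) r by simp
  have "?h (r \<odot>\<^sub>?T x) = finsum ?T (%b. ?pb b (T b (r \<odot>\<^sub>?T x))) ?A"
  by(rule enl[symmetric]) (use fA x r in auto)
  also have "\<dots> = finsum ?T (%b. r \<odot>\<^sub>?T ?pb b (T b x)) ?A"
  by(rule mod_finsum_cong[OF TM]) (use r x(1) tc lmap_smult[OF T(1)] lmap_smult[OF pl] lmap_in[OF T(1)] in auto)
  also have "\<dots> = r \<odot>\<^sub>?T finsum ?T (%b. ?pb b (T b x)) ?A"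
  by(rule finsum_smult_ldistr[symmetric]) (use fA r tc x(1) in auto)
  also have "\<dots> = r \<odot>\<^sub>?T ?h x"
  by(intro arg_cong2[where f = "(\<odot>\<^sub>?T)"] refl enl) (use fA x in auto)
  finally show "r \<odot>\<^sub>?T x \<in> {z \<in> ?T. z = ?h z}" using x r by simp
  next
  fix p x assume px: "p \<in> P" "x \<in> C"
  let ?A = "{b \<in> P. c b p ~= \<zero>\<^sub>R}"
  note l = bilin_left[OF pure px(2)]
  have m: "pure R P C p x \<in> ?T" by(rule bilin_closed[OF pure px])
  have "?h (pure R P C p x) = finsum ?T (%b. ?pb b (T b (pure R P C p x))) ?A"
  by(rule enl[symmetric, OF m fin[OF px(1)]]) (use T(2)[OF _ px] px in \<open>auto simp: modD[OF C]\<close>)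
  also have "\<dots> = finsum ?T (%b. pure R P C (c b p \<odot>\<^sub>P b) x) ?A"
  by(rule mod_finsum_cong[OF TM])
  (use T(2)[OF _ px] px cr lmap_smult[OF pl] lmap_smult[OF l] lmap_in[OF l] in \<open>auto simp: modD[OF PM] modD[OF TM]\<close>)
  also have "\<dots> = pure R P C (finsum P (%b. c b p \<odot>\<^sub>P b) ?A) x"
  by(rule lmap_finsum[OF l fin[OF px(1)], symmetric]) (use cr px in \<open>auto simp: modD[OF PM]\<close>)
  finally show "pure R P C p x \<in> {z \<in> ?T. z = ?h z}" using pe[OF px(1)] m by simp
  qed auto
  thus ?thesis using z by blast
 qed
 have "loc_summand R C X (carrier P) (%b y. g (pure R P C b y)) (%b x. T b (f x))"
  unfolding loc_summand_def
 proof(intro conjI ballI XM)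
  show "lmap R C X (%y. g (pure R P C b y))" if "b \<in> P" for b by(rule lmap_comp[OF pl[OF that] g])
  show "lmap R X C (%x. T b (f x))" if "b \<in> P" for b by(rule lmap_comp[OF f T(1)[OF that]])
  fix x assume x: "x \<in> X"
  have fx: "f x \<in> ?T" by(rule lmap_in[OF f x])
  show "finite {b \<in> P. T b (f x) ~= \<zero>\<^sub>C}" by(rule finT[OF fx])
  have "x = g (finsum ?T (%b. ?pb b (T b (f x))) (?S (f x)))" using sumT[OF fx] gf[OF x] by simp
  also have "\<dots> = finsum X (%b. g (?pb b (T b (f x)))) (?S (f x))"
  by(rule lmap_finsum[OF g finT[OF fx]]) (use lmap_in[OF pl lmap_in[OF T(1) fx]] in auto)
  finally show "x = finsum X (%b. g (pure R P C b (T b (f x)))) {b \<in> P. T b (f x) ~= \<zero>\<^sub>C}" .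
 qed
 thus ?thesis by blast
qed

text \<open>This is \<open>Hom(P \<otimes> C, I) = Hom(C, Hom(P, I))\<close> with
  \<open>Hom(P, I)\<close> injective. Duals of members of the class thus have the form to which
  \<open>hom_C'_exact\<close> applies.\<close>

lemma P_class_dual:
 fixes R :: "('a,'r) ring_scheme" and X :: "('a,'m) module" and C :: "('a,'c) module" and I :: "('a,'i) module"
 assumes inf: "infinite (UNIV :: 'm set)" and \<iota>: "inj_on (\<iota> :: 'a => 'm) (carrier R)"
  and C: "module R C" and X: "X \<in> P_class R C" and I: "baer R I"
 shows "EX (P :: ('a,'m) module) u v. baer R (Hom R P I) &
  lmap R (Hom R X I) (Hom R C (Hom R P I)) u & lmap R (Hom R C (Hom R P I)) (Hom R X I) v &
  (\<forall>x\<in>Hom R X I. v (u x) = x) & (\<forall>y\<in>Hom R C (Hom R P I). u (v y) = y)"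
proof -
 obtain P :: "('a,'m) module" and f g where P: "projective R P" and f: "lmap R X (tensor R P C) f" and g: "lmap R (tensor R P C) X g"
  and gf: "!!x. x \<in> X ==> g (f x) = x" and fg: "!!y. y \<in> tensor R P C ==> f (g y) = y"
  using P_class_maps[OF C X] by(elim exE conjE) (rule that, auto)
 have PM: "module R P" using P by(simp add: projective_def)
 obtain c where c: "loc_basis R P (carrier P) (%b. b) c" using projective_loc_basis[OF inf \<iota> P] by blast
 note XM = lmap_dom[OF f] and IM = baer_module[OF I] and TM = module_tensor[OF PM C]
 note pure = bilin_pure[OF PM C]
 let ?PI = "Hom R P I" let ?XI = "Hom R X I" let ?CPI = "Hom R C ?PI"
 have PI: "module R ?PI" and XI: "module R ?XI" and CPI: "module R ?CPI" using PM IM XM C by auto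
 define u where "u h = (\<lambda>y\<in>C. \<lambda>p\<in>P. h (g (pure R P C p y)))" for h :: "'m => 'i"
 have bh: "bilin R P C I (%p y. h (g (pure R P C p y)))" if "h \<in> ?XI" for h
  by(rule bilin_post[OF bilin_post[OF pure g] hom_lmap[OF that XM IM]])
 have u: "lmap R ?XI ?CPI u"
 proof -
  have "bilin R ?XI C ?PI (%h y. \<lambda>p\<in>P. h (g (pure R P C p y)))"
  proof(rule bilinI[OF XI C PI])
  fix h assume h: "h \<in> ?XI"
  show "lmap R C ?PI (%y. \<lambda>p\<in>P. h (g (pure R P C p y)))" by(rule lmap_curry[OF bilin_flip[OF bh[OF h]]])
  next
  fix y assume y: "y \<in> C"
  show "lmap R ?XI ?PI (%h. \<lambda>p\<in>P. h (g (pure R P C p y)))"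
  by(rule lmap_curry, rule bilin_comp_right[OF bilin_hom_comp[OF XM IM] lmap_comp[OF bilin_left[OF pure y] g]])
  qed
  from lmap_curry[OF this] show ?thesis unfolding u_def[abs_def] .
 qed
 have "EX v. lmap R ?CPI ?XI v & (\<forall>a\<in>?XI. v (u a) = a) & (\<forall>b\<in>?CPI. u (v b) = b)"
 proof(rule lmap_inverse[OF u])
  fix q assume q: "q \<in> ?CPI"
  have "bilin R P C I (%p y. q y p)" by(rule bilin_flip[OF bilin_uncurry[OF hom_lmap[OF q C PI] PM IM]])
  from tensor_universal[OF PM C this] obtain T where T: "lmap R (tensor R P C) I T"
  "!!p y. p \<in> P ==> y \<in> C ==> T (pure R P C p y) = q y p" by blast
  have m: "(\<lambda>x\<in>X. T (f x)) \<in> ?XI" by(rule hom_mem[OF lmap_comp[OF f T(1)]])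
  have "u (\<lambda>x\<in>X. T (f x)) = q"
  proof(rule hom_eqI[OF lmap_in[OF u m] q])
  fix y assume y: "y \<in> C"
  show "u (\<lambda>x\<in>X. T (f x)) y = q y"
  proof(rule hom_eqI[OF hom_closed[OF lmap_in[OF u m] y] hom_closed[OF q y]])
  fix p assume p: "p \<in> P"
  show "u (\<lambda>x\<in>X. T (f x)) y p = q y p"
  using y p T(2) fg[OF bilin_closed[OF pure p y]] lmap_in[OF g bilin_closed[OF pure p y]] by(simp add: u_def)
  qed
  qed
  thus "\<exists>a\<in>?XI. u a = q" using m by blast
 next
  fix h assume h: "h \<in> ?XI" and z: "u h = \<zero>\<^sub>?CPI"
  have hz: "h (g (pure R P C p y)) = \<zero>\<^sub>I" if "p \<in> P" "y \<in> C" for p y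
  using fun_cong[OF fun_cong[OF z, of y], of p] that by(simp add: u_def)
  have "h x = \<zero>\<^sub>I" if x: "x \<in> X" for x
  using tensor_map_zero[OF PM C lmap_comp[OF g hom_lmap[OF h XM IM]] hz lmap_in[OF f x]] gf[OF x] by simp
  thus "h = \<zero>\<^sub>?XI" by(intro hom_eqI[OF h mod_zero_closed[OF XI]]) auto
 qed
 thus ?thesis using baer_hom[OF c I] u by blast
qed

lemma I_class_maps:
 fixes R :: "('a,'r) ring_scheme" and Y :: "('a,'m) module" and C :: "('a,'c) module"
 assumes \<iota>: "inj_on (\<iota> :: 'a => 'm) (carrier R)" and C: "module R C" and Y: "Y \<in> I_class R C"
 shows "EX (I :: ('a,'m) module) u v. baer R I & lmap R Y (Hom R C I) u & lmap R (Hom R C I) Y v &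
  (\<forall>x\<in>Y. v (u x) = x) & (\<forall>y\<in>Hom R C I. u (v y) = y)"
proof -
 obtain I :: "('a,'m) module" where I: "injective R I" "module R Y" "mod_isomorphic R Y (Hom R C I)"
  using Y unfolding I_class_def by blast
 note b = baer_injective[OF \<iota> I(1)]
 show ?thesis using mod_isomorphic_maps[OF I(2) module_hom_mod[OF C baer_module[OF b]] I(3)] b by blast
qed

lemma I_class_module: "Y \<in> I_class R C ==> module R Y"
 by(simp add: I_class_def)

text \<open>Ext out of \<open>S\<close> commutes with direct sums because the terms
  \<open>F n\<close> are finitely generated: a cocycle meets only the finitely many summands in
  \<open>A'\<close>.\<close>

lemma (in fp_res) acyclic_loc_summand:
 assumes X: "loc_summand R Q X B t s" and Q: "acyclic Q"
 shows "acyclic X"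
proof(rule acyclicI)
 show XM: "module R X" using X by(simp add: loc_summand_def)
 have t: "!!b. b \<in> B ==> lmap R Q X (t b)" and s: "!!b. b \<in> B ==> lmap R X Q (s b)"
  and fin: "!!x. x \<in> X ==> finite {b \<in> B. s b x ~= \<zero>\<^sub>Q}"
  and x: "!!x. x \<in> X ==> x = finsum X (%b. t b (s b x)) {b \<in> B. s b x ~= \<zero>\<^sub>Q}"
  using X by(auto simp: loc_summand_def)
 fix n \<phi> assume \<phi>: "lmap R (F (Suc n)) X \<phi>" and z: "!!x. x \<in> (F (Suc (Suc n))) ==> \<phi> (d (Suc n) x) = \<zero>\<^sub>X"
 note FM = fgproj_module[OF F]
 obtain A where A: "finite A" "A \<subseteq> carrier (F (Suc n))" "carrier (F (Suc n)) = mspan R (F (Suc n)) A"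
  using fgproj_fin_gen[OF F[of "Suc n"]] by(auto simp: fin_gen_def)
 define A' where "A' = (\<Union>a\<in>A. {b \<in> B. s b (\<phi> a) ~= \<zero>\<^sub>Q})"
 have A': "finite A'" "A' \<subseteq> B" using A fin lmap_in[OF \<phi>] by(auto simp: A'_def)
 have out: "s b (\<phi> y) = \<zero>\<^sub>Q" if "b \<in> B" "b \<notin> A'" "y \<in> (F (Suc n))" for b y
 proof -
  note l = lmap_comp[OF \<phi> s[OF that(1)]]
  have "mspan R (F (Suc n)) A \<subseteq> kern (F (Suc n)) Q (%y. s b (\<phi> y))"
  by(rule mspan_minimal[OF submodule_kern[OF l] FM]) (use that A(2) in \<open>auto simp: kern_def A'_def\<close>)
  thus ?thesis using that(3) A(3) by(auto simp: kern_def)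
 qed
 have "EX \<psi>. lmap R (F n) Q \<psi> & (\<forall>y\<in>(F (Suc n)). \<psi> (d n y) = s b (\<phi> y))" if "b \<in> B" for b
  by(rule acyclicD[OF Q lmap_comp[OF \<phi> s[OF that]]]) (use z lmap_zero[OF s[OF that]] in simp)
 then obtain \<psi> where \<psi>: "!!b. b \<in> B ==> lmap R (F n) Q (\<psi> b)" "!!b y. b \<in> B ==> y \<in> (F (Suc n)) ==> \<psi> b (d n y) = s b (\<phi> y)" by metis
 let ?\<psi> = "%w. finsum X (%b. t b (\<psi> b w)) A'"
 have l: "lmap R (F n) X ?\<psi>"
  by(rule lmap_sum_maps[OF A'(1) FM XM]) (use lmap_comp[OF \<psi>(1) t] A'(2) in auto)
 have "?\<psi> (d n y) = \<phi> y" if y: "y \<in> (F (Suc n))" for y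
 proof -
  have \<phi>y: "\<phi> y \<in> X" by(rule lmap_in[OF \<phi> y])
  have tc: "t b (s b (\<phi> y)) \<in> X" if "b \<in> B" for b using lmap_in[OF t[OF that] lmap_in[OF s[OF that] \<phi>y]] .
  have "?\<psi> (d n y) = finsum X (%b. t b (s b (\<phi> y))) A'"
  by(rule mod_finsum_cong[OF XM]) (use A'(2) \<psi>(2)[OF _ y] tc in auto)
  also have "\<dots> = finsum X (%b. t b (s b (\<phi> y))) {b \<in> B. s b (\<phi> y) ~= \<zero>\<^sub>Q}"
  by(rule finsum_enlarge[OF XM t _ A'(1) _ A'(2)]) (use lmap_in[OF s \<phi>y] out[OF _ _ y] in auto)
  finally show ?thesis using x[OF \<phi>y] by simp
 qed
 with l show "EX \<psi>. lmap R (F n) X \<psi> & (\<forall>x\<in>(F (Suc n)). \<psi> (d n x) = \<phi> x)" by blast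
qed

section \<open>Complexes and their homology\<close>

lemma
 assumes "is_complex R X"
 shows cplx_module: "module R (cobj X n)"
  and cplx_lmap: "m = n - 1 ==> lmap R (cobj X n) (cobj X m) (cdiff X n)"
  and cplx_dd: "x \<in> carrier (cobj X n) ==> m = n - 1 ==> k = n - 2 ==> cdiff X m (cdiff X n x) = \<zero>\<^bsub>cobj X k\<^esub>"
 using assms by(auto simp: is_complex_def lmap_def)

lemma cplxI:
 assumes "!!n. lmap R (cobj X n) (cobj X (n - 1)) (cdiff X n)"
  and "!!n x. x \<in> carrier (cobj X n) ==> cdiff X (n - 1) (cdiff X n x) = \<zero>\<^bsub>cobj X (n - 2)\<^esub>"
 shows "is_complex R X"
 using assms by(auto simp: is_complex_def lmap_def)

abbreviation hclass :: "('a,'m) cplx => int => 'm => 'm set" where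
 "hclass X n x \<equiv> boundaries X n +>\<^sub>(X n) x"

lemma
 assumes X: "is_complex R X"
 shows lmap_hclass: "lmap R (restr_mod (X n) (cycles X n)) (homology X n) (hclass X n)"
  and homology_carrier: "carrier (homology X n) = hclass X n ` cycles X n"
  and hclass_zero: "x \<in> cycles X n ==> hclass X n x = \<zero>\<^sub>(homology X n) \<longleftrightarrow> x \<in> boundaries X n"
  and boundaries_cycles: "x \<in> boundaries X n ==> x \<in> cycles X n"
  and submodule_cycles: "submodule (cycles X n) R (X n)"
proof -
 note d = cplx_lmap[OF X refl, of n] and M = cplx_module[OF X, of n]
 have d1: "lmap R (X (n + 1)) (X n) (cdiff X (n + 1))" by(rule cplx_lmap[OF X]) simp
 have K: "cycles X n = kern (X n) (X (n - 1)) (cdiff X n)" by(simp add: cycles_def kern_def)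
 show sK: "submodule (cycles X n) R (X n)" unfolding K by(rule submodule_kern[OF d])
 have dc: "cdiff X (n + 1) y \<in> cycles X n" if "y \<in> X (n + 1)" for y
  using lmap_in[OF d1 that] cplx_dd[OF X that, of n "n - 1"] by(simp add: cycles_def)
 thus "x \<in> boundaries X n ==> x \<in> cycles X n" by(auto simp: boundaries_def)
 have B: "submodule (boundaries X n) R (restr_mod (X n) (cycles X n))"
  unfolding boundaries_def by(rule submodule_image[OF lmap_restr_cod[OF d1 sK dc]])
 have c: "a_r_coset (restr_mod (X n) (cycles X n)) = a_r_coset (X n)"
  by(auto simp: fun_eq_iff a_r_coset_def')
 note q = quot_map[OF module_restr_mod[OF M sK] B, unfolded c, folded homology_def]
 show "lmap R (restr_mod (X n) (cycles X n)) (homology X n) (hclass X n)" by(rule q(1))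
 show "carrier (homology X n) = hclass X n ` cycles X n"
  using quot_mod_carrier[of "restr_mod (X n) (cycles X n)" "boundaries X n", unfolded c] by(simp add: homology_def)
 show "hclass X n x = \<zero>\<^sub>(homology X n) \<longleftrightarrow> x \<in> boundaries X n" if "x \<in> cycles X n"
  using q(2)[of x] that by simp
qed

lemma zero_mod_homology:
 assumes X: "is_complex R X"
 shows "zero_mod (homology X n) \<longleftrightarrow> (\<forall>x\<in>X n. cdiff X n x = \<zero>\<^sub>(X (n - 1)) -->
  (\<exists>y\<in>X (n + 1). cdiff X (n + 1) y = x))"
proof -
 have "\<zero>\<^sub>(homology X n) \<in> homology X n" using lmap_cod[OF lmap_hclass[OF X]] by(rule mod_zero_closed)
 hence "zero_mod (homology X n) \<longleftrightarrow> (\<forall>x\<in>cycles X n. hclass X n x = \<zero>\<^sub>(homology X n))"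
  unfolding zero_mod_def homology_carrier[OF X] by blast
 also have "\<dots> \<longleftrightarrow> (\<forall>x\<in>cycles X n. x \<in> boundaries X n)" using hclass_zero[OF X] by blast
 finally show ?thesis by(auto simp: cycles_def boundaries_def)
qed

text \<open>\<open>homology_map\<close> is a union over all representatives of a class. Boundaries
  go to boundaries, so all representatives give the same coset, and the result agrees with the map
  supplied by \<open>lmap_factor\<close>.\<close>

lemma
 assumes X: "is_complex R X" and Y: "is_complex R Y" and \<phi>: "chain_map R X Y \<phi>"
 shows lmap_homology_map: "lmap R (homology X n) (homology Y n) (homology_map Y \<phi> n)"
  and homology_map_hclass: "x \<in> cycles X n ==> homology_map Y \<phi> n (hclass X n x) = hclass Y n (\<phi> n x)"
  and chain_map_cycles: "x \<in> cycles X n ==> \<phi> n x \<in> cycles Y n"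
proof -
 have \<phi>l: "lmap R (X n) (Y n) (\<phi> n)" for n
  using \<phi> cplx_module[OF X] cplx_module[OF Y] by(simp add: chain_map_def lmap_def)
 have \<phi>d: "x \<in> X n ==> cdiff Y n (\<phi> n x) = \<phi> (n - 1) (cdiff X n x)" for x n
  using \<phi> by(simp add: chain_map_def)
 show \<phi>c: "\<phi> n x \<in> cycles Y n" if "x \<in> cycles X n" for x
  using that lmap_in[OF \<phi>l] \<phi>d[of x n] lmap_zero[OF \<phi>l] by(simp add: cycles_def)
 have \<phi>b: "\<phi> n x \<in> boundaries Y n" if "x \<in> boundaries X n" for x
  using that \<phi>d[of _ "n + 1"] lmap_in[OF \<phi>l[of "n + 1"]] by(force simp: boundaries_def)
 note qX = lmap_hclass[OF X, of n] and qY = lmap_hclass[OF Y, of n]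
 note sX = submodule_sub[OF submodule_cycles[OF X] cplx_module[OF X]]
 have k: "lmap R (restr_mod (X n) (cycles X n)) (homology Y n) (%x. hclass Y n (\<phi> n x))"
  by(rule lmap_comp[OF _ qY], rule lmap_restr_cod[OF lmap_restr_dom[OF \<phi>l submodule_cycles[OF X]] submodule_cycles[OF Y]])
  (use \<phi>c in auto)
 have kb: "hclass Y n (\<phi> n x) = \<zero>\<^sub>(homology Y n)" if "x \<in> boundaries X n" for x
  using hclass_zero[OF Y \<phi>c] \<phi>b[OF that] boundaries_cycles[OF X that] by blast
 show a: "homology_map Y \<phi> n (hclass X n x) = hclass Y n (\<phi> n x)" if x: "x \<in> cycles X n" for x
 proof -
  have "hclass Y n (\<phi> n z) = hclass Y n (\<phi> n x)" if z: "z \<in> hclass X n x" for z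
  proof -
  obtain h where h: "h \<in> boundaries X n" "z = h \<oplus>\<^sub>(X n) x" using z coset_mem by metis
  show ?thesis
  using lmap_add[OF k, of h x] h x kb[OF h(1)] boundaries_cycles[OF X h(1)] lmap_in[OF k, of x]
  by(simp add: modD[OF lmap_cod[OF k]])
  qed
  moreover have "\<zero>\<^sub>(X n) \<in> boundaries X n"
  using lmap_zero[OF cplx_lmap[OF X, of n "n + 1"]] mod_zero_closed[OF cplx_module[OF X, of "n + 1"]]
  unfolding boundaries_def by(metis add_diff_cancel_right' image_eqI)
  hence "\<zero>\<^sub>(X n) \<oplus>\<^sub>(X n) x \<in> hclass X n x" unfolding coset_mem by blast
  ultimately show ?thesis unfolding homology_map_def by blast
 qed
 have "EX g. lmap R (homology X n) (homology Y n) g &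
  (\<forall>x\<in>(restr_mod (X n) (cycles X n)). g (hclass X n x) = hclass Y n (\<phi> n x))"
  by(rule lmap_factor[OF qX k]) (use homology_carrier[OF X] kb hclass_zero[OF X] in auto)
 then obtain g where g: "lmap R (homology X n) (homology Y n) g" "!!x. x \<in> cycles X n ==> g (hclass X n x) = hclass Y n (\<phi> n x)"
  by auto
 show "lmap R (homology X n) (homology Y n) (homology_map Y \<phi> n)"
  by(rule lmap_cong[OF g(1)]) (use a g(2) homology_carrier[OF X] in auto)
qed

lemma lmap_bij:
 assumes "lmap R A B f" "!!b. b \<in> B ==> \<exists>a\<in>A. f a = b" "!!a. a \<in> A ==> f a = \<zero>\<^sub>B ==> a = \<zero>\<^sub>A"
 shows "bij_betw f (carrier A) (carrier B)"
proof -
 obtain k where k: "lmap R B A k" "!!a. a \<in> A ==> k (f a) = a" "!!b. b \<in> B ==> f (k b) = b"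
  using lmap_inverse[OF assms] by blast
 show ?thesis by(rule bij_betw_byWitness[where f' = k]) (use k lmap_in[OF k(1)] lmap_in[OF assms(1)] in auto)
qed

text \<open>The last assumption is the exactness of the mapping cone of the chain map.\<close>

lemma quasi_isoI:
 assumes X: "is_complex R X" and Y: "is_complex R Y" and \<phi>: "chain_map R X Y \<phi>"
  and cone: "!!n a b. a \<in> X (n - 1) ==> b \<in> Y n ==> cdiff X (n - 1) a = \<zero>\<^sub>(X (n - 2)) ==>
  cdiff Y n b = \<phi> (n - 1) a ==> \<exists>a'\<in>X n. \<exists>b'\<in>Y (n + 1).
  cdiff X n a' = a & b = \<phi> n a' \<oplus>\<^sub>(Y n) cdiff Y (n + 1) b'"
 shows "quasi_iso R X Y \<phi>"
 unfolding quasi_iso_def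
proof(intro conjI allI X Y \<phi>)
 fix n
 note L = lmap_homology_map[OF X Y \<phi>, of n] and q = lmap_hclass[OF Y, of n]
 show "bij_betw (homology_map Y \<phi> n) (carrier (homology X n)) (carrier (homology Y n))"
 \<comment> \<open>Surjectivity is the cone condition for a pair with first entry zero; injectivity
   is the cone condition one degree higher.\<close>
 proof(rule lmap_bij[OF L])
  fix B assume "B \<in> homology Y n"
  then obtain y where y: "y \<in> cycles Y n" "B = hclass Y n y" using homology_carrier[OF Y] by auto
  have "lmap R (X (n - 1)) (X (n - 2)) (cdiff X (n - 1))" by(rule cplx_lmap[OF X]) simp
  from lmap_zero[OF this] have z: "cdiff X (n - 1) \<zero>\<^sub>(X (n - 1)) = \<zero>\<^sub>(X (n - 2))" .
  have "lmap R (X (n - 1)) (Y (n - 1)) (\<phi> (n - 1))"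
  using \<phi> cplx_module[OF X] cplx_module[OF Y] by(simp add: chain_map_def lmap_def)
  from lmap_zero[OF this] have "cdiff Y n y = \<phi> (n - 1) \<zero>\<^sub>(X (n - 1))" using y(1) by(simp add: cycles_def)
  with cone[OF mod_zero_closed[OF cplx_module[OF X]] _ z, of y] y(1)
  obtain a b where ab: "a \<in> X n" "b \<in> Y (n + 1)" "cdiff X n a = \<zero>\<^sub>(X (n - 1))"
  "y = \<phi> n a \<oplus>\<^sub>(Y n) cdiff Y (n + 1) b"
  unfolding cycles_def by blast
  have a: "a \<in> cycles X n" using ab by(simp add: cycles_def)
  have b: "cdiff Y (n + 1) b \<in> boundaries Y n" using ab by(simp add: boundaries_def)
  have "B = hclass Y n (\<phi> n a) \<oplus>\<^sub>(homology Y n) hclass Y n (cdiff Y (n + 1) b)"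
  unfolding y(2) ab(4) using lmap_add[OF q] chain_map_cycles[OF X Y \<phi> a] boundaries_cycles[OF Y b] by simp
  also have "\<dots> = homology_map Y \<phi> n (hclass X n a)"
  using hclass_zero[OF Y boundaries_cycles[OF Y b]] b homology_map_hclass[OF X Y \<phi> a]
  lmap_in[OF q, of "\<phi> n a"] chain_map_cycles[OF X Y \<phi> a] by(simp add: modD[OF lmap_cod[OF q]])
  finally show "\<exists>A\<in>homology X n. homology_map Y \<phi> n A = B" using a homology_carrier[OF X] by auto
 next
  fix A assume "A \<in> homology X n" and z: "homology_map Y \<phi> n A = \<zero>\<^sub>(homology Y n)"
  then obtain x where x: "x \<in> cycles X n" "A = hclass X n x" using homology_carrier[OF X] by auto
  hence "\<phi> n x \<in> boundaries Y n"
  using z homology_map_hclass[OF X Y \<phi> x(1)] hclass_zero[OF Y chain_map_cycles[OF X Y \<phi> x(1)]] by simp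
  then obtain b where "b \<in> Y (n + 1)" "cdiff Y (n + 1) b = \<phi> n x" by(auto simp: boundaries_def)
  then obtain a where "a \<in> X (n + 1)" "cdiff X (n + 1) a = x"
  using cone[of x "n + 1" b] x(1) by(auto simp: cycles_def)
  hence "x \<in> boundaries X n" by(auto simp: boundaries_def)
  thus "A = \<zero>\<^sub>(homology X n)" using hclass_zero[OF X x(1)] x(2) by simp
 qed
qed

lemma module_prod_mod:
 assumes M: "!!i. module R (M i)"
 shows "module R (prod_mod M)"
proof -
 have [simp]: "carrier (prod_mod M) = {f. ALL i. f i \<in> (M i)}" "\<zero>\<^sub>(prod_mod M) = (%i. \<zero>\<^sub>(M i))"
  "f \<oplus>\<^sub>(prod_mod M) g = (%i. f i \<oplus>\<^sub>(M i) g i)" "r \<odot>\<^sub>(prod_mod M) f = (%i. r \<odot>\<^sub>(M i) f i)" for f g r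
  by(simp_all add: prod_mod_def)
 show ?thesis
  by(rule moduleI'[OF module_cring[OF M]])
  (simp_all add: modD[OF M] mod_assoc[OF M] mod_smult_add[OF M] mod_add_smult[OF M] mod_mult_smult[OF M] mod_ac[OF M])
qed

section \<open>Hom complexes\<close>

text \<open>The sign \<open>(-1)^n\<close> as a scalar, which merges the two cases of the
  differential of \<open>hom_cplx\<close> into one formula.\<close>

definition hsign :: "('a,'r) ring_scheme => int => 'a" where
 "hsign R n = (if even n then \<one>\<^sub>R else \<ominus>\<^sub>R \<one>\<^sub>R)"

lemma
 assumes R: "cring R"
 shows hsign_closed: "hsign R n \<in> R" and hsign_square: "hsign R n \<otimes>\<^sub>R hsign R n = \<one>\<^sub>R"
proof -
 interpret cring R by fact
 show "hsign R n \<in> R" "hsign R n \<otimes>\<^sub>R hsign R n = \<one>\<^sub>R" by(auto simp: hsign_def l_minus r_minus)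
qed

lemma hsign_succ:
 assumes M: "module R M" and x: "x \<in> M"
 shows "hsign R (n + 1) \<odot>\<^sub>M x = \<ominus>\<^sub>M (hsign R n \<odot>\<^sub>M x)" "hsign R (n - 1) \<odot>\<^sub>M x = \<ominus>\<^sub>M (hsign R n \<odot>\<^sub>M x)"
 using x module_cring[OF M] by(auto simp: hsign_def mod_neg_smult[OF M] modD[OF M])

lemma hom_cplx_carrier:
 "f \<in> cobj (hom_cplx R X Y) n \<longleftrightarrow> (ALL p. f p \<in> (Hom R (X p) (Y (p + n))))"
 by(simp add: hom_cplx_def prod_mod_def)

lemma hom_cplx_ops:
 "x \<in> carrier (cobj X p) ==> \<zero>\<^bsub>cobj (hom_cplx R X Y) n\<^esub> p x = \<zero>\<^bsub>cobj Y (p + n)\<^esub>"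
 "x \<in> carrier (cobj X p) ==> (f \<oplus>\<^bsub>cobj (hom_cplx R X Y) n\<^esub> g) p x = f p x \<oplus>\<^bsub>cobj Y (p + n)\<^esub> g p x"
 "x \<in> carrier (cobj X p) ==> (r \<odot>\<^bsub>cobj (hom_cplx R X Y) n\<^esub> f) p x = r \<odot>\<^bsub>cobj Y (p + n)\<^esub> f p x"
 by(simp_all add: hom_cplx_def prod_mod_def)

lemma hom_cplx_eqI:
 assumes "f \<in> cobj (hom_cplx R X Y) n" "g \<in> cobj (hom_cplx R X Y) n"
  "!!p x. x \<in> X p ==> f p x = g p x"
 shows "f = g"
proof
 fix p
 show "f p = g p" by(rule hom_eqI[of _ R "X p" "Y (p + n)"]) (use assms in \<open>auto simp: hom_cplx_carrier\<close>)
qed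

context
 fixes R :: "('a,'r) ring_scheme" and X :: "('a,'m) cplx" and Y :: "('a,'n) cplx"
 assumes X: "is_complex R X" and Y: "is_complex R Y"
begin

private abbreviation "HC \<equiv> hom_cplx R X Y"

lemma hom_cplx_lmap: "f \<in> cobj HC n ==> m = p + n ==> lmap R (X p) (Y m) (f p)"
 using hom_lmap[OF _ cplx_module[OF X] cplx_module[OF Y]] by(simp add: hom_cplx_carrier)

lemma hom_cplx_mem: "(!!p. lmap R (X p) (Y (p + n)) (f p)) ==> (%p. \<lambda>x\<in>X p. f p x) \<in> cobj HC n"
 unfolding hom_cplx_carrier using hom_mem by blast

lemma hom_cplx_diff:
 assumes f: "f \<in> cobj HC n" and x: "x \<in> X p" and m: "m = p + n - 1"
 shows "cdiff HC n f p x = cdiff Y (p + n) (f p x) \<ominus>\<^sub>(Y m) hsign R n \<odot>\<^sub>(Y m) f (p - 1) (cdiff X p x)"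
proof -
 have "f (p - 1) (cdiff X p x) \<in> Y m"
  by(rule lmap_in[OF hom_cplx_lmap[OF f] lmap_in[OF cplx_lmap[OF X refl] x]]) (simp add: m)
 thus ?thesis
  using x unfolding m hom_cplx_def hsign_def
  by(simp add: a_minus_def mod_neg_smult[OF cplx_module[OF Y]] modD[OF cplx_module[OF Y]]
  module_cring[OF cplx_module[OF Y]])
qed

text \<open>Passing from \<open>n\<close> to \<open>n + 1\<close> flips the sign, so the difference
  becomes a sum with the scalar of degree \<open>n\<close>. This is the shape used in
  \<open>htpy\<close>.\<close>

lemma hom_cplx_diff_succ:
 assumes f: "f \<in> cobj HC (n + 1)" and x: "x \<in> X p"
 shows "cdiff HC (n + 1) f p x = cdiff Y (p + n + 1) (f p x) \<oplus>\<^sub>(Y (p + n)) hsign R n \<odot>\<^sub>(Y (p + n)) f (p - 1) (cdiff X p x)"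
proof -
 have i: "p + n = p + (n + 1) - 1" "p + (n + 1) = p + n + 1" "p + n = p - 1 + (n + 1)" by auto
 have "f (p - 1) (cdiff X p x) \<in> Y (p + n)"
  by(rule lmap_in[OF hom_cplx_lmap[OF f i(3)] lmap_in[OF cplx_lmap[OF X refl] x]])
 thus ?thesis
  unfolding hom_cplx_diff[OF f x i(1)] i(2) a_minus_def
  by(simp add: hsign_succ(1)[OF cplx_module[OF Y]] modD[OF cplx_module[OF Y]] hsign_closed[OF module_cring[OF cplx_module[OF Y]]])
qed

lemma hom_cplx_diff_mem:
 assumes f: "f \<in> cobj HC n" and m: "m = n - 1"
 shows "cdiff HC n f \<in> cobj HC m"
proof -
 note R = module_cring[OF cplx_module[OF X]]
 have "lmap R (X p) (Y (p + m)) (%x. cdiff Y (p + n) (f p x) \<ominus>\<^sub>(Y (p + m)) hsign R n \<odot>\<^sub>(Y (p + m)) f (p - 1) (cdiff X p x))" for p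
  by(rule lmap_diff[OF lmap_comp[OF hom_cplx_lmap[OF f refl] cplx_lmap[OF Y]]
  lmap_scale[OF lmap_comp[OF cplx_lmap[OF X refl] hom_cplx_lmap[OF f]] hsign_closed[OF R]]]) (simp_all add: m)
 from hom_cplx_mem[OF this] have l: "(%p. \<lambda>x\<in>X p. cdiff Y (p + n) (f p x) \<ominus>\<^sub>(Y (p + m)) hsign R n \<odot>\<^sub>(Y (p + m)) f (p - 1) (cdiff X p x)) \<in> cobj HC m" .
 have "cdiff HC n f = (%p. \<lambda>x\<in>X p. cdiff Y (p + n) (f p x) \<ominus>\<^sub>(Y (p + m)) hsign R n \<odot>\<^sub>(Y (p + m)) f (p - 1) (cdiff X p x))"
 proof(intro ext)
  fix p x
  show "cdiff HC n f p x = (\<lambda>x\<in>X p. cdiff Y (p + n) (f p x) \<ominus>\<^sub>(Y (p + m)) hsign R n \<odot>\<^sub>(Y (p + m)) f (p - 1) (cdiff X p x)) x"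
  using hom_cplx_diff[OF f, of x p "p + m"] by(cases "x \<in> X p") (simp_all add: m, simp add: hom_cplx_def)
 qed
 with l show ?thesis by simp
qed

lemma is_complex_hom: "is_complex R HC"
proof(rule cplxI)
 note R = module_cring[OF cplx_module[OF X]]
 have M: "module R (cobj HC n)" for n
  using module_prod_mod[of R "%p. Hom R (X p) (Y (p + n))"] module_hom_mod[OF cplx_module[OF X] cplx_module[OF Y]]
  by(simp add: hom_cplx_def)
 fix n
 show "lmap R (cobj HC n) (cobj HC (n - 1)) (cdiff HC n)"
 proof(rule lmapI[OF M M hom_cplx_diff_mem[OF _ refl]])
  fix f g assume f: "f \<in> cobj HC n" and g: "g \<in> cobj HC n"
  note fg = mod_add_closed[OF M f g]
  show "cdiff HC n (f \<oplus>\<^sub>(cobj HC n) g) = cdiff HC n f \<oplus>\<^sub>(cobj HC (n - 1)) cdiff HC n g"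
  proof(rule hom_cplx_eqI[OF hom_cplx_diff_mem[OF fg refl] mod_add_closed[OF M hom_cplx_diff_mem[OF f refl] hom_cplx_diff_mem[OF g refl]]])
  fix p x assume x: "x \<in> X p"
  note dx = lmap_in[OF cplx_lmap[OF X refl] x]
  let ?m = "p + (n - 1)"
  have m: "?m = p + n - 1" "p - 1 + n = ?m" by auto
  note YM = cplx_module[OF Y, of ?m]
  note d = cplx_lmap[OF Y m(1)]
  have c: "f p x \<in> Y (p + n)" "g p x \<in> Y (p + n)"
  "f (p - 1) (cdiff X p x) \<in> Y ?m" "g (p - 1) (cdiff X p x) \<in> Y ?m"
  using lmap_in[OF hom_cplx_lmap[OF f] x] lmap_in[OF hom_cplx_lmap[OF g] x]
  lmap_in[OF hom_cplx_lmap[OF f m(2)[symmetric]] dx] lmap_in[OF hom_cplx_lmap[OF g m(2)[symmetric]] dx] by auto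
  show "cdiff HC n (f \<oplus>\<^sub>(cobj HC n) g) p x = (cdiff HC n f \<oplus>\<^sub>(cobj HC (n - 1)) cdiff HC n g) p x"
  unfolding hom_cplx_ops(2)[OF x] hom_cplx_diff[OF fg x m(1)] hom_cplx_diff[OF f x m(1)] hom_cplx_diff[OF g x m(1)]
  hom_cplx_ops(2)[OF dx] m(2) using c
  by(simp add: lmap_add[OF d] lmap_in[OF d] mod_smult_add[OF YM hsign_closed[OF R]] a_minus_def mod_neg_distrib[OF YM]
  modD[OF YM] hsign_closed[OF R] mod_ac[OF YM])
  qed
 next
  fix r f assume r: "r \<in> R" and f: "f \<in> cobj HC n"
  note fg = mod_smult_closed[OF M r f]
  show "cdiff HC n (r \<odot>\<^sub>(cobj HC n) f) = r \<odot>\<^sub>(cobj HC (n - 1)) cdiff HC n f"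
  proof(rule hom_cplx_eqI[OF hom_cplx_diff_mem[OF fg refl] mod_smult_closed[OF M r hom_cplx_diff_mem[OF f refl]]])
  fix p x assume x: "x \<in> X p"
  note dx = lmap_in[OF cplx_lmap[OF X refl] x]
  let ?m = "p + (n - 1)"
  have m: "?m = p + n - 1" "p - 1 + n = ?m" by auto
  note YM = cplx_module[OF Y, of ?m]
  note d = cplx_lmap[OF Y m(1)]
  have c: "f p x \<in> Y (p + n)" "f (p - 1) (cdiff X p x) \<in> Y ?m"
  using lmap_in[OF hom_cplx_lmap[OF f] x] lmap_in[OF hom_cplx_lmap[OF f m(2)[symmetric]] dx] by auto
  have "hsign R n \<odot>\<^sub>(Y ?m) (r \<odot>\<^sub>(Y ?m) y) = r \<odot>\<^sub>(Y ?m) (hsign R n \<odot>\<^sub>(Y ?m) y)" if "y \<in> Y ?m" for y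
  using mod_mult_smult[OF YM] cring_mult_comm[OF R] r hsign_closed[OF R] that by metis
  thus "cdiff HC n (r \<odot>\<^sub>(cobj HC n) f) p x = (r \<odot>\<^sub>(cobj HC (n - 1)) cdiff HC n f) p x"
  unfolding hom_cplx_ops(3)[OF x] hom_cplx_diff[OF fg x m(1)] hom_cplx_diff[OF f x m(1)] hom_cplx_ops(3)[OF dx] m(2) using c r
  by(simp add: lmap_smult[OF d] lmap_in[OF d] mod_smult_add[OF YM] a_minus_def mod_smult_neg[OF YM]
  modD[OF YM] hsign_closed[OF R])
  qed
 qed
 fix f assume f: "f \<in> cobj HC n"
 note df = hom_cplx_diff_mem[OF f refl]
 show "cdiff HC (n - 1) (cdiff HC n f) = \<zero>\<^sub>(cobj HC (n - 2))"
 proof(rule hom_cplx_eqI[OF hom_cplx_diff_mem[OF df] mod_zero_closed[OF M]])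
  show "n - 2 = n - 1 - 1" by simp
  fix p x assume x: "x \<in> X p"
  note dx = lmap_in[OF cplx_lmap[OF X refl] x]
  let ?m = "p + n - 1" and ?k = "p + (n - 2)"
  have m: "p + (n - 1) = ?m" "p - 1 + n = ?m" "?k = p + (n - 1) - 1" "?k = ?m - 1" "?k = p - 1 + n - 1" "?k = p - 1 - 1 + n" by auto
  note YM = cplx_module[OF Y]
  note d = cplx_lmap[OF Y m(4)]
  have ddx: "cdiff X (p - 1) (cdiff X p x) = \<zero>\<^sub>(X (p - 1 - 1))" by(rule cplx_dd[OF X x]) auto
  have ddy: "cdiff Y ?m (cdiff Y (p + n) (f p x)) = \<zero>\<^sub>(Y ?k)"
  by(rule cplx_dd[OF Y lmap_in[OF hom_cplx_lmap[OF f refl] x]]) auto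
  let ?y = "f (p - 1) (cdiff X p x)"
  have y: "?y \<in> Y ?m" using lmap_in[OF hom_cplx_lmap[OF f m(2)[symmetric]] dx] .
  have fz: "f (p - 1 - 1) \<zero>\<^sub>(X (p - 1 - 1)) = \<zero>\<^sub>(Y ?k)" by(rule lmap_zero[OF hom_cplx_lmap[OF f m(6)]])
  have c: "cdiff Y (p + n) (f p x) \<in> Y ?m"
  using lmap_in[OF cplx_lmap[OF Y refl] lmap_in[OF hom_cplx_lmap[OF f refl] x]] .
  have 1: "cdiff Y ?m (cdiff HC n f p x) = \<ominus>\<^sub>(Y ?k) (hsign R n \<odot>\<^sub>(Y ?k) cdiff Y ?m ?y)"
  unfolding hom_cplx_diff[OF f x refl] using c y
  by(simp add: lmap_minus[OF d] lmap_smult[OF d] modD[OF YM] hsign_closed[OF R] ddy, simp add: a_minus_def lmap_in[OF d] modD[OF YM] hsign_closed[OF R])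
  have 2: "cdiff HC n f (p - 1) (cdiff X p x) = cdiff Y ?m ?y"
  unfolding hom_cplx_diff[OF f dx m(5)] ddx fz m(2) using lmap_in[OF d y] by(simp add: modD[OF YM] hsign_closed[OF R])
  show "cdiff HC (n - 1) (cdiff HC n f) p x = \<zero>\<^sub>(cobj HC (n - 2)) p x"
  unfolding hom_cplx_diff[OF df x m(3)] hom_cplx_ops(1)[OF x] m(1) 1 2 hsign_succ(2)[OF YM lmap_in[OF d y]]
  using lmap_in[OF d y] by(simp add: modD[OF YM] hsign_closed[OF R])
 qed
qed

end

section \<open>Null homotopies\<close>

text \<open>The differential keeps its sign; all signs are carried by the scalar \<open>e\<close> of
  \<open>cmap\<close> and \<open>htpy\<close>.\<close>

definition shift :: "int => ('a,'m) cplx => ('a,'m) cplx" where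
 "shift n Y = \<lparr>cobj = (%p. Y (p + n)), cdiff = (%p. cdiff Y (p + n))\<rparr>"

lemma shift_simps [simp]: "cobj (shift n Y) p = Y (p + n)" "cdiff (shift n Y) p = cdiff Y (p + n)"
 by(simp_all add: shift_def)

lemma is_complex_shift: "is_complex R Y ==> is_complex R (shift n Y)"
 by(rule cplxI) (simp_all add: cplx_lmap cplx_dd algebra_simps)

text \<open>For \<open>e = (-1)^n\<close> and a target shifted by \<open>n\<close>, these families
  are the cycles of degree \<open>n\<close> in the Hom complex, and \<open>htpy\<close> with the
  same \<open>e\<close> says that \<open>f\<close> is the boundary of \<open>h\<close>.\<close>

definition cmap :: "('a,'r) ring_scheme => 'a => ('a,'m) cplx => ('a,'n) cplx => (int => 'm => 'n) => bool" where
 "cmap R e X Y f \<longleftrightarrow> (ALL p. lmap R (X p) (Y p) (f p)) &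
  (ALL p. \<forall>x\<in>X p. cdiff Y p (f p x) = e \<odot>\<^sub>(Y (p - 1)) f (p - 1) (cdiff X p x))"

definition htpy :: "('a,'r) ring_scheme => 'a => ('a,'m) cplx => ('a,'n) cplx => (int => 'm => 'n) => (int => 'm => 'n) => bool" where
 "htpy R e X Y f h \<longleftrightarrow> (ALL p. lmap R (X p) (Y (p + 1)) (h p)) &
  (ALL p. \<forall>x\<in>X p. f p x = cdiff Y (p + 1) (h p x) \<oplus>\<^sub>(Y p) e \<odot>\<^sub>(Y p) h (p - 1) (cdiff X p x))"

text \<open>Cycles and boundaries of the Hom complex are unfolded. Its elements are extensional
  while \<open>f\<close> and \<open>h\<close> on the right are arbitrary functions, so restrictions
  mediate between the two sides.\<close>

lemma homology_hom_zero_iff: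
 assumes X: "is_complex R X" and Y: "is_complex R Y"
 shows "zero_mod (homology (hom_cplx R X Y) n) \<longleftrightarrow>
  (ALL f. cmap R (hsign R n) X (shift n Y) f --> (EX h. htpy R (hsign R n) X (shift n Y) f h))"
proof -
 note R = module_cring[OF cplx_module[OF X]]
 let ?H = "hom_cplx R X Y"
 note YM = cplx_module[OF Y] and e = hsign_closed[OF R, of n]
 have i: "p - 1 + n = p + n - 1" "p + 1 + n = p + n + 1" "p + (n - 1) = p + n - 1" "p + (n + 1) = p + n + 1" for p by auto
 have zero: "cdiff ?H n f = \<zero>\<^sub>(cobj ?H (n - 1)) \<longleftrightarrow> cmap R (hsign R n) X (shift n Y) f" if f: "f \<in> cobj ?H n" for f
 proof -
  have "cdiff ?H n f = \<zero>\<^sub>(cobj ?H (n - 1)) \<longleftrightarrow> (ALL p. \<forall>x\<in>X p. cdiff ?H n f p x = \<zero>\<^sub>(cobj ?H (n - 1)) p x)"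
  using hom_cplx_eqI[OF hom_cplx_diff_mem[OF X Y f refl] mod_zero_closed[OF cplx_module[OF is_complex_hom[OF X Y]]]] by metis
  also have "\<dots> \<longleftrightarrow> (ALL p. \<forall>x\<in>X p. cdiff Y (p + n) (f p x) = hsign R n \<odot>\<^sub>(Y (p + n - 1)) f (p - 1) (cdiff X p x))"
  proof(intro all_cong1 ball_cong refl)
  fix p x assume x: "x \<in> X p"
  note dx = lmap_in[OF cplx_lmap[OF X refl] x]
  have "cdiff Y (p + n) (f p x) \<in> Y (p + n - 1)" "f (p - 1) (cdiff X p x) \<in> Y (p + n - 1)"
  using lmap_in[OF cplx_lmap[OF Y refl] lmap_in[OF hom_cplx_lmap[OF X Y f refl] x]]
  lmap_in[OF hom_cplx_lmap[OF X Y f i(1)[symmetric]] dx] by auto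
  thus "cdiff ?H n f p x = \<zero>\<^sub>(cobj ?H (n - 1)) p x \<longleftrightarrow>
  cdiff Y (p + n) (f p x) = hsign R n \<odot>\<^sub>(Y (p + n - 1)) f (p - 1) (cdiff X p x)"
  unfolding hom_cplx_diff[OF X Y f x refl] hom_cplx_ops(1)[OF x] i using e
  by(simp add: mod_minus_eq_zero[OF YM] modD[OF YM])
  qed
  finally show ?thesis using hom_cplx_lmap[OF X Y f] by(simp add: cmap_def i)
 qed
 have bd: "cdiff ?H (n + 1) h = f \<longleftrightarrow> htpy R (hsign R n) X (shift n Y) f h" if f: "f \<in> cobj ?H n" and h: "h \<in> cobj ?H (n + 1)" for f h
 proof -
  have "cdiff ?H (n + 1) h = f \<longleftrightarrow> (ALL p. \<forall>x\<in>X p. cdiff ?H (n + 1) h p x = f p x)"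
  using hom_cplx_eqI[OF hom_cplx_diff_mem[OF X Y h] f] by auto
  thus ?thesis using hom_cplx_lmap[OF X Y h] hom_cplx_diff_succ[OF X Y h] by(auto simp: htpy_def i)
 qed
 have res: "(%p. \<lambda>x\<in>X p. f p x) \<in> cobj ?H n" if "cmap R (hsign R n) X (shift n Y) f" for f
  by(rule hom_cplx_mem[OF X Y]) (use that in \<open>simp add: cmap_def\<close>)
 have resh: "(%p. \<lambda>x\<in>X p. h p x) \<in> cobj ?H (n + 1)" if "htpy R (hsign R n) X (shift n Y) f h" for f h
  by(rule hom_cplx_mem[OF X Y]) (use that in \<open>simp add: htpy_def i\<close>)
 note dx = lmap_in[OF cplx_lmap[OF X refl]]
 have rc: "cmap R (hsign R n) X (shift n Y) (%p. \<lambda>x\<in>X p. f p x)" if f: "cmap R (hsign R n) X (shift n Y) f" for f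
  unfolding cmap_def
 proof(intro conjI allI ballI)
  show "lmap R (X p) (cobj (shift n Y) p) (\<lambda>x\<in>X p. f p x)" for p
  by(rule lmap_cong[of _ _ _ "f p"]) (use f in \<open>auto simp: cmap_def\<close>)
 qed (use f dx in \<open>simp add: cmap_def\<close>)
 have rh: "htpy R (hsign R n) X (shift n Y) f (%p. \<lambda>x\<in>X p. h p x)" if h: "htpy R (hsign R n) X (shift n Y) f h" for f h
  unfolding htpy_def
 proof(intro conjI allI ballI)
  show "lmap R (X p) (cobj (shift n Y) (p + 1)) (\<lambda>x\<in>X p. h p x)" for p
  by(rule lmap_cong[of _ _ _ "h p"]) (use h in \<open>auto simp: htpy_def\<close>)
 qed (use h dx in \<open>simp add: htpy_def\<close>)
 have rf: "htpy R (hsign R n) X (shift n Y) (%p. \<lambda>x\<in>X p. f p x) h \<longleftrightarrow> htpy R (hsign R n) X (shift n Y) f h" for f h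
  by(simp add: htpy_def)
 show ?thesis
  unfolding zero_mod_homology[OF is_complex_hom[OF X Y]]
 proof(intro iffI allI impI ballI)
  fix f assume z: "\<forall>x\<in>cobj ?H n. cdiff ?H n x = \<zero>\<^sub>(cobj ?H (n - 1)) --> (\<exists>y\<in>cobj ?H (n + 1). cdiff ?H (n + 1) y = x)"
  and f: "cmap R (hsign R n) X (shift n Y) f"
  note r = res[OF f]
  obtain h where h: "h \<in> cobj ?H (n + 1)" "cdiff ?H (n + 1) h = (%p. \<lambda>x\<in>X p. f p x)"
  using bspec[OF z r] zero[OF r] rc[OF f] by blast
  show "EX h. htpy R (hsign R n) X (shift n Y) f h" using h(2) unfolding bd[OF r h(1)] rf by blast
 next
  fix f assume z: "ALL f. cmap R (hsign R n) X (shift n Y) f --> (EX h. htpy R (hsign R n) X (shift n Y) f h)"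
  and f: "f \<in> cobj ?H n" and 0: "cdiff ?H n f = \<zero>\<^sub>(cobj ?H (n - 1))"
  obtain h where h: "htpy R (hsign R n) X (shift n Y) f h" using z zero[OF f] 0 by blast
  show "\<exists>y\<in>cobj ?H (n + 1). cdiff ?H (n + 1) y = f" using bd[OF f resh[OF h]] rh[OF h] resh[OF h] by blast
 qed
qed

lemma int_recursive_choice:
 assumes "P b h0" and step: "!!p h. b \<le> p ==> P p h ==> EX h'. P (p + 1) h' & Q p h h'"
 shows "EX h. (\<forall>p\<ge>b::int. P p (h p) & Q p (h p) (h (p + 1)))"
proof -
 have "EX k. ALL n. P (b + int n) (k n) & Q (b + int n) (k n) (k (Suc n))"
 proof(rule dependent_nat_choice)
  show "EX h. P (b + int 0) h" using assms(1) by auto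
  show "EX h'. P (b + int (Suc n)) h' & Q (b + int n) h h'" if "P (b + int n) h" for h n
  using step[OF _ that] by(simp add: algebra_simps)
 qed
 then obtain k where k: "!!n. P (b + int n) (k n)" "!!n. Q (b + int n) (k n) (k (Suc n))" by blast
 show ?thesis
 proof(intro exI[of _ "%p. k (nat (p - b))"] allI impI)
  fix p assume p: "b \<le> p"
  hence "nat (p + 1 - b) = Suc (nat (p - b))" by simp
  thus "P p (k (nat (p - b))) & Q p (k (nat (p - b))) (k (nat (p + 1 - b)))"
  using k[of "nat (p - b)"] p by simp
 qed
qed

text \<open>Exactness of \<open>Hom(Q, Z)\<close> in elementary terms, and
  \<open>hom_extends\<close> likewise for \<open>Hom(Z, E)\<close>; \<open>hom_lifts_iff\<close> and
  \<open>hom_extends_iff\<close> connect them with the Hom complexes that define properness.\<close>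

definition hom_lifts :: "('a,'r) ring_scheme => ('a,'q) module => ('a,'m) cplx => bool" where
 "hom_lifts R Q Z \<longleftrightarrow> (ALL q g. lmap R Q (Z q) g & (\<forall>x\<in>Q. cdiff Z q (g x) = \<zero>\<^sub>(Z (q - 1))) -->
  (EX k. lmap R Q (Z (q + 1)) k & (\<forall>x\<in>Q. cdiff Z (q + 1) (k x) = g x)))"

definition hom_extends :: "('a,'r) ring_scheme => ('a,'m) cplx => ('a,'e) module => bool" where
 "hom_extends R Z E \<longleftrightarrow> (ALL q g. lmap R (Z q) E g & (\<forall>x\<in>Z (q + 1). g (cdiff Z (q + 1) x) = \<zero>\<^sub>E) -->
  (EX k. lmap R (Z (q - 1)) E k & (\<forall>x\<in>Z q. k (cdiff Z q x) = g x)))"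

lemma hom_liftsD:
 assumes "hom_lifts R Q Z" "lmap R Q (Z q) g" "!!x. x \<in> Q ==> cdiff Z q (g x) = \<zero>\<^sub>(Z (q - 1))" "s = q + 1"
 shows "EX k. lmap R Q (Z s) k & (\<forall>x\<in>Q. cdiff Z s (k x) = g x)"
 using assms unfolding hom_lifts_def by blast

lemma hom_extendsD:
 assumes "hom_extends R Z E" "lmap R (Z q) E g" "!!x. x \<in> Z (q + 1) ==> g (cdiff Z (q + 1) x) = \<zero>\<^sub>E" "s = q - 1"
 shows "EX k. lmap R (Z s) E k & (\<forall>x\<in>Z q. k (cdiff Z q x) = g x)"
 using assms unfolding hom_extends_def by blast

lemma hom_lifts_zero:
 assumes Z: "is_complex R Z" and Q: "module R Q" "!!x. x \<in> Q ==> x = \<zero>\<^sub>Q"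
 shows "hom_lifts R Q Z"
 unfolding hom_lifts_def
proof(intro allI impI, elim conjE)
 fix q g assume g: "lmap R Q (Z q) g"
 have "lmap R (Z (q + 1)) (Z q) (cdiff Z (q + 1))" by(rule cplx_lmap[OF Z]) simp
 thus "EX k. lmap R Q (Z (q + 1)) k & (\<forall>x\<in>Q. cdiff Z (q + 1) (k x) = g x)"
  using lmap_const_zero[OF Q(1) cplx_module[OF Z]] Q(2) lmap_zero[OF g] lmap_zero by metis
qed

lemma hom_extends_zero:
 assumes Z: "is_complex R Z" and E: "module R E" "!!x. x \<in> E ==> x = \<zero>\<^sub>E"
 shows "hom_extends R Z E"
 unfolding hom_extends_def using lmap_const_zero[OF cplx_module[OF Z] E(1)] E(2) lmap_in by metis

lemma hom_lifts_shift:
 assumes "hom_lifts R Q Z"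
 shows "hom_lifts R Q (shift n Z)"
proof -
 have i: "q - 1 + n = q + n - 1" "q + 1 + n = q + n + 1" for q by auto
 show ?thesis using assms unfolding hom_lifts_def shift_simps i by blast
qed

text \<open>\<open>h\<close> is built from below, where \<open>X\<close> vanishes, by lifting along
  the exact sequences \<open>Hom(X p, W)\<close>. With suitable signs and shifts this one lemma
  yields comparison maps, homotopies between them, and exactness of mapping cones.\<close>

lemma null_up:
 assumes X: "is_complex R X" and W: "is_complex R W" and neg: "!!p x. p < 0 ==> x \<in> X p ==> x = \<zero>\<^sub>(X p)"
  and lift: "!!p. p \<ge> 0 ==> hom_lifts R (X p) W" and f: "cmap R e X W f" and e: "e \<in> R"
 shows "EX h. htpy R e X W f h"
proof -
 note XM = cplx_module[OF X] and WM = cplx_module[OF W]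
 have fl: "lmap R (X p) (W p) (f p)"
  and fd: "x \<in> X p ==> cdiff W p (f p x) = e \<odot>\<^sub>(W (p - 1)) f (p - 1) (cdiff X p x)" for p x
  using f by(auto simp: cmap_def)
 have dX: "lmap R (X (p + 1)) (X p) (cdiff X (p + 1))" for p by(rule cplx_lmap[OF X]) simp
 have dW: "lmap R (W (p + 1)) (W p) (cdiff W (p + 1))" for p by(rule cplx_lmap[OF W]) simp
 have dX': "lmap R (X p) (X (p - 1)) (cdiff X p)" for p by(rule cplx_lmap[OF X]) simp
 have dW': "lmap R (W p) (W (p - 1)) (cdiff W p)" for p by(rule cplx_lmap[OF W]) simp
 \<comment> \<open>\<open>P\<close> is the invariant that makes the next lifting problem solvable:
   \<open>f\<close> minus \<open>e h d\<close> in the following degree is then a cycle.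
   \<open>Q\<close> is the homotopy equation between successive degrees.\<close>
 define P where "P p h \<longleftrightarrow> lmap R (X p) (W (p + 1)) h &
  (\<forall>x\<in>X (p + 1). cdiff W (p + 1) (h (cdiff X (p + 1) x)) = f p (cdiff X (p + 1) x))" for p h
 define Q where "Q p h h' \<longleftrightarrow> (\<forall>x\<in>X (p + 1).
  f (p + 1) x = cdiff W (p + 1 + 1) (h' x) \<oplus>\<^sub>(W (p + 1)) e \<odot>\<^sub>(W (p + 1)) h (cdiff X (p + 1) x))" for p h h'
 have "EX h. \<forall>p\<ge>-1. P p (h p) & Q p (h p) (h (p + 1))"
 proof(rule int_recursive_choice)
  have "f (-1) (cdiff X 0 x) = \<zero>\<^sub>(W (-1))" if "x \<in> X 0" for x
  using neg[of "-1", OF _ lmap_in[OF dX[of "-1"], simplified, OF that]] lmap_zero[OF fl[of "-1"]] by simp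
  thus "P (-1) (%_. \<zero>\<^sub>(W (-1 + 1)))"
  using lmap_const_zero[OF XM WM] lmap_zero[OF dW[of "-1"]] by(simp add: P_def)
 next
  fix p h assume p: "-1 \<le> p" and "P p h"
  hence h: "lmap R (X p) (W (p + 1)) h"
  "!!x. x \<in> X (p + 1) ==> cdiff W (p + 1) (h (cdiff X (p + 1) x)) = f p (cdiff X (p + 1) x)"
  by(auto simp: P_def)
  let ?M = "W (p + 1)"
  let ?g = "%x. f (p + 1) x \<ominus>\<^sub>?M e \<odot>\<^sub>?M h (cdiff X (p + 1) x)"
  note hd = lmap_comp[OF dX h(1)] and f1 = fl[of "p + 1"]
  have g: "lmap R (X (p + 1)) ?M ?g" by(rule lmap_diff[OF f1 lmap_scale[OF hd e]])
  have gz: "cdiff W (p + 1) (?g x) = \<zero>\<^sub>(W (p + 1 - 1))" if x: "x \<in> X (p + 1)" for x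
  using lmap_in[OF f1 x] lmap_in[OF hd x] e h(2)[OF x] fd[OF x] lmap_in[OF lmap_comp[OF dX fl] x]
  by(simp add: lmap_minus[OF dW] lmap_smult[OF dW] modD[OF WM])
  obtain k where k: "lmap R (X (p + 1)) (W (p + 1 + 1)) k"
  "!!x. x \<in> X (p + 1) ==> cdiff W (p + 1 + 1) (k x) = ?g x"
  using hom_liftsD[OF lift g gz refl] p by auto
  have "Q p h k"
  unfolding Q_def using k(2) lmap_in[OF f1] lmap_in[OF hd] e by(simp add: modD[OF WM])
  moreover have "P (p + 1) k"
  unfolding P_def
  proof(intro conjI ballI k(1))
  fix x assume x: "x \<in> X (p + 1 + 1)"
  note dx = lmap_in[OF dX x]
  have "cdiff X (p + 1) (cdiff X (p + 1 + 1) x) = \<zero>\<^sub>(X p)" by(rule cplx_dd[OF X x]) auto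
  thus "cdiff W (p + 1 + 1) (k (cdiff X (p + 1 + 1) x)) = f (p + 1) (cdiff X (p + 1 + 1) x)"
  using k(2)[OF dx] lmap_in[OF f1 dx] e by(simp add: lmap_zero[OF h(1)] modD[OF WM])
  qed
  ultimately show "EX h'. P (p + 1) h' & Q p h h'" by blast
 qed
 then obtain h where h: "!!p. p \<ge> -1 ==> P p (h p)" "!!p. p \<ge> -1 ==> Q p (h p) (h (p + 1))" by blast
 let ?h = "%p. if p \<ge> -1 then h p else (%_. \<zero>\<^sub>(W (p + 1)))"
 have l: "lmap R (X p) (W (p + 1)) (?h p)" for p
  using h(1) lmap_const_zero[OF XM WM] by(auto simp: P_def)
 have "f p x = cdiff W (p + 1) (?h p x) \<oplus>\<^sub>(W p) e \<odot>\<^sub>(W p) ?h (p - 1) (cdiff X p x)" if x: "x \<in> X p" for p x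
 proof(cases "p \<ge> 0")
  case True
  thus ?thesis using h(2)[of "p - 1"] x by(simp add: Q_def)
 next
  case False
  hence "x = \<zero>\<^sub>(X p)" using neg x by simp
  thus ?thesis
  using lmap_zero[OF l[of p]] lmap_zero[OF l[of "p - 1"]] e
  by(simp only: lmap_zero[OF fl] lmap_zero[OF dX'] lmap_zero[OF dW] diff_add_cancel) (simp add: modD[OF WM])
 qed
 with l have "htpy R e X W f ?h" unfolding htpy_def by blast
 thus ?thesis by blast
qed

text \<open>The mirror image of \<open>null_up\<close>: \<open>h\<close> is built downwards from the
  degree above which \<open>Y\<close> vanishes, by extension along \<open>Hom(X, Y p)\<close>. The
  new component occurs multiplied by \<open>e\<close> and is solved for by means of
  \<open>e e = 1\<close>.\<close>

lemma null_down:
 assumes X: "is_complex R X" and Y: "is_complex R Y" and bd: "!!p x. p > q ==> x \<in> Y p ==> x = \<zero>\<^sub>(Y p)"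
  and ext: "!!p. hom_extends R X (Y p)" and f: "cmap R e X Y f" and e: "e \<in> R" "e \<otimes>\<^sub>R e = \<one>\<^sub>R"
 shows "EX h. htpy R e X Y f h"
proof -
 note XM = cplx_module[OF X] and YM = cplx_module[OF Y]
 have ee: "e \<odot>\<^sub>(Y p) (e \<odot>\<^sub>(Y p) x) = x" if "x \<in> Y p" for p x
  using mod_mult_smult[OF YM e(1,1) that] e(2) that by(simp add: modD[OF YM])
 have fl: "lmap R (X p) (Y p) (f p)"
  and fd: "x \<in> X p ==> cdiff Y p (f p x) = e \<odot>\<^sub>(Y (p - 1)) f (p - 1) (cdiff X p x)" for p x
  using f by(auto simp: cmap_def)
 have dX: "lmap R (X (p + 1)) (X p) (cdiff X (p + 1))" for p by(rule cplx_lmap[OF X]) simp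
 have dY: "lmap R (Y (p + 1)) (Y p) (cdiff Y (p + 1))" for p by(rule cplx_lmap[OF Y]) simp
 have dX': "lmap R (X p) (X (p - 1)) (cdiff X p)" for p by(rule cplx_lmap[OF X]) simp
 have dY': "lmap R (Y p) (Y (p - 1)) (cdiff Y p)" for p by(rule cplx_lmap[OF Y]) simp
 define P where "P p h \<longleftrightarrow> lmap R (X p) (Y (p + 1)) h &
  (\<forall>x\<in>X (p + 1). cdiff Y (p + 1) (h (cdiff X (p + 1) x)) = f p (cdiff X (p + 1) x))" for p h
 define Q where "Q p h h' \<longleftrightarrow> (\<forall>x\<in>X p.
  f p x = cdiff Y (p + 1) (h x) \<oplus>\<^sub>(Y p) e \<odot>\<^sub>(Y p) h' (cdiff X p x))" for p h h'
 \<comment> \<open>Negated degrees make the descending recursion an ascending one.\<close>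
 have "EX h. \<forall>p\<ge>-q. P (- p) (h p) & Q (- p) (h p) (h (p + 1))"
 proof(rule int_recursive_choice)
  have "f q (cdiff X (q + 1) x) = \<zero>\<^sub>(Y q)" if x: "x \<in> X (q + 1)" for x
  proof -
  have "f (q + 1) x = \<zero>\<^sub>(Y (q + 1))" using bd[OF _ lmap_in[OF fl x]] by simp
  hence "e \<odot>\<^sub>(Y q) f q (cdiff X (q + 1) x) = \<zero>\<^sub>(Y q)" using fd[OF x] lmap_zero[OF dY[of q]] by simp
  thus ?thesis using ee[OF lmap_in[OF lmap_comp[OF dX fl] x]] e(1) by(simp add: modD[OF YM])
  qed
  thus "P (- (- q)) (%_. \<zero>\<^sub>(Y (q + 1)))"
  using lmap_const_zero[OF XM YM] lmap_zero[OF dY[of q]] by(simp add: P_def)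
 next
  fix p' h assume "-q \<le> p'" and "P (- p') h"
  define p where "p = - p'"
  have h: "lmap R (X p) (Y (p + 1)) h"
  "!!x. x \<in> X (p + 1) ==> cdiff Y (p + 1) (h (cdiff X (p + 1) x)) = f p (cdiff X (p + 1) x)"
  using \<open>P (- p') h\<close> by(auto simp: P_def p_def)
  let ?g = "%x. f p x \<ominus>\<^sub>(Y p) cdiff Y (p + 1) (h x)"
  note dh = lmap_comp[OF h(1) dY]
  have g: "lmap R (X p) (Y p) ?g" by(rule lmap_diff[OF fl dh])
  have gz: "?g (cdiff X (p + 1) x) = \<zero>\<^sub>(Y p)" if x: "x \<in> X (p + 1)" for x
  using h(2)[OF x] lmap_in[OF lmap_comp[OF dX fl] x] by(simp add: modD[OF YM])
  obtain k where k: "lmap R (X (p - 1)) (Y p) k" "!!x. x \<in> X p ==> k (cdiff X p x) = ?g x"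
  using hom_extendsD[OF ext g gz refl] by auto
  let ?k = "%x. e \<odot>\<^sub>(Y p) k x"
  have kd: "e \<odot>\<^sub>(Y p) ?k (cdiff X p x) = ?g x" if x: "x \<in> X p" for x
  using ee[OF lmap_in[OF lmap_comp[OF dX' k(1)] x]] k(2)[OF x] by simp
  have "Q p h ?k"
  unfolding Q_def
  proof
  fix x assume x: "x \<in> X p"
  show "f p x = cdiff Y (p + 1) (h x) \<oplus>\<^sub>(Y p) e \<odot>\<^sub>(Y p) ?k (cdiff X p x)"
  unfolding kd[OF x] mod_comm[OF YM lmap_in[OF dh x] lmap_in[OF g x]]
  using lmap_in[OF fl x] lmap_in[OF dh x] by(simp add: modD[OF YM])
  qed
  moreover have "P (p - 1) ?k"
  unfolding P_def diff_add_cancel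
  proof(intro conjI ballI lmap_scale[OF k(1) e(1)])
  fix x assume x: "x \<in> X p"
  have "cdiff Y p (cdiff Y (p + 1) (h x)) = \<zero>\<^sub>(Y (p - 1))" by(rule cplx_dd[OF Y lmap_in[OF h(1) x]]) auto
  hence "cdiff Y p (?g x) = e \<odot>\<^sub>(Y (p - 1)) f (p - 1) (cdiff X p x)"
  using lmap_in[OF fl x] lmap_in[OF dh x] fd[OF x] lmap_in[OF lmap_comp[OF dX' fl] x] e(1)
  by(simp add: lmap_minus[OF dY'] modD[OF YM])
  thus "cdiff Y p (?k (cdiff X p x)) = f (p - 1) (cdiff X p x)"
  using lmap_smult[OF dY' e(1) lmap_in[OF g x]] k(2)[OF x] ee[OF lmap_in[OF lmap_comp[OF dX' fl] x]] by simp
  qed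
  ultimately show "EX h'. P (- (p' + 1)) h' & Q (- p') h h'" unfolding p_def by(intro exI[of _ ?k]) (simp add: p_def)
 qed
 then obtain h where h: "!!p. p \<ge> -q ==> P (- p) (h p)" "!!p. p \<ge> -q ==> Q (- p) (h p) (h (p + 1))" by blast
 let ?h = "%p. if p \<le> q then h (- p) else (%_. \<zero>\<^sub>(Y (p + 1)))"
 have l: "lmap R (X p) (Y (p + 1)) (?h p)" for p
  using h(1)[of "- p"] lmap_const_zero[OF XM YM] by(auto simp: P_def)
 have "f p x = cdiff Y (p + 1) (?h p x) \<oplus>\<^sub>(Y p) e \<odot>\<^sub>(Y p) ?h (p - 1) (cdiff X p x)" if x: "x \<in> X p" for p x
 proof(cases "p \<le> q")
  case True
  thus ?thesis using h(2)[of "- p"] x by(simp add: Q_def)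
 next
  case False
  have l': "lmap R (X (p - 1)) (Y p) (?h (p - 1))" using l[of "p - 1"] by(simp only: diff_add_cancel)
  have "cdiff Y (p + 1) (?h p x) \<oplus>\<^sub>(Y p) e \<odot>\<^sub>(Y p) ?h (p - 1) (cdiff X p x) \<in> Y p"
  by(intro mod_add_closed[OF YM] mod_smult_closed[OF YM] e(1) lmap_in[OF dY lmap_in[OF l x]]
  lmap_in[OF l' lmap_in[OF dX' x]])
  thus ?thesis using False bd[of p] lmap_in[OF fl x] by(metis not_le)
 qed
 with l have "htpy R e X Y f ?h" unfolding htpy_def by blast
 thus ?thesis by blast
qed

section \<open>Modules as complexes concentrated in degree zero\<close>

lemma stalk_simps [simp]: "cobj (stalk M) 0 = M" "n ~= 0 ==> cobj (stalk M) n = restr_mod M {\<zero>\<^sub>M}" "cdiff (stalk M) n x = \<zero>\<^sub>M"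
 "\<zero>\<^sub>(cobj (stalk M) n) = \<zero>\<^sub>M"
 by(simp_all add: stalk_def)

lemma stalk_zero: "n ~= 0 ==> x \<in> cobj (stalk M) n ==> x = \<zero>\<^sub>M"
 by simp

lemma is_complex_stalk:
 assumes M: "module R M"
 shows "is_complex R (stalk M)"
proof(rule cplxI)
 have z: "submodule {\<zero>\<^sub>M} R M" by(rule submoduleI'[OF M]) (auto simp: modD[OF M])
 have m: "module R (cobj (stalk M) n)" for n using M module_restr_mod[OF M z] by(cases "n = 0") auto
 show "lmap R (cobj (stalk M) n) (cobj (stalk M) (n - 1)) (cdiff (stalk M) n)" for n
  by(rule lmap_cong[OF lmap_const_zero[OF m m]]) simp
qed simp

text \<open>A family out of the stalk complex is one map \<open>g\<close> in degree zero, and a null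
  homotopy of it is a lift of \<open>g\<close>; the signs are absorbed by
  \<open>null_up\<close>.\<close>

lemma hom_lifts_iff:
 assumes Q: "module R Q" and Z: "is_complex R Z"
 shows "exact_complex R (hom_cplx R (stalk Q) Z) \<longleftrightarrow> hom_lifts R Q Z"
 unfolding exact_complex_def homology_hom_zero_iff[OF is_complex_stalk[OF Q] Z]
proof(intro iffI conjI allI impI is_complex_hom[OF is_complex_stalk[OF Q] Z])
 note S = is_complex_stalk[OF Q] and ZM = cplx_module[OF Z] and R = module_cring[OF Q]
 note SM = cplx_module[OF S]
 assume "hom_lifts R Q Z"
 fix n f assume f: "cmap R (hsign R n) (stalk Q) (shift n Z) f"
 show "EX h. htpy R (hsign R n) (stalk Q) (shift n Z) f h"
 proof(rule null_up[OF S is_complex_shift[OF Z] _ _ f hsign_closed[OF R]])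
  show "hom_lifts R (cobj (stalk Q) p) (shift n Z)" for p
  using hom_lifts_shift[OF \<open>hom_lifts R Q Z\<close>] hom_lifts_zero[OF is_complex_shift[OF Z] SM[of p]] by(cases "p = 0") auto
 qed auto
next
 note S = is_complex_stalk[OF Q] and ZM = cplx_module[OF Z] and R = module_cring[OF Q]
 assume a: "is_complex R (hom_cplx R (stalk Q) Z) &
  (ALL n f. cmap R (hsign R n) (stalk Q) (shift n Z) f --> (EX h. htpy R (hsign R n) (stalk Q) (shift n Z) f h))"
 show "hom_lifts R Q Z"
  unfolding hom_lifts_def
 proof(intro allI impI, elim conjE)
  fix q g assume g: "lmap R Q (Z q) g" and z: "\<forall>x\<in>Q. cdiff Z q (g x) = \<zero>\<^sub>(Z (q - 1))"
  let ?f = "%p::int. if p = 0 then g else (%_. \<zero>\<^sub>(Z (p + q)))"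
  have fl: "lmap R (cobj (stalk Q) p) (Z (p + q)) (?f p)" for p
  using g lmap_const_zero[OF cplx_module[OF S] ZM, of p "p + q"] by(cases "p = 0") simp_all
  have fz: "?f p \<zero>\<^sub>Q = \<zero>\<^sub>(Z (p + q))" for p using lmap_zero[OF fl[of p]] by simp
  have "cmap R (hsign R q) (stalk Q) (shift q Z) ?f"
  unfolding cmap_def
  proof(intro conjI allI ballI)
  show "lmap R (cobj (stalk Q) p) (cobj (shift q Z) p) (?f p)" for p using fl[of p] by simp
  fix p x assume x: "x \<in> cobj (stalk Q) p"
  have i: "p - 1 + q = p + q - 1" by simp
  have "cdiff Z (p + q) (?f p x) = \<zero>\<^sub>(Z (p + q - 1))"
  using z x lmap_zero[OF cplx_lmap[OF Z refl]] by(cases "p = 0") auto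
  moreover have "hsign R q \<odot>\<^sub>(cobj (shift q Z) (p - 1)) ?f (p - 1) (cdiff (stalk Q) p x) = \<zero>\<^sub>(Z (p + q - 1))"
  unfolding stalk_simps(3) fz shift_simps i by(simp add: lmap_zero[OF g] modD[OF ZM] hsign_closed[OF R])
  ultimately show "cdiff (shift q Z) p (?f p x) = hsign R q \<odot>\<^sub>(cobj (shift q Z) (p - 1)) ?f (p - 1) (cdiff (stalk Q) p x)"
  by simp
  qed
  then obtain h where h: "htpy R (hsign R q) (stalk Q) (shift q Z) ?f h" using a by blast
  have i: "0 + 1 + q = q + 1" by simp
  have h0: "lmap R Q (Z (q + 1)) (h 0)" using h[unfolded htpy_def, THEN conjunct1, rule_format, of 0] by(simp add: add.commute)
  have h1: "h (-1) \<zero>\<^sub>Q = \<zero>\<^sub>(Z q)" using h[unfolded htpy_def, THEN conjunct1, rule_format, of "-1", THEN lmap_zero] by simp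
  have "g x = cdiff Z (q + 1) (h 0 x)" if x: "x \<in> Q" for x
  using h[unfolded htpy_def, THEN conjunct2, rule_format, of x 0] x lmap_in[OF cplx_lmap[OF Z, of q "q + 1"] lmap_in[OF h0 x]]
  by(simp add: h1 modD[OF ZM] hsign_closed[OF R] i add.commute[of 1 q])
  with h0 show "EX k. lmap R Q (Z (q + 1)) k & (\<forall>x\<in>Q. cdiff Z (q + 1) (k x) = g x)" by metis
 qed
qed

text \<open>Stated for a single degree because \<open>semidualizing\<close> provides vanishing of
  Ext in positive degrees only.\<close>

lemma hom_stalk_extends:
 assumes E: "module R E" and Z: "is_complex R Z" and z0: "zero_mod (homology (hom_cplx R Z (stalk E)) (- q))"
  and g: "lmap R (Z q) E g" and z: "\<forall>x\<in>Z (q + 1). g (cdiff Z (q + 1) x) = \<zero>\<^sub>E"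
 shows "EX k. lmap R (Z (q - 1)) E k & (\<forall>x\<in>Z q. k (cdiff Z q x) = g x)"
proof -
 note S = is_complex_stalk[OF E] and R = module_cring[OF E]
 note SM = cplx_module[OF S]
 let ?e = "hsign R (- q)" and ?f = "%p. if p = q then g else (%_. \<zero>\<^sub>E)"
 have sm: "?e \<odot>\<^sub>(cobj (stalk E) p) \<zero>\<^sub>E = \<zero>\<^sub>E" for p using mod_smult_zero[OF SM[of p] hsign_closed[OF R, of "- q"]] by(simp only: stalk_simps)
 have "cmap R ?e Z (shift (- q) (stalk E)) ?f"
  unfolding cmap_def
 proof(intro conjI allI ballI)
  show "lmap R (Z p) (cobj (shift (- q) (stalk E)) p) (?f p)" for p
  using g lmap_const_zero[OF cplx_module[OF Z] SM[of "p - q"]] by(cases "p = q") auto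
  fix p x assume x: "x \<in> Z p"
  have "?f (p - 1) (cdiff Z p x) = \<zero>\<^sub>E" using z x by(cases "p = q + 1") auto
  thus "cdiff (shift (- q) (stalk E)) p (?f p x) = ?e \<odot>\<^sub>(cobj (shift (- q) (stalk E)) (p - 1)) ?f (p - 1) (cdiff Z p x)"
  by(simp only: shift_simps stalk_simps(3) sm)
 qed
 then obtain h where h: "htpy R ?e Z (shift (- q) (stalk E)) ?f h" using z0[unfolded homology_hom_zero_iff[OF Z S]] by blast
 have hl: "lmap R (Z (q - 1)) E (h (q - 1))" using h[unfolded htpy_def, THEN conjunct1, rule_format, of "q - 1"] by simp
 have "g x = ?e \<odot>\<^sub>E h (q - 1) (cdiff Z q x)" if x: "x \<in> Z q" for x
  using h[unfolded htpy_def, THEN conjunct2, rule_format, of x q] x lmap_in[OF hl lmap_in[OF cplx_lmap[OF Z refl] x]]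
  by(simp add: modD[OF E] hsign_closed[OF R])
 with lmap_scale[OF hl hsign_closed[OF R]] show "EX k. lmap R (Z (q - 1)) E k & (\<forall>x\<in>Z q. k (cdiff Z q x) = g x)" by metis
qed

lemma hom_extends_iff:
 assumes E: "module R E" and Z: "is_complex R Z"
 shows "exact_complex R (hom_cplx R Z (stalk E)) \<longleftrightarrow> hom_extends R Z E"
proof
 note S = is_complex_stalk[OF E] and R = module_cring[OF E]
 note SM = cplx_module[OF S]
 assume x: "hom_extends R Z E"
 show "exact_complex R (hom_cplx R Z (stalk E))"
  unfolding exact_complex_def homology_hom_zero_iff[OF Z S]
 proof(intro conjI allI impI is_complex_hom[OF Z S])
  fix n f assume f: "cmap R (hsign R n) Z (shift n (stalk E)) f"
  show "EX h. htpy R (hsign R n) Z (shift n (stalk E)) f h"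
  proof(rule null_down[OF Z is_complex_shift[OF S] _ _ f hsign_closed[OF R] hsign_square[OF R]])
  show "x = \<zero>\<^sub>(cobj (shift n (stalk E)) p)" if "- n < p" "x \<in> (cobj (shift n (stalk E)) p)" for p x
  using that stalk_zero[of "p + n" x E] by simp
  show "hom_extends R Z (cobj (shift n (stalk E)) p)" for p
  using x hom_extends_zero[OF Z SM[of "p + n"]] by(cases "p + n = 0") auto
  qed
 qed
qed (use hom_stalk_extends[OF E Z] in \<open>simp add: hom_extends_def exact_complex_def\<close>)

section \<open>Augmented resolutions and the comparison theorem\<close>

lemma exact_complexD:
 assumes "exact_complex R Z" "x \<in> Z p" "cdiff Z p x = \<zero>\<^sub>(Z (p - 1))" "q = p + 1"
 shows "\<exists>y\<in>Z q. cdiff Z q y = x"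
proof -
 have Z: "is_complex R Z" and "zero_mod (homology Z p)" using assms(1) by(auto simp: exact_complex_def)
 thus ?thesis using assms unfolding zero_mod_homology[OF Z] by blast
qed

lemma exact_complex_iff:
 assumes Z: "exact_complex R Z" and x: "x \<in> Z p" and "q = p + 1" "r = p - 1"
 shows "cdiff Z p x = \<zero>\<^sub>(Z r) \<longleftrightarrow> (\<exists>y\<in>Z q. cdiff Z q y = x)"
proof -
 have C: "is_complex R Z" using Z by(simp add: exact_complex_def)
 show ?thesis
 proof
  show "\<exists>y\<in>Z q. cdiff Z q y = x" if "cdiff Z p x = \<zero>\<^sub>(Z r)"
  using exact_complexD[OF Z x _ assms(3)] that assms(4) by simp
  show "cdiff Z p x = \<zero>\<^sub>(Z r)" if "\<exists>y\<in>Z q. cdiff Z q y = x"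
  using that cplx_dd[OF C, of _ q p r] assms(3,4) by force
 qed
qed

lemma aug_res_simps [simp]:
 "cobj (aug_res X \<epsilon> M) (-1) = M" "p ~= -1 ==> cobj (aug_res X \<epsilon> M) p = X p"
 "cdiff (aug_res X \<epsilon> M) 0 = \<epsilon>" "cdiff (aug_res X \<epsilon> M) (-1) = (%_. \<zero>\<^sub>(X (-2)))"
 "p ~= 0 ==> p ~= -1 ==> cdiff (aug_res X \<epsilon> M) p = cdiff X p"
 by(simp_all add: aug_res_def)

lemma aug_cores_simps [simp]:
 "cobj (aug_cores N \<eta> Y) 1 = N" "p ~= 1 ==> cobj (aug_cores N \<eta> Y) p = Y p"
 "cdiff (aug_cores N \<eta> Y) 1 = \<eta>" "cdiff (aug_cores N \<eta> Y) 2 = (%_. \<zero>\<^sub>N)"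
 "p ~= 1 ==> p ~= 2 ==> cdiff (aug_cores N \<eta> Y) p = cdiff Y p"
 by(simp_all add: aug_cores_def)

lemma cmap_shiftI:
 assumes "!!p. lmap R (cobj X p) (cobj Y (p + n)) (f p)"
  and "!!p x. x \<in> carrier (cobj X p) ==> cdiff Y (p + n) (f p x) = e \<odot>\<^bsub>cobj Y (p + n - 1)\<^esub> f (p - 1) (cdiff X p x)"
 shows "cmap R e X (shift n Y) f"
proof -
 have i: "p - 1 + n = p + n - 1" for p by simp
 show ?thesis using assms unfolding cmap_def shift_simps i by blast
qed

lemma
 assumes "htpy R e X (shift n Y) f h"
 shows htpy_shift_lmap: "q = p + n + 1 ==> lmap R (X p) (Y q) (h p)"
  and htpy_shift_eq: "q = p + n + 1 ==> r = p + n ==> x \<in> X p ==>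
  f p x = cdiff Y q (h p x) \<oplus>\<^sub>(Y r) e \<odot>\<^sub>(Y r) h (p - 1) (cdiff X p x)"
proof -
 have i: "p + 1 + n = p + n + 1" for p by simp
 note h = assms[unfolded htpy_def shift_simps i]
 show "q = p + n + 1 ==> lmap R (X p) (Y q) (h p)" using h by blast
 show "q = p + n + 1 ==> r = p + n ==> x \<in> X p ==>
  f p x = cdiff Y q (h p x) \<oplus>\<^sub>(Y r) e \<odot>\<^sub>(Y r) h (p - 1) (cdiff X p x)" using h by blast
qed

lemma mod_add_neg_one_smult:
 "module R M ==> z \<in> M ==> y \<oplus>\<^sub>M (\<ominus>\<^sub>R \<one>\<^sub>R) \<odot>\<^sub>M z = y \<ominus>\<^sub>M z"
 using module_cring[of R M] by(simp add: a_minus_def mod_neg_smult modD)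

text \<open>Comparison arguments see only the exactness of the augmented complex and the vanishing
  in negative degrees, so the class of the terms does not appear.\<close>

locale aug_resolution =
 fixes R :: "('a,'r) ring_scheme" and X :: "('a,'m) cplx" and \<epsilon> and M :: "('a,'m) module"
 assumes X: "is_complex R X" and neg: "!!p x. p < 0 ==> x \<in> X p ==> x = \<zero>\<^sub>(X p)"
  and exact: "exact_complex R (aug_res X \<epsilon> M)"
begin

abbreviation "Z \<equiv> aug_res X \<epsilon> M"

lemma Z: "is_complex R Z" using exact by(simp add: exact_complex_def)

lemma M: "module R M" using cplx_module[OF Z, of "-1"] by simp

lemmas XM = cplx_module[OF X]

lemma R: "cring R" by(rule module_cring[OF M])

lemma \<epsilon>: "lmap R (X 0) M \<epsilon>" using cplx_lmap[OF Z, of "-1" 0] by simp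

lemma \<epsilon>_d:
 assumes x: "x \<in> X 1"
 shows "\<epsilon> (cdiff X 1 x) = \<zero>\<^sub>M"
proof -
 have 1: "cdiff Z 1 = cdiff X 1" "Z 1 = X 1" by simp_all
 have "cdiff Z 0 (cdiff Z 1 x) = \<zero>\<^sub>(Z (-1))" by(rule cplx_dd[OF Z]) (use x in simp_all)
 thus ?thesis unfolding 1 aug_res_simps(1,3) .
qed

lemma \<epsilon>_surj: "m \<in> M ==> \<exists>x\<in>X 0. \<epsilon> x = m"
 using exact_complexD[OF exact, of m "-1" 0] by simp

lemma Z_neg: "p < -1 ==> x \<in> Z p ==> x = \<zero>\<^sub>(Z p)"
 using neg[of p x] by simp

lemma d_zero: "x \<in> X 0 ==> cdiff X 0 x = \<zero>\<^sub>(X (-1))"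
 using neg[of "-1"] lmap_in[OF cplx_lmap[OF X, of "-1" 0]] by simp

lemma hom_extendsI:
 assumes EM: "module R E" and ext: "!!q g. 0 \<le> q ==> lmap R (Z q) E g ==>
  \<forall>x\<in>Z (q + 1). g (cdiff Z (q + 1) x) = \<zero>\<^sub>E ==>
  EX k. lmap R (Z (q - 1)) E k & (\<forall>x\<in>Z q. k (cdiff Z q x) = g x)"
 shows "hom_extends R Z E"
 unfolding hom_extends_def
proof(intro allI impI, elim conjE)
 fix q g assume g: "lmap R (Z q) E g" and z: "\<forall>x\<in>Z (q + 1). g (cdiff Z (q + 1) x) = \<zero>\<^sub>E"
 show "EX k. lmap R (Z (q - 1)) E k & (\<forall>x\<in>Z q. k (cdiff Z q x) = g x)"
 proof(cases "q \<ge> 0")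
  case False
  have "g x = \<zero>\<^sub>E" if x: "x \<in> Z q" for x
  proof(cases "q = -1")
  case True
  thus ?thesis using z x \<epsilon>_surj[of x] by auto
  next
  case False
  thus ?thesis using \<open>\<not> q \<ge> 0\<close> Z_neg[OF _ x] lmap_zero[OF g] by simp
  qed
  thus ?thesis using lmap_const_zero[OF cplx_module[OF Z] EM] by metis
 qed (use ext g z in blast)
qed

text \<open>The augmented complex has \<open>M\<close> in degree -1 while sequences start at index
  zero, whence the shift by one.\<close>

lemma left_exact: "left_exact_res R (%n. Z (int n - 1)) (%n. cdiff Z (int n))"
 unfolding left_exact_res_def
proof(intro conjI allI ballI)
 have i: "int (Suc n) - 1 = int n" "int (Suc (Suc n)) - 1 = int n + 1" "int (Suc n) = int n + 1" for n by auto
 show "lmap R (Z (int (Suc n) - 1)) (Z (int n - 1)) (cdiff Z (int n))" for n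
  unfolding i(1) by(rule cplx_lmap[OF Z refl])
 show "\<exists>y\<in>(Z (int (Suc 0) - 1)). cdiff Z (int 0) y = x" if "x \<in> Z (int 0 - 1)" for x
  using \<epsilon>_surj that by simp
 show "cdiff Z (int n) x = \<zero>\<^sub>(Z (int n - 1)) \<longleftrightarrow> (\<exists>y\<in>(Z (int (Suc (Suc n)) - 1)). cdiff Z (int (Suc n)) y = x)"
  if "x \<in> (Z (int (Suc n) - 1))" for n x
  using that unfolding i(1,2) unfolding i(3) by(intro exact_complex_iff[OF exact]) auto
qed

text \<open>A comparison map is a null homotopy in disguise. View \<open>\<epsilon>\<close> as a
  family of degree -1 from \<open>X\<close> to the augmented complex of \<open>X'\<close>; the
  equations of a homotopy with \<open>e = -1\<close> say exactly that its components form a chain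
  map over the identity of \<open>M\<close>.\<close>

lemma comparison_map:
 assumes B: "aug_resolution R X' \<epsilon>' M" and lift: "!!p. p \<ge> 0 ==> hom_lifts R (X p) (aug_res X' \<epsilon>' M)"
 shows "EX F. (\<forall>p\<ge>0. lmap R (X p) (X' p) (F p)) & (\<forall>x\<in>X 0. \<epsilon>' (F 0 x) = \<epsilon> x) &
  (\<forall>p\<ge>1. \<forall>x\<in>X p. cdiff X' p (F p x) = F (p - 1) (cdiff X p x))"
proof -
 interpret B: aug_resolution R X' \<epsilon>' M by(rule B)
 note e1 = cring_neg_closed[OF R cring_one_closed[OF R]]
 note BM = cplx_module[OF B.Z]
 let ?g = "%p::int. if p = 0 then \<epsilon> else (%_. \<zero>\<^sub>(B.Z (p - 1)))"
 have "cmap R (\<ominus>\<^sub>R \<one>\<^sub>R) X (shift (-1) B.Z) ?g"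
 proof(rule cmap_shiftI)
  show l: "lmap R (X p) (B.Z (p + -1)) (?g p)" for p
  using \<epsilon> lmap_const_zero[OF XM BM[of "p - 1"], of p] by(cases "p = 0") auto
  fix p x assume x: "x \<in> X p"
  have "cdiff B.Z (p + -1) (?g p x) = \<zero>\<^sub>(B.Z (p + -1 - 1))"
  using lmap_zero[OF cplx_lmap[OF B.Z refl], of "p - 1"] by(cases "p = 0") auto
  moreover have "?g (p - 1) (cdiff X p x) = \<zero>\<^sub>(B.Z (p + -1 - 1))"
  using \<epsilon>_d[of x] x by(cases "p = 1") auto
  ultimately show "cdiff B.Z (p + -1) (?g p x) = (\<ominus>\<^sub>R \<one>\<^sub>R) \<odot>\<^sub>(B.Z (p + -1 - 1)) ?g (p - 1) (cdiff X p x)"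
  using e1 by(simp only: modD[OF BM])
 qed
 from null_up[OF X is_complex_shift[OF B.Z] neg hom_lifts_shift[OF lift] this e1]
 obtain h where h: "htpy R (\<ominus>\<^sub>R \<one>\<^sub>R) X (shift (-1) B.Z) ?g h" by blast
 have hl: "lmap R (X p) (B.Z p) (h p)" for p by(rule htpy_shift_lmap[OF h]) simp
 have dh: "cdiff B.Z p (h p x) \<in> B.Z (p - 1)" if "x \<in> X p" for p x
  by(rule lmap_in[OF cplx_lmap[OF B.Z refl] lmap_in[OF hl that]])
 have he: "?g p x = cdiff B.Z p (h p x) \<ominus>\<^sub>(B.Z (p - 1)) h (p - 1) (cdiff X p x)" if x: "x \<in> X p" for p x
  by(rule trans[OF htpy_shift_eq[OF h, of p p "p - 1" x] mod_add_neg_one_smult[OF BM lmap_in[OF hl lmap_in[OF cplx_lmap[OF X refl] x]]]])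
  (use x in simp_all)
 show ?thesis
 proof(intro exI[of _ h] conjI allI impI ballI)
  show "lmap R (X p) (X' p) (h p)" if "0 \<le> p" for p using hl[of p] that by simp
  show "\<epsilon>' (h 0 x) = \<epsilon> x" if x: "x \<in> X 0" for x
  using he[OF x] d_zero[OF x] lmap_zero[OF hl[of "-1"]] dh[OF x] by(simp add: modD[OF B.M])
  fix p :: int and x assume p: "1 \<le> p" and x: "x \<in> X p"
  have 0: "\<zero>\<^sub>(X' (p - 1)) = cdiff X' p (h p x) \<ominus>\<^sub>(X' (p - 1)) h (p - 1) (cdiff X p x)" using he[OF x] p by simp
  have c: "cdiff X' p (h p x) \<in> X' (p - 1)" "h (p - 1) (cdiff X p x) \<in> X' (p - 1)"
  using dh[OF x] lmap_in[OF hl lmap_in[OF cplx_lmap[OF X refl] x]] p by simp_all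
  show "cdiff X' p (h p x) = h (p - 1) (cdiff X p x)" by(rule iffD1[OF mod_minus_eq_zero[OF B.XM c] 0[symmetric]])
 qed
qed

text \<open>Homotopy equivalent resolutions have homotopy equivalent Hom complexes. This is the
  passage from a bounded resolution \<open>X'\<close> to an arbitrary proper one.\<close>

lemma hom_extends_transfer:
 assumes B: "aug_resolution R X' \<epsilon>' M" and l1: "!!p. p \<ge> 0 ==> hom_lifts R (X p) (aug_res X' \<epsilon>' M)"
  and l2: "!!p. p \<ge> 0 ==> hom_lifts R (X' p) Z" and l3: "!!p. p \<ge> 0 ==> hom_lifts R (X p) Z"
  and E: "hom_extends R (aug_res X' \<epsilon>' M) E" and EM: "module R E"
 shows "hom_extends R Z E"
proof -
 interpret B: aug_resolution R X' \<epsilon>' M by(rule B)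
 note ZM = cplx_module[OF Z]
 obtain F where F: "!!p. p \<ge> 0 ==> lmap R (X p) (X' p) (F p)" "!!x. x \<in> X 0 ==> \<epsilon>' (F 0 x) = \<epsilon> x"
  "!!p x. p \<ge> 1 ==> x \<in> X p ==> cdiff X' p (F p x) = F (p - 1) (cdiff X p x)"
  using comparison_map[OF B l1] by - (drule meta_mp, assumption, elim exE conjE, rule that, auto)
 obtain G where G: "!!p. p \<ge> 0 ==> lmap R (X' p) (X p) (G p)" "!!x. x \<in> X' 0 ==> \<epsilon> (G 0 x) = \<epsilon>' x"
  "!!p x. p \<ge> 1 ==> x \<in> X' p ==> cdiff X p (G p x) = G (p - 1) (cdiff X' p x)"
  using B.comparison_map[OF aug_resolution_axioms l2] by - (drule meta_mp, assumption, elim exE conjE, rule that, auto)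
 note GF = lmap_comp[OF F(1) G(1)]
 \<comment> \<open>The identity minus \<open>G F\<close>, with values in the augmented complex so
   that its homotopy can be found by lifting there; in negative degrees it is zero.\<close>
 let ?U = "%p x. if p \<ge> 0 then x \<ominus>\<^sub>(X p) G p (F p x) else \<zero>\<^sub>(Z p)"
 have one: "\<one>\<^sub>R \<in> R" using R by simp
 have "cmap R \<one>\<^sub>R X Z ?U"
  unfolding cmap_def
 proof(intro conjI allI ballI)
  show "lmap R (X p) (Z p) (?U p)" for p
  using lmap_diff[OF lmap_ident[OF XM] GF, of p] lmap_const_zero[OF XM ZM] by(cases "p \<ge> 0") auto
  fix p x assume x: "x \<in> X p"
  show "cdiff Z p (?U p x) = \<one>\<^sub>R \<odot>\<^sub>(Z (p - 1)) ?U (p - 1) (cdiff X p x)"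
  proof(cases "p \<ge> 1")
  case True
  note d = cplx_lmap[OF X refl, of p]
  have "cdiff X p (?U p x) = cdiff X p x \<ominus>\<^sub>(X (p - 1)) G (p - 1) (F (p - 1) (cdiff X p x))"
  using True x lmap_minus[OF d x lmap_in[OF GF x]] G(3)[OF True lmap_in[OF F(1) x]] F(3)[OF True x] by simp
  thus ?thesis
  using True lmap_in[OF d x] lmap_in[OF GF lmap_in[OF d x]] by(simp add: modD[OF XM])
  next
  case False
  have "\<epsilon> (x \<ominus>\<^sub>(X 0) G 0 (F 0 x)) = \<zero>\<^sub>M" if "p = 0"
  using that x lmap_minus[OF \<epsilon> _ lmap_in[OF GF, of 0 x]] F(2)[of x] G(2)[OF lmap_in[OF F(1)], of x] lmap_in[OF \<epsilon>, of x]
  by(simp add: modD[OF M])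
  thus ?thesis
  using False lmap_zero[OF cplx_lmap[OF Z refl], of p] by(cases "p = 0") (simp_all add: modD[OF ZM] one modD[OF M] modD[OF XM])
  qed
 qed
 from null_up[OF X Z neg l3 this one] obtain s where s: "htpy R \<one>\<^sub>R X Z ?U s" by blast
 have sl: "lmap R (X p) (Z (p + 1)) (s p)" for p using s by(simp add: htpy_def)
 have sl': "lmap R (X (p - 1)) (Z p) (s (p - 1))" for p using sl[of "p - 1"] by simp
 have se: "?U p x = cdiff Z (p + 1) (s p x) \<oplus>\<^sub>(Z p) s (p - 1) (cdiff X p x)" if x: "x \<in> X p" for p x
 proof -
  have "s (p - 1) (cdiff X p x) \<in> Z p"
  by(rule lmap_in[OF sl' lmap_in[OF cplx_lmap[OF X refl] x]])
  moreover have "?U p x = cdiff Z (p + 1) (s p x) \<oplus>\<^sub>(Z p) \<one>\<^sub>R \<odot>\<^sub>(Z p) s (p - 1) (cdiff X p x)"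
  using s x unfolding htpy_def by blast
  ultimately show ?thesis by(simp only: mod_one_smult[OF ZM])
 qed
 show ?thesis
 proof(rule hom_extendsI[OF EM])
  fix q \<phi> assume q: "0 \<le> q" and \<phi>: "lmap R (Z q) E \<phi>" and z: "\<forall>x\<in>Z (q + 1). \<phi> (cdiff Z (q + 1) x) = \<zero>\<^sub>E"
  from q have Zq: "Z q = X q" "Z (q + 1) = X (q + 1)" "cdiff Z (q + 1) = cdiff X (q + 1)"
  "B.Z q = X' q" "B.Z (q + 1) = X' (q + 1)" "cdiff B.Z (q + 1) = cdiff X' (q + 1)" by auto
  note \<phi> = \<phi>[unfolded Zq]
  have "lmap R (B.Z q) E (%y. \<phi> (G q y))" using lmap_comp[OF G(1)[OF q] \<phi>] by(simp only: Zq)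
  moreover have "\<phi> (G q (cdiff B.Z (q + 1) y)) = \<zero>\<^sub>E" if y: "y \<in> B.Z (q + 1)" for y
  proof -
  have y: "y \<in> X' (q + 1)" using y by(simp only: Zq)
  have "G q (cdiff X' (q + 1) y) = cdiff X (q + 1) (G (q + 1) y)" using G(3)[of "q + 1" y] q y by simp
  thus ?thesis using z lmap_in[OF G(1) y] q unfolding Zq by simp
  qed
  ultimately obtain \<psi> where \<psi>: "lmap R (B.Z (q - 1)) E \<psi>" "!!y. y \<in> X' q ==> \<psi> (cdiff B.Z q y) = \<phi> (G q y)"
  using hom_extendsD[OF E _ _ refl, of q "%y. \<phi> (G q y)"] unfolding Zq by blast
  \<comment> \<open>Since \<open>\<phi>\<close> kills boundaries, the homotopy gives
    \<open>\<phi> = \<psi> d F + \<phi> s d\<close>. Both terms factor through a differential, so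
    \<open>\<psi> F + \<phi> s\<close> is the extension sought; for \<open>q = 0\<close> the second
    term vanishes and \<open>\<psi>\<close> alone suffices.\<close>
  have dec: "\<phi> x = \<psi> (cdiff B.Z q (F q x)) \<oplus>\<^sub>E \<phi> (s (q - 1) (cdiff X q x))" if x: "x \<in> X q" for x
  proof -
  have c: "cdiff X (q + 1) (s q x) \<in> X q" "s (q - 1) (cdiff X q x) \<in> X q"
  using lmap_in[OF cplx_lmap[OF X, of q "q + 1"] lmap_in[OF sl x, unfolded Zq]]
  lmap_in[OF sl' lmap_in[OF cplx_lmap[OF X refl] x]] unfolding Zq by auto
  have "\<phi> x \<ominus>\<^sub>E \<phi> (G q (F q x)) = \<phi> (x \<ominus>\<^sub>(X q) G q (F q x))" using q x lmap_minus[OF \<phi> x lmap_in[OF GF x]] by simp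
  also have "x \<ominus>\<^sub>(X q) G q (F q x) = cdiff X (q + 1) (s q x) \<oplus>\<^sub>(X q) s (q - 1) (cdiff X q x)" using se[OF x] q by simp
  also have "\<phi> \<dots> = \<phi> (s (q - 1) (cdiff X q x))"
  using lmap_add[OF \<phi> c] z lmap_in[OF sl x] lmap_in[OF \<phi> c(2)] unfolding Zq by(simp add: modD[OF EM])
  finally have "\<phi> x = \<phi> (s (q - 1) (cdiff X q x)) \<oplus>\<^sub>E \<phi> (G q (F q x))"
  using lmap_in[OF \<phi> x] lmap_in[OF \<phi> lmap_in[OF GF[OF q q] x]] mod_minus_add_cancel[OF EM] by metis
  thus ?thesis
  using \<psi>(2)[OF lmap_in[OF F(1)[OF q] x]] lmap_in[OF \<phi> c(2)] lmap_in[OF \<phi> lmap_in[OF GF[OF q q] x]]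
  by(simp add: mod_comm[OF EM])
  qed
  show "EX k. lmap R (Z (q - 1)) E k & (\<forall>x\<in>Z q. k (cdiff Z q x) = \<phi> x)"
  proof(cases "q = 0")
  case True
  have "\<psi> (\<epsilon> x) = \<phi> x" if x: "x \<in> X 0" for x
  proof -
  have "\<phi> (s (q - 1) (cdiff X q x)) = \<zero>\<^sub>E"
  using d_zero[OF x] lmap_zero[OF sl'[of q]] lmap_zero[OF \<phi>] True by simp
  thus ?thesis
  using dec[of x] x F(2)[OF x] lmap_in[OF \<psi>(1), of "\<epsilon> x"] lmap_in[OF \<epsilon> x] True by(simp add: modD[OF EM])
  qed
  thus ?thesis using \<psi>(1) True by(intro exI[of _ \<psi>]) auto
  next
  case False
  hence q1: "q \<ge> 1" and Z1: "Z (q - 1) = X (q - 1)" "cdiff Z q = cdiff X q" "B.Z (q - 1) = X' (q - 1)" "cdiff B.Z q = cdiff X' q"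
  using q by auto
  have "lmap R (X (q - 1)) E (%y. \<psi> (F (q - 1) y) \<oplus>\<^sub>E \<phi> (s (q - 1) y))"
  using q1 sl'[of q] by(intro lmap_plus[OF lmap_comp[OF F(1) \<psi>(1)[unfolded Z1]] lmap_comp[OF _ \<phi>]]) (auto simp: Zq)
  moreover have "\<psi> (F (q - 1) (cdiff X q x)) \<oplus>\<^sub>E \<phi> (s (q - 1) (cdiff X q x)) = \<phi> x" if x: "x \<in> X q" for x
  using dec[OF x] F(3)[OF q1 x] by(simp add: Z1)
  ultimately show ?thesis unfolding Z1 Zq by(intro exI[of _ "%y. \<psi> (F (q - 1) y) \<oplus>\<^sub>E \<phi> (s (q - 1) y)"]) auto
  qed
 qed
qed

end

section \<open>Augmented coresolutions, dual to the preceding locale\<close>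

locale aug_coresolution =
 fixes R :: "('a,'r) ring_scheme" and N :: "('a,'m) module" and \<eta> and Y :: "('a,'m) cplx"
 assumes Y: "is_complex R Y" and pos: "!!p x. p > 0 ==> x \<in> Y p ==> x = \<zero>\<^sub>(Y p)"
  and exact: "exact_complex R (aug_cores N \<eta> Y)"
begin

abbreviation "W \<equiv> aug_cores N \<eta> Y"

lemma W: "is_complex R W" using exact by(simp add: exact_complex_def)

lemma N: "module R N" using cplx_module[OF W, of 1] by simp

lemmas YM = cplx_module[OF Y]

lemma R: "cring R" by(rule module_cring[OF N])

lemma \<eta>: "lmap R N (Y 0) \<eta>" using cplx_lmap[OF W, of 0 1] by simp

lemma d_\<eta>: "x \<in> N ==> cdiff Y 0 (\<eta> x) = \<zero>\<^sub>(Y (-1))"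
 using cplx_dd[OF W, of x 1 0 "-1"] by simp

lemma \<eta>_inj:
 assumes "x \<in> N" "\<eta> x = \<zero>\<^sub>(Y 0)"
 shows "x = \<zero>\<^sub>N"
 using exact_complexD[OF exact, of x 1 2] assms by auto

lemma W_pos: "p > 1 ==> x \<in> W p ==> x = \<zero>\<^sub>(W p)"
 using pos[of p x] by simp

lemma hom_liftsI:
 assumes QM: "module R Q" and lift: "!!q g. q \<le> 0 ==> lmap R Q (W q) g ==>
  \<forall>x\<in>Q. cdiff W q (g x) = \<zero>\<^sub>(W (q - 1)) ==>
  EX k. lmap R Q (W (q + 1)) k & (\<forall>x\<in>Q. cdiff W (q + 1) (k x) = g x)"
 shows "hom_lifts R Q W"
 unfolding hom_lifts_def
proof(intro allI impI, elim conjE)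
 fix q g assume g: "lmap R Q (W q) g" and z: "\<forall>x\<in>Q. cdiff W q (g x) = \<zero>\<^sub>(W (q - 1))"
 show "EX k. lmap R Q (W (q + 1)) k & (\<forall>x\<in>Q. cdiff W (q + 1) (k x) = g x)"
 proof(cases "q \<le> 0")
  case False
  have "g x = \<zero>\<^sub>(W q)" if x: "x \<in> Q" for x
  using \<eta>_inj[of "g x"] z x W_pos[of q "g x"] lmap_in[OF g x] False by(cases "q = 1") auto
  moreover have "lmap R (W (q + 1)) (W q) (cdiff W (q + 1))" by(rule cplx_lmap[OF W]) simp
  ultimately show ?thesis using lmap_const_zero[OF QM cplx_module[OF W]] lmap_zero by metis
 qed (use lift g z in blast)
qed

lemma right_exact: "right_exact_cores R (%n. W (1 - int n)) (%n. cdiff W (1 - int n))"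
 unfolding right_exact_cores_def
proof(intro conjI allI ballI impI)
 show "lmap R (W (1 - int n)) (W (1 - int (Suc n))) (cdiff W (1 - int n))" for n
  by(rule cplx_lmap[OF W]) simp
 show "x = \<zero>\<^sub>(W (1 - int 0))" if "x \<in> W (1 - int 0)" "cdiff W (1 - int 0) x = \<zero>\<^sub>(W (1 - int (Suc 0)))" for x
  using \<eta>_inj[of x] that by simp
qed (rule exact_complex_iff[OF exact]; simp)

lemma comparison_map:
 assumes B: "aug_coresolution R N \<eta>' Y'" and ext: "!!p. hom_extends R W (Y' p)"
 shows "EX F. (\<forall>p\<le>0. lmap R (Y p) (Y' p) (F p)) & (\<forall>x\<in>N. F 0 (\<eta> x) = \<eta>' x) &
  (\<forall>p\<le>0. \<forall>x\<in>Y p. cdiff Y' p (F p x) = F (p - 1) (cdiff Y p x))"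
proof -
 interpret B: aug_coresolution R N \<eta>' Y' by(rule B)
 interpret cring R by(rule R)
 have e: "\<ominus>\<^sub>R \<one>\<^sub>R \<in> R" "\<ominus>\<^sub>R \<one>\<^sub>R \<otimes>\<^sub>R \<ominus>\<^sub>R \<one>\<^sub>R = \<one>\<^sub>R" by(auto simp: l_minus r_minus)
 \<comment> \<open>The minus sign compensates \<open>e = -1\<close>: the homotopy has its degree one
   component in \<open>Y' 1 = 0\<close>, so the equation there reads
   \<open>- \<eta>' = - h 0 \<eta>\<close>.\<close>
 let ?g = "%p. if p = 1 then (%x. \<ominus>\<^sub>(Y' 0) \<eta>' x) else (%_. \<zero>\<^sub>(Y' (p - 1)))"
 have "cmap R (\<ominus>\<^sub>R \<one>\<^sub>R) W (shift (-1) Y') ?g"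
 proof(rule cmap_shiftI)
  show l: "lmap R (W p) (Y' (p + -1)) (?g p)" for p
  using lmap_uminus[OF B.\<eta>] lmap_const_zero[OF cplx_module[OF W, of p] B.YM[of "p - 1"]] by(cases "p = 1") auto
  fix p x assume x: "x \<in> W p"
  have "cdiff Y' (p + -1) (?g p x) = \<zero>\<^sub>(Y' (p + -1 - 1))"
  using lmap_zero[OF cplx_lmap[OF B.Y refl], of "p - 1"] x lmap_neg[OF cplx_lmap[OF B.Y, of "-1" 0] lmap_in[OF B.\<eta>, of x]]
  by(cases "p = 1") (auto simp: B.d_\<eta> modD[OF B.YM])
  moreover have "?g (p - 1) (cdiff W p x) = \<zero>\<^sub>(Y' (p + -1 - 1))"
  by(cases "p = 2") (auto simp: lmap_zero[OF B.\<eta>] modD[OF B.YM])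
  ultimately show "cdiff Y' (p + -1) (?g p x) = (\<ominus>\<^sub>R \<one>\<^sub>R) \<odot>\<^sub>(Y' (p + -1 - 1)) ?g (p - 1) (cdiff W p x)"
  using e(1) by(simp only: modD[OF B.YM])
 qed
 then obtain h where h: "htpy R (\<ominus>\<^sub>R \<one>\<^sub>R) W (shift (-1) Y') ?g h"
  using null_down[OF W is_complex_shift[OF B.Y], of 1 "-1", OF _ _ _ e] B.pos ext by fastforce
 have hl: "lmap R (W p) (Y' p) (h p)" for p by(rule htpy_shift_lmap[OF h]) simp
 note dW = lmap_in[OF cplx_lmap[OF W refl]]
 have dh: "cdiff Y' p (h p x) \<in> Y' (p - 1)" if "x \<in> W p" for p x
  by(rule lmap_in[OF cplx_lmap[OF B.Y refl] lmap_in[OF hl that]])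
 have he: "?g p x = cdiff Y' p (h p x) \<ominus>\<^sub>(Y' (p - 1)) h (p - 1) (cdiff W p x)" if x: "x \<in> W p" for p x
  by(rule trans[OF htpy_shift_eq[OF h, of p p "p - 1" x] mod_add_neg_one_smult[OF B.YM lmap_in[OF hl dW[OF x]]]])
  (use x in simp_all)
 show ?thesis
 proof(intro exI[of _ h] conjI allI impI ballI)
  show "lmap R (Y p) (Y' p) (h p)" if "p \<le> 0" for p using hl[of p] that by simp
  fix x assume x: "x \<in> N"
  have "h 1 x = \<zero>\<^sub>(Y' 1)" using B.pos[of 1] lmap_in[OF hl, of x 1] x by simp
  hence "cdiff Y' 1 (h 1 x) = \<zero>\<^sub>(Y' 0)" using lmap_zero[OF cplx_lmap[OF B.Y, of 0 1]] by simp
  moreover have c: "h 0 (\<eta> x) \<in> Y' 0" using lmap_in[OF hl[of 0], of "\<eta> x"] lmap_in[OF \<eta> x] by simp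
  ultimately have "\<ominus>\<^sub>(Y' 0) \<eta>' x = \<ominus>\<^sub>(Y' 0) h 0 (\<eta> x)"
  using he[of x 1] x by(simp add: a_minus_def modD[OF B.YM])
  thus "h 0 (\<eta> x) = \<eta>' x" using mod_neg_neg[OF B.YM c] mod_neg_neg[OF B.YM lmap_in[OF B.\<eta> x]] by metis
 next
  fix p :: int and x assume p: "p \<le> 0" and x: "x \<in> Y p"
  hence xW: "x \<in> W p" by simp
  have 0: "\<zero>\<^sub>(Y' (p - 1)) = cdiff Y' p (h p x) \<ominus>\<^sub>(Y' (p - 1)) h (p - 1) (cdiff Y p x)" using he[OF xW] p by simp
  have c: "cdiff Y' p (h p x) \<in> Y' (p - 1)" "h (p - 1) (cdiff Y p x) \<in> Y' (p - 1)"
  using dh[OF xW] lmap_in[OF hl dW[OF xW]] p by simp_all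
  show "cdiff Y' p (h p x) = h (p - 1) (cdiff Y p x)" by(rule iffD1[OF mod_minus_eq_zero[OF B.YM c] 0[symmetric]])
 qed
qed

text \<open>Dual to \<open>hom_extends_transfer\<close>: the decomposition
  \<open>\<phi> = d s \<phi> + G d \<psi>\<close> exhibits \<open>\<phi>\<close> as a
  boundary.\<close>

lemma hom_lifts_transfer:
 assumes B: "aug_coresolution R N \<eta>' Y'" and l1: "!!p. hom_extends R W (Y' p)"
  and l2: "!!p. hom_extends R (aug_cores N \<eta>' Y') (Y p)" and l3: "!!p. hom_extends R W (Y p)"
  and Q: "hom_lifts R Q (aug_cores N \<eta>' Y')" and QM: "module R Q"
 shows "hom_lifts R Q W"
proof -
 interpret B: aug_coresolution R N \<eta>' Y' by(rule B)
 note WM = cplx_module[OF W]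
 obtain F where F: "!!p. p \<le> 0 ==> lmap R (Y p) (Y' p) (F p)" "!!x. x \<in> N ==> F 0 (\<eta> x) = \<eta>' x"
  "!!p x. p \<le> 0 ==> x \<in> Y p ==> cdiff Y' p (F p x) = F (p - 1) (cdiff Y p x)"
  using comparison_map[OF B l1] by(elim exE conjE) (rule that, auto)
 obtain G where G: "!!p. p \<le> 0 ==> lmap R (Y' p) (Y p) (G p)" "!!x. x \<in> N ==> G 0 (\<eta>' x) = \<eta> x"
  "!!p x. p \<le> 0 ==> x \<in> Y' p ==> cdiff Y p (G p x) = G (p - 1) (cdiff Y' p x)"
  using B.comparison_map[OF aug_coresolution_axioms l2] by(elim exE conjE) (rule that, auto)
 note GF = lmap_comp[OF F(1) G(1)]
 let ?U = "%p x. if p \<le> 0 then x \<ominus>\<^sub>(Y p) G p (F p x) else \<zero>\<^sub>(Y p)"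
 have one: "\<one>\<^sub>R \<in> R" "\<one>\<^sub>R \<otimes>\<^sub>R \<one>\<^sub>R = \<one>\<^sub>R" using R by(auto simp: cring.cring_simprules)
 have "cmap R \<one>\<^sub>R W Y ?U"
  unfolding cmap_def
 proof(intro conjI allI ballI)
  show "lmap R (W p) (Y p) (?U p)" for p
  using lmap_diff[OF lmap_ident[OF YM] GF, of p] lmap_const_zero[OF WM YM] by(cases "p \<le> 0") auto
  fix p x assume x: "x \<in> W p"
  show "cdiff Y p (?U p x) = \<one>\<^sub>R \<odot>\<^sub>(Y (p - 1)) ?U (p - 1) (cdiff W p x)"
  proof(cases "p \<le> 0")
  case True
  note d = cplx_lmap[OF Y refl, of p]
  have x: "x \<in> Y p" using x True by simp
  have "cdiff Y p (?U p x) = cdiff Y p x \<ominus>\<^sub>(Y (p - 1)) G (p - 1) (F (p - 1) (cdiff Y p x))"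
  using True x lmap_minus[OF d x lmap_in[OF GF x]] G(3)[OF True lmap_in[OF F(1) x]] F(3)[OF True x] by simp
  thus ?thesis
  using True lmap_in[OF d x] lmap_in[OF GF lmap_in[OF d x]] by(simp add: modD[OF YM])
  next
  case False
  have "\<eta> x \<ominus>\<^sub>(Y 0) G 0 (F 0 (\<eta> x)) = \<zero>\<^sub>(Y 0)" if "p = 1"
  using that x F(2)[of x] G(2)[of x] lmap_in[OF \<eta>, of x] by(simp add: modD[OF YM])
  thus ?thesis
  using False lmap_zero[OF cplx_lmap[OF Y refl], of p] by(cases "p = 1") (simp_all add: modD[OF YM] one)
  qed
 qed
 from null_down[OF W Y pos l3 this one] obtain s where s: "htpy R \<one>\<^sub>R W Y ?U s" by blast
 have sl: "lmap R (W p) (Y (p + 1)) (s p)" for p using s by(simp add: htpy_def)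
 have sl': "lmap R (W (p - 1)) (Y p) (s (p - 1))" for p using sl[of "p - 1"] by simp
 show ?thesis
 proof(rule hom_liftsI[OF QM])
  fix q \<phi> assume q: "q \<le> 0" and \<phi>: "lmap R Q (W q) \<phi>" and z: "\<forall>x\<in>Q. cdiff W q (\<phi> x) = \<zero>\<^sub>(W (q - 1))"
  from q have Wq: "W q = Y q" "W (q - 1) = Y (q - 1)" "cdiff W q = cdiff Y q"
  "B.W q = Y' q" "B.W (q - 1) = Y' (q - 1)" "cdiff B.W q = cdiff Y' q" by auto
  note \<phi> = \<phi>[unfolded Wq]
  have "lmap R Q (B.W q) (%y. F q (\<phi> y))" using lmap_comp[OF \<phi> F(1)[OF q]] by(simp only: Wq)
  moreover have "cdiff B.W q (F q (\<phi> x)) = \<zero>\<^sub>(B.W (q - 1))" if x: "x \<in> Q" for x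
  using F(3)[OF q lmap_in[OF \<phi> x]] q x z lmap_zero[OF F(1), of "q - 1"] unfolding Wq by simp
  ultimately obtain \<psi> where \<psi>: "lmap R Q (B.W (q + 1)) \<psi>" "!!y. y \<in> Q ==> cdiff B.W (q + 1) (\<psi> y) = F q (\<phi> y)"
  using hom_liftsD[OF Q _ _ refl, of q "%y. F q (\<phi> y)"] by blast
  have dec: "\<phi> x = cdiff Y (q + 1) (s q (\<phi> x)) \<oplus>\<^sub>(Y q) G q (cdiff B.W (q + 1) (\<psi> x))" if x: "x \<in> Q" for x
  proof -
  note y = lmap_in[OF \<phi> x]
  have c: "cdiff Y (q + 1) (s q (\<phi> x)) \<in> Y q"
  using lmap_in[OF cplx_lmap[OF Y, of q "q + 1"] lmap_in[OF sl[of q, unfolded Wq] y]] by simp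
  have "\<phi> x \<ominus>\<^sub>(Y q) G q (F q (\<phi> x)) = ?U q (\<phi> x)" using q by simp
  also have "\<dots> = cdiff Y (q + 1) (s q (\<phi> x)) \<oplus>\<^sub>(Y q) \<one>\<^sub>R \<odot>\<^sub>(Y q) s (q - 1) (cdiff W q (\<phi> x))"
  using s[unfolded htpy_def, THEN conjunct2, rule_format, of "\<phi> x" q] y unfolding Wq by blast
  also have "s (q - 1) (cdiff W q (\<phi> x)) = \<zero>\<^sub>(Y q)" using z x lmap_zero[OF sl'] by simp
  finally have "\<phi> x \<ominus>\<^sub>(Y q) G q (F q (\<phi> x)) = cdiff Y (q + 1) (s q (\<phi> x))" using c by(simp add: modD[OF YM] one)
  thus ?thesis
  using mod_minus_add_cancel[OF YM y lmap_in[OF GF[OF q q] y]] \<psi>(2)[OF x] by simp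
  qed
  show "EX k. lmap R Q (W (q + 1)) k & (\<forall>x\<in>Q. cdiff W (q + 1) (k x) = \<phi> x)"
  proof(cases "q = 0")
  case True
  have "\<eta> (\<psi> x) = \<phi> x" if x: "x \<in> Q" for x
  proof -
  have "s q (\<phi> x) = \<zero>\<^sub>(Y (q + 1))" using pos[of "q + 1"] lmap_in[OF sl[of q], of "\<phi> x"] lmap_in[OF \<phi> x] True by simp
  hence "cdiff Y (q + 1) (s q (\<phi> x)) = \<zero>\<^sub>(Y q)" using lmap_zero[OF cplx_lmap[OF Y, of q "q + 1"]] by simp
  moreover have "\<psi> x \<in> N" using lmap_in[OF \<psi>(1) x] True by simp
  ultimately show ?thesis using dec[OF x] G(2)[of "\<psi> x"] lmap_in[OF \<eta>] True by(simp add: modD[OF YM])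
  qed
  thus ?thesis using \<psi>(1) True by(intro exI[of _ \<psi>]) auto
  next
  case False
  hence q1: "q + 1 \<le> 0" and W1: "W (q + 1) = Y (q + 1)" "cdiff W (q + 1) = cdiff Y (q + 1)" "B.W (q + 1) = Y' (q + 1)" "cdiff B.W (q + 1) = cdiff Y' (q + 1)"
  using q by auto
  note \<psi>1 = lmap_comp[OF \<psi>(1)[unfolded W1] G(1)[OF q1]] and s1 = lmap_comp[OF \<phi> sl[of q, unfolded Wq]]
  have d: "lmap R (Y (q + 1)) (Y q) (cdiff Y (q + 1))" by(rule cplx_lmap[OF Y]) simp
  have "cdiff Y (q + 1) (s q (\<phi> x) \<oplus>\<^sub>(Y (q + 1)) G (q + 1) (\<psi> x)) = \<phi> x" if x: "x \<in> Q" for x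
  using dec[OF x] G(3)[OF q1 lmap_in[OF \<psi>(1)[unfolded W1] x]] lmap_add[OF d lmap_in[OF s1 x] lmap_in[OF \<psi>1 x]]
  by(simp add: W1)
  with lmap_plus[OF s1 \<psi>1] show ?thesis unfolding W1 by(intro exI[of _ "%x. s q (\<phi> x) \<oplus>\<^sub>(Y (q + 1)) G (q + 1) (\<psi> x)"]) auto
  qed
 qed
qed

end

section \<open>Balance from exactness\<close>

lemma chain_map_precomp:
 assumes X: "is_complex R X" and X': "is_complex R X'" and Y: "is_complex R Y"
  and \<alpha>: "!!p. lmap R (X p) (X' p) (\<alpha> p)"
  and c: "!!p x. x \<in> X p ==> cdiff X' p (\<alpha> p x) = \<alpha> (p - 1) (cdiff X p x)"
 shows "chain_map R (hom_cplx R X' Y) (hom_cplx R X Y) (hom_precomp X \<alpha>)"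
proof -
 let ?A = "hom_cplx R X' Y" and ?B = "hom_cplx R X Y"
 note AM = cplx_module[OF is_complex_hom[OF X' Y]] and BM = cplx_module[OF is_complex_hom[OF X Y]]
 have mem: "hom_precomp X \<alpha> n f \<in> cobj ?B n" if "f \<in> cobj ?A n" for f n
  unfolding hom_precomp_def by(rule hom_cplx_mem[OF X Y lmap_comp[OF \<alpha> hom_cplx_lmap[OF X' Y that refl]]])
 have ap: "hom_precomp X \<alpha> n f p x = f p (\<alpha> p x)" if "x \<in> X p" for n f p x
  using that by(simp add: hom_precomp_def)
 have "lmap R (cobj ?A n) (cobj ?B n) (hom_precomp X \<alpha> n)" for n
  by(rule lmapI[OF AM BM mem], assumption; rule hom_cplx_eqI[of _ R X Y n])
  (auto simp: mem modD[OF AM] modD[OF BM] ap hom_cplx_ops lmap_in[OF \<alpha>])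
 moreover have "cdiff ?B n (hom_precomp X \<alpha> n f) = hom_precomp X \<alpha> (n - 1) (cdiff ?A n f)" if f: "f \<in> cobj ?A n" for n f
 proof(rule hom_cplx_eqI[OF hom_cplx_diff_mem[OF X Y mem[OF f] refl] mem[OF hom_cplx_diff_mem[OF X' Y f refl]]])
  fix p x assume x: "x \<in> X p"
  show "cdiff ?B n (hom_precomp X \<alpha> n f) p x = hom_precomp X \<alpha> (n - 1) (cdiff ?A n f) p x"
  unfolding hom_cplx_diff[OF X Y mem[OF f] x refl] ap[OF x] hom_cplx_diff[OF X' Y f lmap_in[OF \<alpha> x] refl]
  ap[OF lmap_in[OF cplx_lmap[OF X refl] x]] c[OF x] ..
 qed
 ultimately show ?thesis by(simp add: chain_map_def lmap_def)
qed

lemma chain_map_postcomp: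
 assumes X: "is_complex R X" and Y: "is_complex R Y" and Y': "is_complex R Y'"
  and \<beta>: "!!p. lmap R (Y p) (Y' p) (\<beta> p)"
  and c: "!!p x. x \<in> Y p ==> cdiff Y' p (\<beta> p x) = \<beta> (p - 1) (cdiff Y p x)"
 shows "chain_map R (hom_cplx R X Y) (hom_cplx R X Y') (hom_postcomp X \<beta>)"
proof -
 let ?A = "hom_cplx R X Y" and ?B = "hom_cplx R X Y'"
 note AM = cplx_module[OF is_complex_hom[OF X Y]] and BM = cplx_module[OF is_complex_hom[OF X Y']]
 have mem: "hom_postcomp X \<beta> n f \<in> cobj ?B n" if "f \<in> cobj ?A n" for f n
  unfolding hom_postcomp_def by(rule hom_cplx_mem[OF X Y' lmap_comp[OF hom_cplx_lmap[OF X Y that refl] \<beta>]])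
 have ap: "hom_postcomp X \<beta> n f p x = \<beta> (p + n) (f p x)" if "x \<in> X p" for n f p x
  using that by(simp add: hom_postcomp_def)
 have "lmap R (cobj ?A n) (cobj ?B n) (hom_postcomp X \<beta> n)" for n
  by(rule lmapI[OF AM BM mem], assumption; rule hom_cplx_eqI[of _ R X Y' n])
  (auto simp: mem modD[OF AM] modD[OF BM] ap hom_cplx_ops lmap_add[OF \<beta>] lmap_smult[OF \<beta>] lmap_in[OF hom_cplx_lmap[OF X Y _ refl]])
 moreover have "cdiff ?B n (hom_postcomp X \<beta> n f) = hom_postcomp X \<beta> (n - 1) (cdiff ?A n f)" if f: "f \<in> cobj ?A n" for n f
 proof(rule hom_cplx_eqI[OF hom_cplx_diff_mem[OF X Y' mem[OF f] refl] mem[OF hom_cplx_diff_mem[OF X Y f refl]]])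
  fix p x assume x: "x \<in> X p"
  let ?m = "p + (n - 1)"
  have m: "?m = p + n - 1" "p - 1 + n = ?m" by auto
  note dx = lmap_in[OF cplx_lmap[OF X refl] x]
  note y = lmap_in[OF hom_cplx_lmap[OF X Y f refl] x] and z = lmap_in[OF hom_cplx_lmap[OF X Y f m(2)[symmetric]] dx]
  note e = hsign_closed[OF module_cring[OF cplx_module[OF X]]]
  show "cdiff ?B n (hom_postcomp X \<beta> n f) p x = hom_postcomp X \<beta> (n - 1) (cdiff ?A n f) p x"
  unfolding hom_cplx_diff[OF X Y' mem[OF f] x m(1)] ap[OF x] ap[OF dx] hom_cplx_diff[OF X Y f x m(1)] m(2) c[OF y]
  using lmap_minus[OF \<beta> lmap_in[OF cplx_lmap[OF Y m(1)] y] mod_smult_closed[OF cplx_module[OF Y] e z], of n]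
  lmap_smult[OF \<beta> e z, of n] by(simp add: m(1))
 qed
 ultimately show ?thesis by(simp add: chain_map_def lmap_def)
qed

text \<open>The two entries of a pair in the mapping cone form one family on the augmented complex
  \<open>Z\<close>: \<open>a\<close> on \<open>M\<close> in degree -1 and \<open>b\<close> on
  \<open>X\<close>. Cone cycles become families commuting up to sign, and the null homotopies from
  \<open>null_down\<close> are read back as cone boundaries.\<close>

lemma (in aug_resolution) precomp_quasi_iso:
 assumes Y: "is_complex R Y" and pos: "!!p x. p > 0 ==> x \<in> Y p ==> x = \<zero>\<^sub>(Y p)"
  and ext: "!!p. hom_extends R Z (Y p)"
 shows "quasi_iso R (hom_cplx R (stalk M) Y) (hom_cplx R X Y) (hom_precomp X (aug_chain_map M \<epsilon>))"
proof(rule quasi_isoI[OF is_complex_hom[OF is_complex_stalk[OF M] Y] is_complex_hom[OF X Y]])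
 let ?A = "hom_cplx R (stalk M) Y" and ?B = "hom_cplx R X Y" and ?\<alpha> = "aug_chain_map M \<epsilon>"
 note S = is_complex_stalk[OF M]
 note YM = cplx_module[OF Y] and SM = cplx_module[OF S]
 note dX = lmap_in[OF cplx_lmap[OF X refl]]
 have \<alpha>: "lmap R (X p) (cobj (stalk M) p) (?\<alpha> p)" for p
  using \<epsilon> lmap_const_zero[OF XM[of p] SM[of p]] by(cases "p = 0") (simp_all add: aug_chain_map_def)
 have \<alpha>d: "?\<alpha> (p - 1) (cdiff X p x) = \<zero>\<^sub>M" if "x \<in> X p" for p x
  using \<epsilon>_d that by(cases "p = 1") (simp_all add: aug_chain_map_def)
 show \<phi>: "chain_map R ?A ?B (hom_precomp X ?\<alpha>)"
  by(rule chain_map_precomp[OF X S Y \<alpha>]) (simp add: \<alpha>d)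
 fix n a b assume a: "a \<in> cobj ?A (n - 1)" and b: "b \<in> cobj ?B n"
  and da: "cdiff ?A (n - 1) a = \<zero>\<^sub>(cobj ?A (n - 2))" and db: "cdiff ?B n b = hom_precomp X ?\<alpha> (n - 1) a"
 let ?e = "hsign R n"
 note e = hsign_closed[OF R]
 have ee: "?e \<odot>\<^sub>(Y p) (?e \<odot>\<^sub>(Y p) x) = x" if "x \<in> Y p" for p x
  using mod_mult_smult[OF YM e e that, of n n] hsign_square[OF R] that by(simp add: modD[OF YM])
 have a0: "lmap R M (Y (n - 1)) (a 0)" using hom_cplx_lmap[OF S Y a, of "n - 1" 0] by simp
 have az: "a p \<zero>\<^sub>M = \<zero>\<^sub>(Y q)" if "q = p + n - 1" for p q
  using lmap_zero[OF hom_cplx_lmap[OF S Y a, of q p]] that by simp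
 have da0: "cdiff Y (n - 1) (a 0 m) = \<zero>\<^sub>(Y (n - 2))" if m: "m \<in> M" for m
 proof -
  have "cdiff ?A (n - 1) a 0 m = \<zero>\<^sub>(Y (n - 2))" using da hom_cplx_ops(1)[of m "stalk M" 0 R Y "n - 2"] m by simp
  thus ?thesis
  using hom_cplx_diff[OF S Y a, of m 0 "n - 2"] m az[of "n - 2" "-1"] lmap_in[OF cplx_lmap[OF Y] lmap_in[OF a0 m], of "n - 2"] e
  by(simp add: modD[OF YM])
 qed
 have bl: "lmap R (X p) (Y (p + n)) (b p)" for p by(rule hom_cplx_lmap[OF X Y b refl])
 have bd: "cdiff Y (p + n) (b p x) \<ominus>\<^sub>(Y (p + n - 1)) ?e \<odot>\<^sub>(Y (p + n - 1)) b (p - 1) (cdiff X p x) = a p (?\<alpha> p x)"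
  if x: "x \<in> X p" for p x
  unfolding hom_cplx_diff[OF X Y b x refl, symmetric] db using x by(simp add: hom_precomp_def)
 have bc: "cdiff Y (p + n) (b p x) \<in> Y (p + n - 1)" "b (p - 1) (cdiff X p x) \<in> Y (p + n - 1)"
  if x: "x \<in> X p" for p x
  using lmap_in[OF cplx_lmap[OF Y refl] lmap_in[OF bl x]] lmap_in[OF hom_cplx_lmap[OF X Y b, of "p + n - 1" "p - 1"] dX[OF x]]
  by auto
 \<comment> \<open>The factor \<open>e\<close> adjusts the square in degree zero: the cone condition
   there is \<open>d b = a \<epsilon>\<close>, while \<open>cmap\<close> wants \<open>e\<close>
   times the component on \<open>M\<close>, and \<open>e e = 1\<close>.\<close>
 let ?f = "%p. if p = -1 then (%m. ?e \<odot>\<^sub>(Y (n - 1)) a 0 m) else b p"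
 have "cmap R ?e Z (shift n Y) ?f"
 proof(rule cmap_shiftI)
  have i: "-1 + n = n - 1" by simp
  show fl: "lmap R (Z p) (Y (p + n)) (?f p)" for p
  using lmap_scale[OF a0 e] bl[of p] by(cases "p = -1") (simp_all add: i)
  fix p x assume x: "x \<in> Z p"
  consider "p \<ge> 1" | "p = 0" | "p = -1" | "p < -1" by linarith
  thus "cdiff Y (p + n) (?f p x) = ?e \<odot>\<^sub>(Y (p + n - 1)) ?f (p - 1) (cdiff Z p x)"
  proof cases
  case 1
  hence x: "x \<in> X p" using x by simp
  have "cdiff Y (p + n) (b p x) \<ominus>\<^sub>(Y (p + n - 1)) ?e \<odot>\<^sub>(Y (p + n - 1)) b (p - 1) (cdiff X p x) = \<zero>\<^sub>(Y (p + n - 1))"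
  using bd[OF x] az[of "p + n - 1" p] 1 by(simp add: aug_chain_map_def)
  thus ?thesis using 1 bc[OF x] mod_minus_eq_zero[OF YM] e by(simp add: modD[OF YM])
  next
  case 2
  hence x: "x \<in> X 0" using x by simp
  have "b (-1) (cdiff X 0 x) = \<zero>\<^sub>(Y (n - 1))" using d_zero[OF x] lmap_zero[OF bl[of "-1"]] by(simp add: i)
  hence "cdiff Y n (b 0 x) = a 0 (\<epsilon> x)" using bd[OF x] bc(1)[OF x] e by(simp add: modD[OF YM] aug_chain_map_def)
  thus ?thesis using 2 ee[OF lmap_in[OF a0 lmap_in[OF \<epsilon> x]]] by simp
  next
  case 3
  hence "x \<in> M" using x by simp
  hence "cdiff Y (n - 1) (?e \<odot>\<^sub>(Y (n - 1)) a 0 x) = \<zero>\<^sub>(Y (n - 2))"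
  using lmap_smult[OF cplx_lmap[OF Y, of "n - 2" "n - 1"] e lmap_in[OF a0]] da0 e by(simp add: modD[OF YM])
  moreover have "b (-2) \<zero>\<^sub>(X (-2)) = \<zero>\<^sub>(Y (n - 2))" using lmap_zero[OF bl[of "-2"]] by simp
  ultimately show ?thesis using 3 e by(simp add: i modD[OF YM])
  next
  case 4
  hence "x = \<zero>\<^sub>(X p)" using x Z_neg[of p x] by simp
  thus ?thesis
  using 4 lmap_zero[OF bl[of p]] lmap_zero[OF hom_cplx_lmap[OF X Y b, of "p + n - 1" "p - 1"]] e
  lmap_zero[OF cplx_lmap[OF X refl, of p]] lmap_zero[OF cplx_lmap[OF Y refl, of "p + n"]]
  by(simp add: modD[OF YM])
  qed
 qed
 then obtain h where h: "htpy R ?e Z (shift n Y) ?f h"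
  using null_down[OF Z is_complex_shift[OF Y], of "-n", OF _ _ _ e hsign_square[OF R]] pos ext by fastforce
 have hl: "lmap R (Z p) (Y (p + n + 1)) (h p)" for p by(rule htpy_shift_lmap[OF h refl])
 have h1: "lmap R M (Y n) (h (-1))" using hl[of "-1"] by simp
 \<comment> \<open>The homotopy is split again: its component on \<open>M\<close> gives
   \<open>a'\<close> up to \<open>e\<close>, the others give \<open>b'\<close>. In degree -1 the
   latter is reset to zero, because there \<open>h\<close> is defined on \<open>M\<close> and not on
   the zero module \<open>X (-1)\<close>.\<close>
 let ?a = "%p. if p = 0 then (%m. ?e \<odot>\<^sub>(Y n) h (-1) m) else (%_. \<zero>\<^sub>(Y (p + n)))"
 let ?b = "%p. if p = -1 then (%_. \<zero>\<^sub>(Y n)) else h p"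
 define a' where "a' = (%p. \<lambda>m\<in>cobj (stalk M) p. ?a p m)"
 define b' where "b' = (%p. \<lambda>x\<in>X p. ?b p x)"
 have a': "a' \<in> cobj ?A n"
  unfolding a'_def
 proof(rule hom_cplx_mem[OF S Y])
  show "lmap R (cobj (stalk M) p) (Y (p + n)) (?a p)" for p
  using lmap_scale[OF h1 e] lmap_const_zero[OF SM[of p] YM[of "p + n"]] by(cases "p = 0") simp_all
 qed
 have b': "b' \<in> cobj ?B (n + 1)"
  unfolding b'_def
 proof(rule hom_cplx_mem[OF X Y])
  have i: "p + (n + 1) = p + n + 1" for p by simp
  show "lmap R (X p) (Y (p + (n + 1))) (?b p)" for p
  using hl[of p] lmap_const_zero[OF XM[of "-1"] YM[of n]] by(cases "p = -1") (simp_all add: i)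
 qed
 have a'z: "a' p \<zero>\<^sub>M = \<zero>\<^sub>(Y q)" if "q = p + n" for p q using lmap_zero[OF hom_cplx_lmap[OF S Y a' that]] by simp
 have "cdiff ?A n a' = a"
 proof(rule hom_cplx_eqI[OF hom_cplx_diff_mem[OF S Y a' refl] a])
  fix p m assume m: "m \<in> cobj (stalk M) p"
  show "cdiff ?A n a' p m = a p m"
  proof(cases "p = 0")
  case True
  hence m: "m \<in> M" using m by simp
  have hm: "h (-1) m \<in> Y n" by(rule lmap_in[OF h1 m])
  have d: "lmap R (Y n) (Y (n - 1)) (cdiff Y n)" by(rule cplx_lmap[OF Y refl])
  have h2: "h (-2) \<zero>\<^sub>(X (-2)) = \<zero>\<^sub>(Y (n - 1))" using lmap_zero[OF hl[of "-2"]] by simp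
  have i: "-1 - 1 = (-2::int)" by simp
  have "?f (-1) m = cdiff Y n (h (-1) m) \<oplus>\<^sub>(Y (n - 1)) ?e \<odot>\<^sub>(Y (n - 1)) h (-1 - 1) (cdiff Z (-1) m)"
  by(rule htpy_shift_eq[OF h]) (use m in simp_all)
  hence "?e \<odot>\<^sub>(Y (n - 1)) a 0 m = cdiff Y n (h (-1) m)"
  unfolding i aug_res_simps(4) h2 using lmap_in[OF d hm] e by(simp add: modD[OF YM])
  hence "cdiff Y n (?e \<odot>\<^sub>(Y n) h (-1) m) = a 0 m"
  using lmap_smult[OF d e hm] ee[OF lmap_in[OF a0 m]] by simp
  moreover have "a' 0 m = ?e \<odot>\<^sub>(Y n) h (-1) m" using m by(simp add: a'_def)
  ultimately show ?thesis
  using True hom_cplx_diff[OF S Y a', of m 0 "n - 1"] m a'z[of "n - 1" "-1"] lmap_in[OF a0 m] e by(simp add: modD[OF YM])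
  next
  case False
  hence "m = \<zero>\<^sub>M" using m by simp
  thus ?thesis using az[OF refl, of p] lmap_zero[OF hom_cplx_lmap[OF S Y hom_cplx_diff_mem[OF S Y a' refl] refl], of p]
  by(simp add: algebra_simps)
  qed
 qed
 moreover have "b = hom_precomp X ?\<alpha> n a' \<oplus>\<^sub>(cobj ?B n) cdiff ?B (n + 1) b'"
 proof -
  note BM = cplx_module[OF is_complex_hom[OF X Y]]
  have \<phi>a: "hom_precomp X ?\<alpha> n a' \<in> cobj ?B n"
  unfolding hom_precomp_def by(rule hom_cplx_mem[OF X Y lmap_comp[OF \<alpha> hom_cplx_lmap[OF S Y a' refl]]])
  have db': "cdiff ?B (n + 1) b' \<in> cobj ?B n" by(rule hom_cplx_diff_mem[OF X Y b']) simp
  note sum = mod_add_closed[OF BM \<phi>a db']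
  show ?thesis
  proof(rule hom_cplx_eqI[OF b sum])
  fix p x assume x: "x \<in> X p"
  show "b p x = (hom_precomp X ?\<alpha> n a' \<oplus>\<^sub>(cobj ?B n) cdiff ?B (n + 1) b') p x"
  proof(cases "p \<ge> 0")
  case False
  hence "x = \<zero>\<^sub>(X p)" using neg x by simp
  thus ?thesis using lmap_zero[OF bl[of p]] lmap_zero[OF hom_cplx_lmap[OF X Y sum refl, of p]] by simp
  next
  case p: True
  have hx: "cdiff Y (p + n + 1) (h p x) \<in> Y (p + n)"
  using lmap_in[OF cplx_lmap[OF Y] lmap_in[OF hl[of p]], of "p + n" x] x p by simp
  have v: "hom_precomp X ?\<alpha> n a' p x = a' p (?\<alpha> p x)" "b' p x = h p x" using x p by(simp_all add: hom_precomp_def b'_def)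
  note rhs = hom_cplx_ops(2)[OF x, of R Y n "hom_precomp X ?\<alpha> n a'" "cdiff ?B (n + 1) b'", unfolded hom_cplx_diff_succ[OF X Y b' x] v]
  have eq: "b p x = cdiff Y (p + n + 1) (h p x) \<oplus>\<^sub>(Y (p + n)) ?e \<odot>\<^sub>(Y (p + n)) h (p - 1) (cdiff Z p x)"
  using htpy_shift_eq[OF h refl refl, of x p] x p by simp
  show ?thesis
  proof(cases "p = 0")
  case True
  hence x: "x \<in> X 0" using x by simp
  have "a' 0 (?\<alpha> 0 x) = ?e \<odot>\<^sub>(Y n) h (-1) (\<epsilon> x)" using lmap_in[OF \<epsilon> x] by(simp add: a'_def aug_chain_map_def)
  moreover have "b' (-1) (cdiff X 0 x) = \<zero>\<^sub>(Y n)" using dX[OF x] by(simp add: b'_def)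
  ultimately show ?thesis
  using eq rhs True hx lmap_in[OF h1 lmap_in[OF \<epsilon> x]] e by(simp add: modD[OF YM] mod_comm[OF YM])
  next
  case False
  hence "a' p (?\<alpha> p x) = \<zero>\<^sub>(Y (p + n))" using a'z[OF refl, of p] by(simp add: aug_chain_map_def)
  moreover have "b' (p - 1) (cdiff X p x) = h (p - 1) (cdiff X p x)" using dX[OF x] False p by(simp add: b'_def)
  moreover have "h (p - 1) (cdiff X p x) \<in> Y (p + n)"
  using lmap_in[OF hl[of "p - 1"], of "cdiff X p x"] dX[OF x] False p by simp
  ultimately show ?thesis using eq rhs hx e False p by(simp add: modD[OF YM])
  qed
  qed
  qed
 qed
 ultimately show "\<exists>a'\<in>cobj ?A n. \<exists>b'\<in>cobj ?B (n + 1).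
  cdiff ?A n a' = a & b = hom_precomp X ?\<alpha> n a' \<oplus>\<^sub>(cobj ?B n) cdiff ?B (n + 1) b'"
  using a' b' by blast
qed

text \<open>Dually, \<open>b\<close> with values in \<open>Y\<close> and \<open>a\<close> with
  values in \<open>N\<close> combine to one family from \<open>X\<close> into the augmented complex
  \<open>W\<close>, and \<open>null_up\<close> contracts it.\<close>

lemma (in aug_coresolution) postcomp_quasi_iso:
 assumes X: "is_complex R X" and neg: "!!p x. p < 0 ==> x \<in> X p ==> x = \<zero>\<^sub>(X p)"
  and lift: "!!p. p \<ge> 0 ==> hom_lifts R (X p) W"
 shows "quasi_iso R (hom_cplx R X (stalk N)) (hom_cplx R X Y) (hom_postcomp X (coaug_chain_map Y \<eta>))"
proof(rule quasi_isoI[OF is_complex_hom[OF X is_complex_stalk[OF N]] is_complex_hom[OF X Y]])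
 let ?A = "hom_cplx R X (stalk N)" and ?B = "hom_cplx R X Y" and ?\<beta> = "coaug_chain_map Y \<eta>"
 note S = is_complex_stalk[OF N]
 note WM = cplx_module[OF W] and SM = cplx_module[OF S] and XM = cplx_module[OF X]
 note dX = lmap_in[OF cplx_lmap[OF X refl]]
 have \<beta>: "lmap R (cobj (stalk N) p) (Y p) (?\<beta> p)" for p
  using \<eta> lmap_const_zero[OF SM[of p] YM[of p]] by(cases "p = 0") (simp_all add: coaug_chain_map_def)
 show \<phi>: "chain_map R ?A ?B (hom_postcomp X ?\<beta>)"
 proof(rule chain_map_postcomp[OF X S Y \<beta>])
  fix p x assume x: "x \<in> cobj (stalk N) p"
  have "?\<beta> (p - 1) \<zero>\<^sub>N = \<zero>\<^sub>(Y (p - 1))" using lmap_zero[OF \<beta>[of "p - 1"]] by simp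
  thus "cdiff Y p (?\<beta> p x) = ?\<beta> (p - 1) (cdiff (stalk N) p x)"
  using x d_\<eta>[of x] lmap_zero[OF cplx_lmap[OF Y refl, of p]] by(cases "p = 0") (simp_all add: coaug_chain_map_def)
 qed
 fix n a b assume a: "a \<in> cobj ?A (n - 1)" and b: "b \<in> cobj ?B n"
  and da: "cdiff ?A (n - 1) a = \<zero>\<^sub>(cobj ?A (n - 2))" and db: "cdiff ?B n b = hom_postcomp X ?\<beta> (n - 1) a"
 let ?e = "hsign R n"
 note e = hsign_closed[OF R]
 have a1: "lmap R (X (1 - n)) N (a (1 - n))" using hom_cplx_lmap[OF X S a, of 0 "1 - n"] by simp
 have da1: "?e \<odot>\<^sub>N a (1 - n) (cdiff X (2 - n) x) = \<zero>\<^sub>N" if x: "x \<in> X (2 - n)" for x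
 proof -
  have dx: "cdiff X (2 - n) x \<in> X (1 - n)" using lmap_in[OF cplx_lmap[OF X, of "1 - n" "2 - n"] x] by simp
  have "cdiff ?A (n - 1) a (2 - n) x = \<zero>\<^sub>N" using da hom_cplx_ops(1)[OF x, of R "stalk N" "n - 2"] by simp
  hence "\<zero>\<^sub>N \<ominus>\<^sub>N hsign R (n - 1) \<odot>\<^sub>N a (1 - n) (cdiff X (2 - n) x) = \<zero>\<^sub>N"
  using hom_cplx_diff[OF X S a x, of 0] by simp
  thus ?thesis
  using lmap_in[OF a1 dx] e by(simp add: hsign_succ(2)[OF N] a_minus_def modD[OF N])
 qed
 have bl: "lmap R (X p) (Y q) (b p)" if "q = p + n" for p q by(rule hom_cplx_lmap[OF X Y b that])
 have bd: "cdiff Y (p + n) (b p x) \<ominus>\<^sub>(Y (p + n - 1)) ?e \<odot>\<^sub>(Y (p + n - 1)) b (p - 1) (cdiff X p x) = ?\<beta> (p + n - 1) (a p x)"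
  if x: "x \<in> X p" for p x
 proof -
  have i: "p + (n - 1) = p + n - 1" by simp
  show ?thesis unfolding hom_cplx_diff[OF X Y b x refl, symmetric] db hom_postcomp_def i using x by simp
 qed
 have bc: "cdiff Y (p + n) (b p x) \<in> Y (p + n - 1)" "b (p - 1) (cdiff X p x) \<in> Y (p + n - 1)"
  if x: "x \<in> X p" for p x
  using lmap_in[OF cplx_lmap[OF Y refl] lmap_in[OF bl[OF refl] x]] lmap_in[OF bl[of "p + n - 1" "p - 1"] dX[OF x]]
  by auto
 \<comment> \<open>Component \<open>1 - n\<close> lands in degree one of \<open>W\<close>, which is
   \<open>N\<close>. There \<open>b\<close> vanishes and the cone condition becomes
   \<open>- e b d = \<eta> a\<close>, so \<open>- a\<close> is the entry that commutes up to
   \<open>e\<close>.\<close>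
 let ?f = "%p. if p = 1 - n then (%x. \<ominus>\<^sub>N a (1 - n) x) else b p"
 have fl: "lmap R (X p) (W (p + n)) (?f p)" for p
  using lmap_uminus[OF a1] bl[of "p + n" p] by(cases "p = 1 - n") simp_all
 have "cmap R ?e X (shift n W) ?f"
 proof(rule cmap_shiftI[OF fl])
  fix p x assume x: "x \<in> X p"
  consider "p + n \<le> 0" | "p = 1 - n" | "p = 2 - n" | "p + n \<ge> 3" by linarith
  thus "cdiff W (p + n) (?f p x) = ?e \<odot>\<^sub>(W (p + n - 1)) ?f (p - 1) (cdiff X p x)"
  proof cases
  case 1
  hence "cdiff Y (p + n) (b p x) \<ominus>\<^sub>(Y (p + n - 1)) ?e \<odot>\<^sub>(Y (p + n - 1)) b (p - 1) (cdiff X p x) = \<zero>\<^sub>(Y (p + n - 1))"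
  using bd[OF x] by(simp add: coaug_chain_map_def)
  thus ?thesis using 1 bc[OF x] mod_minus_eq_zero[OF YM] e by(simp add: modD[OF YM])
  next
  case 2
  have "b p x = \<zero>\<^sub>(Y 1)" using pos[of 1] lmap_in[OF bl[of 1 p] x] 2 by simp
  hence "cdiff Y 1 (b p x) = \<zero>\<^sub>(Y 0)" using lmap_zero[OF cplx_lmap[OF Y, of 0 1]] by simp
  hence q: "\<ominus>\<^sub>(Y 0) (?e \<odot>\<^sub>(Y 0) b (p - 1) (cdiff X p x)) = \<eta> (a p x)"
  using bd[OF x] bc(2)[OF x] 2 e by(simp add: coaug_chain_map_def a_minus_def modD[OF YM])
  have "b (p - 1) (cdiff X p x) \<in> Y 0" using bc(2)[OF x] 2 by simp
  hence "\<ominus>\<^sub>(Y 0) \<eta> (a p x) = ?e \<odot>\<^sub>(Y 0) b (p - 1) (cdiff X p x)"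
  unfolding q[symmetric] using mod_neg_neg[OF YM mod_smult_closed[OF YM e]] by blast
  thus ?thesis using 2 x lmap_neg[OF \<eta> lmap_in[OF a1]] by simp
  next
  case 3
  hence x: "x \<in> X (2 - n)" using x by simp
  have "a (1 - n) (cdiff X (2 - n) x) \<in> N"
  using lmap_in[OF a1 lmap_in[OF cplx_lmap[OF X, of "1 - n" "2 - n"] x]] by simp
  hence "?e \<odot>\<^sub>N (\<ominus>\<^sub>N a (1 - n) (cdiff X (2 - n) x)) = \<zero>\<^sub>N"
  using da1[OF x] e by(simp add: mod_smult_neg[OF N] modD[OF N])
  thus ?thesis using 3 by simp
  next
  case 4
  have i: "p - 1 + n = p + n - 1" by simp
  have "?e \<odot>\<^sub>(W (p + n - 1)) ?f (p - 1) (cdiff X p x) \<in> W (p + n - 1)"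
  by(rule mod_smult_closed[OF WM e lmap_in[OF fl[of "p - 1", unfolded i] dX[OF x]]])
  moreover have "cdiff W (p + n) (?f p x) \<in> W (p + n - 1)" by(rule lmap_in[OF cplx_lmap[OF W refl] lmap_in[OF fl x]])
  moreover have "y = \<zero>\<^sub>(W (p + n - 1))" if "y \<in> W (p + n - 1)" for y
  by(rule W_pos[OF _ that]) (use 4 in simp)
  ultimately show ?thesis by metis
  qed
 qed
 from null_up[OF X is_complex_shift[OF W] neg hom_lifts_shift[OF lift] this e]
 obtain h where h: "htpy R ?e X (shift n W) ?f h" by blast
 have hl: "lmap R (X p) (W q) (h p)" if "q = p + n + 1" for p q by(rule htpy_shift_lmap[OF h that])
 have h1: "lmap R (X (- n)) N (h (- n))" using hl[of 1 "- n"] by simp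
 let ?a = "%p. if p = - n then h (- n) else (%_. \<zero>\<^sub>N)"
 let ?b = "%p. if p = - n then (%_. \<zero>\<^sub>(Y 1)) else h p"
 define a' where "a' = (%p. \<lambda>x\<in>X p. ?a p x)"
 define b' where "b' = (%p. \<lambda>x\<in>X p. ?b p x)"
 have a': "a' \<in> cobj ?A n"
  unfolding a'_def
 proof(rule hom_cplx_mem[OF X S])
  show "lmap R (X p) (cobj (stalk N) (p + n)) (?a p)" for p
  using h1 lmap_const_zero[OF XM[of p] SM[of "p + n"]] by(cases "p = - n") simp_all
 qed
 have b': "b' \<in> cobj ?B (n + 1)"
  unfolding b'_def
 proof(rule hom_cplx_mem[OF X Y])
  have i: "p + (n + 1) = p + n + 1" for p by simp
  show "lmap R (X p) (Y (p + (n + 1))) (?b p)" for p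
  using hl[of "p + n + 1" p] lmap_const_zero[OF XM[of "- n"] YM[of 1]] by(cases "p = - n") (simp_all add: i)
 qed
 have "cdiff ?A n a' = a"
 proof(rule hom_cplx_eqI[OF hom_cplx_diff_mem[OF X S a' refl] a])
  fix p x assume x: "x \<in> X p"
  show "cdiff ?A n a' p x = a p x"
  proof(cases "p = 1 - n")
  case True
  hence x: "x \<in> X (1 - n)" using x by simp
  have dx: "cdiff X (1 - n) x \<in> X (- n)" using lmap_in[OF cplx_lmap[OF X, of "- n" "1 - n"] x] by simp
  have c: "h (- n) (cdiff X (1 - n) x) \<in> N" by(rule lmap_in[OF h1 dx])
  have "\<ominus>\<^sub>N a (1 - n) x = ?e \<odot>\<^sub>N h (- n) (cdiff X (1 - n) x)"
  using htpy_shift_eq[OF h, of 2 "1 - n" 1 x] x c e by(simp add: modD[OF N])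
  hence "a (1 - n) x = \<ominus>\<^sub>N (?e \<odot>\<^sub>N h (- n) (cdiff X (1 - n) x))" using mod_neg_neg[OF N lmap_in[OF a1 x]] by simp
  moreover have "a' (- n) (cdiff X (1 - n) x) = h (- n) (cdiff X (1 - n) x)" using dx by(simp add: a'_def)
  ultimately show ?thesis
  using True hom_cplx_diff[OF X S a' x, of 0] c e by(simp add: a_minus_def modD[OF N])
  next
  case False
  have c: "cdiff ?A n a' p x \<in> cobj (stalk N) (p + n - 1)" "a p x \<in> cobj (stalk N) (p + n - 1)"
  using lmap_in[OF hom_cplx_lmap[OF X S hom_cplx_diff_mem[OF X S a' refl], of "p + n - 1" p] x]
  lmap_in[OF hom_cplx_lmap[OF X S a, of "p + n - 1" p] x] by auto
  have "p + n - 1 ~= 0" using False by simp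
  thus ?thesis using stalk_zero c by metis
  qed
 qed
 moreover have "b = hom_postcomp X ?\<beta> n a' \<oplus>\<^sub>(cobj ?B n) cdiff ?B (n + 1) b'"
 proof -
  note BM = cplx_module[OF is_complex_hom[OF X Y]]
  have \<phi>a: "hom_postcomp X ?\<beta> n a' \<in> cobj ?B n"
  unfolding hom_postcomp_def by(rule hom_cplx_mem[OF X Y lmap_comp[OF hom_cplx_lmap[OF X S a' refl] \<beta>]])
  have db': "cdiff ?B (n + 1) b' \<in> cobj ?B n" by(rule hom_cplx_diff_mem[OF X Y b']) simp
  note sum = mod_add_closed[OF BM \<phi>a db']
  show ?thesis
  proof(rule hom_cplx_eqI[OF b sum])
  fix p x assume x: "x \<in> X p"
  have v: "hom_postcomp X ?\<beta> n a' p x = ?\<beta> (p + n) (a' p x)" using x by(simp add: hom_postcomp_def)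
  note rhs = hom_cplx_ops(2)[OF x, of R Y n "hom_postcomp X ?\<beta> n a'" "cdiff ?B (n + 1) b'", unfolded hom_cplx_diff_succ[OF X Y b' x] v]
  show "b p x = (hom_postcomp X ?\<beta> n a' \<oplus>\<^sub>(cobj ?B n) cdiff ?B (n + 1) b') p x"
  proof(cases "p + n \<le> 0")
  case False
  thus ?thesis
  using pos[OF _ lmap_in[OF bl[OF refl] x]] pos[OF _ lmap_in[OF hom_cplx_lmap[OF X Y sum refl] x]] by simp
  next
  case p: True
  have eq: "b p x = cdiff W (p + n + 1) (h p x) \<oplus>\<^sub>(Y (p + n)) ?e \<odot>\<^sub>(Y (p + n)) h (p - 1) (cdiff X p x)"
  using htpy_shift_eq[OF h refl refl, of x p] x p by simp
  have b1: "b' (p - 1) (cdiff X p x) = h (p - 1) (cdiff X p x)" using dX[OF x] p by(simp add: b'_def)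
  have hc: "h (p - 1) (cdiff X p x) \<in> Y (p + n)" using lmap_in[OF hl[of "p + n" "p - 1"] dX[OF x]] p by simp
  show ?thesis
  proof(cases "p = - n")
  case True
  have "?\<beta> 0 (a' p x) = \<eta> (h p x)" using x True by(simp add: coaug_chain_map_def a'_def)
  moreover have "cdiff Y 1 (b' p x) = \<zero>\<^sub>(Y 0)"
  using x True lmap_zero[OF cplx_lmap[OF Y, of 0 1]] by(simp add: b'_def)
  moreover have "p + n = 0" using True by simp
  ultimately show ?thesis
  using eq rhs b1 hc e lmap_in[OF \<eta>] by(simp add: modD[OF YM])
  next
  case False
  hence "?\<beta> (p + n) (a' p x) = \<zero>\<^sub>(Y (p + n))" "b' p x = h p x" "cdiff W (p + n + 1) = cdiff Y (p + n + 1)"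
  using p x by(simp_all add: coaug_chain_map_def b'_def)
  moreover have "cdiff Y (p + n + 1) (h p x) \<in> Y (p + n)"
  using lmap_in[OF cplx_lmap[OF W, of "p + n" "p + n + 1"] lmap_in[OF hl[OF refl] x]] p False by simp
  ultimately show ?thesis using eq rhs b1 hc e by(simp add: modD[OF YM])
  qed
  qed
  qed
 qed
 ultimately show "\<exists>a'\<in>cobj ?A n. \<exists>b'\<in>cobj ?B (n + 1).
  cdiff ?A n a' = a & b = hom_postcomp X ?\<beta> n a' \<oplus>\<^sub>(cobj ?B n) cdiff ?B (n + 1) b'"
  using a' b' by blast
qed

lemma quasi_iso_isomorphic:
 assumes "quasi_iso R A B \<phi>" "quasi_iso R A' B \<psi>"
 shows "mod_isomorphic R (homology A n) (homology A' n)"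
proof -
 have f: "lmap R (homology A n) (homology B n) (homology_map B \<phi> n)" and g: "lmap R (homology A' n) (homology B n) (homology_map B \<psi> n)"
  using assms lmap_homology_map[of R A B \<phi> n] lmap_homology_map[of R A' B \<psi> n] by(auto simp: quasi_iso_def)
 have fb: "bij_betw (homology_map B \<phi> n) (carrier (homology A n)) (carrier (homology B n))"
  and gb: "bij_betw (homology_map B \<psi> n) (carrier (homology A' n)) (carrier (homology B n))"
  using assms by(auto simp: quasi_iso_def)
 let ?g = "homology_map B \<psi> n"
 have "EX k. lmap R (homology B n) (homology A' n) k & (\<forall>a\<in>homology A' n. k (?g a) = a) & (\<forall>b\<in>homology B n. ?g (k b) = b)"
 proof(rule lmap_inverse[OF g])
  show "\<exists>a\<in>homology A' n. ?g a = b" if "b \<in> homology B n" for b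
  using gb that unfolding bij_betw_def by(metis imageE)
  show "a = \<zero>\<^sub>(homology A' n)" if "a \<in> homology A' n" "?g a = \<zero>\<^sub>(homology B n)" for a
  using gb that lmap_zero[OF g] mod_zero_closed[OF lmap_dom[OF g]] unfolding bij_betw_def inj_on_def by metis
 qed
 then obtain k where k: "lmap R (homology B n) (homology A' n) k" "!!a. a \<in> homology A' n ==> k (?g a) = a"
  "!!b. b \<in> homology B n ==> ?g (k b) = b" by(elim exE conjE) (rule that, auto)
 have "bij_betw k (carrier (homology B n)) (carrier (homology A' n))"
  by(rule bij_betw_byWitness[where f' = ?g]) (use k lmap_in[OF k(1)] lmap_in[OF g] in auto)
 from bij_betw_trans[OF fb this] lmap_comp[OF f k(1)] show ?thesis
  unfolding mod_isomorphic_def lmap_def by(auto simp: comp_def)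
qed

section \<open>Balance over a dualizing module\<close>

lemma hom_lifts_loc_summand:
 assumes Q: "loc_summand R C Q B t s" and Z: "is_complex R Z" and C: "hom_lifts R C Z"
 shows "hom_lifts R Q Z"
 unfolding hom_lifts_def
proof(intro allI impI, elim conjE)
 fix q g assume g: "lmap R Q (Z q) g" and z: "\<forall>x\<in>Q. cdiff Z q (g x) = \<zero>\<^sub>(Z (q - 1))"
 have t: "lmap R C Q (t b)" if "b \<in> B" for b using Q that by(simp add: loc_summand_def)
 show "EX k. lmap R Q (Z (q + 1)) k & (\<forall>x\<in>Q. cdiff Z (q + 1) (k x) = g x)"
 proof(rule loc_summand_lift[OF Q _ g])
  show "lmap R (Z (q + 1)) (Z q) (cdiff Z (q + 1))" by(rule cplx_lmap[OF Z]) simp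
  show "EX h. lmap R C (Z (q + 1)) h & (\<forall>x\<in>C. cdiff Z (q + 1) (h x) = g (t b x))" if b: "b \<in> B" for b
  by(rule hom_liftsD[OF C lmap_comp[OF t[OF b] g] _ refl]) (use z lmap_in[OF t[OF b]] in blast)
 qed
qed

lemma hom_extends_retract:
 assumes E: "hom_extends R Z E" and u: "lmap R Y E u" and v: "lmap R E Y v" and vu: "!!y. y \<in> Y ==> v (u y) = y"
 shows "hom_extends R Z Y"
 unfolding hom_extends_def
proof(intro allI impI, elim conjE)
 fix q g assume g: "lmap R (Z q) Y g" and z: "\<forall>x\<in>Z (q + 1). g (cdiff Z (q + 1) x) = \<zero>\<^sub>Y"
 obtain k where k: "lmap R (Z (q - 1)) E k" "!!x. x \<in> Z q ==> k (cdiff Z q x) = u (g x)"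
  using hom_extendsD[OF E lmap_comp[OF g u] _ refl] z lmap_zero[OF u] by auto
 thus "EX k. lmap R (Z (q - 1)) Y k & (\<forall>x\<in>Z q. k (cdiff Z q x) = g x)"
  using lmap_comp[OF k(1) v] vu lmap_in[OF g] by(intro exI[of _ "%x. v (k x)"]) auto
qed

text \<open>The results on bounded sequences in terms of augmented complexes: degree -1 is the
  surjectivity part, degrees from zero on are \<open>bounded_resolution_lift\<close>.\<close>

lemma (in semidual) resolution_hom_lifts:
 assumes A: "aug_resolution R X \<epsilon> M" and bd: "bounded_seq (%n. cobj (aug_res X \<epsilon> M) (int n - 1)) K"
  and ac: "!!p. acyclic (X p)"
 shows "hom_lifts R S (aug_res X \<epsilon> M)"
 unfolding hom_lifts_def
proof(intro allI impI, elim conjE)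
 interpret A: aug_resolution R X \<epsilon> M by(rule A)
 let ?A = "%n. A.Z (int n - 1)"
 have acA: "acyclic (?A (Suc n))" for n using ac[of "int n"] by simp
 have i: "int (Suc n) = int n + 1" for n by simp
 fix q g assume g: "lmap R S (A.Z q) g" and z: "\<forall>x\<in>S. cdiff A.Z q (g x) = \<zero>\<^sub>(A.Z (q - 1))"
 consider "q < -1" | "q = -1" | "q \<ge> 0" by linarith
 thus "EX k. lmap R S (A.Z (q + 1)) k & (\<forall>x\<in>S. cdiff A.Z (q + 1) (k x) = g x)"
 proof cases
  case 1
  have "g x = \<zero>\<^sub>(A.Z q)" if "x \<in> S" for x using A.Z_neg[OF 1 lmap_in[OF g that]] .
  moreover have "lmap R (A.Z (q + 1)) (A.Z q) (cdiff A.Z (q + 1))" by(rule cplx_lmap[OF A.Z]) simp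
  ultimately show ?thesis using lmap_const_zero[OF S_module cplx_module[OF A.Z]] lmap_zero by metis
 next
  case 2
  thus ?thesis using bounded_resolution_lift_acyclic[OF A.left_exact bd acA] g by simp
 next
  case 3
  then obtain n where 3: "q = int n" using nonneg_int_cases by blast
  have "lmap R S (?A (Suc n)) g" using g unfolding 3 by simp
  from bounded_resolution_lift[OF A.left_exact bd acA this] z show ?thesis unfolding 3 by(simp add: algebra_simps)
 qed
qed

context dualizing_pair
begin

context
 fixes \<iota> :: "'a => 'x"
 assumes inf: "infinite (UNIV :: 'x set)" and \<iota>: "inj_on \<iota> (carrier R)"
begin

text \<open>Bounded resolutions by the class of \<open>C\<close> are automatically proper: their
  terms are summands of sums of copies of \<open>C\<close>, hence acyclic for \<open>C\<close>, and
  lifting from \<open>Q\<close> is checked on copies of \<open>C\<close> too.\<close>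

lemma resolution_lifts:
 fixes X :: "('a,'x) cplx"
 assumes A: "aug_resolution R X \<epsilon> M" and bd: "bounded_seq (%n. cobj (aug_res X \<epsilon> M) (int n - 1)) K"
  and XP: "!!p. X p \<in> P_class R C" and Q: "(Q :: ('a,'x) module) \<in> P_class R C"
 shows "hom_lifts R Q (aug_res X \<epsilon> M)"
proof -
 note sm = P_class_loc_summand[OF inf \<iota> C.S_module]
 have "C.acyclic (X p)" for p using sm[OF XP[of p]] C.acyclic_loc_summand[OF _ C.self_acyclic] by blast
 from C.resolution_hom_lifts[OF A bd this] show ?thesis
  using sm[OF Q] hom_lifts_loc_summand[OF _ aug_resolution.Z[OF A]] by blast
qed

text \<open>By exchange of arguments \<open>Hom(Z, Hom(C', I))\<close> is
  \<open>Hom(C', Hom(Z, I))\<close>. The dual of \<open>Z\<close> is a bounded coresolution with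
  terms \<open>Hom(C, Hom(P, I))\<close>, so \<open>hom_C'_exact\<close> applies.\<close>

lemma resolution_extends:
 fixes X :: "('a,'x) cplx"
 assumes A: "aug_resolution R X \<epsilon> M" and bd: "bounded_seq (%n. cobj (aug_res X \<epsilon> M) (int n - 1)) K"
  and XP: "!!p. X p \<in> P_class R C" and Y: "(Y :: ('a,'x) module) \<in> I_class R C'"
 shows "hom_extends R (aug_res X \<epsilon> M) Y"
proof -
 interpret A: aug_resolution R X \<epsilon> M by(rule A)
 obtain I :: "('a,'x) module" and u v where I: "baer R I" and u: "lmap R Y (Hom R C' I) u" and v: "lmap R (Hom R C' I) Y v"
  and vu: "!!y. y \<in> Y ==> v (u y) = y"
  using I_class_maps[OF \<iota> C'_module Y] by(elim exE conjE) (rule that, assumption+, blast)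
 note IM = baer_module[OF I]
 let ?A = "%n. A.Z (int n - 1)" and ?\<delta> = "%n. cdiff A.Z (int n)"
 define G where "G n P f g \<longleftrightarrow> baer R (Hom R P I) &
  lmap R (Hom R (?A (Suc n)) I) (Hom R C (Hom R P I)) f & lmap R (Hom R C (Hom R P I)) (Hom R (?A (Suc n)) I) g &
  (\<forall>x\<in>(Hom R (?A (Suc n)) I). g (f x) = x) & (\<forall>y\<in>Hom R C (Hom R P I). f (g y) = y)"
  for n f g and P :: "('a,'x) module"
 have "EX P f g. G n P f g" for n using P_class_dual[OF inf \<iota> C.S_module XP[of "int n"] I] by(simp add: G_def)
 then obtain P f g where "!!n. G n (P n) (f n) (g n)" by metis
 note G = this[unfolded G_def]
 have E: "right_exact_cores R (%n. Hom R C' (Hom R (?A n) I)) (%n. post C' (pre (?A (Suc n)) (?\<delta> n)))"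
  by(rule hom_C'_exact[OF dual_right_exact[OF A.left_exact I] bounded_dual[OF bd cplx_module[OF A.Z] IM], where I = "%n. Hom R (P n) I" and u = f and v = g])
  (use G in auto)
 have "hom_extends R A.Z (Hom R C' I)"
 proof(rule A.hom_extendsI[OF module_hom_mod[OF C'_module IM]])
  fix q h assume q: "0 \<le> q" and h: "lmap R (A.Z q) (Hom R C' I) h"
  and z: "\<forall>x\<in>A.Z (q + 1). h (cdiff A.Z (q + 1) x) = \<zero>\<^sub>(Hom R C' I)"
  obtain n where n: "q = int n" using q nonneg_int_cases by blast
  have i: "int (Suc n) - 1 = q" "int n = q" "int (Suc (Suc n)) - 1 = q + 1" "int (Suc n) = q + 1" using n by auto
  let ?h = "\<lambda>y\<in>C'. \<lambda>w\<in>A.Z q. h w y"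
  have ZM: "module R (A.Z p)" for p by(rule cplx_module[OF A.Z])
  have hm: "?h \<in> (Hom R C' (Hom R (A.Z q) I))"
  by(rule hom_mem[OF lmap_flip[OF h C'_module IM]])
  have dZ: "cdiff A.Z (q + 1) w \<in> A.Z q" if "w \<in> A.Z (q + 1)" for w
  using lmap_in[OF cplx_lmap[OF A.Z, of q "q + 1"] that] by simp
  have pm: "post C' (pre (A.Z (q + 1)) (cdiff A.Z (q + 1))) ?h \<in> (Hom R C' (Hom R (A.Z (q + 1)) I))"
  by(rule lmap_in[OF lmap_post[OF lmap_pre[OF cplx_lmap[OF A.Z] IM] C'_module] hm]) simp
  have "post C' (pre (A.Z (q + 1)) (cdiff A.Z (q + 1))) ?h = \<zero>\<^sub>(Hom R C' (Hom R (A.Z (q + 1)) I))"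
  proof(rule hom_eqI[OF pm mod_zero_closed[OF module_hom_mod[OF C'_module module_hom_mod[OF ZM IM]]]])
  fix y assume y: "y \<in> C'"
  show "post C' (pre (A.Z (q + 1)) (cdiff A.Z (q + 1))) ?h y = \<zero>\<^sub>(Hom R C' (Hom R (A.Z (q + 1)) I)) y"
  using y z dZ by(auto simp: pre_def hom_mod_simps)
  qed
  from rec_exact[OF E, of _ n, unfolded i add_diff_cancel_right', OF hm this]
  obtain k where k: "k \<in> (Hom R C' (Hom R (A.Z (q - 1)) I))" "post C' (pre (A.Z q) (cdiff A.Z q)) k = ?h"
  by blast
  let ?k = "%w. \<lambda>y\<in>C'. k y w"
  have kl: "lmap R (A.Z (q - 1)) (Hom R C' I) ?k"
  by(rule lmap_flip[OF hom_lmap[OF k(1) C'_module module_hom_mod[OF ZM IM]] ZM IM])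
  show "EX k. lmap R (A.Z (q - 1)) (Hom R C' I) k & (\<forall>x\<in>A.Z q. k (cdiff A.Z q x) = h x)"
  proof(rule exI[of _ ?k], intro conjI ballI kl)
  fix x assume x: "x \<in> A.Z q"
  note dx = lmap_in[OF cplx_lmap[OF A.Z refl] x]
  show "?k (cdiff A.Z q x) = h x"
  proof(rule hom_eqI[OF lmap_in[OF kl dx] lmap_in[OF h x]])
  fix y assume y: "y \<in> C'"
  show "?k (cdiff A.Z q x) y = h x y"
  using fun_cong[OF fun_cong[OF k(2), of y], of x] x y dx by simp
  qed
  qed
 qed
 thus ?thesis by(rule hom_extends_retract[OF _ u v]) (rule vu)
qed

text \<open>The first part is the automatic properness of bounded coresolutions, obtained from
  \<open>hom_into_dual_exact\<close> for the semidualizing module \<open>C'\<close>. The second part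
  is \<open>hom_C_exact\<close> for \<open>C\<close> itself, extended to its class by
  summands.\<close>

lemma
 fixes Y :: "('a,'x) cplx"
 assumes B: "aug_coresolution R N' \<eta> Y" and bd: "bounded_seq (%n. cobj (aug_cores N' \<eta> Y) (1 - int n)) K"
  and YI: "!!p. Y p \<in> I_class R C'"
 shows coresolution_extends: "(E :: ('a,'x) module) \<in> I_class R C' ==> hom_extends R (aug_cores N' \<eta> Y) E"
  and coresolution_lifts: "(Q :: ('a,'x) module) \<in> P_class R C ==> hom_lifts R Q (aug_cores N' \<eta> Y)"
proof -
 interpret B: aug_coresolution R N' \<eta> Y by(rule B)
 let ?U = "%n. B.W (1 - int n)" and ?\<delta> = "%n. cdiff B.W (1 - int n)"
 note WM = cplx_module[OF B.W]
 define G where "G n I f g \<longleftrightarrow> baer R I & lmap R (?U (Suc n)) (Hom R C' I) f & lmap R (Hom R C' I) (?U (Suc n)) g &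
  (\<forall>x\<in>(?U (Suc n)). g (f x) = x) & (\<forall>y\<in>Hom R C' I. f (g y) = y)"
  for n f g and I :: "('a,'x) module"
 have "EX I f g. G n I f g" for n using I_class_maps[OF \<iota> C'_module YI[of "- int n"]] by(simp add: G_def)
 then obtain I f g where "!!n. G n (I n) (f n) (g n)" by metis
 note G = this[unfolded G_def]
 have I: "!!n. baer R (I n)" and f: "!!n. lmap R (?U (Suc n)) (Hom R C' (I n)) (f n)" and g: "!!n. lmap R (Hom R C' (I n)) (?U (Suc n)) (g n)"
  and gf: "!!n x. x \<in> (?U (Suc n)) ==> g n (f n x) = x" and fg: "!!n x. x \<in> Hom R C' (I n) ==> f n (g n x) = x"
  using G by auto
 show "hom_extends R B.W E" if E: "E \<in> I_class R C'" for E :: "('a,'x) module"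
 proof -
  obtain I' :: "('a,'x) module" and u v where I': "baer R I'" and u: "lmap R E (Hom R C' I') u" and v: "lmap R (Hom R C' I') E v"
  and vu: "!!y. y \<in> E ==> v (u y) = y"
  using I_class_maps[OF \<iota> C'_module E] by(elim exE conjE) (rule that, assumption+, blast)
  obtain H :: "nat => ('a, nat => 'a) module" and d e where "semidual R C' H d e" using semidual_C' by blast
  then interpret S': semidual R C' H d e .
  note ex = S'.hom_into_dual_exact[OF B.right_exact bd I f g gf I']
  and ex0 = S'.hom_into_dual_extends[OF B.right_exact bd I f g gf I']
  have "hom_extends R B.W (Hom R C' I')"
  unfolding hom_extends_def
  proof(intro allI impI, elim conjE)
  fix q h assume h: "lmap R (B.W q) (Hom R C' I') h"
  and z: "\<forall>x\<in>B.W (q + 1). h (cdiff B.W (q + 1) x) = \<zero>\<^sub>(Hom R C' I')"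
  show "EX k. lmap R (B.W (q - 1)) (Hom R C' I') k & (\<forall>x\<in>B.W q. k (cdiff B.W q x) = h x)"
  proof(cases "q \<le> 1")
  case False
  have "h x = \<zero>\<^sub>(Hom R C' I')" if "x \<in> B.W q" for x
  using B.W_pos[OF _ that] lmap_zero[OF h] False by simp
  thus ?thesis using lmap_const_zero[OF WM lmap_cod[OF h]] by metis
  next
  case True
  define m where "m = nat (1 - q)"
  have m: "1 - int m = q" using True by(simp add: m_def)
  show ?thesis
  proof(cases m)
  case 0
  have i: "1 - int 0 = q" "1 - int (Suc 0) = q - 1" using m 0 by auto
  show ?thesis by(rule ex0[unfolded i, OF _ h])
  next
  case (Suc n)
  have i: "1 - int (Suc n) = q" "1 - int (Suc (Suc n)) = q - 1" "1 - int n = q + 1" using m Suc by auto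
  show ?thesis by(rule ex[of n h, unfolded i, OF _ h]) (use z in blast)+
  qed
  qed
  qed
  thus ?thesis by(rule hom_extends_retract[OF _ u v]) (rule vu)
 qed
 show "hom_lifts R Q B.W" if Q: "Q \<in> P_class R C" for Q :: "('a,'x) module"
 proof -
  have "right_exact_cores R (%n. Hom R C (?U n)) (%n. post C (?\<delta> n))"
  by(rule hom_C_exact[OF B.right_exact bd I f g gf fg])
  note ex = rec_exact[OF this]
  have "hom_lifts R C B.W"
  proof(rule B.hom_liftsI[OF C.S_module])
  fix q h assume q: "q \<le> 0" and h: "lmap R C (B.W q) h" and z: "\<forall>x\<in>C. cdiff B.W q (h x) = \<zero>\<^sub>(B.W (q - 1))"
  define n where "n = nat (- q)"
  have i: "1 - int (Suc n) = q" "1 - int (Suc (Suc n)) = q - 1" "1 - int n = q + 1" using q by(auto simp: n_def)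
  let ?h = "\<lambda>x\<in>C. h x"
  have hm: "?h \<in> Hom R C (B.W q)" by(rule hom_mem[OF h])
  have "post C (cdiff B.W q) ?h = \<zero>\<^sub>(Hom R C (B.W (q - 1)))"
  using z by(auto simp: post_def hom_mod_simps)
  from ex[of ?h n, unfolded i, OF hm this]
  obtain k where k: "k \<in> (Hom R C (B.W (q + 1)))" "post C (cdiff B.W (q + 1)) k = ?h" by blast
  have "cdiff B.W (q + 1) (k x) = h x" if "x \<in> C" for x using fun_cong[OF k(2), of x] that by simp
  with hom_lmap[OF k(1) C.S_module WM] show "EX k. lmap R C (B.W (q + 1)) k & (\<forall>x\<in>C. cdiff B.W (q + 1) (k x) = h x)" by blast
  qed
  thus ?thesis using P_class_loc_summand[OF inf \<iota> C.S_module Q] hom_lifts_loc_summand[OF _ B.W] by blast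
 qed
qed

end

end

section \<open>From the given definitions to the locales\<close>

lemma resolution_aug:
 assumes "resolution R \<X> X \<epsilon> M"
 shows "aug_resolution R X \<epsilon> M"
 using assms by unfold_locales (auto simp: resolution_def zero_mod_def)

lemma coresolution_aug:
 assumes "coresolution R \<Y> N \<eta> Y"
 shows "aug_coresolution R N \<eta> Y"
 using assms by unfold_locales (auto simp: coresolution_def zero_mod_def)

lemma pd_bounded:
 assumes "pd R \<X> M < \<infinity>"
 shows "EX X \<epsilon> K. resolution R \<X> X \<epsilon> M & bounded_seq (%n. cobj (aug_res X \<epsilon> M) (int n - 1)) K"
proof -
 obtain X \<epsilon> where X: "resolution R \<X> X \<epsilon> M" and s: "Sup {enat n |n. \<not> zero_mod (X (int n))} < \<infinity>"
  using assms unfolding pd_def Inf_less_iff by blast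
 obtain k where k: "Sup {enat n |n. \<not> zero_mod (X (int n))} = enat k" using s by auto
 have z: "zero_mod (X (int n))" if "k < n" for n
 proof(rule ccontr)
  assume "\<not> zero_mod (X (int n))"
  hence "enat n \<le> enat k" unfolding k[symmetric] by(intro Sup_upper) auto
  with that show False by simp
 qed
 \<comment> \<open>Index \<open>n\<close> of the augmented sequence is degree \<open>n - 1\<close>,
   which has to exceed the last degree \<open>k\<close> with a possibly nonzero term; hence
   \<open>k + 2\<close>.\<close>
 have "bounded_seq (%n. cobj (aug_res X \<epsilon> M) (int n - 1)) (k + 2)"
  unfolding bounded_seq_def
 proof(intro allI impI ballI)
  fix n x assume n: "k + 2 \<le> n" and x: "x \<in> cobj (aug_res X \<epsilon> M) (int n - 1)"
  have i: "int n - 1 = int (n - 1)" using n by simp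
  show "x = \<zero>\<^sub>(cobj (aug_res X \<epsilon> M) (int n - 1))" using x z[of "n - 1"] n unfolding i zero_mod_def by simp
 qed
 with X show ?thesis by blast
qed

lemma idim_bounded:
 assumes "idim R \<Y> N < \<infinity>"
 shows "EX \<eta> Y K. coresolution R \<Y> N \<eta> Y & bounded_seq (%n. cobj (aug_cores N \<eta> Y) (1 - int n)) K"
proof -
 obtain \<eta> Y where Y: "coresolution R \<Y> N \<eta> Y" and s: "Sup {enat n |n. \<not> zero_mod (Y (- int n))} < \<infinity>"
  using assms unfolding idim_def Inf_less_iff by blast
 obtain k where k: "Sup {enat n |n. \<not> zero_mod (Y (- int n))} = enat k" using s by auto
 have z: "zero_mod (Y (- int n))" if "k < n" for n
 proof(rule ccontr)
  assume "\<not> zero_mod (Y (- int n))"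
  hence "enat n \<le> enat k" unfolding k[symmetric] by(intro Sup_upper) auto
  with that show False by simp
 qed
 have "bounded_seq (%n. cobj (aug_cores N \<eta> Y) (1 - int n)) (k + 2)"
  unfolding bounded_seq_def
 proof(intro allI impI ballI)
  fix n x assume n: "k + 2 \<le> n" and x: "x \<in> cobj (aug_cores N \<eta> Y) (1 - int n)"
  have i: "1 - int n = - int (n - 1)" using n by simp
  show "x = \<zero>\<^sub>(cobj (aug_cores N \<eta> Y) (1 - int n))" using x z[of "n - 1"] n unfolding i zero_mod_def by simp
 qed
 with Y show ?thesis by blast
qed

text \<open>The given finite free resolution serves twice: as the data of \<open>fp_res\<close>, and
  as a projective resolution from which the vanishing of Ext is read off.\<close>

lemma semidualizing_semidual:
 fixes C :: "('a,'m) module"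
 assumes C: "semidualizing R C"
 shows "EX (F :: nat => ('a,'m) module) d e. semidual R C F d e"
proof -
 obtain F \<epsilon> where F: "resolution R (finite_free R) F \<epsilon> C" using C unfolding semidualizing_def by blast
 interpret A: aug_resolution R F \<epsilon> C by(rule resolution_aug[OF F])
 have fg: "fgproj R (F p)" for p using F finite_free_fgproj[OF A.R] unfolding resolution_def by blast
 have i: "int (Suc n) = int n + 1" for n by simp
 have ex: "\<exists>y\<in>F q. cdiff F q y = x" if "x \<in> F p" "cdiff F p x = \<zero>\<^sub>(F (p - 1))" "p \<ge> 1" "q = p + 1" for p q x
  using exact_complexD[OF A.exact, of x p q] that by simp
 have res: "fp_res R C (%n. F (int n)) (%n. cdiff F (int n + 1)) \<epsilon>"
 proof(rule fp_res.intro)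
  show "lmap R (F (int (Suc n))) (F (int n)) (cdiff F (int n + 1))" for n unfolding i by(rule cplx_lmap[OF A.X]) simp
  show "lmap R (F (int 0)) C \<epsilon>" using A.\<epsilon> by simp
  show "\<exists>x\<in>F (int 0). \<epsilon> x = s" if "s \<in> C" for s using A.\<epsilon>_surj[OF that] by simp
  show "\<epsilon> (cdiff F (int 0 + 1) x) = \<zero>\<^sub>C" if "x \<in> (F (int (Suc 0)))" for x using A.\<epsilon>_d that by simp
  show "\<exists>y\<in>(F (int (Suc 0))). cdiff F (int 0 + 1) y = x" if "x \<in> F (int 0)" "\<epsilon> x = \<zero>\<^sub>C" for x
  using exact_complexD[OF A.exact, of x 0 1] that by simp
  show "cdiff F (int n + 1) (cdiff F (int (Suc n) + 1) x) = \<zero>\<^sub>(F (int n))" if "x \<in> (F (int (Suc (Suc n))))" for n x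
  by(rule cplx_dd[OF A.X, of x "int (Suc n) + 1"]) (use that in \<open>simp_all add: algebra_simps\<close>)
  show "\<exists>y\<in>(F (int (Suc (Suc n)))). cdiff F (int (Suc n) + 1) y = x"
  if "x \<in> (F (int (Suc n)))" "cdiff F (int n + 1) x = \<zero>\<^sub>(F (int n))" for n x
  using that ex[of x "int n + 1" "int n + 1 + 1"] unfolding i by simp
 qed (rule fg)
 interpret fp: fp_res R C "%n. F (int n)" "%n. cdiff F (int n + 1)" \<epsilon> by(rule res)
 have "semidual R C (%n. F (int n)) (%n. cdiff F (int n + 1)) \<epsilon>"
 proof
  have hb: "bij_betw (%r. \<lambda>x\<in>C. r \<odot>\<^sub>C x) (carrier R) (carrier (Hom R C C))" using C by(simp add: semidualizing_def)
  show "fp.acyclic C"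
  proof(rule fp.acyclicI[OF A.M])
  fix n \<phi> assume \<phi>: "lmap R (F (int (Suc n))) C \<phi>"
  and z: "!!x. x \<in> (F (int (Suc (Suc n)))) ==> \<phi> (cdiff F (int (Suc n) + 1) x) = \<zero>\<^sub>C"
  have "resolution R {P. projective R P} F \<epsilon> C" using F fg fgproj_projective by(auto simp: resolution_def)
  hence "zero_mod (homology (hom_cplx R F (stalk C)) (- (int n + 1)))"
  using C unfolding semidualizing_def Ext_res_def by(metis le_add_same_cancel2 of_nat_0_le_iff)
  from hom_stalk_extends[OF A.M A.X this, of \<phi>] \<phi> z
  show "EX \<psi>. lmap R (F (int n)) C \<psi> & (\<forall>x\<in>(F (int (Suc n))). \<psi> (cdiff F (int n + 1) x) = \<phi> x)"
  unfolding i by simp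
  qed
  show "\<exists>r\<in>R. \<forall>s\<in>C. f s = r \<odot>\<^sub>C s" if f: "lmap R C C f" for f
  proof -
  obtain r where r: "r \<in> R" "(\<lambda>x\<in>C. r \<odot>\<^sub>C x) = (\<lambda>x\<in>C. f x)"
  using hb hom_mem[OF f] unfolding bij_betw_def by(metis (no_types, lifting) imageE)
  have "f s = r \<odot>\<^sub>C s" if "s \<in> C" for s using fun_cong[OF r(2), of s] that by simp
  with r(1) show ?thesis by blast
  qed
  show "faithful R C"
  unfolding faithful_def
  proof(intro ballI impI)
  fix r assume r: "r \<in> R" and z: "\<forall>s\<in>C. r \<odot>\<^sub>C s = \<zero>\<^sub>C"
  have "(\<lambda>x\<in>C. r \<odot>\<^sub>C x) = (\<lambda>x\<in>C. \<zero>\<^sub>R \<odot>\<^sub>C x)"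
  by(rule restrict_ext) (use z in \<open>simp add: modD[OF A.M]\<close>)
  thus "r = \<zero>\<^sub>R" using inj_onD[OF bij_betw_imp_inj_on[OF hb]] r cring_zero_closed[OF A.R] by blast
  qed
 qed
 thus ?thesis by blast
qed

theorem proposition5p4:
  fixes R :: "('a,'r) ring_scheme" and C D :: "('a,'m) module"
  assumes universe: "infinite (UNIV :: 'm set)" "\<exists>\<iota> :: 'a \<Rightarrow> 'm. inj_on \<iota> (carrier R)"
    and "cohen_macaulay R" and "dualizing R D" and "semidualizing R C"
  shows "balanced_on R (P_class R C) (I_class R (hom_mod R C D))
           (res_hat R (P_class R C) :: ('a,'m) module set) (cores_hat R (I_class R (hom_mod R C D)))
       \<and> (\<forall>(M :: ('a,'m) module) (N :: ('a,'m) module).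
            module R M \<and> module R N \<and>
            pd R (P_class R C) M < \<infinity> \<and> idim R (I_class R (hom_mod R C D)) N < \<infinity> \<longrightarrow>
            (\<forall>X \<epsilon> \<eta> Y. proper_resolution R (P_class R C) X \<epsilon> M \<and>
               proper_coresolution R (I_class R (hom_mod R C D)) N \<eta> Y \<longrightarrow>
               (\<forall>n::int. mod_isomorphic R (Ext_res R n X N) (Ext_cores R n M Y))))"
proof -
 let ?P = "P_class R C :: ('a,'m) module set" and ?I = "I_class R (Hom R C D) :: ('a,'m) module set"
 obtain \<iota> :: "'a => 'm" where \<iota>: "inj_on \<iota> (carrier R)" using universe(2) by blast
 have noeth: "noetherian_ring R" using assms(3) by(simp add: cohen_macaulay_def)
 obtain FC :: "nat => ('a,'m) module" and dC eC where C: "semidual R C FC dC eC"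
  using semidualizing_semidual[OF assms(5)] by blast
 obtain FD :: "nat => ('a,'m) module" and dD eD where D: "semidual R D FD dD eD"
  using semidualizing_semidual[of R D] assms(4) unfolding dualizing_def by blast
 obtain \<eta>\<^sub>D J K\<^sub>D where J: "coresolution R {I. injective R I} D \<eta>\<^sub>D J" "bounded_seq (%n. cobj (aug_cores D \<eta>\<^sub>D J) (1 - int n)) K\<^sub>D"
  using idim_bounded assms(4) unfolding dualizing_def by blast
 interpret J: aug_coresolution R D \<eta>\<^sub>D J by(rule coresolution_aug[OF J(1)])
 have "baer R (cobj J.W (1 - int (Suc n)))" for n
  using J(1) baer_injective[OF \<iota>, of "J (- int n)"] by(simp add: coresolution_def)
 \<comment> \<open>Index zero of the sequence is degree one of the augmented coresolution, the place
   of \<open>D\<close>; the injectives follow from degree zero downwards.\<close>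
 then interpret dualizing_pair R C FC dC eC D FD dD eD "%n. cobj J.W (1 - int n)" "%n. cdiff J.W (1 - int n)" K\<^sub>D
  by(intro dualizing_pair.intro C D dualizing_pair_axioms.intro noeth J.right_exact J(2)) simp_all
 note PM = P_class_module and IM = I_class_module
 note rl = resolution_lifts[OF universe(1) \<iota>] and re = resolution_extends[OF universe(1) \<iota>]
  and ce = coresolution_extends[OF universe(1) \<iota>] and cl = coresolution_lifts[OF universe(1) \<iota>]
 have proper_res: "hom_lifts R Q (aug_res X \<epsilon> M)" if "proper_resolution R ?P X \<epsilon> M" "Q \<in> ?P" for X \<epsilon> M Q
  using that hom_lifts_iff[OF PM aug_resolution.Z[OF resolution_aug]] unfolding proper_resolution_def by blast
 have proper_cores: "hom_extends R (aug_cores N \<eta> Y) E" if "proper_coresolution R ?I N \<eta> Y" "E \<in> ?I" for Y \<eta> N E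
  using that hom_extends_iff[OF IM aug_coresolution.W[OF coresolution_aug]] unfolding proper_coresolution_def by blast
 have ex_res: "EX X \<epsilon> K. proper_resolution R ?P X \<epsilon> M & bounded_seq (%n. cobj (aug_res X \<epsilon> M) (int n - 1)) K"
  if pd: "pd R ?P M < \<infinity>" for M
 proof -
  obtain X \<epsilon> K where X: "resolution R ?P X \<epsilon> M" and bd: "bounded_seq (%n. cobj (aug_res X \<epsilon> M) (int n - 1)) K"
  using pd_bounded[OF pd] by blast
  note A = resolution_aug[OF X]
  have XP: "X p \<in> ?P" for p using X by(simp add: resolution_def)
  have "proper_resolution R ?P X \<epsilon> M"
  using X rl[OF A bd XP] hom_lifts_iff[OF PM aug_resolution.Z[OF A]] unfolding proper_resolution_def by blast
  with bd show ?thesis by blast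
 qed
 have ex_cores: "EX \<eta> Y K. proper_coresolution R ?I N \<eta> Y & bounded_seq (%n. cobj (aug_cores N \<eta> Y) (1 - int n)) K"
  if id: "idim R ?I N < \<infinity>" for N
 proof -
  obtain \<eta> Y K where Y: "coresolution R ?I N \<eta> Y" and bd: "bounded_seq (%n. cobj (aug_cores N \<eta> Y) (1 - int n)) K"
  using idim_bounded[OF id] by blast
  note B = coresolution_aug[OF Y]
  have YI: "Y p \<in> ?I" for p using Y by(simp add: coresolution_def)
  have "proper_coresolution R ?I N \<eta> Y"
  using Y ce[OF B bd YI] hom_extends_iff[OF IM aug_coresolution.W[OF B]] unfolding proper_coresolution_def by blast
  with bd show ?thesis by blast
 qed
 \<comment> \<open>\<open>X\<close> and \<open>Y\<close> are arbitrary proper ones. The bounded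
   \<open>X'\<close> and \<open>Y'\<close> are proper as well, which gives comparison maps and
   homotopies in both directions, so that exactness of Hom into the class of \<open>C'\<close>,
   respectively out of the class of \<open>C\<close>, can be transferred.\<close>
 have qi: "quasi_iso R (hom_cplx R (stalk M) Y) (hom_cplx R X Y) (hom_precomp X (aug_chain_map M \<epsilon>)) &
  quasi_iso R (hom_cplx R X (stalk N)) (hom_cplx R X Y) (hom_postcomp X (coaug_chain_map Y \<eta>))"
  if pd: "pd R ?P M < \<infinity>" and id: "idim R ?I N < \<infinity>"
  and X: "proper_resolution R ?P X \<epsilon> M" and Y: "proper_coresolution R ?I N \<eta> Y" for M N X \<epsilon> \<eta> Y
 proof -
  have Xr: "resolution R ?P X \<epsilon> M" and Yr: "coresolution R ?I N \<eta> Y"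
  using X Y by(auto simp: proper_resolution_def proper_coresolution_def)
  interpret A: aug_resolution R X \<epsilon> M by(rule resolution_aug[OF Xr])
  interpret B: aug_coresolution R N \<eta> Y by(rule coresolution_aug[OF Yr])
  have XP: "X p \<in> ?P" and YI: "Y p \<in> ?I" for p using Xr Yr by(simp_all add: resolution_def coresolution_def)
  obtain X' \<epsilon>' K where X': "proper_resolution R ?P X' \<epsilon>' M" and bX: "bounded_seq (%n. cobj (aug_res X' \<epsilon>' M) (int n - 1)) K"
  using ex_res[OF pd] by blast
  obtain \<eta>' Y' L where Y': "proper_coresolution R ?I N \<eta>' Y'" and bY: "bounded_seq (%n. cobj (aug_cores N \<eta>' Y') (1 - int n)) L"
  using ex_cores[OF id] by blast
  have X'r: "resolution R ?P X' \<epsilon>' M" and Y'r: "coresolution R ?I N \<eta>' Y'"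
  using X' Y' by(auto simp: proper_resolution_def proper_coresolution_def)
  note A' = resolution_aug[OF X'r] and B' = coresolution_aug[OF Y'r]
  have X'P: "X' p \<in> ?P" and Y'I: "Y' p \<in> ?I" for p using X'r Y'r by(simp_all add: resolution_def coresolution_def)
  have "hom_extends R A.Z E" if "E \<in> ?I" for E
  by(rule A.hom_extends_transfer[OF A' proper_res[OF X' XP] proper_res[OF X X'P] proper_res[OF X XP] re[OF A' bX X'P that] IM[OF that]])
  moreover have "hom_lifts R Q B.W" if "Q \<in> ?P" for Q
  by(rule B.hom_lifts_transfer[OF B' proper_cores[OF Y Y'I] proper_cores[OF Y' YI] proper_cores[OF Y YI] cl[OF B' bY Y'I that] PM[OF that]])
  ultimately show ?thesis
  using A.precomp_quasi_iso[OF B.Y B.pos] B.postcomp_quasi_iso[OF A.X A.neg] YI XP by blast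
 qed
 have "balanced_on R ?P ?I (res_hat R ?P) (cores_hat R ?I)"
  unfolding balanced_on_def res_hat_def cores_hat_def using ex_res ex_cores qi by blast
 moreover have "mod_isomorphic R (Ext_res R n X N) (Ext_cores R n M Y)"
  if "pd R ?P M < \<infinity>" "idim R ?I N < \<infinity>" "proper_resolution R ?P X \<epsilon> M" "proper_coresolution R ?I N \<eta> Y" for M N X \<epsilon> \<eta> Y n
  using qi[OF that] quasi_iso_isomorphic unfolding Ext_res_def Ext_cores_def by blast
 ultimately show ?thesis by blast
qed

end
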